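(* Let $(\mathsf{T},\mathsf{U},Q,D)$ be an Auslander--Gruson--Jensen (AGJ) duality triple. For $\mathsf{X}\subseteq\mathsf{T}$ put $\mathsf{A}_{\mathsf{X}}=\{F\in\mathrm{Mod}(\mathsf{U}^{\mathrm{c}}):\partial F\in\mathbf{y}\mathsf{X}\}$ and for $\mathsf{Y}\subseteq\mathsf{U}$ put $\mathsf{A}_{\mathsf{Y}}=\{F\in\mathrm{Mod}(\mathsf{T}^{\mathrm{c}}):\partial F\in\mathbf{y}\mathsf{Y}\}$. If $\mathsf{X}$ is a definable subcategory of $\mathsf{T}$, then $\mathsf{A}_{\mathsf{X}}$ is a definable subcategory of $\mathrm{Mod}(\mathsf{U}^{\mathrm{c}})$. Consequently, if $(\mathsf{X},\mathsf{Y})$ is a duality pair on $(\mathsf{T},\mathsf{U},Q)$ where both $\mathsf{X}$ and $\mathsf{Y}$ are definable, then there is a symmetric duality pair $(\mathsf{A}_{\mathsf{Y}},\mathsf{A}_{\mathsf{X}})$ on $(\mathrm{Mod}(\mathsf{T}^{\mathrm{c}}),\mathrm{Mod}(\mathsf{U}^{\mathrm{c}}),\partial)$ with $(\mathsf{A}_{\mathsf{Y}})_{0}=\mathsf{X}$ and $(\mathsf{A}_{\mathsf{X}})_{0}=\mathsf{Y}$.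
   Context: For a compactly generated triangulated category $\mathsf{T}$ with compact objects $\mathsf{T}^{\mathrm{c}}$, $\mathrm{Mod}(\mathsf{T}^{\mathrm{c}})$ is the category of additive functors $(\mathsf{T}^{\mathrm{c}})^{\mathrm{op}}\to\mathbf{Ab}$ and $\mathbf{y}X=\mathrm{Hom}_{\mathsf{T}}(-,X)|_{\mathsf{T}^{\mathrm{c}}}$; $\mathbf{y}\mathsf{X}$ is the class of functors isomorphic to $\mathbf{y}X$ with $X\in\mathsf{X}$. A morphism $X\to Y$ is a pure monomorphism if it sits in a triangle $X\to Y\to Z\to\Sigma X$ with $0\to\mathbf{y}X\to\mathbf{y}Y\to\mathbf{y}Z\to0$ exact; $X$ is pure injective if $\mathbf{y}X$ is injective. A duality triple $(\mathsf{T},\mathsf{U},Q)$ consists of two compactly generated triangulated categories $\mathsf{T},\mathsf{U}$ and exact functors $Q\colon\mathsf{T}^{\mathrm{op}}\to\mathsf{U}$ and $Q\colon\mathsf{U}^{\mathrm{op}}\to\mathsf{T}$ (both denoted $Q$) such that: (1) $Q(X)$ is pure injective for every $X$ in $\mathsf{T}$ or $\mathsf{U}$; (2) for every $X$ in $\mathsf{T}$ or $\mathsf{U}$ there is a natural map $i_X\colon X\to Q^2(X)$ which is a pure monomorphism; (3) $Q(i_X)\circ i_{Q(X)}$ is the identity for every $X$ in $\mathsf{T}$ or $\mathsf{U}$; (4) $Q(\bigoplus_I X_i)\simeq\prod_I Q(X_i)$ for every set of objects $\{X_i\}_I$ in $\mathsf{T}$ or in $\mathsf{U}$. An AGJ duality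 triple $(\mathsf{T},\mathsf{U},Q,D)$ is a duality triple together with functors $D\colon(\mathsf{T}^{\mathrm{c}})^{\mathrm{op}}\to\mathsf{U}^{\mathrm{c}}$ and $D\colon(\mathsf{U}^{\mathrm{c}})^{\mathrm{op}}\to\mathsf{T}^{\mathrm{c}}$ such that: (1) they form an adjoint equivalence between $\mathsf{T}^{\mathrm{c}}$ and $(\mathsf{U}^{\mathrm{c}})^{\mathrm{op}}$; (2) for all $C\in\mathsf{T}^{\mathrm{c}}$, $X\in\mathsf{T}$, $C'\in\mathsf{U}^{\mathrm{c}}$, $Y\in\mathsf{U}$ there are isomorphisms $\mathrm{Hom}_{\mathbb{Z}}(\mathrm{Hom}_{\mathsf{T}}(C,X),\mathbb{Q}/\mathbb{Z})\cong\mathrm{Hom}_{\mathsf{U}}(DC,QX)$ and $\mathrm{Hom}_{\mathbb{Z}}(\mathrm{Hom}_{\mathsf{U}}(C',Y),\mathbb{Q}/\mathbb{Z})\cong\mathrm{Hom}_{\mathsf{T}}(DC',QY)$, natural in both variables. A duality pair on $(\mathsf{T},\mathsf{U},Q)$ is a pair of classes $\mathsf{X}\subseteq\mathsf{T}$, $\mathsf{Y}\subseteq\mathsf{U}$ with $M\in\mathsf{X}$ iff $Q(M)\in\mathsf{Y}$ and $\mathsf{Y}$ closed under finite coproducts and retracts. A class $\mathsf{X}\subseteq\mathsf{T}$ is definable if there is a set of maps $f_i$ in $\mathsf{T}^{\mathrm{c}}$ with $\mathsf{X}=\{X:\mathrm{Hom}_{\mathsf{T}}(f_i,X)\text{ is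 surjective for all }i\}$ (similarly in $\mathsf{U}$). A class in $\mathrm{Mod}(\mathsf{U}^{\mathrm{c}})$ is definable if it is closed under direct limits, products and pure subobjects. The contravariant functor $\partial\colon\mathrm{Mod}(\mathsf{T}^{\mathrm{c}})\to\mathrm{Mod}(\mathsf{U}^{\mathrm{c}})$ is $\partial f=\mathrm{Hom}_{\mathbb{Z}}(f(D(-)),\mathbb{Q}/\mathbb{Z})$, and $\partial\colon\mathrm{Mod}(\mathsf{U}^{\mathrm{c}})\to\mathrm{Mod}(\mathsf{T}^{\mathrm{c}})$ is defined likewise. A duality pair on $(\mathrm{Mod}(\mathsf{T}^{\mathrm{c}}),\mathrm{Mod}(\mathsf{U}^{\mathrm{c}}),\partial)$ is a pair of classes $\mathsf{A}\subseteq\mathrm{Mod}(\mathsf{T}^{\mathrm{c}})$, $\mathsf{B}\subseteq\mathrm{Mod}(\mathsf{U}^{\mathrm{c}})$ with $f\in\mathsf{A}$ iff $\partial f\in\mathsf{B}$ and $\mathsf{B}$ closed under finite direct sums and summands; symmetric if $(\mathsf{B},\mathsf{A})$ is also a duality pair. For a class $\mathsf{A}\subseteq\mathrm{Mod}(\mathsf{T}^{\mathrm{c}})$, $\mathsf{A}_0=\{X\in\mathsf{T}:\mathbf{y}X\in\mathsf{A}\}$, and similarly for $\mathsf{U}$. *)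

theory Defs
  imports "HOL-Algebra.Product_Groups" "HOL-Algebra.Weak_Morphisms"
begin

unbundle cardinal_syntax

text \<open>
  The phrases ``set of objects'', ``all set-indexed coproducts'', \dots\ refer to a fixed Grothendieck
  universe. It is represented by a type of inaccessible cardinality: classes are sets over that type,
  and sets are the subsets of strictly smaller cardinality. The arrows of the categories
  \<open>T\<close> and \<open>U\<close> and the elements of the abelian groups in \<open>Ab\<close> are drawn from this type.
\<close>

definition inaccessible_universe :: "'u itself \<Rightarrow> bool"
  where "inaccessible_universe (_ :: 'u itself) \<longleftrightarrow>
    natLeq <o |UNIV :: 'u set| \<and>
    regularCard |UNIV :: 'u set| \<and>
    (\<forall>A :: 'u set. |A| <o |UNIV :: 'u set| \<longrightarrow> |Pow A| <o |UNIV :: 'u set| )"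

definition small :: "'u set \<Rightarrow> bool"
  where "small A \<longleftrightarrow> |A| <o |UNIV :: 'u set|"


section \<open>Categories and functors\<close>

record ('o, 'a) category =
  Ob :: "'o set"
  Arr :: "'a set"
  Dom :: "'a \<Rightarrow> 'o"
  Cod :: "'a \<Rightarrow> 'o"
  Comp :: "'a \<Rightarrow> 'a \<Rightarrow> 'a" (infixl \<open>\<star>\<index>\<close> 70)
  Ide :: "'o \<Rightarrow> 'a"

definition Hom :: "('o, 'a, 'z) category_scheme \<Rightarrow> 'o \<Rightarrow> 'o \<Rightarrow> 'a set"
  where "Hom C X Y = {f \<in> Arr C. Dom C f = X \<and> Cod C f = Y}"

locale category =
  fixes C :: "('o, 'a, 'z) category_scheme" (structure)
  assumes Dom_closed: "f \<in> Arr C \<Longrightarrow> Dom C f \<in> Ob C"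
    and Cod_closed: "f \<in> Arr C \<Longrightarrow> Cod C f \<in> Ob C"
    and Comp_closed: "f \<in> Hom C X Y \<Longrightarrow> g \<in> Hom C Y Z \<Longrightarrow> g \<star> f \<in> Hom C X Z"
    and Comp_assoc: "f \<in> Hom C W X \<Longrightarrow> g \<in> Hom C X Y \<Longrightarrow> h \<in> Hom C Y Z \<Longrightarrow>
      h \<star> (g \<star> f) = (h \<star> g) \<star> f"
    and Ide_closed: "X \<in> Ob C \<Longrightarrow> Ide C X \<in> Hom C X X"
    and Comp_Ide: "f \<in> Hom C X Y \<Longrightarrow> f \<star> Ide C X = f"
    and Ide_Comp: "f \<in> Hom C X Y \<Longrightarrow> Ide C Y \<star> f = f"

definition iso_arrow :: "('o, 'a, 'z) category_scheme \<Rightarrow> 'o \<Rightarrow> 'o \<Rightarrow> 'a \<Rightarrow> bool"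
  where "iso_arrow C X Y f \<longleftrightarrow> f \<in> Hom C X Y \<and>
    (\<exists>g \<in> Hom C Y X. g \<star>\<^bsub>C\<^esub> f = Ide C X \<and> f \<star>\<^bsub>C\<^esub> g = Ide C Y)"

definition isomorphic :: "('o, 'a, 'z) category_scheme \<Rightarrow> 'o \<Rightarrow> 'o \<Rightarrow> bool"
  where "isomorphic C X Y \<longleftrightarrow> X \<in> Ob C \<and> Y \<in> Ob C \<and> (\<exists>f. iso_arrow C X Y f)"

definition mono_arrow :: "('o, 'a, 'z) category_scheme \<Rightarrow> 'o \<Rightarrow> 'o \<Rightarrow> 'a \<Rightarrow> bool"
  where "mono_arrow C X Y f \<longleftrightarrow> f \<in> Hom C X Y \<and>
    (\<forall>W \<in> Ob C. \<forall>g \<in> Hom C W X. \<forall>h \<in> Hom C W X. f \<star>\<^bsub>C\<^esub> g = f \<star>\<^bsub>C\<^esub> h \<longrightarrow> g = h)"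

definition zero_object :: "('o, 'a, 'z) category_scheme \<Rightarrow> 'o \<Rightarrow> bool"
  where "zero_object C Z \<longleftrightarrow> Z \<in> Ob C \<and>
    (\<forall>X \<in> Ob C. (\<exists>!f. f \<in> Hom C X Z) \<and> (\<exists>!f. f \<in> Hom C Z X))"

definition injective_object :: "('o, 'a, 'z) category_scheme \<Rightarrow> 'o \<Rightarrow> bool"
  where "injective_object C E \<longleftrightarrow> E \<in> Ob C \<and>
    (\<forall>X \<in> Ob C. \<forall>Y \<in> Ob C. \<forall>m f. mono_arrow C X Y m \<and> f \<in> Hom C X E \<longrightarrow>
      (\<exists>g \<in> Hom C Y E. g \<star>\<^bsub>C\<^esub> m = f))"

definition retract :: "('o, 'a, 'z) category_scheme \<Rightarrow> 'o \<Rightarrow> 'o \<Rightarrow> bool"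
  where "retract C X Y \<longleftrightarrow> X \<in> Ob C \<and> Y \<in> Ob C \<and>
    (\<exists>s \<in> Hom C X Y. \<exists>r \<in> Hom C Y X. r \<star>\<^bsub>C\<^esub> s = Ide C X)"

definition is_coproduct ::
    "('o, 'a, 'z) category_scheme \<Rightarrow> 'i set \<Rightarrow> ('i \<Rightarrow> 'o) \<Rightarrow> 'o \<Rightarrow> ('i \<Rightarrow> 'a) \<Rightarrow> bool"
  where "is_coproduct C I X S \<iota> \<longleftrightarrow>
    (\<forall>i \<in> I. X i \<in> Ob C) \<and> S \<in> Ob C \<and> (\<forall>i \<in> I. \<iota> i \<in> Hom C (X i) S) \<and>
    (\<forall>Y \<in> Ob C. \<forall>f. (\<forall>i \<in> I. f i \<in> Hom C (X i) Y) \<longrightarrow>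
      (\<exists>!u. u \<in> Hom C S Y \<and> (\<forall>i \<in> I. u \<star>\<^bsub>C\<^esub> \<iota> i = f i)))"

definition is_product ::
    "('o, 'a, 'z) category_scheme \<Rightarrow> 'i set \<Rightarrow> ('i \<Rightarrow> 'o) \<Rightarrow> 'o \<Rightarrow> ('i \<Rightarrow> 'a) \<Rightarrow> bool"
  where "is_product C I X P \<pi> \<longleftrightarrow>
    (\<forall>i \<in> I. X i \<in> Ob C) \<and> P \<in> Ob C \<and> (\<forall>i \<in> I. \<pi> i \<in> Hom C P (X i)) \<and>
    (\<forall>Y \<in> Ob C. \<forall>f. (\<forall>i \<in> I. f i \<in> Hom C Y (X i)) \<longrightarrow>
      (\<exists>!u. u \<in> Hom C Y P \<and> (\<forall>i \<in> I. \<pi> i \<star>\<^bsub>C\<^esub> u = f i)))"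

definition directed_index :: "'i set \<Rightarrow> 'i rel \<Rightarrow> bool"
  where "directed_index I r \<longleftrightarrow> I \<noteq> {} \<and> partial_order_on I r \<and>
    (\<forall>i \<in> I. \<forall>j \<in> I. \<exists>k \<in> I. (i, k) \<in> r \<and> (j, k) \<in> r)"

definition direct_system :: "('o, 'a, 'z) category_scheme \<Rightarrow> 'i set \<Rightarrow> 'i rel \<Rightarrow>
    ('i \<Rightarrow> 'o) \<Rightarrow> ('i \<Rightarrow> 'i \<Rightarrow> 'a) \<Rightarrow> bool"
  where "direct_system C I r X \<phi> \<longleftrightarrow> directed_index I r \<and>
    (\<forall>i \<in> I. X i \<in> Ob C \<and> \<phi> i i = Ide C (X i)) \<and>
    (\<forall>i j. (i, j) \<in> r \<longrightarrow> \<phi> i j \<in> Hom C (X i) (X j)) \<and>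
    (\<forall>i j k. (i, j) \<in> r \<and> (j, k) \<in> r \<longrightarrow> \<phi> j k \<star>\<^bsub>C\<^esub> \<phi> i j = \<phi> i k)"

definition is_direct_limit :: "('o, 'a, 'z) category_scheme \<Rightarrow> 'i set \<Rightarrow> 'i rel \<Rightarrow>
    ('i \<Rightarrow> 'o) \<Rightarrow> ('i \<Rightarrow> 'i \<Rightarrow> 'a) \<Rightarrow> 'o \<Rightarrow> ('i \<Rightarrow> 'a) \<Rightarrow> bool"
  where "is_direct_limit C I r X \<phi> L \<mu> \<longleftrightarrow>
    direct_system C I r X \<phi> \<and> L \<in> Ob C \<and> (\<forall>i \<in> I. \<mu> i \<in> Hom C (X i) L) \<and>
    (\<forall>i j. (i, j) \<in> r \<longrightarrow> \<mu> j \<star>\<^bsub>C\<^esub> \<phi> i j = \<mu> i) \<and>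
    (\<forall>Y \<in> Ob C. \<forall>f. (\<forall>i \<in> I. f i \<in> Hom C (X i) Y) \<and>
        (\<forall>i j. (i, j) \<in> r \<longrightarrow> f j \<star>\<^bsub>C\<^esub> \<phi> i j = f i) \<longrightarrow>
      (\<exists>!u. u \<in> Hom C L Y \<and> (\<forall>i \<in> I. u \<star>\<^bsub>C\<^esub> \<mu> i = f i)))"

definition full_subcategory :: "('o, 'a, 'z) category_scheme \<Rightarrow> 'o set \<Rightarrow> ('o, 'a, 'z) category_scheme"
  where "full_subcategory C S =
    C\<lparr>Ob := S, Arr := {f \<in> Arr C. Dom C f \<in> S \<and> Cod C f \<in> S}\<rparr>"

record ('o, 'a, 'p, 'b) fctr =
  on_ob :: "'o \<Rightarrow> 'p"
  on_ar :: "'a \<Rightarrow> 'b"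

definition cov_functor ::
    "('o, 'a, 'y) category_scheme \<Rightarrow> ('p, 'b, 'z) category_scheme \<Rightarrow> ('o, 'a, 'p, 'b) fctr \<Rightarrow> bool"
  where "cov_functor C D F \<longleftrightarrow>
    (\<forall>X \<in> Ob C. on_ob F X \<in> Ob D \<and> on_ar F (Ide C X) = Ide D (on_ob F X)) \<and>
    (\<forall>X Y. \<forall>f \<in> Hom C X Y. on_ar F f \<in> Hom D (on_ob F X) (on_ob F Y)) \<and>
    (\<forall>X Y Z. \<forall>f \<in> Hom C X Y. \<forall>g \<in> Hom C Y Z. on_ar F (g \<star>\<^bsub>C\<^esub> f) = on_ar F g \<star>\<^bsub>D\<^esub> on_ar F f)"

definition contra_functor ::
    "('o, 'a, 'y) category_scheme \<Rightarrow> ('p, 'b, 'z) category_scheme \<Rightarrow> ('o, 'a, 'p, 'b) fctr \<Rightarrow> bool"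
  where "contra_functor C D F \<longleftrightarrow>
    (\<forall>X \<in> Ob C. on_ob F X \<in> Ob D \<and> on_ar F (Ide C X) = Ide D (on_ob F X)) \<and>
    (\<forall>X Y. \<forall>f \<in> Hom C X Y. on_ar F f \<in> Hom D (on_ob F Y) (on_ob F X)) \<and>
    (\<forall>X Y Z. \<forall>f \<in> Hom C X Y. \<forall>g \<in> Hom C Y Z. on_ar F (g \<star>\<^bsub>C\<^esub> f) = on_ar F f \<star>\<^bsub>D\<^esub> on_ar F g)"

definition equivalence_functor ::
    "('o, 'a, 'y) category_scheme \<Rightarrow> ('p, 'b, 'z) category_scheme \<Rightarrow> ('o, 'a, 'p, 'b) fctr \<Rightarrow> bool"
  where "equivalence_functor C D F \<longleftrightarrow> cov_functor C D F \<and>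
    (\<forall>X \<in> Ob C. \<forall>Y \<in> Ob C. bij_betw (on_ar F) (Hom C X Y) (Hom D (on_ob F X) (on_ob F Y))) \<and>
    (\<forall>Z \<in> Ob D. \<exists>X \<in> Ob C. isomorphic D (on_ob F X) Z)"


section \<open>Additive and triangulated categories\<close>

record ('o, 'a) ab_category = "('o, 'a) category" +
  hadd :: "'a \<Rightarrow> 'a \<Rightarrow> 'a"
  hzero :: "'o \<Rightarrow> 'o \<Rightarrow> 'a"

text \<open>The hom-groups, in the multiplicative notation of \<open>HOL-Algebra\<close>.\<close>

definition hom_group :: "('o, 'a, 'z) ab_category_scheme \<Rightarrow> 'o \<Rightarrow> 'o \<Rightarrow> 'a monoid"
  where "hom_group C X Y =
    \<lparr>carrier = Hom C X Y, monoid.mult = hadd C, one = hzero C X Y\<rparr>"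

locale additive_category = category C
  for C :: "('o, 'a, 'z) ab_category_scheme" (structure) +
  assumes hom_group: "X \<in> Ob C \<Longrightarrow> Y \<in> Ob C \<Longrightarrow> comm_group (hom_group C X Y)"
    and Comp_hadd_left: "f \<in> Hom C X Y \<Longrightarrow> g \<in> Hom C Y Z \<Longrightarrow> g' \<in> Hom C Y Z \<Longrightarrow>
      hadd C g g' \<star> f = hadd C (g \<star> f) (g' \<star> f)"
    and Comp_hadd_right: "f \<in> Hom C X Y \<Longrightarrow> f' \<in> Hom C X Y \<Longrightarrow> g \<in> Hom C Y Z \<Longrightarrow>
      g \<star> hadd C f f' = hadd C (g \<star> f) (g \<star> f')"
    and zero_object: "\<exists>Z. zero_object C Z"
    and binary_coproducts: "X \<in> Ob C \<Longrightarrow> Y \<in> Ob C \<Longrightarrow>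
      \<exists>S \<iota>. is_coproduct C UNIV (case_bool X Y) S \<iota>"

definition additive_on :: "('o, 'a, 'y) ab_category_scheme \<Rightarrow> ('p, 'b, 'z) ab_category_scheme \<Rightarrow>
    ('o, 'a, 'p, 'b) fctr \<Rightarrow> bool"
  where "additive_on C D F \<longleftrightarrow>
    (\<forall>X \<in> Ob C. \<forall>Y \<in> Ob C. \<forall>f \<in> Hom C X Y. \<forall>g \<in> Hom C X Y.
      on_ar F (hadd C f g) = hadd D (on_ar F f) (on_ar F g))"

text \<open>\<open>(f, g, h) \<in> Tri T\<close> stands for the triangle $X \to Y \to Z \to \Sigma X$ with these arrows;
  the objects are recovered as domains and codomains.\<close>

record ('o, 'a) tri_category = "('o, 'a) ab_category" +
  Susp :: "('o, 'a, 'o, 'a) fctr"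
  Tri :: "('a \<times> 'a \<times> 'a) set"

abbreviation susp_ob :: "('o, 'a, 'z) tri_category_scheme \<Rightarrow> 'o \<Rightarrow> 'o"
  where "susp_ob T \<equiv> on_ob (Susp T)"

abbreviation susp_ar :: "('o, 'a, 'z) tri_category_scheme \<Rightarrow> 'a \<Rightarrow> 'a"
  where "susp_ar T \<equiv> on_ar (Susp T)"

locale triangulated_category = additive_category T
  for T :: "('o, 'a, 'z) tri_category_scheme" (structure) +
  assumes Susp_equivalence: "equivalence_functor T T (Susp T)"
    and Susp_additive: "additive_on T T (Susp T)"
    and Tri_arrows: "(f, g, h) \<in> Tri T \<Longrightarrow>
      \<exists>X Y Z. f \<in> Hom T X Y \<and> g \<in> Hom T Y Z \<and> h \<in> Hom T Z (susp_ob T X)"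
    and Tri_iso: "(f, g, h) \<in> Tri T \<Longrightarrow>
      f \<in> Hom T X Y \<Longrightarrow> g \<in> Hom T Y Z \<Longrightarrow> h \<in> Hom T Z (susp_ob T X) \<Longrightarrow>
      f' \<in> Hom T X' Y' \<Longrightarrow> g' \<in> Hom T Y' Z' \<Longrightarrow> h' \<in> Hom T Z' (susp_ob T X') \<Longrightarrow>
      iso_arrow T X X' a \<Longrightarrow> iso_arrow T Y Y' b \<Longrightarrow> iso_arrow T Z Z' c \<Longrightarrow>
      b \<star> f = f' \<star> a \<Longrightarrow> c \<star> g = g' \<star> b \<Longrightarrow> susp_ar T a \<star> h = h' \<star> c \<Longrightarrow>
      (f', g', h') \<in> Tri T"
    and Tri_identity: "X \<in> Ob T \<Longrightarrow> zero_object T Z \<Longrightarrow>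
      (Ide T X, hzero T X Z, hzero T Z (susp_ob T X)) \<in> Tri T"
    and Tri_complete: "f \<in> Arr T \<Longrightarrow> \<exists>g h. (f, g, h) \<in> Tri T"
    and Tri_rotate: "f \<in> Hom T X Y \<Longrightarrow> g \<in> Hom T Y Z \<Longrightarrow> h \<in> Hom T Z (susp_ob T X) \<Longrightarrow>
      (f, g, h) \<in> Tri T \<longleftrightarrow>
      (g, h, inv\<^bsub>hom_group T (susp_ob T X) (susp_ob T Y)\<^esub> (susp_ar T f)) \<in> Tri T"
    and Tri_morphism: "(f, g, h) \<in> Tri T \<Longrightarrow> (f', g', h') \<in> Tri T \<Longrightarrow>
      f \<in> Hom T X Y \<Longrightarrow> f' \<in> Hom T X' Y' \<Longrightarrow> g \<in> Hom T Y Z \<Longrightarrow> g' \<in> Hom T Y' Z' \<Longrightarrow>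
      a \<in> Hom T X X' \<Longrightarrow> b \<in> Hom T Y Y' \<Longrightarrow> b \<star> f = f' \<star> a \<Longrightarrow>
      \<exists>c \<in> Hom T Z Z'. c \<star> g = g' \<star> b \<and> susp_ar T a \<star> h = h' \<star> c"
    and Tri_octahedron: "f \<in> Hom T X Y \<Longrightarrow> g \<in> Hom T Y Z \<Longrightarrow>
      (f, f1, f2) \<in> Tri T \<Longrightarrow> (g, g1, g2) \<in> Tri T \<Longrightarrow> (g \<star> f, k1, k2) \<in> Tri T \<Longrightarrow>
      \<exists>u v. (u, v, susp_ar T f1 \<star> g2) \<in> Tri T \<and>
        u \<in> Hom T (Cod T f1) (Cod T k1) \<and> v \<in> Hom T (Cod T k1) (Cod T g1) \<and>
        u \<star> f1 = k1 \<star> g \<and> k2 \<star> u = f2 \<and> v \<star> k1 = g1 \<and> g2 \<star> v = susp_ar T f \<star> k2"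

text \<open>
  Exactness of a functor $T^{op} \to U$. The suspension of $T^{op}$ is $\Sigma^{-1}$, so the isomorphism
  $Q\Sigma^{-1} \cong \Sigma Q$ is recorded as \<open>\<theta> X\<close>$\colon QX \to \Sigma Q \Sigma X$. Replacing \<open>\<theta>\<close> by
  its negative shows that the sign convention for triangles in $T^{op}$ is irrelevant.
\<close>

definition exact_contra :: "('o, 'a, 'y) tri_category_scheme \<Rightarrow> ('p, 'b, 'z) tri_category_scheme \<Rightarrow>
    ('o, 'a, 'p, 'b) fctr \<Rightarrow> bool"
  where "exact_contra T U Q \<longleftrightarrow> contra_functor T U Q \<and> additive_on T U Q \<and>
    (\<exists>\<theta>.
      (\<forall>X \<in> Ob T. iso_arrow U (on_ob Q X) (susp_ob U (on_ob Q (susp_ob T X))) (\<theta> X)) \<and>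
      (\<forall>X Y. \<forall>f \<in> Hom T X Y.
        \<theta> X \<star>\<^bsub>U\<^esub> on_ar Q f = susp_ar U (on_ar Q (susp_ar T f)) \<star>\<^bsub>U\<^esub> \<theta> Y) \<and>
      (\<forall>f g h. (f, g, h) \<in> Tri T \<longrightarrow>
        (on_ar Q g, on_ar Q f, susp_ar U (on_ar Q h) \<star>\<^bsub>U\<^esub> \<theta> (Dom T f)) \<in> Tri U))"


section \<open>Compactly generated triangulated categories\<close>

text \<open>The canonical map $\bigoplus_i \mathrm{Hom}(C, X_i) \to \mathrm{Hom}(C, \coprod_i X_i)$ is an
  isomorphism for all small coproducts.\<close>

definition compact_object :: "('o, 'u, 'z) ab_category_scheme \<Rightarrow> 'o \<Rightarrow> bool"
  where "compact_object T C \<longleftrightarrow> C \<in> Ob T \<and>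
    (\<forall>(I :: 'u set) X S \<iota>. small I \<and> is_coproduct T I X S \<iota> \<longrightarrow>
      (\<lambda>g. finprod (hom_group T C S) (\<lambda>i. \<iota> i \<star>\<^bsub>T\<^esub> g i) {i \<in> I. g i \<noteq> hzero T C (X i)})
        \<in> iso (sum_group I (\<lambda>i. hom_group T C (X i))) (hom_group T C S))"

definition compacts :: "('o, 'u, 'z) ab_category_scheme \<Rightarrow> ('o, 'u, 'z) ab_category_scheme"
  where "compacts T = full_subcategory T {C. compact_object T C}"

definition compactly_generated :: "('o, 'u, 'z) tri_category_scheme \<Rightarrow> bool"
  where "compactly_generated T \<longleftrightarrow> triangulated_category T \<and>
    (\<forall>X \<in> Ob T. \<forall>Y \<in> Ob T. small (Hom T X Y)) \<and>
    (\<forall>(I :: 'u set) X. small I \<and> (\<forall>i \<in> I. X i \<in> Ob T) \<longrightarrow> (\<exists>S \<iota>. is_coproduct T I X S \<iota>)) \<and>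
    (\<exists>(I :: 'u set) G. small I \<and> (\<forall>i \<in> I. compact_object T (G i)) \<and>
      (\<forall>X \<in> Ob T. (\<forall>i \<in> I. Hom T (G i) X = {hzero T (G i) X}) \<longrightarrow> zero_object T X))"


section \<open>The category of additive functors to abelian groups\<close>

type_synonym ('o, 'a, 'u) module_fctr = "('o, 'a, 'u monoid, 'u \<Rightarrow> 'u) fctr"

definition additive_presheaf :: "('o, 'a, 'z) ab_category_scheme \<Rightarrow> ('o, 'a, 'u) module_fctr \<Rightarrow> bool"
  where "additive_presheaf C F \<longleftrightarrow>
    (\<forall>X \<in> Ob C. comm_group (on_ob F X) \<and> small (carrier (on_ob F X))) \<and>
    (\<forall>X Y. \<forall>f \<in> Hom C X Y. on_ar F f \<in> hom (on_ob F Y) (on_ob F X)) \<and>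
    (\<forall>X \<in> Ob C. \<forall>x \<in> carrier (on_ob F X). on_ar F (Ide C X) x = x) \<and>
    (\<forall>X Y Z. \<forall>f \<in> Hom C X Y. \<forall>g \<in> Hom C Y Z. \<forall>x \<in> carrier (on_ob F Z).
      on_ar F (g \<star>\<^bsub>C\<^esub> f) x = on_ar F f (on_ar F g x)) \<and>
    (\<forall>X Y. \<forall>f \<in> Hom C X Y. \<forall>g \<in> Hom C X Y. \<forall>x \<in> carrier (on_ob F Y).
      on_ar F (hadd C f g) x = on_ar F f x \<otimes>\<^bsub>on_ob F X\<^esub> on_ar F g x)"

text \<open>Components are extensional, so that equal natural transformations are equal as functions.\<close>

definition nat_trans :: "('o, 'a, 'z) ab_category_scheme \<Rightarrow> ('o, 'a, 'u) module_fctr \<Rightarrow>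
    ('o, 'a, 'u) module_fctr \<Rightarrow> ('o \<Rightarrow> 'u \<Rightarrow> 'u) set"
  where "nat_trans C F G =
    {\<alpha> \<in> \<Pi>\<^sub>E X\<in>Ob C. hom (on_ob F X) (on_ob G X) \<inter> extensional (carrier (on_ob F X)).
      \<forall>X Y. \<forall>f \<in> Hom C X Y. \<forall>y \<in> carrier (on_ob F Y).
        \<alpha> X (on_ar F f y) = on_ar G f (\<alpha> Y y)}"

type_synonym ('o, 'a, 'u) module_arrow =
  "('o, 'a, 'u) module_fctr \<times> ('o \<Rightarrow> 'u \<Rightarrow> 'u) \<times> ('o, 'a, 'u) module_fctr"

definition ModCat :: "('o, 'a, 'z) ab_category_scheme \<Rightarrow>
    (('o, 'a, 'u) module_fctr, ('o, 'a, 'u) module_arrow) category"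
  where "ModCat C =
    \<lparr>Ob = {F. additive_presheaf C F},
     Arr = {(F, \<alpha>, G). additive_presheaf C F \<and> additive_presheaf C G \<and> \<alpha> \<in> nat_trans C F G},
     Dom = (\<lambda>(F, \<alpha>, G). F),
     Cod = (\<lambda>(F, \<alpha>, G). G),
     Comp = (\<lambda>(G, \<beta>, H) (F, \<alpha>, _). (F, \<lambda>X\<in>Ob C. compose (carrier (on_ob F X)) (\<beta> X) (\<alpha> X), H)),
     Ide = (\<lambda>F. (F, \<lambda>X\<in>Ob C. \<lambda>x\<in>carrier (on_ob F X). x, F))\<rparr>"

abbreviation component :: "('o, 'a, 'u) module_arrow \<Rightarrow> 'o \<Rightarrow> 'u \<Rightarrow> 'u"
  where "component m \<equiv> fst (snd m)"

definition exact_at :: "('o, 'a, 'z) ab_category_scheme \<Rightarrow>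
    ('o, 'a, 'u) module_arrow \<Rightarrow> ('o, 'a, 'u) module_arrow \<Rightarrow> bool"
  where "exact_at C m n \<longleftrightarrow> m \<in> Arr (ModCat C) \<and> n \<in> Arr (ModCat C) \<and> Cod (ModCat C) m = Dom (ModCat C) n \<and>
    (\<forall>X \<in> Ob C. component m X ` carrier (on_ob (Dom (ModCat C) m) X) =
      kernel (on_ob (Dom (ModCat C) n) X) (on_ob (Cod (ModCat C) n) X) (component n X))"

definition epi_Mod :: "('o, 'a, 'z) ab_category_scheme \<Rightarrow> ('o, 'a, 'u) module_arrow \<Rightarrow> bool"
  where "epi_Mod C n \<longleftrightarrow> n \<in> Arr (ModCat C) \<and>
    (\<forall>X \<in> Ob C. component n X ` carrier (on_ob (Dom (ModCat C) n) X) = carrier (on_ob (Cod (ModCat C) n) X))"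

definition short_exact :: "('o, 'a, 'z) ab_category_scheme \<Rightarrow>
    ('o, 'a, 'u) module_arrow \<Rightarrow> ('o, 'a, 'u) module_arrow \<Rightarrow> bool"
  where "short_exact C m n \<longleftrightarrow> exact_at C m n \<and> epi_Mod C n \<and>
    (\<forall>X \<in> Ob C. inj_on (component m X) (carrier (on_ob (Dom (ModCat C) m) X)))"

definition hom_presheaf :: "('o, 'u, 'z) ab_category_scheme \<Rightarrow> 'o \<Rightarrow> ('o, 'u, 'u) module_fctr"
  where "hom_presheaf C X = \<lparr>on_ob = (\<lambda>A. hom_group C A X), on_ar = (\<lambda>f g. g \<star>\<^bsub>C\<^esub> f)\<rparr>"

definition hom_presheaf_map :: "('o, 'u, 'z) ab_category_scheme \<Rightarrow> 'o set \<Rightarrow> 'u \<Rightarrow> ('o, 'u, 'u) module_arrow"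
  where "hom_presheaf_map C S f =
    (hom_presheaf C (Dom C f), \<lambda>A\<in>S. \<lambda>g\<in>Hom C A (Dom C f). f \<star>\<^bsub>C\<^esub> g, hom_presheaf C (Cod C f))"

definition finitely_presented :: "('o, 'u, 'z) ab_category_scheme \<Rightarrow> ('o, 'u, 'u) module_fctr \<Rightarrow> bool"
  where "finitely_presented C P \<longleftrightarrow> P \<in> Ob (ModCat C) \<and>
    (\<exists>f \<in> Arr C. \<exists>p \<in> Hom (ModCat C) (hom_presheaf C (Cod C f)) P.
      exact_at C (hom_presheaf_map C (Ob C) f) p \<and> epi_Mod C p)"

text \<open>Exactness of $\mathrm{Hom}(P, -)$ on $0 \to F \to G \to H \to 0$ amounts to lifting along $G \to H$,
  since $\mathrm{Hom}(P, -)$ is always left exact.\<close>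

definition pure_mono_Mod :: "('o, 'u, 'z) ab_category_scheme \<Rightarrow> ('o, 'u, 'u) module_arrow \<Rightarrow> bool"
  where "pure_mono_Mod C m \<longleftrightarrow> (\<exists>n. short_exact C m n \<and>
    (\<forall>P. finitely_presented C P \<longrightarrow>
      (\<forall>p \<in> Hom (ModCat C) P (Cod (ModCat C) n). \<exists>q \<in> Hom (ModCat C) P (Dom (ModCat C) n).
        n \<star>\<^bsub>ModCat C\<^esub> q = p)))"

definition definable_Mod :: "('o, 'u, 'z) ab_category_scheme \<Rightarrow> ('o, 'u, 'u) module_fctr set \<Rightarrow> bool"
  where "definable_Mod C \<A> \<longleftrightarrow> \<A> \<subseteq> Ob (ModCat C) \<and>
    (\<forall>(I :: 'u set) r F \<phi> L \<mu>. small I \<and> is_direct_limit (ModCat C) I r F \<phi> L \<mu> \<and> (\<forall>i \<in> I. F i \<in> \<A>)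
      \<longrightarrow> L \<in> \<A>) \<and>
    (\<forall>(I :: 'u set) F P \<pi>. small I \<and> is_product (ModCat C) I F P \<pi> \<and> (\<forall>i \<in> I. F i \<in> \<A>) \<longrightarrow> P \<in> \<A>) \<and>
    (\<forall>F G m. m \<in> Hom (ModCat C) F G \<and> pure_mono_Mod C m \<and> G \<in> \<A> \<longrightarrow> F \<in> \<A>)"


section \<open>Purity and definability in a compactly generated triangulated category\<close>

text \<open>\<open>yoneda T X\<close> is regarded as an object of \<open>ModCat (compacts T)\<close>: its values at non-compact objects
  play no role.\<close>

abbreviation yoneda :: "('o, 'u, 'z) tri_category_scheme \<Rightarrow> 'o \<Rightarrow> ('o, 'u, 'u) module_fctr"
  where "yoneda T \<equiv> hom_presheaf T"

abbreviation yoneda_map :: "('o, 'u, 'z) tri_category_scheme \<Rightarrow> 'u \<Rightarrow> ('o, 'u, 'u) module_arrow"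
  where "yoneda_map T \<equiv> hom_presheaf_map T (Ob (compacts T))"

definition yoneda_class :: "('o, 'u, 'z) tri_category_scheme \<Rightarrow> 'o set \<Rightarrow> ('o, 'u, 'u) module_fctr set"
  where "yoneda_class T \<X> = {F \<in> Ob (ModCat (compacts T)). \<exists>X \<in> \<X>. isomorphic (ModCat (compacts T)) F (yoneda T X)}"

definition pure_mono :: "('o, 'u, 'z) tri_category_scheme \<Rightarrow> 'o \<Rightarrow> 'o \<Rightarrow> 'u \<Rightarrow> bool"
  where "pure_mono T X Y f \<longleftrightarrow> f \<in> Hom T X Y \<and>
    (\<exists>g h. (f, g, h) \<in> Tri T \<and> short_exact (compacts T) (yoneda_map T f) (yoneda_map T g))"

definition pure_injective :: "('o, 'u, 'z) tri_category_scheme \<Rightarrow> 'o \<Rightarrow> bool"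
  where "pure_injective T X \<longleftrightarrow> X \<in> Ob T \<and> injective_object (ModCat (compacts T)) (yoneda T X)"

definition definable :: "('o, 'u, 'z) tri_category_scheme \<Rightarrow> 'o set \<Rightarrow> bool"
  where "definable T \<X> \<longleftrightarrow>
    (\<exists>\<Phi> :: 'u set. small \<Phi> \<and> \<Phi> \<subseteq> Arr (compacts T) \<and>
      \<X> = {X \<in> Ob T. \<forall>f \<in> \<Phi>. (\<lambda>g. g \<star>\<^bsub>T\<^esub> f) ` Hom T (Cod T f) X = Hom T (Dom T f) X})"


section \<open>Duality triples\<close>

text \<open>\<open>turns_coproducts\<close> says that $Q(\coprod_i X_i)$ is isomorphic to $\prod_i Q(X_i)$, without
  prescribing the projections.\<close>

definition turns_coproducts :: "('o, 'u, 'y) tri_category_scheme \<Rightarrow> ('p, 'u, 'z) tri_category_scheme \<Rightarrow>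
    ('o, 'u, 'p, 'u) fctr \<Rightarrow> bool"
  where "turns_coproducts T U Q \<longleftrightarrow>
    (\<forall>(I :: 'u set) X S \<iota>. small I \<and> is_coproduct T I X S \<iota> \<longrightarrow>
      (\<exists>\<pi>. is_product U I (\<lambda>i. on_ob Q (X i)) (on_ob Q S) \<pi>))"

definition natural_pure_unit :: "('o, 'u, 'y) tri_category_scheme \<Rightarrow>
    ('o, 'u, 'p, 'u) fctr \<Rightarrow> ('p, 'u, 'o, 'u) fctr \<Rightarrow> ('o \<Rightarrow> 'u) \<Rightarrow> bool"
  where "natural_pure_unit T QT QU i \<longleftrightarrow>
    (\<forall>X \<in> Ob T. pure_mono T X (on_ob QU (on_ob QT X)) (i X)) \<and>
    (\<forall>X Y. \<forall>f \<in> Hom T X Y. i Y \<star>\<^bsub>T\<^esub> f = on_ar QU (on_ar QT f) \<star>\<^bsub>T\<^esub> i X)"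

definition duality_triple :: "('o, 'u, 'y) tri_category_scheme \<Rightarrow> ('p, 'u, 'z) tri_category_scheme \<Rightarrow>
    ('o, 'u, 'p, 'u) fctr \<Rightarrow> ('p, 'u, 'o, 'u) fctr \<Rightarrow> bool"
  where "duality_triple T U QT QU \<longleftrightarrow>
    compactly_generated T \<and> compactly_generated U \<and>
    exact_contra T U QT \<and> exact_contra U T QU \<and>
    (\<forall>X \<in> Ob T. pure_injective U (on_ob QT X)) \<and>
    (\<forall>Y \<in> Ob U. pure_injective T (on_ob QU Y)) \<and>
    (\<exists>iT iU. natural_pure_unit T QT QU iT \<and> natural_pure_unit U QU QT iU \<and>
      (\<forall>X \<in> Ob T. on_ar QT (iT X) \<star>\<^bsub>U\<^esub> iU (on_ob QT X) = Ide U (on_ob QT X)) \<and>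
      (\<forall>Y \<in> Ob U. on_ar QU (iU Y) \<star>\<^bsub>T\<^esub> iT (on_ob QU Y) = Ide T (on_ob QU Y))) \<and>
    turns_coproducts T U QT \<and> turns_coproducts U T QU"

definition rat_mod_int :: "rat set monoid"
  where "rat_mod_int = \<lparr>carrier = UNIV, monoid.mult = (+), one = 0\<rparr> Mod \<int>"

text \<open>The group of homomorphisms from \<open>G\<close> to $\mathbb{Q}/\mathbb{Z}$.\<close>

definition character_group :: "('u, 'z) monoid_scheme \<Rightarrow> ('u \<Rightarrow> rat set) monoid"
  where "character_group G =
    \<lparr>carrier = hom G rat_mod_int \<inter> extensional (carrier G),
     monoid.mult = (\<lambda>\<phi> \<psi>. \<lambda>x\<in>carrier G. \<phi> x \<otimes>\<^bsub>rat_mod_int\<^esub> \<psi> x),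
     one = (\<lambda>x\<in>carrier G. \<one>\<^bsub>rat_mod_int\<^esub>)\<rparr>"

definition character_isos :: "('o, 'u, 'y) tri_category_scheme \<Rightarrow> ('p, 'u, 'z) tri_category_scheme \<Rightarrow>
    ('o, 'u, 'p, 'u) fctr \<Rightarrow> ('o, 'u, 'p, 'u) fctr \<Rightarrow> bool"
  where "character_isos T U Q D \<longleftrightarrow> (\<exists>\<Psi>.
    (\<forall>C \<in> Ob (compacts T). \<forall>X \<in> Ob T.
      \<Psi> C X \<in> iso (character_group (hom_group T C X)) (hom_group U (on_ob D C) (on_ob Q X))) \<and>
    (\<forall>B C. \<forall>f \<in> Hom (compacts T) B C. \<forall>X \<in> Ob T. \<forall>\<phi> \<in> carrier (character_group (hom_group T B X)).
      \<Psi> C X (\<lambda>g\<in>Hom T C X. \<phi> (g \<star>\<^bsub>T\<^esub> f)) = \<Psi> B X \<phi> \<star>\<^bsub>U\<^esub> on_ar D f) \<and>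
    (\<forall>C \<in> Ob (compacts T). \<forall>X Y. \<forall>p \<in> Hom T X Y. \<forall>\<phi> \<in> carrier (character_group (hom_group T C Y)).
      \<Psi> C X (\<lambda>g\<in>Hom T C X. \<phi> (p \<star>\<^bsub>T\<^esub> g)) = on_ar Q p \<star>\<^bsub>U\<^esub> \<Psi> C Y \<phi>))"

text \<open>Contravariant functors \<open>D\<close>, \<open>E\<close> forming an adjoint equivalence between \<open>A\<close> and the opposite
  of \<open>B\<close>: \<open>\<eta>\<close> is the unit, and the counit is written as a family of arrows of \<open>B\<close> instead of
  its opposite.\<close>

definition adjoint_duality :: "('o, 'a, 'y) category_scheme \<Rightarrow> ('p, 'b, 'z) category_scheme \<Rightarrow>
    ('o, 'a, 'p, 'b) fctr \<Rightarrow> ('p, 'b, 'o, 'a) fctr \<Rightarrow> bool"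
  where "adjoint_duality A B D E \<longleftrightarrow> contra_functor A B D \<and> contra_functor B A E \<and>
    (\<exists>\<eta> \<epsilon>.
      (\<forall>X \<in> Ob A. iso_arrow A X (on_ob E (on_ob D X)) (\<eta> X)) \<and>
      (\<forall>Y \<in> Ob B. iso_arrow B Y (on_ob D (on_ob E Y)) (\<epsilon> Y)) \<and>
      (\<forall>X X'. \<forall>f \<in> Hom A X X'. \<eta> X' \<star>\<^bsub>A\<^esub> f = on_ar E (on_ar D f) \<star>\<^bsub>A\<^esub> \<eta> X) \<and>
      (\<forall>Y Y'. \<forall>g \<in> Hom B Y Y'. \<epsilon> Y' \<star>\<^bsub>B\<^esub> g = on_ar D (on_ar E g) \<star>\<^bsub>B\<^esub> \<epsilon> Y) \<and>
      (\<forall>X \<in> Ob A. on_ar D (\<eta> X) \<star>\<^bsub>B\<^esub> \<epsilon> (on_ob D X) = Ide B (on_ob D X)) \<and>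
      (\<forall>Y \<in> Ob B. on_ar E (\<epsilon> Y) \<star>\<^bsub>A\<^esub> \<eta> (on_ob E Y) = Ide A (on_ob E Y)))"

definition AGJ_duality_triple :: "('o, 'u, 'y) tri_category_scheme \<Rightarrow> ('p, 'u, 'z) tri_category_scheme \<Rightarrow>
    ('o, 'u, 'p, 'u) fctr \<Rightarrow> ('p, 'u, 'o, 'u) fctr \<Rightarrow>
    ('o, 'u, 'p, 'u) fctr \<Rightarrow> ('p, 'u, 'o, 'u) fctr \<Rightarrow> bool"
  where "AGJ_duality_triple T U QT QU DT DU \<longleftrightarrow> duality_triple T U QT QU \<and>
    adjoint_duality (compacts T) (compacts U) DT DU \<and>
    character_isos T U QT DT \<and> character_isos U T QU DU"


section \<open>Duality pairs\<close>

definition closed_finite_coproducts :: "('o, 'a, 'z) category_scheme \<Rightarrow> 'o set \<Rightarrow> bool"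
  where "closed_finite_coproducts C \<Y> \<longleftrightarrow>
    (\<forall>(n :: nat) X S \<iota>. is_coproduct C {..<n} X S \<iota> \<and> (\<forall>i<n. X i \<in> \<Y>) \<longrightarrow> S \<in> \<Y>)"

definition closed_retracts :: "('o, 'a, 'z) category_scheme \<Rightarrow> 'o set \<Rightarrow> bool"
  where "closed_retracts C \<Y> \<longleftrightarrow> (\<forall>X Y. retract C X Y \<and> Y \<in> \<Y> \<longrightarrow> X \<in> \<Y>)"

definition closed_summands :: "('o, 'a, 'z) category_scheme \<Rightarrow> 'o set \<Rightarrow> bool"
  where "closed_summands C \<Y> \<longleftrightarrow>
    (\<forall>X X' S \<iota>. is_coproduct C UNIV (case_bool X X') S \<iota> \<and> S \<in> \<Y> \<longrightarrow> X \<in> \<Y>)"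

definition duality_pair :: "('o, 'u, 'y) tri_category_scheme \<Rightarrow> ('p, 'u, 'z) tri_category_scheme \<Rightarrow>
    ('o, 'u, 'p, 'u) fctr \<Rightarrow> 'o set \<Rightarrow> 'p set \<Rightarrow> bool"
  where "duality_pair T U Q \<X> \<Y> \<longleftrightarrow> \<X> \<subseteq> Ob T \<and> \<Y> \<subseteq> Ob U \<and>
    (\<forall>M \<in> Ob T. M \<in> \<X> \<longleftrightarrow> on_ob Q M \<in> \<Y>) \<and>
    closed_finite_coproducts U \<Y> \<and> closed_retracts U \<Y>"

text \<open>Characters are functions, hence not elements of the universe; \<open>encode G\<close> chooses a copy of the
  (small) character group of \<open>G\<close> inside it.\<close>

definition encode :: "'u monoid \<Rightarrow> ('u \<Rightarrow> rat set) \<Rightarrow> 'u"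
  where "encode G = (SOME e. inj_on e (carrier (character_group G)))"

definition decode :: "'u monoid \<Rightarrow> 'u \<Rightarrow> ('u \<Rightarrow> rat set)"
  where "decode G = inv_into (carrier (character_group G)) (encode G)"

text \<open>For \<open>D\<close> from \<open>B\<close> to \<open>A\<close> contravariant and \<open>F\<close> in \<open>ModCat A\<close>, the presheaf on \<open>B\<close> given by
  $C \mapsto \mathrm{Hom}_{\mathbb{Z}}(F(DC), \mathbb{Q}/\mathbb{Z})$.\<close>

definition dual_presheaf :: "('p, 'b, 'z) category_scheme \<Rightarrow> ('p, 'b, 'o, 'a) fctr \<Rightarrow>
    ('o, 'a, 'u) module_fctr \<Rightarrow> ('p, 'b, 'u) module_fctr"
  where "dual_presheaf B D F =
    \<lparr>on_ob = (\<lambda>C. image_group (encode (on_ob F (on_ob D C))) (character_group (on_ob F (on_ob D C)))),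
     on_ar = (\<lambda>f x.
       let G = on_ob F (on_ob D (Dom B f)); H = on_ob F (on_ob D (Cod B f))
       in encode G (\<lambda>g\<in>carrier G. decode H x (on_ar F (on_ar D f) g)))\<rparr>"

text \<open>A duality pair on \<open>(ModCat A, ModCat B, \<partial>)\<close>, where \<open>\<partial>\<close> sends \<open>F\<close> in \<open>ModCat A\<close> to
  \<open>dual_presheaf B D F\<close>.\<close>

definition duality_pair_Mod :: "('o, 'a, 'y) ab_category_scheme \<Rightarrow> ('p, 'b, 'z) ab_category_scheme \<Rightarrow>
    ('p, 'b, 'o, 'a) fctr \<Rightarrow> ('o, 'a, 'u) module_fctr set \<Rightarrow> ('p, 'b, 'u) module_fctr set \<Rightarrow> bool"
  where "duality_pair_Mod A B D \<A> \<B> \<longleftrightarrow> \<A> \<subseteq> Ob (ModCat A) \<and> \<B> \<subseteq> Ob (ModCat B) \<and>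
    (\<forall>F \<in> Ob (ModCat A). F \<in> \<A> \<longleftrightarrow> dual_presheaf B D F \<in> \<B>) \<and>
    closed_finite_coproducts (ModCat B) \<B> \<and> closed_summands (ModCat B) \<B>"

definition symmetric_duality_pair_Mod :: "('o, 'a, 'y) ab_category_scheme \<Rightarrow>
    ('p, 'b, 'z) ab_category_scheme \<Rightarrow> ('o, 'a, 'p, 'b) fctr \<Rightarrow> ('p, 'b, 'o, 'a) fctr \<Rightarrow>
    ('o, 'a, 'u) module_fctr set \<Rightarrow> ('p, 'b, 'u) module_fctr set \<Rightarrow> bool"
  where "symmetric_duality_pair_Mod A B D E \<A> \<B> \<longleftrightarrow>
    duality_pair_Mod A B E \<A> \<B> \<and> duality_pair_Mod B A D \<B> \<A>"

text \<open>\<open>dual_class T U DT \<X>\<close> is the class of \<open>F\<close> in \<open>ModCat (compacts U)\<close> such that \<open>\<partial>F\<close> lies in the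
  class \<open>yoneda_class T \<X>\<close>.\<close>

definition dual_class :: "('o, 'u, 'y) tri_category_scheme \<Rightarrow> ('p, 'u, 'z) tri_category_scheme \<Rightarrow>
    ('o, 'u, 'p, 'u) fctr \<Rightarrow> 'o set \<Rightarrow> ('p, 'u, 'u) module_fctr set"
  where "dual_class T U D \<X> =
    {F \<in> Ob (ModCat (compacts U)). dual_presheaf (compacts T) D F \<in> yoneda_class T \<X>}"

definition yoneda_preimage :: "('o, 'u, 'z) tri_category_scheme \<Rightarrow> ('o, 'u, 'u) module_fctr set \<Rightarrow> 'o set"
  where "yoneda_preimage T \<A> = {X \<in> Ob T. yoneda T X \<in> \<A>}"

end

(* Let A and B be the categories of compact objects of T and U.

   The dual of F in Mod(B) evaluates F at D, so a flat F on B is the same as a flat covariant functor E on A,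
   and its dual is the functor of characters of E. For flat E, the functor of natural transformations from y(-)
   to these characters satisfies the hypotheses of Brown's representability theorem on T: it turns coproducts into
   products, and its weak exactness follows by extending characters from partial ones with a Zorn argument. Hence
   the dual of a flat F is isomorphic to yX for some X. Conversely yX is flat, and characters separate elements,
   so F is flat whenever its dual is. If a class X is defined by surjectivity of Hom(f, -) for f in Phi, then the
   dual of F is in yX if and only if F is flat and F(Df) is injective for all f in Phi: injectivity and
   surjectivity are exchanged by characters. This description of A_X is stable under direct limits, products, pure
   subobjects, summands and finite coproducts.

   For the duality pairs, the isomorphism in the definition of an AGJ triple says that the dual of yX is yQX, so
   yY lies in A_X if and only if QY lies in X; moreover Y and QQY lie in the same definable classes, since
   taking characters twice preserves and reflects surjectivity. That D is additive is not assumed; it follows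
   from the naturality of the same isomorphism and the purity of the unit. *)

theory Submission
  imports Defs
begin

text \<open>Products, direct limits and coproducts of presheaves are given only by universal
  properties, and none of them is constructed pointwise. Elements of a product are reached as arrows
  out of representables. That an element survives in a direct limit is detected by arrows into a
  coinduced presheaf, which amount to characters of a single group. Closure of flatness under
  products needs a witness that does not vary with the element. Triangles provide it: one weak
  cokernel of \<open>f\<close> witnesses every relation imposed by \<open>f\<close>, in every flat
  presheaf. Both uses of Zorn have the same form, with partial maps taken as graphs. The obstruction
  to adding one more point is removed by divisibility of Q/Z in the case of characters, and by
  flatness in the case of functionals on a Hom functor. Brown's theorem is proved for set-valued
  functors with an arbitrary type of values, because a functional on an object of \<open>T\<close>
  is a family indexed by all compact objects and no element of the universe. Smallness of the values
  is available at compact objects, by Yoneda.\<close>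

abbreviation QZ :: "rat set monoid"
  where "QZ \<equiv> rat_mod_int"

abbreviation chars :: "('g, 'z) monoid_scheme \<Rightarrow> ('g \<Rightarrow> rat set) set"
  where "chars G \<equiv> carrier (character_group G)"

abbreviation sec :: "('o, 'a, ('u, 'z) monoid_scheme, 'b) fctr \<Rightarrow> 'o \<Rightarrow> 'u set"
  where "sec F X \<equiv> carrier (on_ob F X)"

section \<open>Small sets\<close>

text \<open>\<open>small\<close> only measures subsets of the universe. The index sets met below
  consist of pairs of arrows, of pairs of an object and an element, or of characters, so smallness
  is also stated for sets over any other type.\<close>

definition small_in :: "'u itself \<Rightarrow> 'k set \<Rightarrow> bool"
  where "small_in (_ :: 'u itself) K \<longleftrightarrow> |K| <o |UNIV :: 'u set|"

lemma small_iff_small_in: "small (A :: 'u set) \<longleftrightarrow> small_in TYPE('u) A"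
  by (simp add: small_def small_in_def)

lemma small_in_inj_on:
  assumes "small_in TYPE('u) B" "inj_on f A" "f ` A \<subseteq> B"
  shows "small_in TYPE('u) A"
proof -
  have "|A| \<le>o |B|" using assms(2,3) card_of_ordLeq by blast
  then show ?thesis using assms(1) ordLeq_ordLess_trans unfolding small_in_def by blast
qed

lemma small_in_subset: "small_in TYPE('u) B \<Longrightarrow> A \<subseteq> B \<Longrightarrow> small_in TYPE('u) A"
  by (rule small_in_inj_on[where f = id]) auto

lemma small_in_image: "small_in TYPE('u) A \<Longrightarrow> small_in TYPE('u) (f ` A)"
  unfolding small_in_def using card_of_image ordLeq_ordLess_trans by blast

text \<open>Coproducts and compactness are postulated for index sets inside the universe; such an
  embedding re-indexes a small family by a subset of it.\<close>

lemma small_in_embed: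
  assumes "small_in TYPE('u) (K :: 'k set)"
  obtains e :: "'k \<Rightarrow> 'u" where "inj_on e K"
  using assms card_of_ordLeq[of K "UNIV :: 'u set"] ordLess_imp_ordLeq unfolding small_in_def by blast

context
  assumes universe: "inaccessible_universe TYPE('u)"
begin

lemma small_in_nat: "small_in TYPE('u) (A :: nat set)"
proof -
  have "|A| \<le>o natLeq"
    using card_of_nat ordLeq_ordIso_trans[of "|A|" "|UNIV :: nat set|"] card_of_mono1[of A UNIV] by auto
  then show ?thesis using universe ordLeq_ordLess_trans unfolding small_in_def inaccessible_universe_def by blast
qed

lemma small_in_countable: "countable A \<Longrightarrow> small_in TYPE('u) A"
  by (meson countable_def small_in_inj_on small_in_nat subset_UNIV)

text \<open>An infinite regular cardinal is stable: fewer sets than the cardinal, each of smaller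
  size, have a sum of smaller size.\<close>

lemma small_in_Sigma:
  assumes "small_in TYPE('u) A" "\<And>a. a \<in> A \<Longrightarrow> small_in TYPE('u) (B a)"
  shows "small_in TYPE('u) (Sigma A B)"
proof -
  have inf: "infinite (UNIV :: 'u set)"
    using universe natLeq_ordLeq_cinfinite ordLess_imp_ordLeq infinite_iff_natLeq_ordLeq
    unfolding inaccessible_universe_def by blast
  have "stable |UNIV :: 'u set|"
    using universe inf by (intro regularCard_stable) (simp_all add: inaccessible_universe_def card_of_card_order_on Field_card_of)
  then show ?thesis using assms stable_elim unfolding small_in_def by blast
qed

lemma small_in_Un:
  assumes "small_in TYPE('u) A" "small_in TYPE('u) B"
  shows "small_in TYPE('u) (A \<union> B)"
proof -
  let ?S = "SIGMA b:(UNIV :: bool set). if b then A else B"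
  have "small_in TYPE('u) ?S" by (rule small_in_Sigma) (use assms in \<open>auto intro: small_in_countable\<close>)
  then have "small_in TYPE('u) (snd ` ?S)" by (rule small_in_image)
  moreover have "A \<union> B \<subseteq> snd ` ?S"
  proof
    fix x assume "x \<in> A \<union> B"
    then have "(x \<in> A, x) \<in> ?S" by auto
    then show "x \<in> snd ` ?S" using image_eqI[of x snd "(x \<in> A, x)" ?S] by simp
  qed
  ultimately show ?thesis using small_in_subset by blast
qed

text \<open>The strong limit clause speaks of subsets of the universe and is moved to
  \<open>A\<close> along an embedding.\<close>

lemma small_in_Pow:
  assumes "small_in TYPE('u) (A :: 'k set)"
  shows "small_in TYPE('u) (Pow A)"
proof -
  obtain e :: "'k \<Rightarrow> 'u" where e: "inj_on e A"
    using small_in_embed[OF assms] .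
  have "small_in TYPE('u) (Pow (e ` A))"
    using universe small_in_image[OF assms, of e] by (simp add: inaccessible_universe_def small_in_def)
  moreover have "inj_on (image e) (Pow A)" by (rule inj_on_image_Pow[OF e])
  ultimately show ?thesis by (rule small_in_inj_on) auto
qed

end


section \<open>Characters with values in the rationals modulo the integers\<close>

text \<open>The coset of \<open>q\<close> modulo \<open>\<int>\<close>; equalities in Q/Z become
  integrality statements about rationals.\<close>

definition qz :: "rat \<Rightarrow> rat set"
  where "qz q = {r. r - q \<in> \<int>}"

lemma qz_eq_iff: "qz a = qz b \<longleftrightarrow> a - b \<in> \<int>"
proof
  assume "qz a = qz b"
  moreover have "a \<in> qz a" by (simp add: qz_def)
  ultimately show "a - b \<in> \<int>" by (simp add: qz_def)
next
  assume ab: "a - b \<in> \<int>"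
  have "r - a \<in> \<int> \<longleftrightarrow> r - b \<in> \<int>" for r using Ints_add[OF _ ab, of "r - a"] Ints_diff[OF _ ab, of "r - b"] by auto
  then show "qz a = qz b" by (simp add: qz_def)
qed

lemma rat_coset: "\<int> #>\<^bsub>\<lparr>carrier = UNIV, monoid.mult = (+), one = 0\<rparr>\<^esub> q = qz q"
proof -
  have "r - q \<in> \<int> \<Longrightarrow> \<exists>z\<in>\<int>. r = z + q" for r by (rule bexI[of _ "r - q"]) auto
  then show ?thesis by (auto simp: r_coset_def qz_def)
qed

lemma carrier_rat_mod_int: "carrier QZ = range qz"
  unfolding rat_mod_int_def FactGroup_def RCOSETS_def by (auto simp: rat_coset)

lemma one_rat_mod_int: "\<one>\<^bsub>QZ\<^esub> = qz 0"
  unfolding rat_mod_int_def FactGroup_def by (simp add: qz_def)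

lemma mult_rat_mod_int: "qz a \<otimes>\<^bsub>QZ\<^esub> qz b = qz (a + b)"
proof -
  have 1: "r - a \<in> \<int> \<Longrightarrow> s - b \<in> \<int> \<Longrightarrow> r + s - (a + b) \<in> \<int>" for r s
    using Ints_add[of "r - a" "s - b"] by (simp add: algebra_simps)
  have 2: "\<exists>r. r - a \<in> \<int> \<and> (\<exists>s. s - b \<in> \<int> \<and> t = r + s)" if "t - (a + b) \<in> \<int>" for t
    by (rule exI[of _ "t - b"]) (use that in \<open>auto simp: algebra_simps intro!: exI[of _ b]\<close>)
  show ?thesis unfolding rat_mod_int_def FactGroup_def set_mult_def qz_def using 1 2 by auto
qed

lemma comm_group_rat_mod_int: "comm_group QZ"
proof (rule comm_groupI)
  fix x assume "x \<in> carrier QZ"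
  then obtain q where "x = qz q" by (auto simp: carrier_rat_mod_int)
  then show "\<exists>y\<in>carrier QZ. y \<otimes>\<^bsub>QZ\<^esub> x = \<one>\<^bsub>QZ\<^esub>"
    by (intro bexI[of _ "qz (- q)"]) (auto simp: carrier_rat_mod_int one_rat_mod_int mult_rat_mod_int)
qed (auto simp: carrier_rat_mod_int one_rat_mod_int mult_rat_mod_int add_ac)

interpretation QZ: comm_group QZ
  by (rule comm_group_rat_mod_int)

lemma qz_nat_pow: "qz a [^]\<^bsub>QZ\<^esub> (n :: nat) = qz (of_nat n * a)"
  by (induction n) (auto simp: one_rat_mod_int mult_rat_mod_int algebra_simps)

lemma qz_int_pow: "qz a [^]\<^bsub>QZ\<^esub> (n :: int) = qz (of_int n * a)"
proof (cases "n \<ge> 0")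
  case True
  then obtain k where "n = int k" using nonneg_int_cases by blast
  then show ?thesis by (simp add: int_pow_int qz_nat_pow)
next
  case False
  then obtain k where k: "n = - int k" by (metis int_cases linorder_linear of_nat_0_le_iff)
  have "inv\<^bsub>QZ\<^esub> (qz (of_nat k * a)) = qz (- (of_nat k * a))"
    by (rule QZ.inv_equality) (auto simp: carrier_rat_mod_int one_rat_mod_int mult_rat_mod_int)
  then show ?thesis by (simp add: k QZ.int_pow_neg_int carrier_rat_mod_int qz_nat_pow)
qed

text \<open>Divisibility is what makes Q/Z injective: it supplies the value of a character at an
  element of which only some power is covered so far.\<close>

lemma rat_mod_int_divisible:
  assumes "x \<in> carrier QZ" "d \<noteq> (0 :: int)"
  obtains y where "y \<in> carrier QZ" "y [^]\<^bsub>QZ\<^esub> d = x"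
proof -
  obtain q where "x = qz q" using assms by (auto simp: carrier_rat_mod_int)
  then have "qz (q / of_int d) [^]\<^bsub>QZ\<^esub> d = x" using assms by (simp add: qz_int_pow)
  then show ?thesis using that by (auto simp: carrier_rat_mod_int)
qed

text \<open>Partial maps are treated as graphs, for which the union bounds a chain and a maximal
  element must be total, since any missing point could be added. The same scheme serves for
  characters of groups and for functionals on a Hom functor.\<close>

lemma relation_extend_Zorn:
  assumes "P R0"
    and chain: "\<And>\<C>. \<C> \<noteq> {} \<Longrightarrow> subset.chain {R. P R} \<C> \<Longrightarrow> P (\<Union>\<C>)"
    and extend: "\<And>R x. P R \<Longrightarrow> x \<in> X \<Longrightarrow> \<exists>R'. P R' \<and> R \<subseteq> R' \<and> x \<in> Domain R'"
  obtains R where "P R" "R0 \<subseteq> R" "X \<subseteq> Domain R"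
proof -
  let ?A = "{R. P R \<and> R0 \<subseteq> R}"
  have "\<exists>M\<in>?A. \<forall>R\<in>?A. M \<subseteq> R \<longrightarrow> R = M"
  proof (rule subset_Zorn_nonempty)
    show "?A \<noteq> {}" using assms(1) by auto
    fix \<C> assume C: "\<C> \<noteq> {}" "subset.chain ?A \<C>"
    then have "subset.chain {R. P R} \<C>" "\<And>R. R \<in> \<C> \<Longrightarrow> R0 \<subseteq> R" by (auto simp: subset.chain_def)
    then show "\<Union>\<C> \<in> ?A" using C(1) chain[OF C(1)] by auto
  qed
  then obtain M where M: "P M" "R0 \<subseteq> M" "\<And>R. P R \<Longrightarrow> R0 \<subseteq> R \<Longrightarrow> M \<subseteq> R \<Longrightarrow> R = M" by auto
  have "x \<in> Domain M" if x: "x \<in> X" for x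
  proof -
    obtain R where R: "P R" "M \<subseteq> R" "x \<in> Domain R" using extend[OF M(1) x] by blast
    then have "R = M" using M(2) by (intro M(3)) auto
    then show ?thesis using R by simp
  qed
  then show ?thesis using that[OF M(1,2)] by blast
qed

text \<open>A closure condition on two pairs of the union of a chain can thus be checked inside one
  member.\<close>

lemma subset_chain_Un:
  assumes "subset.chain \<A> \<C>" "R \<in> \<C>" "S \<in> \<C>"
  shows "R \<union> S \<in> \<C>"
proof -
  have "R \<subseteq> S \<or> S \<subseteq> R" using assms unfolding subset.chain_def by blast
  then show ?thesis using assms(2,3) by (auto simp: Un_absorb1 Un_absorb2)
qed

text \<open>Graphs of characters on subgroups of \<open>G\<close>.\<close>

definition partial_character :: "('g, 'z) monoid_scheme \<Rightarrow> ('g \<times> rat set) set \<Rightarrow> bool"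
  where "partial_character G R \<longleftrightarrow>
    R \<subseteq> carrier G \<times> carrier QZ \<and> (\<one>\<^bsub>G\<^esub>, \<one>\<^bsub>QZ\<^esub>) \<in> R \<and>
    (\<forall>a u b v. (a, u) \<in> R \<longrightarrow> (b, v) \<in> R \<longrightarrow> (a \<otimes>\<^bsub>G\<^esub> b, u \<otimes>\<^bsub>QZ\<^esub> v) \<in> R) \<and>
    (\<forall>a u. (a, u) \<in> R \<longrightarrow> (inv\<^bsub>G\<^esub> a, inv\<^bsub>QZ\<^esub> u) \<in> R) \<and>
    (\<forall>v. (\<one>\<^bsub>G\<^esub>, v) \<in> R \<longrightarrow> v = \<one>\<^bsub>QZ\<^esub>)"

lemma
  assumes "partial_character G R"
  shows partial_character_closed: "(a, u) \<in> R \<Longrightarrow> a \<in> carrier G \<and> u \<in> carrier QZ"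
    and partial_character_one: "(\<one>\<^bsub>G\<^esub>, \<one>\<^bsub>QZ\<^esub>) \<in> R"
    and partial_character_mult:
      "(a, u) \<in> R \<Longrightarrow> (b, v) \<in> R \<Longrightarrow> (a \<otimes>\<^bsub>G\<^esub> b, u \<otimes>\<^bsub>QZ\<^esub> v) \<in> R"
    and partial_character_inv: "(a, u) \<in> R \<Longrightarrow> (inv\<^bsub>G\<^esub> a, inv\<^bsub>QZ\<^esub> u) \<in> R"
    and partial_character_single: "(\<one>\<^bsub>G\<^esub>, v) \<in> R \<Longrightarrow> v = \<one>\<^bsub>QZ\<^esub>"
  using assms unfolding partial_character_def by (simp_all add: subset_iff)

section \<open>Q/Z is an injective cogenerator of abelian groups\<close>

context comm_group
begin

text \<open>Single-valuedness is required at the unit alone; applied to the quotient of two pairs it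
  holds everywhere.\<close>

lemma partial_character_unique:
  assumes "partial_character G R" "(a, u) \<in> R" "(a, v) \<in> R"
  shows "u = v"
proof -
  have "(a \<otimes> inv a, u \<otimes>\<^bsub>QZ\<^esub> inv\<^bsub>QZ\<^esub> v) \<in> R"
    and c: "a \<in> carrier G" "u \<in> carrier QZ" "v \<in> carrier QZ"
    using partial_character_mult[OF assms(1,2) partial_character_inv[OF assms(1,3)]]
      partial_character_closed[OF assms(1)] assms by auto
  then have "u \<otimes>\<^bsub>QZ\<^esub> inv\<^bsub>QZ\<^esub> v = \<one>\<^bsub>QZ\<^esub>" using partial_character_single[OF assms(1)] by simp
  then show ?thesis using c QZ.inv_equality[of u "inv\<^bsub>QZ\<^esub> v"] by simp
qed

lemma partial_character_int_pow:
  assumes R: "partial_character G R" and au: "(a, u) \<in> R"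
  shows "(a [^] (n :: int), u [^]\<^bsub>QZ\<^esub> n) \<in> R"
proof -
  have nat: "(a [^] (k :: nat), u [^]\<^bsub>QZ\<^esub> k) \<in> R" for k
    by (induction k) (use partial_character_one[OF R] partial_character_mult[OF R _ au] in auto)
  have c: "a \<in> carrier G" "u \<in> carrier QZ" using partial_character_closed[OF R au] by auto
  show ?thesis
  proof (cases n rule: int_cases2)
    case (nonneg k)
    then show ?thesis using nat by (simp add: int_pow_int)
  next
    case (nonpos k)
    then show ?thesis using partial_character_inv[OF R nat[of k]] c by (simp add: int_pow_neg_int QZ.int_pow_neg_int)
  qed
qed

text \<open>The new graph sits on the subgroup generated by the old domain and \<open>x\<close>. By
  \<open>pow\<close> the prescribed value agrees with \<open>R\<close> on the powers of
  \<open>x\<close> already covered, and this makes the enlarged graph single-valued at the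
  unit.\<close>

lemma partial_character_adjoin:
  assumes R: "partial_character G R" and x: "x \<in> carrier G" and q: "q \<in> carrier QZ"
    and pow: "\<And>(n :: int) w. (x [^] n, w) \<in> R \<Longrightarrow> w = q [^]\<^bsub>QZ\<^esub> n"
  shows "\<exists>R'. partial_character G R' \<and> R \<subseteq> R' \<and> (x, q) \<in> R'"
proof -
  let ?R = "{(r \<otimes> x [^] n, v \<otimes>\<^bsub>QZ\<^esub> q [^]\<^bsub>QZ\<^esub> n) | r v (n :: int). (r, v) \<in> R}"
  note c = partial_character_closed[OF R] and one = partial_character_one[OF R]
  have mult: "(a \<otimes> b, u \<otimes>\<^bsub>QZ\<^esub> v) \<in> ?R" if "(a, u) \<in> ?R" "(b, v) \<in> ?R" for a u b v
  proof -
    obtain r v1 and n :: int where 1: "(r, v1) \<in> R" "a = r \<otimes> x [^] n"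
        "u = v1 \<otimes>\<^bsub>QZ\<^esub> q [^]\<^bsub>QZ\<^esub> n" using \<open>(a, u) \<in> ?R\<close> by auto
    obtain s v2 and m :: int where 2: "(s, v2) \<in> R" "b = s \<otimes> x [^] m"
        "v = v2 \<otimes>\<^bsub>QZ\<^esub> q [^]\<^bsub>QZ\<^esub> m" using \<open>(b, v) \<in> ?R\<close> by auto
    have "a \<otimes> b = (r \<otimes> s) \<otimes> x [^] (n + m)" using c[OF 1(1)] c[OF 2(1)] x by (simp add: 1 2 int_pow_mult m_ac)
    moreover have "u \<otimes>\<^bsub>QZ\<^esub> v =
        (v1 \<otimes>\<^bsub>QZ\<^esub> v2) \<otimes>\<^bsub>QZ\<^esub> q [^]\<^bsub>QZ\<^esub> (n + m)"
      using c[OF 1(1)] c[OF 2(1)] q by (simp add: 1 2 QZ.int_pow_mult QZ.m_ac)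
    moreover have "(r \<otimes> s, v1 \<otimes>\<^bsub>QZ\<^esub> v2) \<in> R"
      using partial_character_mult[OF R 1(1) 2(1)] .
    ultimately show ?thesis by blast
  qed
  have inv: "(inv a, inv\<^bsub>QZ\<^esub> u) \<in> ?R" if "(a, u) \<in> ?R" for a u
  proof -
    obtain r v1 and n :: int where 1: "(r, v1) \<in> R" "a = r \<otimes> x [^] n"
        "u = v1 \<otimes>\<^bsub>QZ\<^esub> q [^]\<^bsub>QZ\<^esub> n" using \<open>(a, u) \<in> ?R\<close> by auto
    have "inv a = inv r \<otimes> x [^] (- n)"
        "inv\<^bsub>QZ\<^esub> u = inv\<^bsub>QZ\<^esub> v1 \<otimes>\<^bsub>QZ\<^esub> q [^]\<^bsub>QZ\<^esub> (- n)"
      using c[OF 1(1)] x q by (simp_all add: 1 int_pow_neg inv_mult QZ.int_pow_neg QZ.inv_mult)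
    moreover have "(inv r, inv\<^bsub>QZ\<^esub> v1) \<in> R"
      using partial_character_inv[OF R 1(1)] .
    ultimately show ?thesis by blast
  qed
  have single: "v = \<one>\<^bsub>QZ\<^esub>" if one_v: "(\<one>, v) \<in> ?R" for v
  proof -
    obtain r v1 and n :: int where 1: "(r, v1) \<in> R" "\<one> = r \<otimes> x [^] n"
        "v = v1 \<otimes>\<^bsub>QZ\<^esub> q [^]\<^bsub>QZ\<^esub> n" using one_v by auto
    have "r = x [^] (- n)" using 1(2) c[OF 1(1)] x inv_equality[of r "x [^] n"] by (simp add: int_pow_neg)
    then have "v1 = q [^]\<^bsub>QZ\<^esub> (- n)" using pow 1(1) by blast
    then show ?thesis using q by (simp add: 1 QZ.int_pow_neg)
  qed
  have sub: "R \<subseteq> ?R"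
  proof (rule subrelI)
    fix r v assume rv: "(r, v) \<in> R"
    then have "(r, v) = (r \<otimes> x [^] (0::int), v \<otimes>\<^bsub>QZ\<^esub> q [^]\<^bsub>QZ\<^esub> (0::int))" using c[OF rv] by simp
    then show "(r, v) \<in> ?R" using rv by blast
  qed
  have "(x, q) = (\<one> \<otimes> x [^] (1::int), \<one>\<^bsub>QZ\<^esub> \<otimes>\<^bsub>QZ\<^esub> q [^]\<^bsub>QZ\<^esub> (1::int))" using x q by (simp add: int_pow_1 QZ.int_pow_1)
  then have "(x, q) \<in> ?R" using one by blast
  moreover have "partial_character G ?R"
    unfolding partial_character_def
  proof (intro conjI allI impI)
    show "?R \<subseteq> carrier G \<times> carrier QZ" using c x q by auto
    show "(\<one>, \<one>\<^bsub>QZ\<^esub>) \<in> ?R" using sub one by (rule subsetD)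
  qed (fact mult inv single)+
  ultimately show ?thesis using sub by blast
qed

text \<open>The exponents \<open>n\<close> with \<open>x [^] n\<close> in the domain form a subgroup
  of the integers, nonzero by hypothesis; \<open>d\<close> is its positive generator.\<close>

lemma least_positive_power:
  fixes x
  assumes R: "partial_character G R" and x: "x \<in> carrier G" and "x [^] (k :: int) \<in> Domain R" "k \<noteq> 0"
  obtains d :: int where "d > 0" "x [^] d \<in> Domain R"
    "\<And>n :: int. x [^] n \<in> Domain R \<Longrightarrow> d dvd n"
proof -
  let ?N = "{n :: int. x [^] n \<in> Domain R}"
  have add: "n + m \<in> ?N" if "n \<in> ?N" "m \<in> ?N" for n m
    using that x partial_character_mult[OF R] by (auto simp: int_pow_mult) (metis DomainI)
  have neg: "- n \<in> ?N" if "n \<in> ?N" for n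
    using that x partial_character_inv[OF R] by (auto simp: int_pow_neg) (metis DomainI)?
  have mul: "int j * n \<in> ?N" if "n \<in> ?N" for j n
  proof (induction j)
    case 0
    then show ?case using partial_character_one[OF R] by auto
  next
    case (Suc j)
    then show ?case using add[OF that Suc] by (simp add: algebra_simps)
  qed
  have mulz: "j * n \<in> ?N" if "n \<in> ?N" for j n
    using mul[OF that, of "nat j"] neg[OF mul[OF that, of "nat (- j)"]] by (cases "j \<ge> 0") auto
  define d where "d = (LEAST j :: nat. j > 0 \<and> int j \<in> ?N)"
  have "\<exists>j :: nat. j > 0 \<and> int j \<in> ?N" using assms(3,4) neg[of k] by (intro exI[of _ "nat \<bar>k\<bar>"]) (auto simp: abs_if)
  then have d: "d > 0" "int d \<in> ?N" unfolding d_def by (metis (mono_tags, lifting) LeastI)+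
  have "int d dvd n" if "n \<in> ?N" for n
  proof (rule ccontr)
    assume nd: "\<not> int d dvd n"
    let ?r = "n mod int d"
    have "?r = n + (- (n div int d)) * int d" by (simp add: minus_div_mult_eq_mod)
    then have "?r \<in> ?N" using add[OF that mulz[OF d(2)]] by metis
    moreover have r: "0 < ?r" "?r < int d"
    proof -
      have "?r \<noteq> 0" using nd by (simp add: dvd_eq_mod_eq_0)
      then show "0 < ?r" "?r < int d" using d(1) pos_mod_sign[of "int d" n] pos_mod_bound[of "int d" n] by linarith+
    qed
    ultimately have "0 < nat ?r \<and> int (nat ?r) \<in> ?N" by (simp only: nat_0_le[OF less_imp_le] zero_less_nat_eq simp_thms)
    then have "d \<le> nat ?r" unfolding d_def by (rule Least_le)
    then show False using r by linarith
  qed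
  then show ?thesis using that[of "int d"] d by auto
qed

text \<open>If no nonzero power of \<open>x\<close> is covered, the unit may serve as its value.
  Otherwise the value at the least positive covered power \<open>x [^] d\<close> is divided by
  \<open>d\<close>; as \<open>d\<close> divides every covered exponent, the result is compatible
  with \<open>R\<close>.\<close>

lemma partial_character_extend_to:
  assumes R: "partial_character G R" and x: "x \<in> carrier G"
  shows "\<exists>R'. partial_character G R' \<and> R \<subseteq> R' \<and> x \<in> Domain R'"
proof -
  have "\<exists>q\<in>carrier QZ. \<forall>(n :: int) w. (x [^] n, w) \<in> R \<longrightarrow> w = q [^]\<^bsub>QZ\<^esub> n"
  proof (cases "\<exists>k :: int. k \<noteq> 0 \<and> x [^] k \<in> Domain R")
    case False
    have "w = \<one>\<^bsub>QZ\<^esub> [^]\<^bsub>QZ\<^esub> n" if "(x [^] n, w) \<in> R" for n :: int and w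
    proof -
      have "n = 0" using False that by blast
      then show ?thesis using that partial_character_single[OF R] by auto
    qed
    then show ?thesis by blast
  next
    case True
    then obtain d :: int where d: "d > 0" "x [^] d \<in> Domain R"
        "\<And>n :: int. x [^] n \<in> Domain R \<Longrightarrow> d dvd n" using least_positive_power[OF R x] by metis
    then obtain v where v: "(x [^] d, v) \<in> R" by blast
    then obtain q where q: "q \<in> carrier QZ" "q [^]\<^bsub>QZ\<^esub> d = v"
      using rat_mod_int_divisible[of v d] partial_character_closed[OF R v] d(1) by auto
    have "w = q [^]\<^bsub>QZ\<^esub> n" if w: "(x [^] n, w) \<in> R" for n :: int and w
    proof -
      obtain m where m: "n = d * m" using d(3) w by blast
      have "(x [^] n, q [^]\<^bsub>QZ\<^esub> n) \<in> R"
        using partial_character_int_pow[OF R v, of m]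
        unfolding m q(2)[symmetric] int_pow_pow[OF x] QZ.int_pow_pow[OF q(1)] .
      then show ?thesis using partial_character_unique[OF R w] by simp
    qed
    then show ?thesis using q by blast
  qed
  then show ?thesis using partial_character_adjoin[OF R x] by (metis Domain.DomainI)
qed

text \<open>This is injectivity of Q/Z: \<open>R0\<close> may be any character on a subgroup. Zorn
  gives a total graph, from which the values are then selected.\<close>

theorem partial_character_extends:
  assumes R0: "partial_character G R0"
  obtains \<chi> where "\<chi> \<in> hom G QZ" "\<And>a u. (a, u) \<in> R0 \<Longrightarrow> \<chi> a = u"
proof -
  obtain R where R: "partial_character G R" "R0 \<subseteq> R" "carrier G \<subseteq> Domain R"
  proof (rule relation_extend_Zorn[where P = "partial_character G" and X = "carrier G", OF R0])
    fix \<C> :: "('a \<times> rat set) set set"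
    assume ne: "\<C> \<noteq> {}" and ch: "subset.chain {R. partial_character G R} \<C>"
    have P: "\<And>R. R \<in> \<C> \<Longrightarrow> partial_character G R" using ch by (auto simp: subset.chain_def)
    show "partial_character G (\<Union>\<C>)"
      unfolding partial_character_def
    proof (intro conjI allI impI)
      show "(\<one>, \<one>\<^bsub>QZ\<^esub>) \<in> \<Union>\<C>" using ne P partial_character_one by blast
      fix a u b v assume "(a, u) \<in> \<Union>\<C>" "(b, v) \<in> \<Union>\<C>"
      then obtain S where "S \<in> \<C>" "(a, u) \<in> S" "(b, v) \<in> S" using subset_chain_Un[OF ch] by blast
      then show "(a \<otimes> b, u \<otimes>\<^bsub>QZ\<^esub> v) \<in> \<Union>\<C>" using partial_character_mult[OF P] by blast
    next
      show "\<Union>\<C> \<subseteq> carrier G \<times> carrier QZ"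
        using P partial_character_closed by (intro subrelI) (auto dest!: P partial_character_closed)
    next
      fix a u assume "(a, u) \<in> \<Union>\<C>"
      then show "(inv a, inv\<^bsub>QZ\<^esub> u) \<in> \<Union>\<C>" using partial_character_inv[OF P] by auto
    next
      fix v assume "(\<one>, v) \<in> \<Union>\<C>"
      then show "v = \<one>\<^bsub>QZ\<^esub>" using partial_character_single[OF P] by auto
    qed
  next
    show "\<exists>R'. partial_character G R' \<and> R \<subseteq> R' \<and> x \<in> Domain R'"
      if "partial_character G R" "x \<in> carrier G" for R x by (rule partial_character_extend_to[OF that])
  qed
  define \<chi> where "\<chi> = (\<lambda>a. SOME u. (a, u) \<in> R)"
  have graph: "(a, \<chi> a) \<in> R" if "a \<in> carrier G" for a
  proof -
    obtain u where "(a, u) \<in> R" using R(3) \<open>a \<in> carrier G\<close> by blast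
    then show ?thesis unfolding \<chi>_def by (rule someI)
  qed
  have val: "\<chi> a = u" if "(a, u) \<in> R" for a u
    using partial_character_unique[OF R(1) graph that] partial_character_closed[OF R(1) that] by simp
  have "\<chi> \<in> hom G QZ"
  proof (rule homI)
    fix a b assume "a \<in> carrier G" "b \<in> carrier G"
    then have "(a \<otimes> b, \<chi> a \<otimes>\<^bsub>QZ\<^esub> \<chi> b) \<in> R" by (intro partial_character_mult[OF R(1)] graph)
    then show "\<chi> (a \<otimes> b) = \<chi> a \<otimes>\<^bsub>QZ\<^esub> \<chi> b" by (rule val)
  next
    show "\<chi> a \<in> carrier QZ" if "a \<in> carrier G" for a using partial_character_closed[OF R(1) graph[OF that]] by simp
  qed
  then show ?thesis using R(2) by (intro that[of \<chi>] val) auto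
qed

text \<open>The trivial character on \<open>N\<close> is extended by a nontrivial value at
  \<open>p\<close>, chosen so that it is killed by every power of \<open>p\<close> lying in
  \<open>N\<close>.\<close>

theorem character_separates:
  assumes N: "subgroup N G" and p: "p \<in> carrier G" "p \<notin> N"
  obtains \<chi> where "\<chi> \<in> hom G QZ" "\<And>n. n \<in> N \<Longrightarrow> \<chi> n = \<one>\<^bsub>QZ\<^esub>" "\<chi> p \<noteq> \<one>\<^bsub>QZ\<^esub>"
proof -
  let ?R = "N \<times> {\<one>\<^bsub>QZ\<^esub>}"
  have R: "partial_character G ?R"
    using subgroup.subset[OF N] subgroup.one_closed[OF N] subgroup.m_closed[OF N] subgroup.m_inv_closed[OF N]
    by (auto simp: partial_character_def)
  have D: "Domain ?R = N" by auto
  have "\<exists>q\<in>carrier QZ. q \<noteq> \<one>\<^bsub>QZ\<^esub> \<and> (\<forall>n :: int. p [^] n \<in> N \<longrightarrow> q [^]\<^bsub>QZ\<^esub> n = \<one>\<^bsub>QZ\<^esub>)"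
  proof (cases "\<exists>k :: int. k \<noteq> 0 \<and> p [^] k \<in> N")
    case False
    \<comment> \<open>Here \<open>p\<close> has infinite order modulo \<open>N\<close>, so any
      nontrivial value is consistent; the class of 1/2 is taken.\<close>
    have "(1/2 :: rat) \<notin> \<int>"
    proof
      assume "(1/2 :: rat) \<in> \<int>"
      then obtain z :: int where "(1/2 :: rat) = of_int z" by (auto elim: Ints_cases)
      then have "of_int (2 * z) = (1 :: rat)" by simp
      then show False using of_int_eq_1_iff[of "2 * z", where ?'a = rat] by presburger
    qed
    then have "qz (1/2) \<noteq> \<one>\<^bsub>QZ\<^esub>" by (simp add: one_rat_mod_int qz_eq_iff)
    moreover have "qz (1/2) [^]\<^bsub>QZ\<^esub> n = \<one>\<^bsub>QZ\<^esub>" if "p [^] n \<in> N" for n :: int using False that by (cases "n = 0") auto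
    ultimately show ?thesis by (intro bexI[of _ "qz (1/2)"] conjI allI impI) (simp_all add: carrier_rat_mod_int)
  next
    case True
    then obtain d :: int where d: "d > 0" "p [^] d \<in> N" "\<And>n :: int. p [^] n \<in> N \<Longrightarrow> d dvd n"
      using least_positive_power[OF R p(1)] unfolding D by metis
    \<comment> \<open>\<open>d\<close> is the order of \<open>p\<close> modulo \<open>N\<close>. It
      differs from 1 because \<open>p\<close> is outside \<open>N\<close>, so the class of 1/d is
      nontrivial, and it is killed by \<open>d\<close>.\<close>
    have "d \<noteq> 1" using d(2) p by auto
    have "(1 / of_int d :: rat) \<notin> \<int>"
    proof
      assume "(1 / of_int d :: rat) \<in> \<int>"
      then obtain z :: int where "(1 / of_int d :: rat) = of_int z" by (auto elim: Ints_cases)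
      then have "of_int (z * d) = (1 :: rat)" using d(1) by (simp add: field_simps)
      then have "z * d = 1" using of_int_eq_1_iff by blast
      then show False using \<open>d \<noteq> 1\<close> d(1) by (simp add: zmult_eq_1_iff)
    qed
    then have "qz (1 / of_int d) \<noteq> \<one>\<^bsub>QZ\<^esub>" by (simp add: one_rat_mod_int qz_eq_iff)
    moreover have "qz (1 / of_int d) [^]\<^bsub>QZ\<^esub> n = \<one>\<^bsub>QZ\<^esub>" if n: "p [^] n \<in> N" for n :: int
    proof -
      obtain m where "n = d * m" using d(3)[OF n] by blast
      then show ?thesis using d(1) by (simp add: qz_int_pow one_rat_mod_int qz_eq_iff)
    qed
    ultimately show ?thesis by (intro bexI[of _ "qz (1 / of_int d)"] conjI allI impI) (simp_all add: carrier_rat_mod_int)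
  qed
  then obtain q where q: "q \<in> carrier QZ" "q \<noteq> \<one>\<^bsub>QZ\<^esub>"
      "\<And>n :: int. p [^] n \<in> N \<Longrightarrow> q [^]\<^bsub>QZ\<^esub> n = \<one>\<^bsub>QZ\<^esub>" by blast
  obtain R' where R': "partial_character G R'" "?R \<subseteq> R'" "(p, q) \<in> R'"
    using partial_character_adjoin[OF R p(1) q(1)] q(3) by auto
  obtain \<chi> where \<chi>: "\<chi> \<in> hom G QZ" "\<And>a u. (a, u) \<in> R' \<Longrightarrow> \<chi> a = u" using partial_character_extends[OF R'(1)] by metis
  show ?thesis using R' q(2) \<chi>(2) by (intro that[OF \<chi>(1)]) auto
qed

end

lemma hom_finprod:
  assumes "comm_group G" "comm_group H" "h \<in> hom G H" "f \<in> A \<rightarrow> carrier G"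
  shows "h (finprod G f A) = finprod H (\<lambda>i. h (f i)) A"
proof -
  interpret G: comm_group G by fact
  interpret H: comm_group H by fact
  interpret h: group_hom G H h using assms(3) by unfold_locales
  show ?thesis using assms(4) by (induction A rule: infinite_finite_induct) (simp_all add: Pi_iff)
qed

section \<open>Character groups and their copies inside the universe\<close>

lemma carrier_character_group:
  "chars G = hom G QZ \<inter> extensional (carrier G)" by (simp add: character_group_def)

lemma mult_character_group:
  "\<phi> \<otimes>\<^bsub>character_group G\<^esub> \<psi> = (\<lambda>x\<in>carrier G. \<phi> x \<otimes>\<^bsub>QZ\<^esub> \<psi> x)" by (simp add: character_group_def)

lemma one_character_group: "\<one>\<^bsub>character_group G\<^esub> = (\<lambda>x\<in>carrier G. \<one>\<^bsub>QZ\<^esub>)"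
  by (simp add: character_group_def)

lemma restrict_character:
  assumes "group G" "\<chi> \<in> hom G QZ"
  shows "restrict \<chi> (carrier G) \<in> chars G"
  using assms group.hom_restrict[of G \<chi> QZ "restrict \<chi> (carrier G)"] by (auto simp: carrier_character_group)

lemma character_eqI:
  assumes "\<phi> \<in> chars G" "\<psi> \<in> chars G"
    "\<And>x. x \<in> carrier G \<Longrightarrow> \<phi> x = \<psi> x"
  shows "\<phi> = \<psi>"
  using assms by (auto simp: carrier_character_group intro: extensionalityI)

lemma character_closed:
  "\<phi> \<in> chars G \<Longrightarrow> x \<in> carrier G \<Longrightarrow> \<phi> x \<in> carrier QZ" by (auto simp: carrier_character_group hom_def)

lemma character_mult:
  "\<phi> \<in> chars G \<Longrightarrow> x \<in> carrier G \<Longrightarrow> y \<in> carrier G \<Longrightarrow>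
    \<phi> (x \<otimes>\<^bsub>G\<^esub> y) = \<phi> x \<otimes>\<^bsub>QZ\<^esub> \<phi> y"
  by (auto simp: carrier_character_group hom_def)

lemma character_one:
  assumes "group G" "\<phi> \<in> chars G"
  shows "\<phi> \<one>\<^bsub>G\<^esub> = \<one>\<^bsub>QZ\<^esub>"
  using assms group.is_group QZ.group_axioms hom_one[of \<phi> G QZ] by (auto simp: carrier_character_group)

lemma comm_group_character_group:
  assumes "comm_group G"
  shows "comm_group (character_group G)"
proof -
  interpret comm_group G by fact
  have mult: "\<phi> \<otimes>\<^bsub>character_group G\<^esub> \<psi> \<in> chars G"
    if "\<phi> \<in> chars G" "\<psi> \<in> chars G" for \<phi> \<psi>
    using that by (auto simp: carrier_character_group mult_character_group hom_def Pi_iff QZ.m_ac)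
  have one: "\<one>\<^bsub>character_group G\<^esub> \<in> chars G" by (auto simp: carrier_character_group one_character_group hom_def)
  have inv: "(\<lambda>x\<in>carrier G. inv\<^bsub>QZ\<^esub> \<phi> x) \<in> chars G"
    if "\<phi> \<in> chars G" for \<phi> using that by (auto simp: carrier_character_group hom_def Pi_iff QZ.inv_mult)
  show ?thesis
  proof (rule comm_groupI)
    fix \<phi> assume "\<phi> \<in> chars G"
    then show "\<one>\<^bsub>character_group G\<^esub> \<otimes>\<^bsub>character_group G\<^esub> \<phi> = \<phi>"
      by (intro character_eqI[OF mult[OF one]])
        (auto simp: mult_character_group one_character_group character_closed)
  next
    fix \<phi> assume p: "\<phi> \<in> chars G"
    show "\<exists>\<psi>\<in>chars G. \<psi> \<otimes>\<^bsub>character_group G\<^esub> \<phi> = \<one>\<^bsub>character_group G\<^esub>"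
      by (rule bexI[OF _ inv[OF p]])
        (use p in \<open>auto simp: mult_character_group one_character_group character_closed intro!: restrict_ext\<close>)
  qed (use mult one in \<open>auto simp: mult_character_group character_closed QZ.m_ac intro!: restrict_ext\<close>)
qed

text \<open>A character is determined by its graph, a subset of the product of \<open>G\<close> with
  the countable group Q/Z, and the universe is closed under power sets.\<close>

lemma small_character_group:
  assumes "inaccessible_universe TYPE('u)" "small_in TYPE('u) (carrier G)"
  shows "small_in TYPE('u) (chars G)"
proof -
  have "small_in TYPE('u) (Pow (carrier G \<times> range qz))"
    using assms(2) small_in_countable[OF assms(1), of "range qz"]
    by (intro small_in_Pow[OF assms(1)] small_in_Sigma[OF assms(1)]) auto
  moreover have "inj_on (\<lambda>\<phi>. {(x, \<phi> x) | x. x \<in> carrier G}) (chars G)"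
  proof (rule inj_onI)
    fix \<phi> \<psi> assume *: "\<phi> \<in> chars G" "\<psi> \<in> chars G"
      "{(x, \<phi> x) | x. x \<in> carrier G} = {(x, \<psi> x) | x. x \<in> carrier G}"
    show "\<phi> = \<psi>"
    proof (rule character_eqI[OF *(1,2)])
      fix x assume "x \<in> carrier G"
      then have "(x, \<phi> x) \<in> {(x, \<psi> x) | x. x \<in> carrier G}" unfolding *(3)[symmetric] by blast
      then show "\<phi> x = \<psi> x" by blast
    qed
  qed
  moreover have "(\<lambda>\<phi>. {(x, \<phi> x) | x. x \<in> carrier G}) ` chars G \<subseteq> Pow (carrier G \<times> range qz)"
    using character_closed carrier_rat_mod_int by fastforce
  ultimately show ?thesis by (rule small_in_inj_on)
qed

text \<open>\<open>encode\<close> selects some injection, which is meaningful only once one exists: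
  the character group of a small group is small and therefore embeds into the universe.\<close>

lemma inj_on_encode:
  fixes G :: "'u monoid"
  assumes "inaccessible_universe TYPE('u)" "small (carrier G)"
  shows "inj_on (encode G) (chars G)"
proof -
  have "small_in TYPE('u) (chars G)" using small_character_group assms small_iff_small_in by blast
  then obtain e :: "('u \<Rightarrow> rat set) \<Rightarrow> 'u" where "inj_on e (chars G)" using small_in_embed by blast
  then show ?thesis unfolding encode_def by (rule someI[where P = "\<lambda>e. inj_on e (chars G)"])
qed

lemma decode_encode:
  fixes G :: "'u monoid"
  assumes "inaccessible_universe TYPE('u)" "small (carrier G)" "\<phi> \<in> chars G"
  shows "decode G (encode G \<phi>) = \<phi>"
  using inj_on_encode[OF assms(1,2)] assms(3) by (simp add: decode_def)

lemma carrier_image_group: "carrier (image_group f G) = f ` carrier G"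
  by (simp add: image_group_def)

lemma mult_image_group:
  "inj_on f (carrier G) \<Longrightarrow> x \<in> carrier G \<Longrightarrow> y \<in> carrier G \<Longrightarrow>
    f x \<otimes>\<^bsub>image_group f G\<^esub> f y = f (x \<otimes>\<^bsub>G\<^esub> y)"
  by (simp add: image_group_def)

lemma comm_group_image_group:
  assumes "comm_group G" "inj_on f (carrier G)"
  shows "comm_group (image_group f G)"
  using comm_group.iso_imp_img_comm_group[OF assms(1) inj_imp_image_group_iso[OF assms(2)]] by (simp add: image_group_def)

section \<open>Additive categories\<close>

lemma Hom_DomCod: "f \<in> Hom C X Y \<Longrightarrow> Dom C f = X \<and> Cod C f = Y \<and> f \<in> Arr C"
  by (simp add: Hom_def)

lemma Arr_Hom: "f \<in> Arr C \<Longrightarrow> f \<in> Hom C (Dom C f) (Cod C f)"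
  by (simp add: Hom_def)

context category
begin

lemma Hom_ob:
  assumes "f \<in> Hom C X Y"
  shows "X \<in> Ob C" "Y \<in> Ob C"
  using assms Dom_closed[of f] Cod_closed[of f] by (auto simp: Hom_def)

lemma iso_arrowE:
  assumes "iso_arrow C X Y f"
  obtains g where "f \<in> Hom C X Y" "g \<in> Hom C Y X" "g \<star> f = Ide C X" "f \<star> g = Ide C Y"
  using assms unfolding iso_arrow_def by blast

lemma iso_arrow_cancel_left:
  assumes "iso_arrow C Y Z f" "g \<in> Hom C X Y" "h \<in> Hom C X Y" "f \<star> g = f \<star> h"
  shows "g = h"
proof -
  obtain f' where f': "f \<in> Hom C Y Z" "f' \<in> Hom C Z Y" "f' \<star> f = Ide C Y" using assms(1) by (rule iso_arrowE)
  then have "f' \<star> (f \<star> g) = f' \<star> (f \<star> h)" using assms(4) by simp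
  then show ?thesis
    using Comp_assoc[OF assms(2) f'(1,2)] Comp_assoc[OF assms(3) f'(1,2)] f'(3) assms(2,3) Ide_Comp by metis
qed

lemma coproduct_ob:
  assumes "is_coproduct C I X S \<iota>"
  shows "S \<in> Ob C" "i \<in> I \<Longrightarrow> X i \<in> Ob C" "i \<in> I \<Longrightarrow> \<iota> i \<in> Hom C (X i) S"
  using assms by (auto simp: is_coproduct_def)

lemma coproduct_desc:
  assumes "is_coproduct C I X S \<iota>" "Y \<in> Ob C" "\<And>i. i \<in> I \<Longrightarrow> f i \<in> Hom C (X i) Y"
  obtains u where "u \<in> Hom C S Y" "\<And>i. i \<in> I \<Longrightarrow> u \<star> \<iota> i = f i"
proof -
  have "\<exists>!u. u \<in> Hom C S Y \<and> (\<forall>i \<in> I. u \<star> \<iota> i = f i)"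
    using assms(1)[unfolded is_coproduct_def, THEN conjunct2, THEN conjunct2, THEN conjunct2] assms(2,3) by simp
  then obtain u where u: "u \<in> Hom C S Y \<and> (\<forall>i \<in> I. u \<star> \<iota> i = f i)" by (rule exE[OF ex1_implies_ex])
  show ?thesis by (rule that[of u]) (use u in simp_all)
qed

lemma coproduct_ext:
  assumes "is_coproduct C I X S \<iota>" "u \<in> Hom C S Y" "v \<in> Hom C S Y"
    "\<And>i. i \<in> I \<Longrightarrow> u \<star> \<iota> i = v \<star> \<iota> i"
  shows "u = v"
proof -
  have "\<forall>i \<in> I. u \<star> \<iota> i \<in> Hom C (X i) Y" using Comp_closed[OF coproduct_ob(3)[OF assms(1)] assms(2)] by blast
  then have "\<exists>!w. w \<in> Hom C S Y \<and> (\<forall>i \<in> I. w \<star> \<iota> i = u \<star> \<iota> i)"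
    using assms(1)[unfolded is_coproduct_def, THEN conjunct2, THEN conjunct2, THEN conjunct2]
      Hom_ob(2)[OF assms(2)] by simp
  then show ?thesis using assms(2-4) by (elim ex1E) metis
qed

lemma coproduct_reindex:
  assumes S: "is_coproduct C I X S \<iota>" and e: "bij_betw e K I"
  shows "is_coproduct C K (\<lambda>k. X (e k)) S (\<lambda>k. \<iota> (e k))"
  unfolding is_coproduct_def
proof (intro conjI ballI allI impI)
  have eI: "\<And>k. k \<in> K \<Longrightarrow> e k \<in> I" using e bij_betwE by blast
  show "S \<in> Ob C" using S coproduct_ob by blast
  fix k assume "k \<in> K"
  then show "X (e k) \<in> Ob C" "\<iota> (e k) \<in> Hom C (X (e k)) S" using coproduct_ob[OF S] eI by blast+
next
  have eI: "\<And>k. k \<in> K \<Longrightarrow> e k \<in> I" using e bij_betwE by blast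
  define e' where "e' = inv_into K e"
  have e': "\<And>i. i \<in> I \<Longrightarrow> e' i \<in> K \<and> e (e' i) = i" "\<And>k. k \<in> K \<Longrightarrow> e' (e k) = k"
    unfolding e'_def using e by (auto simp: bij_betw_def inv_into_into f_inv_into_f)
  fix Y f assume Y: "Y \<in> Ob C" and f: "\<forall>k\<in>K. f k \<in> Hom C (X (e k)) Y"
  have f': "f (e' i) \<in> Hom C (X i) Y" if "i \<in> I" for i using f e'(1)[OF that] by metis
  obtain u where u: "u \<in> Hom C S Y" "\<And>i. i \<in> I \<Longrightarrow> u \<star> \<iota> i = f (e' i)" using coproduct_desc[OF S Y f'] by blast
  show "\<exists>!u. u \<in> Hom C S Y \<and> (\<forall>k\<in>K. u \<star> \<iota> (e k) = f k)"
  proof (rule ex1I)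
    show "u \<in> Hom C S Y \<and> (\<forall>k\<in>K. u \<star> \<iota> (e k) = f k)" using u e'(2) eI by simp
    fix v assume v: "v \<in> Hom C S Y \<and> (\<forall>k\<in>K. v \<star> \<iota> (e k) = f k)"
    show "v = u"
    proof (rule coproduct_ext[OF S])
      fix i assume i: "i \<in> I"
      then have "v \<star> \<iota> (e (e' i)) = f (e' i)" using v e'(1) by blast
      then show "v \<star> \<iota> i = u \<star> \<iota> i" using u(2) e'(1) i by simp
    qed (use u v in auto)
  qed
qed

end

text \<open>The hom-group in which the inverse is taken is read off from the domain and codomain of
  \<open>g\<close>, so that differences need no object arguments.\<close>

definition hsub :: "('o, 'a, 'z) ab_category_scheme \<Rightarrow> 'a \<Rightarrow> 'a \<Rightarrow> 'a"
  where "hsub C f g = hadd C f (inv\<^bsub>hom_group C (Dom C g) (Cod C g)\<^esub> g)"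

lemma hom_group_simps [simp]:
  "carrier (hom_group C X Y) = Hom C X Y"
  "f \<otimes>\<^bsub>hom_group C X Y\<^esub> g = hadd C f g"
  "\<one>\<^bsub>hom_group C X Y\<^esub> = hzero C X Y" by (simp_all add: hom_group_def)

context additive_category
begin

lemma hom_comm_group:
  assumes "f \<in> Hom C X Y"
  shows "comm_group (hom_group C X Y)"
  using hom_group Hom_ob[OF assms] by blast

lemma hom_monoid:
  assumes "f \<in> Hom C X Y"
  shows "comm_monoid (hom_group C X Y)"
  using hom_comm_group[OF assms] by (rule comm_group.axioms(1))

lemma hzero_closed [simp, intro]:
  assumes "X \<in> Ob C" "Y \<in> Ob C"
  shows "hzero C X Y \<in> Hom C X Y"
proof -
  interpret comm_group "hom_group C X Y" by (rule hom_group[OF assms])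
  show ?thesis using one_closed by simp
qed

lemma hadd_closed [intro]: "f \<in> Hom C X Y \<Longrightarrow> g \<in> Hom C X Y \<Longrightarrow> hadd C f g \<in> Hom C X Y"
  using monoid.m_closed[OF comm_monoid.axioms(1)[OF hom_monoid[of f X Y]], of f g] by simp

lemma hadd_comm: "f \<in> Hom C X Y \<Longrightarrow> g \<in> Hom C X Y \<Longrightarrow> hadd C f g = hadd C g f"
  using comm_monoid.m_comm[OF hom_monoid[of f X Y], of f g] by simp

lemma hadd_assoc:
  "f \<in> Hom C X Y \<Longrightarrow> g \<in> Hom C X Y \<Longrightarrow> h \<in> Hom C X Y \<Longrightarrow>
    hadd C (hadd C f g) h = hadd C f (hadd C g h)"
  using monoid.m_assoc[OF comm_monoid.axioms(1)[OF hom_monoid[of f X Y]], of f g h] by simp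

lemma hadd_hzero [simp]:
  assumes "f \<in> Hom C X Y"
  shows "hadd C f (hzero C X Y) = f" "hadd C (hzero C X Y) f = f"
proof -
  interpret G: comm_group "hom_group C X Y" by (rule hom_comm_group[OF assms])
  show "hadd C f (hzero C X Y) = f" "hadd C (hzero C X Y) f = f" using G.r_one[of f] G.l_one[of f] assms by simp_all
qed

lemma hadd_left_cancel:
  assumes "f \<in> Hom C X Y" "g \<in> Hom C X Y" "h \<in> Hom C X Y" "hadd C f g = hadd C f h"
  shows "g = h"
proof -
  interpret G: comm_group "hom_group C X Y" by (rule hom_comm_group[OF assms(1)])
  show ?thesis using G.right_cancel[of f g h] hadd_comm assms by (metis hom_group_simps(1,2))
qed

lemma hsub_closed [intro]:
  assumes "f \<in> Hom C X Y" "g \<in> Hom C X Y"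
  shows "hsub C f g \<in> Hom C X Y"
proof -
  interpret G: comm_group "hom_group C X Y" by (rule hom_comm_group[OF assms(1)])
  show ?thesis using hadd_closed[OF assms(1)] G.inv_closed[of g] assms Hom_DomCod[OF assms(2)] by (simp add: hsub_def)
qed

lemma hsub_hadd_cancel:
  assumes "f \<in> Hom C X Y" "g \<in> Hom C X Y"
  shows "hadd C (hsub C f g) g = f"
proof -
  interpret G: comm_group "hom_group C X Y" by (rule hom_comm_group[OF assms(1)])
  have "(f \<otimes>\<^bsub>hom_group C X Y\<^esub> inv\<^bsub>hom_group C X Y\<^esub> g) \<otimes>\<^bsub>hom_group C X Y\<^esub> g = f"
    using assms G.m_assoc[of f "inv\<^bsub>hom_group C X Y\<^esub> g" g] G.l_inv[of g] G.r_one[of f] G.inv_closed[of g]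
    by (metis hom_group_simps(1))
  then show ?thesis using Hom_DomCod[OF assms(2)] by (simp add: hsub_def)
qed

lemma hsub_eqI:
  assumes "f \<in> Hom C X Y" "g \<in> Hom C X Y" "h \<in> Hom C X Y" "hadd C h g = f"
  shows "hsub C f g = h"
  using hadd_left_cancel[of g X Y "hsub C f g" h] hsub_hadd_cancel[OF assms(1,2)] hsub_closed[OF assms(1,2)]
    assms hadd_comm by metis

lemma hsub_eq_hzero_iff:
  assumes "f \<in> Hom C X Y" "g \<in> Hom C X Y"
  shows "hsub C f g = hzero C X Y \<longleftrightarrow> f = g"
  using hsub_hadd_cancel[OF assms] hsub_eqI[OF assms] hadd_hzero(2)[OF assms(2)]
    hzero_closed[OF Hom_ob[OF assms(1)]] by metis

lemma Comp_hzero_left [simp]: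
  assumes "f \<in> Hom C X Y" "Z \<in> Ob C"
  shows "hzero C Y Z \<star> f = hzero C X Z"
proof -
  have z: "hzero C Y Z \<in> Hom C Y Z" using Hom_ob[OF assms(1)] assms(2) by simp
  have zf: "hzero C Y Z \<star> f \<in> Hom C X Z"
    using Comp_closed[OF assms(1) z] .
  have "hadd C (hzero C Y Z \<star> f) (hzero C Y Z \<star> f) = hadd C (hzero C Y Z \<star> f) (hzero C X Z)"
    using Comp_hadd_left[OF assms(1) z z] hadd_hzero[OF z] hadd_hzero[OF zf] by simp
  then show ?thesis using hadd_left_cancel[OF zf zf] Hom_ob[OF zf] by simp
qed

lemma Comp_hzero_right [simp]:
  assumes "f \<in> Hom C Y Z" "X \<in> Ob C"
  shows "f \<star> hzero C X Y = hzero C X Z"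
proof -
  have z: "hzero C X Y \<in> Hom C X Y" using Hom_ob[OF assms(1)] assms(2) by simp
  have zf: "f \<star> hzero C X Y \<in> Hom C X Z"
    using Comp_closed[OF z assms(1)] .
  have "hadd C (f \<star> hzero C X Y) (f \<star> hzero C X Y) = hadd C (f \<star> hzero C X Y) (hzero C X Z)"
    using Comp_hadd_right[OF z z assms(1)] hadd_hzero[OF z] hadd_hzero[OF zf] by simp
  then show ?thesis using hadd_left_cancel[OF zf zf] Hom_ob[OF zf] by simp
qed

lemma Comp_hsub_left:
  assumes f: "f \<in> Hom C X Y" and g: "g \<in> Hom C Y Z" "g' \<in> Hom C Y Z"
  shows "hsub C g g' \<star> f = hsub C (g \<star> f) (g' \<star> f)"
proof (rule hsub_eqI[symmetric])
  show "hadd C (hsub C g g' \<star> f) (g' \<star> f) = g \<star> f"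
    using Comp_hadd_left[OF f hsub_closed[OF g] g(2)] hsub_hadd_cancel[OF g] by simp
qed (use f g in \<open>auto intro: Comp_closed\<close>)

lemma Comp_hsub_right:
  assumes f: "f \<in> Hom C X Y" "f' \<in> Hom C X Y" and g: "g \<in> Hom C Y Z"
  shows "g \<star> hsub C f f' = hsub C (g \<star> f) (g \<star> f')"
proof (rule hsub_eqI[symmetric])
  show "hadd C (g \<star> hsub C f f') (g \<star> f') = g \<star> f"
    using Comp_hadd_right[OF hsub_closed[OF f] f(2) g] hsub_hadd_cancel[OF f] by simp
qed (use f g in \<open>auto intro: Comp_closed\<close>)

text \<open>Only binary coproducts are postulated. The projections are induced by identities and
  zero arrows, and the sum formula holds because both sides agree on the two injections.\<close>

lemma biproduct:
  assumes "X \<in> Ob C" "Y \<in> Ob C"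
  obtains S i j p q where
    "i \<in> Hom C X S" "j \<in> Hom C Y S" "p \<in> Hom C S X" "q \<in> Hom C S Y"
    "p \<star> i = Ide C X" "p \<star> j = hzero C Y X" "q \<star> i = hzero C X Y" "q \<star> j = Ide C Y"
    "hadd C (i \<star> p) (j \<star> q) = Ide C S" "is_coproduct C UNIV (case_bool X Y) S (case_bool i j)"
proof -
  obtain S \<iota> where S: "is_coproduct C UNIV (case_bool X Y) S \<iota>" using binary_coproducts[OF assms] by blast
  let ?i = "\<iota> True" and ?j = "\<iota> False"
  have ij: "?i \<in> Hom C X S" "?j \<in> Hom C Y S"
    using coproduct_ob(3)[OF S, of True] coproduct_ob(3)[OF S, of False] by simp_all
  have desc: "\<exists>u. u \<in> Hom C S Z \<and> u \<star> ?i = a \<and> u \<star> ?j = b"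
    if "Z \<in> Ob C" "a \<in> Hom C X Z" "b \<in> Hom C Y Z" for a b Z
  proof -
    have "case_bool a b k \<in> Hom C (case_bool X Y k) Z" for k using that by (cases k) auto
    then obtain u where "u \<in> Hom C S Z" "\<And>k. u \<star> \<iota> k = case_bool a b k"
      using coproduct_desc[OF S \<open>Z \<in> Ob C\<close>, of "case_bool a b"] by (metis UNIV_I)
    then show ?thesis by (intro exI[of _ u]) auto
  qed
  obtain p where p: "p \<in> Hom C S X" "p \<star> ?i = Ide C X" "p \<star> ?j = hzero C Y X"
    using desc[OF assms(1) Ide_closed[OF assms(1)] hzero_closed[OF assms(2,1)]] by blast
  obtain q where q: "q \<in> Hom C S Y" "q \<star> ?i = hzero C X Y" "q \<star> ?j = Ide C Y"
    using desc[OF assms(2) hzero_closed[OF assms] Ide_closed[OF assms(2)]] by blast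
  have ip: "?i \<star> p \<in> Hom C S S" "?j \<star> q \<in> Hom C S S"
    using Comp_closed[OF p(1) ij(1)] Comp_closed[OF q(1) ij(2)] by simp_all
  have "hadd C (?i \<star> p) (?j \<star> q) = Ide C S"
  proof (rule coproduct_ext[OF S])
    show "hadd C (?i \<star> p) (?j \<star> q) \<in> Hom C S S" "Ide C S \<in> Hom C S S"
      using ip hadd_closed Ide_closed coproduct_ob(1)[OF S] by auto
    fix k :: bool
    have "hadd C (?i \<star> p) (?j \<star> q) \<star> ?i = ?i"
      using Comp_hadd_left[OF ij(1) ip] Comp_assoc[OF ij(1) p(1) ij(1), symmetric] Comp_assoc[OF ij(1) q(1) ij(2), symmetric]
        p q ij Comp_Ide[OF ij(1)] by (simp add: assms)
    moreover have "hadd C (?i \<star> p) (?j \<star> q) \<star> ?j = ?j"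
      using Comp_hadd_left[OF ij(2) ip] Comp_assoc[OF ij(2) p(1) ij(1), symmetric] Comp_assoc[OF ij(2) q(1) ij(2), symmetric]
        p q ij Comp_Ide[OF ij(2)] by (simp add: assms)
    ultimately show "hadd C (?i \<star> p) (?j \<star> q) \<star> \<iota> k = Ide C S \<star> \<iota> k" using ij Ide_Comp by (cases k) auto
  qed
  moreover have "case_bool ?i ?j = \<iota>" by (rule ext) (simp split: bool.split)
  ultimately show ?thesis using that[OF ij p(1) q(1) p(2,3) q(2,3)] S by simp
qed

lemma zero_object_arrows:
  assumes "zero_object C Z" "f \<in> Hom C X Z"
  shows "f = hzero C X Z"
proof -
  have "\<exists>!f. f \<in> Hom C X Z" using assms Hom_ob(1)[OF assms(2)] by (simp add: zero_object_def)
  then show ?thesis using assms(2) hzero_closed[OF Hom_ob[OF assms(2)]] by (elim ex1E) metis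
qed

lemma zero_object_arrows':
  assumes "zero_object C Z" "f \<in> Hom C Z X"
  shows "f = hzero C Z X"
proof -
  have "\<exists>!f. f \<in> Hom C Z X" using assms Hom_ob(2)[OF assms(2)] by (simp add: zero_object_def)
  then show ?thesis using assms(2) hzero_closed[OF Hom_ob[OF assms(2)]] by (elim ex1E) metis
qed

lemma zero_objectI:
  assumes "Z \<in> Ob C" "Ide C Z = hzero C Z Z"
  shows "zero_object C Z"
proof -
  have "f = hzero C X Z" if "f \<in> Hom C X Z" for f X
    using Ide_Comp[OF that] Comp_hzero_left[OF that assms(1)] assms(2) by simp
  moreover have "f = hzero C Z X" if "f \<in> Hom C Z X" for f X
    using Comp_Ide[OF that] Comp_hzero_right[OF that assms(1)] assms(2) by simp
  ultimately show ?thesis unfolding zero_object_def by (metis assms(1) hzero_closed)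
qed

end


subsection \<open>Arrows into coproducts\<close>

text \<open>This is the image of the canonical map from the direct sum of the groups
  \<open>Hom C W (X i)\<close>. The inductive form lets closure properties be proved by adding one
  summand at a time.\<close>

inductive_set coproduct_sums ::
    "('o, 'a, 'z) ab_category_scheme \<Rightarrow> 'i set \<Rightarrow> ('i \<Rightarrow> 'o) \<Rightarrow> 'o \<Rightarrow> ('i \<Rightarrow> 'a) \<Rightarrow> 'o \<Rightarrow> 'a set"
  for C I X S \<iota> W where
    zero: "hzero C W S \<in> coproduct_sums C I X S \<iota> W"
  | add: "g \<in> coproduct_sums C I X S \<iota> W \<Longrightarrow> i \<in> I \<Longrightarrow> c \<in> Hom C W (X i) \<Longrightarrow>
      hadd C g (\<iota> i \<star>\<^bsub>C\<^esub> c) \<in> coproduct_sums C I X S \<iota> W"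

context additive_category
begin

context
  fixes I and X and S and \<iota>
  assumes S: "is_coproduct C I X S \<iota>"
begin

lemma coproduct_sums_closed:
  assumes "W \<in> Ob C" "g \<in> coproduct_sums C I X S \<iota> W"
  shows "g \<in> Hom C W S"
  using assms(2)
proof induction
  case zero
  then show ?case using assms(1) coproduct_ob(1)[OF S] by simp
next
  case (add g i c)
  then show ?case using Comp_closed[OF add(3) coproduct_ob(3)[OF S add(2)]] hadd_closed by blast
qed

lemma coproduct_projection:
  assumes "i \<in> I"
  obtains p where "p \<in> Hom C S (X i)" "p \<star> \<iota> i = Ide C (X i)"
    "\<And>j. j \<in> I \<Longrightarrow> j \<noteq> i \<Longrightarrow> p \<star> \<iota> j = hzero C (X j) (X i)"
proof -
  have "(if j = i then Ide C (X i) else hzero C (X j) (X i)) \<in> Hom C (X j) (X i)" if "j \<in> I" for j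
    using coproduct_ob(2)[OF S] assms that Ide_closed by auto
  then obtain p where "p \<in> Hom C S (X i)"
    "\<And>j. j \<in> I \<Longrightarrow> p \<star> \<iota> j = (if j = i then Ide C (X i) else hzero C (X j) (X i))"
    using coproduct_desc[OF S coproduct_ob(2)[OF S assms],
        of "\<lambda>j. if j = i then Ide C (X i) else hzero C (X j) (X i)"] by metis
  then show ?thesis using that assms by auto
qed

text \<open>A finite sum meets only finitely many components and is fixed by the endomorphism
  \<open>e\<close> of \<open>S\<close> that projects onto them. As \<open>e\<close> is itself such a
  finite sum, every \<open>e \<star> k\<close> is one too, which is how \<open>e\<close> is used
  later. The clause on the injections is what allows a further component to be added to
  \<open>e\<close>.\<close>

lemma coproduct_sums_local_unit:
  assumes W: "W \<in> Ob C" and "g \<in> coproduct_sums C I X S \<iota> W"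
  shows "\<exists>e\<in>coproduct_sums C I X S \<iota> S. e \<star> g = g \<and> (\<forall>i\<in>I. e \<star> \<iota> i = \<iota> i \<or> e \<star> \<iota> i = hzero C (X i) S)"
  using assms(2)
proof induction
  case zero
  have "hzero C S S \<star> \<iota> i = hzero C (X i) S" if "i \<in> I" for i
    using Comp_hzero_left[OF coproduct_ob(3)[OF S that] coproduct_ob(1)[OF S]] .
  then show ?case
    using W coproduct_ob(1)[OF S] by (intro bexI[OF _ coproduct_sums.zero]) simp
next
  case (add g i c)
  note S_ob = coproduct_ob(1)[OF S] and X = coproduct_ob(2)[OF S] and \<iota> = coproduct_ob(3)[OF S]
  obtain e where e0: "e \<in> coproduct_sums C I X S \<iota> S" "e \<star> g = g"
    and e\<iota>: "\<And>k. k \<in> I \<Longrightarrow> e \<star> \<iota> k = \<iota> k \<or> e \<star> \<iota> k = hzero C (X k) S"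
    using add.IH by blast
  note e = coproduct_sums_closed[OF S_ob e0(1)] and i = add(2) and g = coproduct_sums_closed[OF W add(1)]
  have ic: "\<iota> i \<star> c \<in> Hom C W S" by (rule Comp_closed[OF add(3) \<iota>[OF i]])
  obtain p where p: "p \<in> Hom C S (X i)" "p \<star> \<iota> i = Ide C (X i)"
    "\<And>j. j \<in> I \<Longrightarrow> j \<noteq> i \<Longrightarrow> p \<star> \<iota> j = hzero C (X j) (X i)"
    by (rule coproduct_projection[OF i]) blast
  show ?case
  proof (cases "e \<star> \<iota> i = \<iota> i")
    case True
    have "e \<star> hadd C g (\<iota> i \<star> c) = hadd C g (\<iota> i \<star> c)"
      using Comp_hadd_right[OF g ic e] Comp_assoc[OF add(3) \<iota>[OF i] e] e0(2) True by simp
    then show ?thesis using e0(1) e\<iota> by blast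
  next
    case False
    then have ei: "e \<star> \<iota> i = hzero C (X i) S" using e\<iota>[OF i] by blast
    have ip: "\<iota> i \<star> p \<in> Hom C S S" by (rule Comp_closed[OF p(1) \<iota>[OF i]])
    \<comment> \<open>Each injection is preserved or annihilated by \<open>e\<close>, and the one at
      \<open>i\<close> is annihilated, so \<open>e\<close> has no component at \<open>i\<close>.
      Neither has \<open>g\<close>, which equals \<open>e \<star> g\<close>, and therefore adding
      \<open>\<iota> i \<star> p\<close> to \<open>e\<close> does not change its action on
      \<open>g\<close>.\<close>
    have "p \<star> e = hzero C S (X i)"
    proof (rule coproduct_ext[OF S Comp_closed[OF e p(1)] hzero_closed[OF S_ob X[OF i]]])
      fix k assume k: "k \<in> I"
      have "p \<star> (e \<star> \<iota> k) = hzero C (X k) (X i)"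
        using e\<iota>[OF k] ei p(3)[OF k] Comp_hzero_right[OF p(1) X[OF k]] by (cases "k = i") auto
      then show "(p \<star> e) \<star> \<iota> k = hzero C S (X i) \<star> \<iota> k"
        using Comp_assoc[OF \<iota>[OF k] e p(1)] Comp_hzero_left[OF \<iota>[OF k] X[OF i]] by simp
    qed
    then have "p \<star> g = hzero C W (X i)" using Comp_assoc[OF g e p(1)] e0(2) Comp_hzero_left[OF g X[OF i]] by simp
    then have "hadd C e (\<iota> i \<star> p) \<star> g = g"
      using Comp_hadd_left[OF g e ip] Comp_assoc[OF g p(1) \<iota>[OF i]] e0(2) Comp_hzero_right[OF \<iota>[OF i] W] hadd_hzero[OF g] by simp
    moreover have e'\<iota>: "hadd C e (\<iota> i \<star> p) \<star> \<iota> k = (if k = i then \<iota> i else e \<star> \<iota> k)" if k: "k \<in> I" for k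
    proof (cases "k = i")
      case True
      then show ?thesis
        using Comp_hadd_left[OF \<iota>[OF i] e ip] Comp_assoc[OF \<iota>[OF i] p(1) \<iota>[OF i]] ei p(2) Comp_Ide[OF \<iota>[OF i]] hadd_hzero[OF \<iota>[OF i]]
        by simp
    next
      case False
      then show ?thesis
        using Comp_hadd_left[OF \<iota>[OF k] e ip] Comp_assoc[OF \<iota>[OF k] p(1) \<iota>[OF i]] p(3)[OF k] Comp_hzero_right[OF \<iota>[OF i] X[OF k]]
          hadd_hzero[OF Comp_closed[OF \<iota>[OF k] e]] by simp
    qed
    moreover have "hadd C e (\<iota> i \<star> p) \<star> (\<iota> i \<star> c) = \<iota> i \<star> c"
      using Comp_assoc[OF add(3) \<iota>[OF i] hadd_closed[OF e ip]] e'\<iota>[OF i] by simp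
    ultimately show ?thesis
      using Comp_hadd_right[OF g ic hadd_closed[OF e ip]] coproduct_sums.add[OF e0(1) i p(1)] e\<iota>
      by (intro bexI[of _ "hadd C e (\<iota> i \<star> p)"]) auto
  qed
qed

end

context
  fixes I :: "'i set" and X :: "'i \<Rightarrow> 'o" and S :: 'o and \<iota> :: "'i \<Rightarrow> 'a" and W :: 'o
  assumes S: "is_coproduct C I X S \<iota>" and W: "W \<in> Ob C"
begin

interpretation H: comm_group "hom_group C W S"
  by (rule hom_group[OF W coproduct_ob(1)[OF S]])

lemma component_closed: "i \<in> I \<Longrightarrow> c \<in> Hom C W (X i) \<Longrightarrow> \<iota> i \<star> c \<in> Hom C W S"
  using Comp_closed coproduct_ob(3)[OF S] by blast

lemma finprod_components:
  assumes "finite J" "J \<subseteq> I" "\<And>i. i \<in> J \<Longrightarrow> g i \<in> Hom C W (X i)"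
  shows "finprod (hom_group C W S) (\<lambda>i. \<iota> i \<star> g i) J \<in> coproduct_sums C I X S \<iota> W"
  using assms
proof (induction J rule: finite_induct)
  case empty
  then show ?case using coproduct_sums.zero by fastforce
next
  case (insert j J)
  have IH: "finprod (hom_group C W S) (\<lambda>i. \<iota> i \<star> g i) J \<in> coproduct_sums C I X S \<iota> W" using insert by blast
  have j: "j \<in> I" "g j \<in> Hom C W (X j)" using insert by auto
  have "finprod (hom_group C W S) (\<lambda>i. \<iota> i \<star> g i) (insert j J) =
      hadd C (\<iota> j \<star> g j) (finprod (hom_group C W S) (\<lambda>i. \<iota> i \<star> g i) J)"
    using insert component_closed by (subst H.finprod_insert) auto
  also have "\<dots> = hadd C (finprod (hom_group C W S) (\<lambda>i. \<iota> i \<star> g i) J) (\<iota> j \<star> g j)"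
    using hadd_comm[OF component_closed[OF j] coproduct_sums_closed[OF S W IH]] .
  finally show ?case using coproduct_sums.add[OF IH j] by simp
qed

lemma projection_finprod:
  assumes p: "p \<in> Hom C S (X k)" "p \<star> \<iota> k = Ide C (X k)"
      "\<And>j. j \<in> I \<Longrightarrow> j \<noteq> k \<Longrightarrow> p \<star> \<iota> j = hzero C (X j) (X k)"
    and J: "finite J" "J \<subseteq> I" "\<And>i. i \<in> J \<Longrightarrow> g i \<in> Hom C W (X i)"
  shows "p \<star> finprod (hom_group C W S) (\<lambda>i. \<iota> i \<star> g i) J = (if k \<in> J then g k else hzero C W (X k))"
  using J
proof (induction J rule: finite_induct)
  case empty
  then show ?case using Comp_hzero_right[OF p(1) W] by simp
next
  case (insert j J)
  have j: "j \<in> I" "g j \<in> Hom C W (X j)" using insert by auto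
  have F: "finprod (hom_group C W S) (\<lambda>i. \<iota> i \<star> g i) J \<in> Hom C W S"
    using coproduct_sums_closed[OF S W] finprod_components insert by blast
  have "p \<star> finprod (hom_group C W S) (\<lambda>i. \<iota> i \<star> g i) (insert j J) =
      p \<star> hadd C (\<iota> j \<star> g j) (finprod (hom_group C W S) (\<lambda>i. \<iota> i \<star> g i) J)"
    using insert component_closed by (subst H.finprod_insert) auto
  also have "\<dots> = hadd C ((p \<star> \<iota> j) \<star> g j) (if k \<in> J then g k else hzero C W (X k))"
    using insert Comp_hadd_right[OF component_closed[OF j] F p(1)]
      Comp_assoc[OF j(2) coproduct_ob(3)[OF S j(1)] p(1)] by auto
  also have "\<dots> = (if k \<in> insert j J then g k else hzero C W (X k))"
  proof (cases "j = k")
    case True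
    then show ?thesis using insert(2) p(2) j Ide_Comp[OF j(2)] by simp
  next
    case False
    have z: "hzero C (X j) (X k) \<star> g j = hzero C W (X k)"
      using Comp_hzero_left[OF j(2) Hom_ob(2)[OF p(1)]] .
    have "(if k \<in> J then g k else hzero C W (X k)) \<in> Hom C W (X k)" using insert(5) W Hom_ob(2)[OF p(1)] by auto
    then show ?thesis using False p(3)[OF j(1) False] z by auto
  qed
  finally show ?case .
qed

abbreviation canonical :: "('i \<Rightarrow> 'a) \<Rightarrow> 'a"
  where "canonical g \<equiv> finprod (hom_group C W S) (\<lambda>i. \<iota> i \<star> g i) {i \<in> I. g i \<noteq> hzero C W (X i)}"

text \<open>Zero entries contribute the unit, so the support may be enlarged to any finite
  \<open>J\<close>; two families and their sum can then be compared over one index set.\<close>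

lemma canonical_eq:
  assumes "finite J" "J \<subseteq> I" "{i \<in> I. g i \<noteq> hzero C W (X i)} \<subseteq> J" "\<And>i. i \<in> I \<Longrightarrow> g i \<in> Hom C W (X i)"
  shows "canonical g = finprod (hom_group C W S) (\<lambda>i. \<iota> i \<star> g i) J"
proof (rule H.finprod_mono_neutral_cong_left[OF assms(1,3)])
  show "(\<lambda>i. \<iota> i \<star> g i) \<in> J \<rightarrow> carrier (hom_group C W S)" using assms component_closed by auto
  fix i assume "i \<in> J - {i \<in> I. g i \<noteq> hzero C W (X i)}"
  then have "i \<in> I" "g i = hzero C W (X i)" using assms by auto
  then show "\<iota> i \<star> g i = \<one>\<^bsub>hom_group C W S\<^esub>" using Comp_hzero_right[OF coproduct_ob(3)[OF S] W] by simp
qed auto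

lemma group_components: "i \<in> I \<Longrightarrow> group (hom_group C W (X i))"
  using hom_group[OF W coproduct_ob(2)[OF S]] comm_group.axioms(2) by blast

lemma carrier_components:
  "carrier (sum_group I (\<lambda>i. hom_group C W (X i))) =
    {g \<in> \<Pi>\<^sub>E i\<in>I. Hom C W (X i). finite {i \<in> I. g i \<noteq> hzero C W (X i)}}"
  using carrier_sum_group[of I "\<lambda>i. hom_group C W (X i)"] group_components by simp

lemma canonical_hadd:
  assumes g: "g \<in> carrier (sum_group I (\<lambda>i. hom_group C W (X i)))"
    and h: "h \<in> carrier (sum_group I (\<lambda>i. hom_group C W (X i)))"
  shows "canonical (\<lambda>i\<in>I. hadd C (g i) (h i)) = hadd C (canonical g) (canonical h)"
proof -
  let ?J = "{i \<in> I. g i \<noteq> hzero C W (X i)} \<union> {i \<in> I. h i \<noteq> hzero C W (X i)}"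
  have J: "finite ?J" "?J \<subseteq> I" using g h unfolding carrier_components by auto
  have gh: "\<And>i. i \<in> I \<Longrightarrow> g i \<in> Hom C W (X i)" "\<And>i. i \<in> I \<Longrightarrow> h i \<in> Hom C W (X i)"
    using g h unfolding carrier_components by auto
  have z: "hadd C (g i) (h i) = hzero C W (X i)" if "i \<in> I" "i \<notin> ?J" for i using that coproduct_ob(2)[OF S] W by simp
  have "canonical (\<lambda>i\<in>I. hadd C (g i) (h i)) =
      finprod (hom_group C W S) (\<lambda>i. \<iota> i \<star> (\<lambda>i\<in>I. hadd C (g i) (h i)) i) ?J"
    by (rule canonical_eq[OF J]) (use z gh hadd_closed in auto)
  also have "\<dots> = finprod (hom_group C W S) (\<lambda>i. (\<iota> i \<star> g i) \<otimes>\<^bsub>hom_group C W S\<^esub> (\<iota> i \<star> h i)) ?J"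
  proof (rule H.finprod_cong')
    fix i assume "i \<in> ?J"
    then have i: "i \<in> I" by blast
    then show "\<iota> i \<star> (\<lambda>i\<in>I. hadd C (g i) (h i)) i = (\<iota> i \<star> g i) \<otimes>\<^bsub>hom_group C W S\<^esub> (\<iota> i \<star> h i)"
      using Comp_hadd_right[OF gh(1)[OF i] gh(2)[OF i] coproduct_ob(3)[OF S i]] by simp
  qed (use J gh component_closed hadd_closed in auto)
  also have "\<dots> = finprod (hom_group C W S) (\<lambda>i. \<iota> i \<star> g i) ?J \<otimes>\<^bsub>hom_group C W S\<^esub>
      finprod (hom_group C W S) (\<lambda>i. \<iota> i \<star> h i) ?J"
    by (rule H.finprod_multf) (use gh component_closed in auto)
  also have "\<dots> = hadd C (canonical g) (canonical h)"
  proof -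
    have "canonical g = finprod (hom_group C W S) (\<lambda>i. \<iota> i \<star> g i) ?J"
      "canonical h = finprod (hom_group C W S) (\<lambda>i. \<iota> i \<star> h i) ?J" by (rule canonical_eq[OF J], use gh in auto)+
    then show ?thesis by simp
  qed
  finally show ?thesis .
qed

lemma canonical_projection:
  assumes p: "p \<in> Hom C S (X k)" "p \<star> \<iota> k = Ide C (X k)"
      "\<And>j. j \<in> I \<Longrightarrow> j \<noteq> k \<Longrightarrow> p \<star> \<iota> j = hzero C (X j) (X k)"
    and k: "k \<in> I" and g: "g \<in> carrier (sum_group I (\<lambda>i. hom_group C W (X i)))"
  shows "p \<star> canonical g = g k"
proof -
  have "g \<in> (\<Pi>\<^sub>E i\<in>I. Hom C W (X i))" "finite {i \<in> I. g i \<noteq> hzero C W (X i)}"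
    using g unfolding carrier_components by auto
  then have "p \<star> canonical g = (if k \<in> {i \<in> I. g i \<noteq> hzero C W (X i)} then g k else hzero C W (X k))"
    by (intro projection_finprod[OF p]) auto
  then show ?thesis using k by auto
qed

lemma canonical_inj: "inj_on canonical (carrier (sum_group I (\<lambda>i. hom_group C W (X i))))"
proof (rule inj_onI)
  fix g h
  assume g: "g \<in> carrier (sum_group I (\<lambda>i. hom_group C W (X i)))"
    and h: "h \<in> carrier (sum_group I (\<lambda>i. hom_group C W (X i)))"
    and eq: "canonical g = canonical h"
  show "g = h"
  proof (rule extensionalityI[of _ I])
    show "g \<in> extensional I" "h \<in> extensional I" using g h unfolding carrier_components by (auto simp: PiE_def)
    fix k assume k: "k \<in> I"
    obtain p where p: "p \<in> Hom C S (X k)" "p \<star> \<iota> k = Ide C (X k)"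
      "\<And>j. j \<in> I \<Longrightarrow> j \<noteq> k \<Longrightarrow> p \<star> \<iota> j = hzero C (X j) (X k)"
      by (rule coproduct_projection[OF S k]) blast
    show "g k = h k" using canonical_projection[OF p k g] canonical_projection[OF p k h] eq by simp
  qed
qed

lemma canonical_image:
  "canonical ` carrier (sum_group I (\<lambda>i. hom_group C W (X i))) = coproduct_sums C I X S \<iota> W"
proof (intro equalityI subsetI)
  fix f assume "f \<in> canonical ` carrier (sum_group I (\<lambda>i. hom_group C W (X i)))"
  then show "f \<in> coproduct_sums C I X S \<iota> W" unfolding carrier_components by (auto intro!: finprod_components)
next
  fix f assume "f \<in> coproduct_sums C I X S \<iota> W"
  then show "f \<in> canonical ` carrier (sum_group I (\<lambda>i. hom_group C W (X i)))"
  proof induction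
    case zero
    have "(\<lambda>i\<in>I. hzero C W (X i)) \<in> carrier (sum_group I (\<lambda>i. hom_group C W (X i)))"
      unfolding carrier_components using W coproduct_ob(2)[OF S] by auto
    moreover have "{i \<in> I. (\<lambda>i\<in>I. hzero C W (X i)) i \<noteq> hzero C W (X i)} = {}" by auto
    then have "canonical (\<lambda>i\<in>I. hzero C W (X i)) = hzero C W S" by simp
    ultimately show ?case using image_eqI[of "hzero C W S" canonical "\<lambda>i\<in>I. hzero C W (X i)"] by simp
  next
    case (add g i c)
    obtain x where x: "x \<in> carrier (sum_group I (\<lambda>i. hom_group C W (X i)))" "canonical x = g" using add.IH by blast
    let ?y = "\<lambda>k\<in>I. if k = i then c else hzero C W (X k)"
    have sub: "{k \<in> I. ?y k \<noteq> hzero C W (X k)} \<subseteq> {i}" by auto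
    have y: "?y \<in> carrier (sum_group I (\<lambda>i. hom_group C W (X i)))"
      unfolding carrier_components using W coproduct_ob(2)[OF S] add(3) finite_subset[OF sub] by auto
    have "canonical ?y = finprod (hom_group C W S) (\<lambda>k. \<iota> k \<star> ?y k) {i}"
      using sub add(2,3) W coproduct_ob(2)[OF S] by (intro canonical_eq) auto
    also have "\<dots> = \<iota> i \<star> c"
      using add(2,3) component_closed[OF add(2,3)] H.finprod_insert[of "{}" i "\<lambda>k. \<iota> k \<star> ?y k"] by simp
    finally have yc: "canonical ?y = \<iota> i \<star> c" .
    have "canonical (\<lambda>k\<in>I. hadd C (x k) (?y k)) = hadd C g (\<iota> i \<star> c)" using canonical_hadd[OF x(1) y] x(2) yc by simp
    moreover have "(\<lambda>k\<in>I. hadd C (x k) (?y k)) \<in> carrier (sum_group I (\<lambda>i. hom_group C W (X i)))"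
    proof -
      interpret SG: group "sum_group I (\<lambda>i. hom_group C W (X i))" by (rule sum_group) (rule group_components)
      show ?thesis using SG.m_closed[OF x(1) y] by simp
    qed
    ultimately show ?case using image_eqI[of "hadd C g (\<iota> i \<star> c)" canonical "\<lambda>k\<in>I. hadd C (x k) (?y k)"] by simp
  qed
qed

text \<open>The projections of \<open>f\<close> are the entries of a finitely supported family. This
  finiteness is what later allows functionals on a coproduct to be assembled from functionals on the
  summands.\<close>

lemma coproduct_sums_support:
  assumes f: "f \<in> coproduct_sums C I X S \<iota> W" and p: "\<And>i. i \<in> I \<Longrightarrow> p i \<in> Hom C S (X i)"
    "\<And>i. i \<in> I \<Longrightarrow> p i \<star> \<iota> i = Ide C (X i)"
    "\<And>i j. i \<in> I \<Longrightarrow> j \<in> I \<Longrightarrow> j \<noteq> i \<Longrightarrow> p i \<star> \<iota> j = hzero C (X j) (X i)"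
  shows "finite {i \<in> I. p i \<star> f \<noteq> hzero C W (X i)}"
proof -
  obtain x where x: "x \<in> carrier (sum_group I (\<lambda>i. hom_group C W (X i)))" "f = canonical x"
    using f canonical_image by blast
  have "{i \<in> I. p i \<star> f \<noteq> hzero C W (X i)} = {i \<in> I. x i \<noteq> hzero C W (X i)}"
    unfolding x(2) using canonical_projection[OF p(1,2,3) _ x(1)] by auto
  then show ?thesis using x(1) unfolding carrier_components by simp
qed

text \<open>\<open>f\<close> comes from a finitely supported family whose entries are recovered by
  the projections, so it vanishes together with them.\<close>

lemma coproduct_sums_eq_hzero:
  assumes f: "f \<in> coproduct_sums C I X S \<iota> W"
    and z: "\<And>i p. i \<in> I \<Longrightarrow> p \<in> Hom C S (X i) \<Longrightarrow> p \<star> \<iota> i = Ide C (X i) \<Longrightarrow>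
      (\<And>j. j \<in> I \<Longrightarrow> j \<noteq> i \<Longrightarrow> p \<star> \<iota> j = hzero C (X j) (X i)) \<Longrightarrow> p \<star> f = hzero C W (X i)"
  shows "f = hzero C W S"
proof -
  obtain x where x: "x \<in> carrier (sum_group I (\<lambda>i. hom_group C W (X i)))" "f = canonical x"
    using f canonical_image by blast
  have "x k = hzero C W (X k)" if k: "k \<in> I" for k
  proof -
    obtain p where p: "p \<in> Hom C S (X k)" "p \<star> \<iota> k = Ide C (X k)"
      "\<And>j. j \<in> I \<Longrightarrow> j \<noteq> k \<Longrightarrow> p \<star> \<iota> j = hzero C (X j) (X k)"
      by (rule coproduct_projection[OF S k]) blast
    show ?thesis using canonical_projection[OF p k x(1)] z[OF k p] x(2) by simp
  qed
  then have empty: "{i \<in> I. x i \<noteq> hzero C W (X i)} = {}" by blast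
  show ?thesis unfolding x(2) empty by simp
qed

lemma canonical_iso_iff:
  "canonical \<in> iso (sum_group I (\<lambda>i. hom_group C W (X i))) (hom_group C W S) \<longleftrightarrow>
    Hom C W S \<subseteq> coproduct_sums C I X S \<iota> W"
proof -
  have "coproduct_sums C I X S \<iota> W \<subseteq> Hom C W S" using coproduct_sums_closed[OF S W] by blast
  moreover have "canonical \<in> hom (sum_group I (\<lambda>i. hom_group C W (X i))) (hom_group C W S)"
    using canonical_image canonical_hadd coproduct_sums_closed[OF S W] by (intro homI) auto
  ultimately show ?thesis using canonical_image canonical_inj by (auto simp: iso_def bij_betw_def)
qed

end

text \<open>The canonical map is always an injective homomorphism, so being an isomorphism reduces
  to surjectivity: every arrow from \<open>W\<close> into a small coproduct is a finite sum.\<close>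

lemma compact_object_iff:
  "compact_object C W \<longleftrightarrow> W \<in> Ob C \<and>
    (\<forall>(I :: 'a set) X S \<iota>. small I \<longrightarrow> is_coproduct C I X S \<iota> \<longrightarrow> Hom C W S \<subseteq> coproduct_sums C I X S \<iota> W)"
proof (cases "W \<in> Ob C")
  case True
  then show ?thesis unfolding compact_object_def by (simp add: imp_conjL canonical_iso_iff[OF _ True] cong: imp_cong)
next
  case False
  then show ?thesis by (simp add: compact_object_def)
qed

end

section \<open>Triangulated categories\<close>

abbreviation hneg :: "('o, 'a, 'z) ab_category_scheme \<Rightarrow> 'o \<Rightarrow> 'o \<Rightarrow> 'a \<Rightarrow> 'a"
  where "hneg C X Y f \<equiv> inv\<^bsub>hom_group C X Y\<^esub> f"

section \<open>Negatives, and closure properties of finite sums and compact objects\<close>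

context additive_category
begin

lemma hneg_closed: "f \<in> Hom C X Y \<Longrightarrow> hneg C X Y f \<in> Hom C X Y"
  using group.inv_closed[OF comm_group.axioms(2)[OF hom_comm_group[of f X Y]], of f] by simp

lemma hneg_hadd: "f \<in> Hom C X Y \<Longrightarrow> hadd C (hneg C X Y f) f = hzero C X Y"
  using group.l_inv[OF comm_group.axioms(2)[OF hom_comm_group[of f X Y]], of f] by simp

lemma hneg_unique:
  assumes "f \<in> Hom C X Y" "g \<in> Hom C X Y" "hadd C g f = hzero C X Y"
  shows "hneg C X Y f = g"
  using group.inv_equality[OF comm_group.axioms(2)[OF hom_comm_group[OF assms(1)]], of g f] assms by simp

lemma hneg_hneg: "f \<in> Hom C X Y \<Longrightarrow> hneg C X Y (hneg C X Y f) = f"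
  using group.inv_inv[OF comm_group.axioms(2)[OF hom_comm_group[of f X Y]], of f] by simp

lemma hneg_hzero: "X \<in> Ob C \<Longrightarrow> Y \<in> Ob C \<Longrightarrow> hneg C X Y (hzero C X Y) = hzero C X Y"
  by (rule hneg_unique) auto

lemma Comp_hneg_left:
  assumes "f \<in> Hom C X Y" "g \<in> Hom C Y Z"
  shows "hneg C Y Z g \<star> f = hneg C X Z (g \<star> f)"
proof (rule hneg_unique[symmetric])
  show "hadd C (hneg C Y Z g \<star> f) (g \<star> f) = hzero C X Z"
    using Comp_hadd_left[OF assms(1) hneg_closed[OF assms(2)] assms(2)] hneg_hadd[OF assms(2)]
      Comp_hzero_left[OF assms(1) Hom_ob(2)[OF assms(2)]] by simp
qed (use Comp_closed[OF assms] Comp_closed[OF assms(1) hneg_closed[OF assms(2)]] in auto)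

lemma Comp_hneg_right:
  assumes "f \<in> Hom C X Y" "g \<in> Hom C Y Z"
  shows "g \<star> hneg C X Y f = hneg C X Z (g \<star> f)"
proof (rule hneg_unique[symmetric])
  show "hadd C (g \<star> hneg C X Y f) (g \<star> f) = hzero C X Z"
    using Comp_hadd_right[OF hneg_closed[OF assms(1)] assms] hneg_hadd[OF assms(1)]
      Comp_hzero_right[OF assms(2) Hom_ob(1)[OF assms(1)]] by simp
qed (use Comp_closed[OF assms] Comp_closed[OF hneg_closed[OF assms(1)] assms(2)] in auto)

lemma hneg_eq_hzero_iff:
  assumes "f \<in> Hom C X Y"
  shows "hneg C X Y f = hzero C X Y \<longleftrightarrow> f = hzero C X Y"
  using hneg_hneg[OF assms] hneg_hzero Hom_ob[OF assms] by metis

lemma coproduct_sums_hadd: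
  assumes S: "is_coproduct C I X S \<iota>" and W: "W \<in> Ob C"
    and g: "g \<in> coproduct_sums C I X S \<iota> W" and h: "h \<in> coproduct_sums C I X S \<iota> W"
  shows "hadd C g h \<in> coproduct_sums C I X S \<iota> W"
  using h
proof induction
  case zero
  then show ?case using g hadd_hzero(1)[OF coproduct_sums_closed[OF S W g]] by simp
next
  case (add h i c)
  have "hadd C g (hadd C h (\<iota> i \<star> c)) = hadd C (hadd C g h) (\<iota> i \<star> c)"
    using hadd_assoc[OF coproduct_sums_closed[OF S W g] coproduct_sums_closed[OF S W add(1)]
        Comp_closed[OF add(3) coproduct_ob(3)[OF S add(2)]]] by simp
  then show ?case using coproduct_sums.add[OF add(4) add(2,3)] by simp
qed

lemma coproduct_sums_Comp:
  assumes S: "is_coproduct C I X S \<iota>"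
    and g: "g \<in> coproduct_sums C I X S \<iota> W" and w: "w \<in> Hom C V W"
  shows "g \<star> w \<in> coproduct_sums C I X S \<iota> V"
  using g
proof induction
  case zero
  then show ?case using Comp_hzero_left[OF w coproduct_ob(1)[OF S]] coproduct_sums.zero by metis
next
  case (add g i c)
  note \<iota> = coproduct_ob(3)[OF S add(2)]
  have "hadd C g (\<iota> i \<star> c) \<star> w = hadd C (g \<star> w) (\<iota> i \<star> (c \<star> w))"
    using Comp_hadd_left[OF w coproduct_sums_closed[OF S Hom_ob(2)[OF w] add(1)] Comp_closed[OF add(3) \<iota>]]
      Comp_assoc[OF w add(3) \<iota>] by simp
  then show ?case using coproduct_sums.add[OF add(4) add(2) Comp_closed[OF w add(3)]] by simp
qed

lemma compact_factors:
  assumes "compact_object C W" "small (I :: 'a set)" "is_coproduct C I X S \<iota>" "k \<in> Hom C W S"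
  shows "k \<in> coproduct_sums C I X S \<iota> W"
  using assms unfolding compact_object_iff by blast

lemma compact_retract:
  assumes "compact_object C W" "s \<in> Hom C V W" "r \<in> Hom C W V" "r \<star> s = Ide C V"
  shows "compact_object C V"
  unfolding compact_object_iff
proof (intro conjI allI impI subsetI)
  show "V \<in> Ob C" using Hom_ob assms(2) by blast
  fix I :: "'a set" and X S \<iota> k
  assume I: "small I" and S: "is_coproduct C I X S \<iota>" and k: "k \<in> Hom C V S"
  have "k \<star> r \<in> coproduct_sums C I X S \<iota> W"
    using assms(1) I S Comp_closed[OF assms(3) k] unfolding compact_object_iff by blast
  then have "(k \<star> r) \<star> s \<in> coproduct_sums C I X S \<iota> V" by (rule coproduct_sums_Comp[OF S _ assms(2)])
  then show "k \<in> coproduct_sums C I X S \<iota> V" using Comp_assoc[OF assms(2,3) k] assms(4) Comp_Ide[OF k] by simp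
qed

lemma compact_zero:
  assumes "zero_object C Z"
  shows "compact_object C Z"
  unfolding compact_object_iff
proof (intro conjI allI impI subsetI)
  show "Z \<in> Ob C" using assms by (simp add: zero_object_def)
  show "k \<in> coproduct_sums C I X S \<iota> Z" if "k \<in> Hom C Z S" for I :: "'a set" and X S \<iota> k
    using zero_object_arrows'[OF assms that] coproduct_sums.zero by metis
qed

lemma compact_biproduct:
  assumes "compact_object C X" "compact_object C Y"
    and ij: "i \<in> Hom C X S" "j \<in> Hom C Y S" and pq: "p \<in> Hom C S X" "q \<in> Hom C S Y"
    and id: "hadd C (i \<star> p) (j \<star> q) = Ide C S"
  shows "compact_object C S"
  unfolding compact_object_iff
proof (intro conjI allI impI subsetI)
  show S: "S \<in> Ob C" using Hom_ob[OF ij(1)] by blast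
  fix I :: "'a set" and F R \<iota> k
  assume I: "small I" and R: "is_coproduct C I F R \<iota>" and k: "k \<in> Hom C S R"
  have "k \<star> i \<in> coproduct_sums C I F R \<iota> X" "k \<star> j \<in> coproduct_sums C I F R \<iota> Y"
    using compact_factors[OF assms(1) I R Comp_closed[OF ij(1) k]]
      compact_factors[OF assms(2) I R Comp_closed[OF ij(2) k]] by simp_all
  then have "hadd C ((k \<star> i) \<star> p) ((k \<star> j) \<star> q) \<in> coproduct_sums C I F R \<iota> S"
    using coproduct_sums_Comp[OF R _ pq(1)] coproduct_sums_Comp[OF R _ pq(2)] by (intro coproduct_sums_hadd[OF R S]) auto
  moreover have "hadd C ((k \<star> i) \<star> p) ((k \<star> j) \<star> q) = k \<star> hadd C (i \<star> p) (j \<star> q)"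
    using Comp_hadd_right[OF Comp_closed[OF pq(1) ij(1)] Comp_closed[OF pq(2) ij(2)] k]
      Comp_assoc[OF pq(1) ij(1) k] Comp_assoc[OF pq(2) ij(2) k] by simp
  ultimately show "k \<in> coproduct_sums C I F R \<iota> S" using id Comp_Ide[OF k] by simp
qed

end

section \<open>Suspension, weak kernels and weak cokernels, compactness of cones\<close>

context triangulated_category
begin

lemma
  shows susp_ob_closed: "X \<in> Ob T \<Longrightarrow> susp_ob T X \<in> Ob T"
    and susp_Ide: "X \<in> Ob T \<Longrightarrow> susp_ar T (Ide T X) = Ide T (susp_ob T X)"
    and susp_closed: "f \<in> Hom T X Y \<Longrightarrow> susp_ar T f \<in> Hom T (susp_ob T X) (susp_ob T Y)"
    and susp_Comp: "f \<in> Hom T X Y \<Longrightarrow> g \<in> Hom T Y Z \<Longrightarrow> susp_ar T (g \<star> f) = susp_ar T g \<star> susp_ar T f"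
    and susp_bij: "X \<in> Ob T \<Longrightarrow> Y \<in> Ob T \<Longrightarrow>
      bij_betw (susp_ar T) (Hom T X Y) (Hom T (susp_ob T X) (susp_ob T Y))"
    and susp_dense: "Z \<in> Ob T \<Longrightarrow> \<exists>X \<in> Ob T. isomorphic T (susp_ob T X) Z"
  using Susp_equivalence unfolding equivalence_functor_def cov_functor_def by blast+

lemma susp_full:
  assumes "h \<in> Hom T (susp_ob T X) (susp_ob T Y)" "X \<in> Ob T" "Y \<in> Ob T"
  obtains f where "f \<in> Hom T X Y" "susp_ar T f = h"
proof -
  have "h \<in> susp_ar T ` Hom T X Y" using susp_bij[OF assms(2,3)] assms(1) by (simp add: bij_betw_def)
  then show ?thesis using that by blast
qed

lemma susp_faithful:
  assumes "f \<in> Hom T X Y" "g \<in> Hom T X Y" "susp_ar T f = susp_ar T g"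
  shows "f = g"
  using susp_bij[OF Hom_ob[OF assms(1)]] assms by (simp add: bij_betw_def inj_on_def)

lemma susp_hadd:
  "f \<in> Hom T X Y \<Longrightarrow> g \<in> Hom T X Y \<Longrightarrow> susp_ar T (hadd T f g) = hadd T (susp_ar T f) (susp_ar T g)"
  using Susp_additive Hom_ob unfolding additive_on_def by blast

lemma susp_hzero:
  assumes "X \<in> Ob T" "Y \<in> Ob T"
  shows "susp_ar T (hzero T X Y) = hzero T (susp_ob T X) (susp_ob T Y)"
proof -
  note z = hzero_closed[OF assms]
  note sz = susp_closed[OF z]
  have "hadd T (susp_ar T (hzero T X Y)) (susp_ar T (hzero T X Y)) =
      hadd T (susp_ar T (hzero T X Y)) (hzero T (susp_ob T X) (susp_ob T Y))"
    using susp_hadd[OF z z] hadd_hzero[OF z] hadd_hzero[OF sz] by simp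
  then show ?thesis using hadd_left_cancel[OF sz sz] Hom_ob[OF sz] by simp
qed

lemma susp_eq_hzero_iff:
  assumes "f \<in> Hom T X Y"
  shows "susp_ar T f = hzero T (susp_ob T X) (susp_ob T Y) \<longleftrightarrow> f = hzero T X Y"
  using susp_faithful[OF assms hzero_closed] susp_hzero Hom_ob[OF assms] by metis

text \<open>The suspension is only essentially surjective, so an object is a suspension up to a
  chosen isomorphism, whose two directions are kept at hand.\<close>

lemma desusp:
  assumes "Z \<in> Ob T"
  obtains X \<phi> \<psi> where "X \<in> Ob T" "\<phi> \<in> Hom T (susp_ob T X) Z" "\<psi> \<in> Hom T Z (susp_ob T X)"
    "\<psi> \<star> \<phi> = Ide T (susp_ob T X)" "\<phi> \<star> \<psi> = Ide T Z"
  using susp_dense[OF assms] unfolding isomorphic_def iso_arrow_def by blast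

lemma tri_homs:
  assumes "(f, g, h) \<in> Tri T" "f \<in> Hom T X Y"
  obtains Z where "g \<in> Hom T Y Z" "h \<in> Hom T Z (susp_ob T X)"
proof -
  obtain X' Y' Z where *: "f \<in> Hom T X' Y'" "g \<in> Hom T Y' Z" "h \<in> Hom T Z (susp_ob T X')"
    using Tri_arrows[OF assms(1)] by blast
  then have "X' = X" "Y' = Y" using assms(2) by (auto simp: Hom_def)
  then show ?thesis using * that by blast
qed

lemma cone:
  assumes "f \<in> Hom T X Y"
  obtains Z g h where "(f, g, h) \<in> Tri T" "g \<in> Hom T Y Z" "h \<in> Hom T Z (susp_ob T X)"
proof -
  have "f \<in> Arr T" using assms by (simp add: Hom_def)
  then obtain g h where "(f, g, h) \<in> Tri T" using Tri_complete by blast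
  then show ?thesis using tri_homs[OF _ assms] that by metis
qed

context
  fixes f g h X Y Z
  assumes tri: "(f, g, h) \<in> Tri T"
    and f: "f \<in> Hom T X Y" and g: "g \<in> Hom T Y Z" and h: "h \<in> Hom T Z (susp_ob T X)"
begin

lemma tri_rotated: "(g, h, hneg T (susp_ob T X) (susp_ob T Y) (susp_ar T f)) \<in> Tri T"
  using Tri_rotate[OF f g h] tri by blast

lemma hneg_susp: "hneg T (susp_ob T X) (susp_ob T Y) (susp_ar T f) \<in> Hom T (susp_ob T X) (susp_ob T Y)"
  by (rule hneg_closed[OF susp_closed[OF f]])

text \<open>The identity of \<open>X\<close> and the arrow \<open>f\<close> begin a morphism from
  the identity triangle on \<open>X\<close> to the given triangle, so the composite factors through
  a zero object.\<close>

lemma tri_comp_zero: "g \<star> f = hzero T X Z"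
proof -
  have X: "X \<in> Ob T" using Hom_ob[OF f] by blast
  obtain N where N: "zero_object T N" using zero_object by blast
  then have N': "N \<in> Ob T" by (simp add: zero_object_def)
  have "f \<star> Ide T X = f \<star> Ide T X" "f \<in> Hom T X Y" "Ide T X \<in> Hom T X X" using f Ide_closed[OF X] by auto
  then obtain c where c: "c \<in> Hom T N Z" "c \<star> hzero T X N = g \<star> f"
    using Tri_morphism[OF Tri_identity[OF X N] tri Ide_closed[OF X] f hzero_closed[OF X N'] g Ide_closed[OF X] f] by blast
  then show ?thesis using Comp_hzero_right[OF c(1) X] by simp
qed

text \<open>\<open>k\<close> and a zero arrow begin a morphism from the rotated identity triangle on
  \<open>W\<close> to the rotation of the given one. The completing arrow runs between the
  suspensions of \<open>W\<close> and \<open>X\<close>; its desuspension is the factorization, the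
  two signs cancelling.\<close>

lemma tri_weak_kernel:
  assumes k: "k \<in> Hom T W Y" "g \<star> k = hzero T W Z"
  obtains k' where "k' \<in> Hom T W X" "f \<star> k' = k"
proof -
  have W: "W \<in> Ob T" using Hom_ob[OF k(1)] by blast
  obtain N where N: "zero_object T N" using zero_object by blast
  then have N': "N \<in> Ob T" by (simp add: zero_object_def)
  note z = hzero_closed[OF W N'] and z' = hzero_closed[OF N' susp_ob_closed[OF W]]
  have t: "(hzero T W N, hzero T N (susp_ob T W), hneg T (susp_ob T W) (susp_ob T W) (susp_ar T (Ide T W))) \<in> Tri T"
    using Tri_rotate[OF Ide_closed[OF W] z z'] Tri_identity[OF W N] by blast
  have Z: "Z \<in> Ob T" using Hom_ob[OF g] by blast
  have "hzero T N Z \<star> hzero T W N = g \<star> k" using k(2) Comp_hzero_left[OF z Z] by simp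
  then obtain c where c: "c \<in> Hom T (susp_ob T W) (susp_ob T X)"
      "susp_ar T k \<star> hneg T (susp_ob T W) (susp_ob T W) (susp_ar T (Ide T W)) =
        hneg T (susp_ob T X) (susp_ob T Y) (susp_ar T f) \<star> c"
    using Tri_morphism[OF t tri_rotated z g z' h k(1) hzero_closed[OF N' Z]] by blast
  note sk = susp_closed[OF k(1)] and sf = susp_closed[OF f]
  have sW: "susp_ob T W \<in> Ob T"
    using susp_ob_closed[OF W] .
  have "hneg T (susp_ob T W) (susp_ob T Y) (susp_ar T k) = hneg T (susp_ob T W) (susp_ob T Y) (susp_ar T f \<star> c)"
    using c Comp_hneg_left[OF c(1) sf] Comp_hneg_right[OF Ide_closed[OF sW] sk] Comp_Ide[OF sk] susp_Ide[OF W] by simp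
  then have eq: "susp_ar T k = susp_ar T f \<star> c" using hneg_hneg[OF sk] hneg_hneg[OF Comp_closed[OF c(1) sf]] by metis
  obtain k' where k': "k' \<in> Hom T W X" "susp_ar T k' = c" using susp_full[OF c(1) W] Hom_ob[OF f] by metis
  have "f \<star> k' = k" by (rule susp_faithful[OF Comp_closed[OF k'(1) f] k(1)]) (use susp_Comp[OF k'(1) f] k' eq in simp)
  then show ?thesis using that k' by blast
qed

text \<open>The given triangle is mapped to one starting with a zero object, followed by the
  identity of \<open>V\<close>. That one is a backward rotation of the identity triangle, for which
  the suspension of a zero object has to be zero again.\<close>

lemma tri_weak_cokernel:
  assumes l: "l \<in> Hom T Y V" "l \<star> f = hzero T X V"
  obtains l' where "l' \<in> Hom T Z V" "l' \<star> g = l"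
proof -
  have V: "V \<in> Ob T" using Hom_ob[OF l(1)] by blast
  obtain N where N: "zero_object T N" using zero_object by blast
  then have N': "N \<in> Ob T" by (simp add: zero_object_def)
  note sO = susp_ob_closed[OF N']
  note z = hzero_closed[OF N' V] and i = Ide_closed[OF V] and z' = hzero_closed[OF V sO]
  have "susp_ar T (Ide T N) = susp_ar T (hzero T N N)" using zero_object_arrows[OF N Ide_closed[OF N']] by simp
  then have "zero_object T (susp_ob T N)" using susp_Ide[OF N'] susp_hzero[OF N' N'] zero_objectI[OF sO] by simp
  then have "(Ide T V, hzero T V (susp_ob T N), hzero T (susp_ob T N) (susp_ob T V)) \<in> Tri T" by (rule Tri_identity[OF V])
  moreover have "hneg T (susp_ob T N) (susp_ob T V) (susp_ar T (hzero T N V)) = hzero T (susp_ob T N) (susp_ob T V)"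
    using susp_hzero[OF N' V] hneg_hzero[OF sO susp_ob_closed[OF V]] by simp
  ultimately have t: "(hzero T N V, Ide T V, hzero T V (susp_ob T N)) \<in> Tri T" using Tri_rotate[OF z i z'] by simp
  have X: "X \<in> Ob T" using Hom_ob[OF f] by blast
  have "l \<star> f = hzero T N V \<star> hzero T X N" using l(2) Comp_hzero_left[OF hzero_closed[OF X N'] V] by simp
  then obtain c where "c \<in> Hom T Z V" "c \<star> g = Ide T V \<star> l"
    using Tri_morphism[OF tri t f z g i hzero_closed[OF X N'] l(1)] by blast
  then show ?thesis using that Ide_Comp[OF l(1)] by metis
qed

end

context
  fixes f g h X Y Z
  assumes tri: "(f, g, h) \<in> Tri T"
    and f: "f \<in> Hom T X Y" and g: "g \<in> Hom T Y Z" and h: "h \<in> Hom T Z (susp_ob T X)"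
begin

lemmas rot1 = tri_rotated[OF tri f g h]
lemmas neg_susp_f = hneg_susp[OF tri f g h]
lemmas rot2 = tri_rotated[OF rot1 g h neg_susp_f]
lemmas neg_susp_g = hneg_susp[OF rot1 g h neg_susp_f]

lemma susp_f_h: "susp_ar T f \<star> h = hzero T Z (susp_ob T Y)"
proof -
  have "hneg T (susp_ob T X) (susp_ob T Y) (susp_ar T f) \<star> h = hzero T Z (susp_ob T Y)"
    using tri_comp_zero[OF rot1 g h neg_susp_f] tri_comp_zero[OF rot2 h neg_susp_f neg_susp_g] by simp
  then show ?thesis
    using Comp_hneg_left[OF h susp_closed[OF f]] hneg_eq_hzero_iff[OF Comp_closed[OF h susp_closed[OF f]]] by simp
qed

lemma tri_weak_kernel_susp:
  assumes k: "k \<in> Hom T W (susp_ob T X)" "susp_ar T f \<star> k = hzero T W (susp_ob T Y)"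
  obtains k' where "k' \<in> Hom T W Z" "h \<star> k' = k"
proof -
  have "hneg T (susp_ob T X) (susp_ob T Y) (susp_ar T f) \<star> k = hzero T W (susp_ob T Y)"
    using Comp_hneg_left[OF k(1) susp_closed[OF f]] k(2) hneg_hzero Hom_ob[OF k(1)] Hom_ob[OF susp_closed[OF f]] by simp
  then show ?thesis using tri_weak_kernel[OF rot2 h neg_susp_f neg_susp_g k(1)] that by blast
qed

lemma tri_weak_cokernel_susp:
  assumes l: "l \<in> Hom T (susp_ob T X) V" "l \<star> h = hzero T Z V"
  obtains l' where "l' \<in> Hom T (susp_ob T Y) V" "l' \<star> susp_ar T f = l"
proof -
  obtain m where m: "m \<in> Hom T (susp_ob T Y) V"
      "m \<star> hneg T (susp_ob T X) (susp_ob T Y) (susp_ar T f) = l"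
    using tri_weak_cokernel[OF rot2 h neg_susp_f neg_susp_g l] by blast
  have "hneg T (susp_ob T Y) V m \<star> susp_ar T f = l"
    using m(2) Comp_hneg_left[OF susp_closed[OF f] m(1)] Comp_hneg_right[OF susp_closed[OF f] m(1)] by simp
  then show ?thesis using that hneg_closed[OF m(1)] by blast
qed

lemma tri_weak_kernel_connecting:
  assumes k: "k \<in> Hom T W Z" "h \<star> k = hzero T W (susp_ob T X)"
  obtains k' where "k' \<in> Hom T W Y" "g \<star> k' = k" using tri_weak_kernel[OF rot1 g h neg_susp_f k] that by blast

lemma tri_weak_cokernel_connecting:
  assumes l: "l \<in> Hom T Z V" "l \<star> g = hzero T Y V"
  obtains l' where "l' \<in> Hom T (susp_ob T X) V" "l' \<star> h = l"
  using tri_weak_cokernel[OF rot1 g h neg_susp_f l] that by blast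

text \<open>The weak kernel property lifts the identity of \<open>Y\<close> to a section
  \<open>s\<close>, and exactness one shift up shows that composition with \<open>f\<close> kills
  only zero. Then \<open>s \<star> f\<close> is the identity of \<open>X\<close>, because the two
  agree after composition with \<open>f\<close>.\<close>

lemma tri_zero_iso:
  assumes Z: "zero_object T Z"
  shows "iso_arrow T X Y f"
proof -
  have X: "X \<in> Ob T" and Y: "Y \<in> Ob T" using Hom_ob[OF f] by blast+
  have "g \<star> Ide T Y = hzero T Y Z" using zero_object_arrows[OF Z g] Comp_Ide[OF g] by simp
  then obtain s where s: "s \<in> Hom T Y X" "f \<star> s = Ide T Y" using tri_weak_kernel[OF tri f g h Ide_closed[OF Y]] by blast
  have inj: "k = hzero T W X" if k: "k \<in> Hom T W X" "f \<star> k = hzero T W Y" for k W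
  proof -
    have "susp_ar T f \<star> susp_ar T k = hzero T (susp_ob T W) (susp_ob T Y)"
      using susp_Comp[OF k(1) f] k(2) susp_hzero Hom_ob[OF k(1)] Y by simp
    then obtain k' where "k' \<in> Hom T (susp_ob T W) Z" "h \<star> k' = susp_ar T k"
      using tri_weak_kernel_susp[OF susp_closed[OF k(1)]] by blast
    then have "susp_ar T k = hzero T (susp_ob T W) (susp_ob T X)"
      using zero_object_arrows[OF Z] Comp_hzero_right[OF h] Hom_ob[OF susp_closed[OF k(1)]] by metis
    then show ?thesis using susp_eq_hzero_iff[OF k(1)] by simp
  qed
  have sf: "s \<star> f \<in> Hom T X X"
    using Comp_closed[OF f s(1)] .
  have "f \<star> hsub T (s \<star> f) (Ide T X) = hsub T f f"
    using Comp_hsub_right[OF sf Ide_closed[OF X] f] Comp_assoc[OF f s(1) f] s(2) Ide_Comp[OF f] Comp_Ide[OF f] by simp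
  also have "\<dots> = hzero T X Y" using hsub_eq_hzero_iff[OF f f] by simp
  finally have "s \<star> f = Ide T X"
    using inj[OF hsub_closed[OF sf Ide_closed[OF X]]] hsub_eq_hzero_iff[OF sf Ide_closed[OF X]] by simp
  then show ?thesis using f s unfolding iso_arrow_def by blast
qed

text \<open>A five lemma argument for finite sums. The restriction \<open>k \<star> g\<close> is a
  finite sum, so some local unit \<open>e\<close> fixes it. Then \<open>k\<close> minus
  \<open>e \<star> k\<close> vanishes on \<open>Y\<close> and factors through the suspension of
  \<open>X\<close>, hence is a finite sum, while \<open>e \<star> k\<close> is one because
  \<open>e\<close> is.\<close>

lemma compact_cone:
  assumes "compact_object T (susp_ob T X)" "compact_object T Y"
  shows "compact_object T Z"
  unfolding compact_object_iff
proof (intro conjI allI impI subsetI)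
  show Z: "Z \<in> Ob T" using Hom_ob[OF g] by blast
  fix I :: "'a set" and F S \<iota> k
  assume I: "small I" and S: "is_coproduct T I F S \<iota>" and k: "k \<in> Hom T Z S"
  have "k \<star> g \<in> coproduct_sums T I F S \<iota> Y" using assms(2) I S Comp_closed[OF g k] unfolding compact_object_iff by blast
  then obtain e where e0: "e \<in> coproduct_sums T I F S \<iota> S" "e \<star> (k \<star> g) = k \<star> g"
    using coproduct_sums_local_unit[OF S] Hom_ob(1)[OF g] by blast
  have e: "e \<in> Hom T S S" "e \<star> (k \<star> g) = k \<star> g"
    using coproduct_sums_closed[OF S coproduct_ob(1)[OF S] e0(1)] e0(2) by auto
  have ek: "e \<star> k \<in> Hom T Z S" by (rule Comp_closed[OF k e(1)])
  have ek_sum: "e \<star> k \<in> coproduct_sums T I F S \<iota> Z" by (rule coproduct_sums_Comp[OF S e0(1) k])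
  have "hsub T k (e \<star> k) \<star> g = hsub T (k \<star> g) (k \<star> g)"
    using Comp_hsub_left[OF g k ek] Comp_assoc[OF g k e(1)] e(2) by simp
  also have "\<dots> = hzero T Y S" using hsub_eq_hzero_iff[of "k \<star> g" Y S "k \<star> g"] Comp_closed[OF g k] by simp
  finally obtain l where l: "l \<in> Hom T (susp_ob T X) S" "l \<star> h = hsub T k (e \<star> k)"
    using tri_weak_cokernel_connecting[OF hsub_closed[OF k ek]] by blast
  have "l \<in> coproduct_sums T I F S \<iota> (susp_ob T X)" using assms(1) I S l(1) unfolding compact_object_iff by blast
  then have "hsub T k (e \<star> k) \<in> coproduct_sums T I F S \<iota> Z" using coproduct_sums_Comp[OF S _ h] l(2) by metis
  then have "hadd T (hsub T k (e \<star> k)) (e \<star> k) \<in> coproduct_sums T I F S \<iota> Z"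
    using coproduct_sums_hadd[OF S Z] ek_sum by blast
  then show "k \<in> coproduct_sums T I F S \<iota> Z" using hsub_hadd_cancel[OF k ek] by simp
qed

end

lemma susp_coproduct:
  assumes S: "is_coproduct T I X S \<iota>"
  shows "is_coproduct T I (\<lambda>i. susp_ob T (X i)) (susp_ob T S) (\<lambda>i. susp_ar T (\<iota> i))"
  unfolding is_coproduct_def
proof (intro conjI ballI allI impI)
  show "susp_ob T S \<in> Ob T" using susp_ob_closed coproduct_ob(1)[OF S] by blast
  fix i assume i: "i \<in> I"
  show "susp_ob T (X i) \<in> Ob T" "susp_ar T (\<iota> i) \<in> Hom T (susp_ob T (X i)) (susp_ob T S)"
    using susp_ob_closed[OF coproduct_ob(2)[OF S i]] susp_closed[OF coproduct_ob(3)[OF S i]] by auto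
next
  fix Y f assume Y: "Y \<in> Ob T" and f: "\<forall>i\<in>I. f i \<in> Hom T (susp_ob T (X i)) Y"
  obtain Y' \<phi> \<psi> where Y': "Y' \<in> Ob T" and \<phi>: "\<phi> \<in> Hom T (susp_ob T Y') Y" and \<psi>: "\<psi> \<in> Hom T Y (susp_ob T Y')"
    and inv: "\<psi> \<star> \<phi> = Ide T (susp_ob T Y')" "\<phi> \<star> \<psi> = Ide T Y"
    using desusp[OF Y] by blast
  have "\<forall>i\<in>I. \<exists>f'. f' \<in> Hom T (X i) Y' \<and> susp_ar T f' = \<psi> \<star> f i"
  proof
    fix i assume i: "i \<in> I"
    have "\<psi> \<star> f i \<in> Hom T (susp_ob T (X i)) (susp_ob T Y')" using Comp_closed f \<psi> i by blast
    then show "\<exists>f'. f' \<in> Hom T (X i) Y' \<and> susp_ar T f' = \<psi> \<star> f i"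
      using susp_full[OF _ coproduct_ob(2)[OF S i] Y'] by metis
  qed
  then obtain f' where f': "\<And>i. i \<in> I \<Longrightarrow> f' i \<in> Hom T (X i) Y'" "\<And>i. i \<in> I \<Longrightarrow> susp_ar T (f' i) = \<psi> \<star> f i"
    by (metis (no_types, lifting) bchoice)
  obtain u where u: "u \<in> Hom T S Y'" "\<And>i. i \<in> I \<Longrightarrow> u \<star> \<iota> i = f' i" using coproduct_desc[OF S Y', of f'] f'(1) by metis
  show "\<exists>!u. u \<in> Hom T (susp_ob T S) Y \<and> (\<forall>i\<in>I. u \<star> susp_ar T (\<iota> i) = f i)"
  proof (rule ex1I[of _ "\<phi> \<star> susp_ar T u"], intro conjI ballI)
    show "\<phi> \<star> susp_ar T u \<in> Hom T (susp_ob T S) Y"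
      using Comp_closed[OF susp_closed[OF u(1)] \<phi>] .
    fix i assume i: "i \<in> I"
    have fi: "f i \<in> Hom T (susp_ob T (X i)) Y" using f i by blast
    have "(\<phi> \<star> susp_ar T u) \<star> susp_ar T (\<iota> i) = \<phi> \<star> susp_ar T (u \<star> \<iota> i)"
      using Comp_assoc[OF susp_closed[OF coproduct_ob(3)[OF S i]] susp_closed[OF u(1)] \<phi>]
        susp_Comp[OF coproduct_ob(3)[OF S i] u(1)] by simp
    also have "\<dots> = (\<phi> \<star> \<psi>) \<star> f i" using u(2)[OF i] f'(2)[OF i] Comp_assoc[OF fi \<psi> \<phi>] by simp
    finally show "(\<phi> \<star> susp_ar T u) \<star> susp_ar T (\<iota> i) = f i" using inv Ide_Comp[OF fi] by simp
  next
    fix v assume v: "v \<in> Hom T (susp_ob T S) Y \<and> (\<forall>i\<in>I. v \<star> susp_ar T (\<iota> i) = f i)"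
    then have v1: "v \<in> Hom T (susp_ob T S) Y" by blast
    obtain v' where v': "v' \<in> Hom T S Y'" "susp_ar T v' = \<psi> \<star> v"
      using susp_full[OF Comp_closed[OF v1 \<psi>] coproduct_ob(1)[OF S] Y'] by metis
    have "v' = u"
    proof (rule coproduct_ext[OF S v'(1) u(1)])
      fix i assume i: "i \<in> I"
      note \<iota> = coproduct_ob(3)[OF S i]
      have "susp_ar T (v' \<star> \<iota> i) = \<psi> \<star> (v \<star> susp_ar T (\<iota> i))"
        using susp_Comp[OF \<iota> v'(1)] v'(2) Comp_assoc[OF susp_closed[OF \<iota>] v1 \<psi>] by simp
      also have "\<dots> = susp_ar T (u \<star> \<iota> i)" using v i u(2)[OF i] f'(2)[OF i] by simp
      finally show "v' \<star> \<iota> i = u \<star> \<iota> i" using susp_faithful[OF Comp_closed[OF \<iota> v'(1)] Comp_closed[OF \<iota> u(1)]] by blast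
    qed
    then have "\<phi> \<star> susp_ar T u = \<phi> \<star> (\<psi> \<star> v)" using v'(2) by simp
    then show "v = \<phi> \<star> susp_ar T u" using Comp_assoc[OF v1 \<psi> \<phi>] inv Ide_Comp[OF v1] by simp
  qed
qed

text \<open>Reduces arrows from a suspension into \<open>S\<close> to suspended arrows into a
  coproduct of desuspended objects; \<open>\<phi>\<close> carries the suspended injections to the
  given ones precomposed with comparison arrows \<open>a i\<close>.\<close>

lemma desusp_coproduct:
  assumes cg: "compactly_generated T" and I: "small (I :: 'a set)" and S: "is_coproduct T I X S \<iota>"
  obtains X' S' \<iota>' \<phi> \<psi> a where "is_coproduct T I X' S' \<iota>'"
    "\<phi> \<in> Hom T (susp_ob T S') S" "\<psi> \<in> Hom T S (susp_ob T S')" "\<phi> \<star> \<psi> = Ide T S"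
    "\<And>i. i \<in> I \<Longrightarrow> a i \<in> Hom T (susp_ob T (X' i)) (X i)"
    "\<And>i. i \<in> I \<Longrightarrow> \<phi> \<star> susp_ar T (\<iota>' i) = \<iota> i \<star> a i"
proof -
  note X = coproduct_ob(2)[OF S] and \<iota> = coproduct_ob(3)[OF S]
  have "\<forall>i\<in>I. \<exists>Y. Y \<in> Ob T \<and> isomorphic T (susp_ob T Y) (X i)" using susp_dense X by blast
  from bchoice[OF this] obtain X' where X': "\<And>i. i \<in> I \<Longrightarrow> X' i \<in> Ob T"
    "\<And>i. i \<in> I \<Longrightarrow> isomorphic T (susp_ob T (X' i)) (X i)" by blast
  have "\<forall>i\<in>I. \<exists>a. iso_arrow T (susp_ob T (X' i)) (X i) a" using X'(2) unfolding isomorphic_def by blast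
  from bchoice[OF this] obtain a where a: "\<And>i. i \<in> I \<Longrightarrow> iso_arrow T (susp_ob T (X' i)) (X i) (a i)" by blast
  then have a1: "a i \<in> Hom T (susp_ob T (X' i)) (X i)" if "i \<in> I" for i using that by (simp add: iso_arrow_def)
  have "\<forall>i\<in>I. \<exists>b. b \<in> Hom T (X i) (susp_ob T (X' i)) \<and> a i \<star> b = Ide T (X i)" using a unfolding iso_arrow_def by blast
  from bchoice[OF this] obtain b where b: "\<And>i. i \<in> I \<Longrightarrow> b i \<in> Hom T (X i) (susp_ob T (X' i))"
    "\<And>i. i \<in> I \<Longrightarrow> a i \<star> b i = Ide T (X i)" by blast
  obtain S' \<iota>' where S': "is_coproduct T I X' S' \<iota>'" using cg I X'(1) unfolding compactly_generated_def by blast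
  note \<iota>' = coproduct_ob(3)[OF susp_coproduct[OF S']]
  obtain \<phi> where \<phi>: "\<phi> \<in> Hom T (susp_ob T S') S" "\<And>i. i \<in> I \<Longrightarrow> \<phi> \<star> susp_ar T (\<iota>' i) = \<iota> i \<star> a i"
    by (rule coproduct_desc[OF susp_coproduct[OF S'] coproduct_ob(1)[OF S], of "\<lambda>i. \<iota> i \<star> a i"])
      (use Comp_closed[OF a1 \<iota>] in auto)
  obtain \<psi> where \<psi>: "\<psi> \<in> Hom T S (susp_ob T S')" "\<And>i. i \<in> I \<Longrightarrow> \<psi> \<star> \<iota> i = susp_ar T (\<iota>' i) \<star> b i"
    by (rule coproduct_desc[OF S coproduct_ob(1)[OF susp_coproduct[OF S']], of "\<lambda>i. susp_ar T (\<iota>' i) \<star> b i"])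
      (use Comp_closed[OF b(1) \<iota>'] in auto)
  have "\<phi> \<star> \<psi> = Ide T S"
  proof (rule coproduct_ext[OF S Comp_closed[OF \<psi>(1) \<phi>(1)] Ide_closed[OF coproduct_ob(1)[OF S]]])
    fix i assume i: "i \<in> I"
    show "\<phi> \<star> \<psi> \<star> \<iota> i = Ide T S \<star> \<iota> i"
      using Comp_assoc[OF \<iota>[OF i] \<psi>(1) \<phi>(1)] Comp_assoc[OF b(1)[OF i] \<iota>'[OF i] \<phi>(1)] Comp_assoc[OF b(1)[OF i] a1[OF i] \<iota>[OF i]]
        \<psi>(2)[OF i] \<phi>(2)[OF i] b(2)[OF i] Comp_Ide[OF \<iota>[OF i]] Ide_Comp[OF \<iota>[OF i]] by simp
  qed
  then show ?thesis by (rule that[OF S' \<phi>(1) \<psi>(1) _ a1 \<phi>(2)])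
qed

text \<open>An arrow from the suspension of \<open>C\<close> is desuspended to an arrow from
  \<open>C\<close> into a coproduct of desuspensions, decomposed there, and its finitely many
  summands are suspended again.\<close>

lemma compact_susp:
  assumes cg: "compactly_generated T" and C: "compact_object T C"
  shows "compact_object T (susp_ob T C)"
  unfolding compact_object_iff
proof (intro conjI allI impI subsetI)
  have C': "C \<in> Ob T" using C by (simp add: compact_object_def)
  then show sC: "susp_ob T C \<in> Ob T" by (rule susp_ob_closed)
  fix I :: "'a set" and X S \<iota> k
  assume I: "small I" and S: "is_coproduct T I X S \<iota>" and k: "k \<in> Hom T (susp_ob T C) S"
  obtain X' S' \<iota>' \<phi> \<psi> \<phi>s where S': "is_coproduct T I X' S' \<iota>'"
    and \<phi>: "\<phi> \<in> Hom T (susp_ob T S') S" and \<psi>: "\<psi> \<in> Hom T S (susp_ob T S')" "\<phi> \<star> \<psi> = Ide T S"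
    and \<phi>s: "\<And>i. i \<in> I \<Longrightarrow> \<phi>s i \<in> Hom T (susp_ob T (X' i)) (X i)"
      "\<And>i. i \<in> I \<Longrightarrow> \<phi> \<star> susp_ar T (\<iota>' i) = \<iota> i \<star> \<phi>s i" by (rule desusp_coproduct[OF cg I S]) blast
  obtain k' where k': "k' \<in> Hom T C S'" "susp_ar T k' = \<psi> \<star> k"
    using susp_full[OF Comp_closed[OF k \<psi>(1)] C' coproduct_ob(1)[OF S']] by metis
  have "k' \<in> coproduct_sums T I X' S' \<iota>' C" using C I S' k'(1) unfolding compact_object_iff by blast
  then have "\<phi> \<star> susp_ar T k' \<in> coproduct_sums T I X S \<iota> (susp_ob T C)"
  proof induction
    case zero
    have "\<phi> \<star> susp_ar T (hzero T C S') = hzero T (susp_ob T C) S"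
      using susp_hzero[OF C' coproduct_ob(1)[OF S']] Comp_hzero_right[OF \<phi> sC] by simp
    then show ?case by (simp add: coproduct_sums.zero)
  next
    case (add g i c)
    note \<iota>' = coproduct_ob(3)[OF S' add(2)] and \<iota> = coproduct_ob(3)[OF S add(2)]
    note g = coproduct_sums_closed[OF S' C' add(1)] and c = susp_closed[OF add(3)]
    have "\<phi> \<star> susp_ar T (hadd T g (\<iota>' i \<star> c)) =
        hadd T (\<phi> \<star> susp_ar T g) (\<phi> \<star> (susp_ar T (\<iota>' i) \<star> susp_ar T c))"
      using susp_hadd[OF g Comp_closed[OF add(3) \<iota>']] susp_Comp[OF add(3) \<iota>']
        Comp_hadd_right[OF susp_closed[OF g] Comp_closed[OF c susp_closed[OF \<iota>']] \<phi>] by simp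
    also have "\<phi> \<star> (susp_ar T (\<iota>' i) \<star> susp_ar T c) = \<iota> i \<star> (\<phi>s i \<star> susp_ar T c)"
      using Comp_assoc[OF c susp_closed[OF \<iota>'] \<phi>] \<phi>s(2)[OF add(2)] Comp_assoc[OF c \<phi>s(1)[OF add(2)] \<iota>] by simp
    finally show ?case using coproduct_sums.add[OF add(4) add(2) Comp_closed[OF c \<phi>s(1)[OF add(2)]]] by simp
  qed
  then show "k \<in> coproduct_sums T I X S \<iota> (susp_ob T C)" using k'(2) Comp_assoc[OF k \<psi>(1) \<phi>] \<psi>(2) Ide_Comp[OF k] by simp
qed

text \<open>The suspension carries coproducts to coproducts, so the suspended arrow is a finite sum,
  and its summands descend because the suspension is full and faithful.\<close>

lemma compact_desusp:
  assumes C: "compact_object T (susp_ob T C)" and C': "C \<in> Ob T"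
  shows "compact_object T C"
  unfolding compact_object_iff
proof (intro conjI allI impI subsetI)
  show "C \<in> Ob T" by fact
  fix I :: "'a set" and X S \<iota> k
  assume I: "small I" and S: "is_coproduct T I X S \<iota>" and k: "k \<in> Hom T C S"
  note sS = susp_coproduct[OF S]
  have "susp_ar T k \<in> coproduct_sums T I (\<lambda>i. susp_ob T (X i)) (susp_ob T S) (\<lambda>i. susp_ar T (\<iota> i)) (susp_ob T C)"
    using C I sS susp_closed[OF k] unfolding compact_object_iff by blast
  then have "\<exists>k'\<in>coproduct_sums T I X S \<iota> C. susp_ar T k = susp_ar T k'"
  proof (induction "susp_ar T k" arbitrary: k rule: coproduct_sums.induct)
    case zero
    then show ?case using coproduct_sums.zero susp_hzero[OF C' coproduct_ob(1)[OF S]] by metis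
  next
    case (add g i c k)
    have "g \<in> Hom T (susp_ob T C) (susp_ob T S)"
      using coproduct_sums_closed[OF sS susp_ob_closed[OF C'] add(1)] .
    then obtain g0 where "g0 \<in> Hom T C S" "susp_ar T g0 = g" using susp_full[OF _ C' coproduct_ob(1)[OF S]] by metis
    then obtain g' where g': "g' \<in> coproduct_sums T I X S \<iota> C" "g = susp_ar T g'" using add(2)[of g0] by auto
    obtain c' where c': "c' \<in> Hom T C (X i)" "susp_ar T c' = c"
      using susp_full[OF add(4) C' coproduct_ob(2)[OF S add(3)]] by metis
    note \<iota> = coproduct_ob(3)[OF S add(3)]
    have "susp_ar T (hadd T g' (\<iota> i \<star> c')) = hadd T g (susp_ar T (\<iota> i) \<star> c)"
      using susp_hadd[OF coproduct_sums_closed[OF S C' g'(1)] Comp_closed[OF c'(1) \<iota>]] susp_Comp[OF c'(1) \<iota>] g'(2) c'(2)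
      by simp
    then show ?case using coproduct_sums.add[OF g'(1) add(3) c'(1)] add(5) by metis
  qed
  then show "k \<in> coproduct_sums T I X S \<iota> C" using susp_faithful[OF k coproduct_sums_closed[OF S C']] by blast
qed

lemma compact_desusp_exists:
  assumes "compact_object T Z"
  obtains X \<phi> \<psi> where "compact_object T X" "\<phi> \<in> Hom T (susp_ob T X) Z" "\<psi> \<in> Hom T Z (susp_ob T X)"
    "\<psi> \<star> \<phi> = Ide T (susp_ob T X)" "\<phi> \<star> \<psi> = Ide T Z"
proof -
  have "Z \<in> Ob T" using assms by (simp add: compact_object_def)
  then obtain X \<phi> \<psi> where X: "X \<in> Ob T" "\<phi> \<in> Hom T (susp_ob T X) Z" "\<psi> \<in> Hom T Z (susp_ob T X)"
    "\<psi> \<star> \<phi> = Ide T (susp_ob T X)" "\<phi> \<star> \<psi> = Ide T Z" using desusp by metis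
  have "compact_object T X" by (rule compact_desusp[OF compact_retract[OF assms X(2,3,4)] X(1)])
  then show ?thesis using X that by blast
qed

text \<open>The cone of an arrow between compact objects is compact, so a weak cokernel can be found
  among the compact objects. By the last property \<open>f\<close> is in turn a weak kernel of
  \<open>g\<close>.\<close>

lemma compact_right_sequence:
  assumes cg: "compactly_generated T" and X: "compact_object T X" and Y: "compact_object T Y" and f: "f \<in> Hom T X Y"
  obtains Z g where "compact_object T Z" "g \<in> Hom T Y Z" "g \<star> f = hzero T X Z"
    "\<And>V l. l \<in> Hom T Y V \<Longrightarrow> l \<star> f = hzero T X V \<Longrightarrow> \<exists>l'\<in>Hom T Z V. l' \<star> g = l"
    "\<And>W k. k \<in> Hom T W Y \<Longrightarrow> g \<star> k = hzero T W Z \<Longrightarrow> \<exists>k'\<in>Hom T W X. f \<star> k' = k"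
proof -
  obtain Z g h where t: "(f, g, h) \<in> Tri T" "g \<in> Hom T Y Z" "h \<in> Hom T Z (susp_ob T X)" by (rule cone[OF f])
  note t' = t(1) f t(2,3)
  show ?thesis
  proof (rule that[OF compact_cone[OF t' compact_susp[OF cg X] Y] t(2) tri_comp_zero[OF t']])
    show "\<exists>l'\<in>Hom T Z V. l' \<star> g = l" if "l \<in> Hom T Y V" "l \<star> f = hzero T X V" for V l
      using tri_weak_cokernel[OF t' that] by blast
    show "\<exists>k'\<in>Hom T W X. f \<star> k' = k" if "k \<in> Hom T W Y" "g \<star> k = hzero T W Z" for W k
      using tri_weak_kernel[OF t' that] by blast
  qed
qed

text \<open>The connecting arrow of the cone ends in the suspension of \<open>X\<close>. Replacing
  the cone by a compact desuspension turns it into an arrow \<open>h\<close> ending in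
  \<open>X\<close> itself.\<close>

lemma compact_left_sequence:
  assumes cg: "compactly_generated T" and X: "compact_object T X" and Y: "compact_object T Y" and f: "f \<in> Hom T X Y"
  obtains W h where "compact_object T W" "h \<in> Hom T W X" "f \<star> h = hzero T W Y"
    "\<And>V l. l \<in> Hom T X V \<Longrightarrow> l \<star> h = hzero T W V \<Longrightarrow> \<exists>l'\<in>Hom T Y V. l' \<star> f = l"
    "\<And>V k. k \<in> Hom T V X \<Longrightarrow> f \<star> k = hzero T V Y \<Longrightarrow> \<exists>k'\<in>Hom T V W. h \<star> k' = k"
proof -
  obtain Z g w where t: "(f, g, w) \<in> Tri T" "g \<in> Hom T Y Z" "w \<in> Hom T Z (susp_ob T X)" by (rule cone[OF f])
  note t' = t(1) f t(2,3)
  obtain W \<phi> \<psi> where W: "compact_object T W" "\<phi> \<in> Hom T (susp_ob T W) Z" "\<psi> \<in> Hom T Z (susp_ob T W)"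
    "\<psi> \<star> \<phi> = Ide T (susp_ob T W)" "\<phi> \<star> \<psi> = Ide T Z"
    using compact_desusp_exists[OF compact_cone[OF t' compact_susp[OF cg X] Y]] by metis
  have ob: "W \<in> Ob T" "X \<in> Ob T" "Y \<in> Ob T" using W(1) Hom_ob[OF f] by (auto simp: compact_object_def)
  obtain h where h: "h \<in> Hom T W X" "susp_ar T h = w \<star> \<phi>" using susp_full[OF Comp_closed[OF W(2) t(3)] ob(1,2)] by metis
  have w: "w = susp_ar T h \<star> \<psi>" using h(2) Comp_assoc[OF W(3,2) t(3)] W(5) Comp_Ide[OF t(3)] by simp
  show ?thesis
  proof (rule that[OF W(1) h(1)])
    have "susp_ar T (f \<star> h) = hzero T (susp_ob T W) (susp_ob T Y)"
      using susp_Comp[OF h(1) f] h(2) Comp_assoc[OF W(2) t(3) susp_closed[OF f]] susp_f_h[OF t']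
        Comp_hzero_left[OF W(2) susp_ob_closed[OF ob(3)]] by simp
    then show "f \<star> h = hzero T W Y" using susp_eq_hzero_iff[OF Comp_closed[OF h(1) f]] by simp
    show "\<exists>l'\<in>Hom T Y V. l' \<star> f = l" if l: "l \<in> Hom T X V" "l \<star> h = hzero T W V" for V l
    proof -
      have V: "V \<in> Ob T" using Hom_ob[OF l(1)] by blast
      have "susp_ar T l \<star> w = susp_ar T (l \<star> h) \<star> \<psi>"
        using w Comp_assoc[OF W(3) susp_closed[OF h(1)] susp_closed[OF l(1)]] susp_Comp[OF h(1) l(1)] by simp
      also have "\<dots> = hzero T Z (susp_ob T V)"
        using l(2) susp_hzero[OF ob(1) V] Comp_hzero_left[OF W(3) susp_ob_closed[OF V]] by simp
      finally obtain m where m: "m \<in> Hom T (susp_ob T Y) (susp_ob T V)" "m \<star> susp_ar T f = susp_ar T l"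
        using tri_weak_cokernel_susp[OF t' susp_closed[OF l(1)]] by blast
      obtain l' where l': "l' \<in> Hom T Y V" "susp_ar T l' = m" using susp_full[OF m(1) ob(3) V] by metis
      have "l' \<star> f = l"
        by (rule susp_faithful[OF Comp_closed[OF f l'(1)] l(1)]) (use susp_Comp[OF f l'(1)] l'(2) m(2) in simp)
      then show ?thesis using l'(1) by blast
    qed
    show "\<exists>k'\<in>Hom T V W. h \<star> k' = k" if k: "k \<in> Hom T V X" "f \<star> k = hzero T V Y" for V k
    proof -
      have V: "V \<in> Ob T" using Hom_ob[OF k(1)] by blast
      have "susp_ar T f \<star> susp_ar T k = hzero T (susp_ob T V) (susp_ob T Y)"
        using susp_Comp[OF k(1) f] k(2) susp_hzero[OF V ob(3)] by simp
      then obtain k1 where k1: "k1 \<in> Hom T (susp_ob T V) Z" "w \<star> k1 = susp_ar T k"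
        using tri_weak_kernel_susp[OF t' susp_closed[OF k(1)]] by blast
      obtain k' where k': "k' \<in> Hom T V W" "susp_ar T k' = \<psi> \<star> k1"
        using susp_full[OF Comp_closed[OF k1(1) W(3)] V ob(1)] by metis
      have "susp_ar T (h \<star> k') = (susp_ar T h \<star> \<psi>) \<star> k1"
        using susp_Comp[OF k'(1) h(1)] k'(2) Comp_assoc[OF k1(1) W(3) susp_closed[OF h(1)]] by simp
      then have "h \<star> k' = k" using susp_faithful[OF Comp_closed[OF k'(1) h(1)] k(1)] w k1(2) by simp
      then show ?thesis using k'(1) by blast
    qed
  qed
qed

end

section \<open>Consequences of compact generation\<close>

lemma compactly_generatedD:
  fixes T :: "('o, 'u, 'z) tri_category_scheme"
  assumes "compactly_generated T"
  shows "triangulated_category T"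
    and "X \<in> Ob T \<Longrightarrow> Y \<in> Ob T \<Longrightarrow> small (Hom T X Y)"
    and "small (I :: 'u set) \<Longrightarrow> (\<And>i. i \<in> I \<Longrightarrow> F i \<in> Ob T) \<Longrightarrow> \<exists>S \<iota>. is_coproduct T I F S \<iota>"
  using assms unfolding compactly_generated_def by blast+

text \<open>The desuspensions of the generators are added, so that no shift is needed to detect isomorphisms.\<close>

lemma (in triangulated_category) iso_detecting_generators:
  assumes universe: "inaccessible_universe TYPE('a)" and cg: "compactly_generated T"
  obtains \<G> where "small_in TYPE('a) \<G>" "\<And>G. G \<in> \<G> \<Longrightarrow> compact_object T G"
    "\<And>X Y f. f \<in> Hom T X Y \<Longrightarrow>
      (\<And>G. G \<in> \<G> \<Longrightarrow> bij_betw (\<lambda>c. f \<star> c) (Hom T G X) (Hom T G Y)) \<Longrightarrow> iso_arrow T X Y f"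
proof -
  obtain I :: "'a set" and G where I: "small I" and G: "\<And>i. i \<in> I \<Longrightarrow> compact_object T (G i)"
    and gen: "\<And>X. X \<in> Ob T \<Longrightarrow> (\<And>i. i \<in> I \<Longrightarrow> Hom T (G i) X = {hzero T (G i) X}) \<Longrightarrow> zero_object T X"
  proof -
    have "\<exists>(I :: 'a set) G. small I \<and> (\<forall>i \<in> I. compact_object T (G i)) \<and>
      (\<forall>X \<in> Ob T. (\<forall>i \<in> I. Hom T (G i) X = {hzero T (G i) X}) \<longrightarrow> zero_object T X)"
      using cg by (simp add: compactly_generated_def)
    then show ?thesis using that by metis
  qed
  have "\<forall>i\<in>I. \<exists>X. compact_object T X \<and> isomorphic T (susp_ob T X) (G i)"
  proof
    fix i assume i: "i \<in> I"
    obtain X \<phi> \<psi> where X: "compact_object T X" "\<phi> \<in> Hom T (susp_ob T X) (G i)" "\<psi> \<in> Hom T (G i) (susp_ob T X)"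
      "\<psi> \<star> \<phi> = Ide T (susp_ob T X)" "\<phi> \<star> \<psi> = Ide T (G i)" by (rule compact_desusp_exists[OF G[OF i]])
    then have "isomorphic T (susp_ob T X) (G i)" using Hom_ob[OF X(2)] unfolding isomorphic_def iso_arrow_def by blast
    then show "\<exists>X. compact_object T X \<and> isomorphic T (susp_ob T X) (G i)" using X(1) by blast
  qed
  from bchoice[OF this] obtain G' where G': "\<And>i. i \<in> I \<Longrightarrow> compact_object T (G' i)"
      "\<And>i. i \<in> I \<Longrightarrow> isomorphic T (susp_ob T (G' i)) (G i)" by blast
  show ?thesis
  proof (rule that[of "G ` I \<union> G' ` I"])
    show "small_in TYPE('a) (G ` I \<union> G' ` I)"
      using I universe by (intro small_in_Un small_in_image) (auto simp: small_iff_small_in)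
    show "compact_object T H" if "H \<in> G ` I \<union> G' ` I" for H using that G G'(1) by blast
    fix X Y f assume f: "f \<in> Hom T X Y"
      and bij: "\<And>H. H \<in> G ` I \<union> G' ` I \<Longrightarrow> bij_betw (\<lambda>c. f \<star> c) (Hom T H X) (Hom T H Y)"
    obtain Z g h where t: "(f, g, h) \<in> Tri T" "g \<in> Hom T Y Z" "h \<in> Hom T Z (susp_ob T X)" using cone[OF f] by blast
    note t' = t(1) f t(2,3)
    have Z: "Z \<in> Ob T" and Y: "Y \<in> Ob T" and X: "X \<in> Ob T" using Hom_ob[OF t(2)] Hom_ob[OF f] by auto
    \<comment> \<open>For \<open>t\<close> from \<open>G i\<close>, the composite
      \<open>h \<star> t\<close> corresponds to the suspension of an arrow \<open>s\<close> from
      \<open>G' i\<close> to \<open>X\<close>. As \<open>f\<close> kills \<open>s\<close>,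
      injectivity at \<open>G' i\<close> makes it zero. Hence \<open>t\<close> comes from
      \<open>Y\<close>, by surjectivity at \<open>G i\<close> even from \<open>X\<close>, and
      \<open>g \<star> f\<close> vanishes.\<close>
    have "zero_object T Z"
    proof (rule gen[OF Z])
      fix i assume i: "i \<in> I"
      have Gi: "G i \<in> Ob T" "G' i \<in> Ob T" using G[OF i] G'(1)[OF i] by (auto simp: compact_object_def)
      obtain \<phi> \<psi> where \<phi>: "\<phi> \<in> Hom T (susp_ob T (G' i)) (G i)" and \<psi>: "\<psi> \<in> Hom T (G i) (susp_ob T (G' i))"
        "\<phi> \<star> \<psi> = Ide T (G i)" using G'(2)[OF i] unfolding isomorphic_def iso_arrow_def by blast
      have "t = hzero T (G i) Z" if t1: "t \<in> Hom T (G i) Z" for t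
      proof -
        have ht: "h \<star> t \<in> Hom T (G i) (susp_ob T X)"
          using Comp_closed[OF t1 t(3)] .
        obtain s where s: "s \<in> Hom T (G' i) X" "susp_ar T s = (h \<star> t) \<star> \<phi>"
          using susp_full[OF Comp_closed[OF \<phi> ht] Gi(2) X] by metis
        have "susp_ar T (f \<star> s) = (susp_ar T f \<star> h) \<star> (t \<star> \<phi>)"
          using susp_Comp[OF s(1) f] s(2) Comp_assoc[OF \<phi> t1 t(3)]
            Comp_assoc[OF Comp_closed[OF \<phi> t1] t(3) susp_closed[OF f]] by simp
        also have "\<dots> = hzero T (susp_ob T (G' i)) (susp_ob T Y)"
          using susp_f_h[OF t'] Comp_hzero_left[OF Comp_closed[OF \<phi> t1] susp_ob_closed[OF Y]] by simp
        finally have "f \<star> s = f \<star> hzero T (G' i) X"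
          using susp_eq_hzero_iff[OF Comp_closed[OF s(1) f]] Comp_hzero_right[OF f Gi(2)] by simp
        then have "s = hzero T (G' i) X"
          using bij[of "G' i"] i s(1) hzero_closed[OF Gi(2) X] by (auto simp: bij_betw_def inj_on_def)
        then have "(h \<star> t) \<star> \<phi> = hzero T (susp_ob T (G' i)) (susp_ob T X)" using s(2) susp_hzero[OF Gi(2) X] by simp
        then have "((h \<star> t) \<star> \<phi>) \<star> \<psi> = hzero T (G i) (susp_ob T X)"
          using Comp_hzero_left[OF \<psi>(1) susp_ob_closed[OF X]] by simp
        then have "h \<star> t = hzero T (G i) (susp_ob T X)" using Comp_assoc[OF \<psi>(1) \<phi> ht] \<psi>(2) Comp_Ide[OF ht] by simp
        then obtain t2 where t2: "t2 \<in> Hom T (G i) Y" "g \<star> t2 = t" using tri_weak_kernel_connecting[OF t' t1] by blast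
        then have "t2 \<in> (\<lambda>c. f \<star> c) ` Hom T (G i) X" using bij[of "G i"] i by (auto simp: bij_betw_def)
        then obtain t3 where t3: "t3 \<in> Hom T (G i) X" "t2 = f \<star> t3" by blast
        then have "t = hzero T X Z \<star> t3" using t2(2) Comp_assoc[OF t3(1) f t(2)] tri_comp_zero[OF t'] by simp
        then show ?thesis using Comp_hzero_left[OF t3(1) Z] by simp
      qed
      then show "Hom T (G i) Z = {hzero T (G i) Z}" using hzero_closed[OF Gi(1) Z] by blast
    qed
    then show "iso_arrow T X Y f" using tri_zero_iso[OF t'] by blast
  qed
qed

section \<open>Brown representability\<close>

context category
begin

lemma coproduct_inv_into:
  assumes S: "is_coproduct C (e ` K) (\<lambda>i. F (inv_into K e i)) S \<iota>" and e: "inj_on e K"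
  shows "is_coproduct C K F S (\<lambda>k. \<iota> (e k))"
proof -
  have "is_coproduct C K (\<lambda>k. F (inv_into K e (e k))) S (\<lambda>k. \<iota> (e k))"
    using coproduct_reindex[OF S, of e K] e by (simp add: bij_betw_def)
  then show ?thesis using e unfolding is_coproduct_def by simp
qed

end

lemma coproduct_sums_inv_into:
  assumes "g \<in> coproduct_sums C (e ` K) (\<lambda>i. F (inv_into K e i)) S (\<lambda>i. \<iota> (inv_into K e i)) W" "inj_on e K"
  shows "g \<in> coproduct_sums C K F S \<iota> W"
  using assms(1)
proof induction
  case zero
  then show ?case by (rule coproduct_sums.zero)
next
  case (add g i c)
  then obtain k where k: "k \<in> K" "i = e k" by blast
  show ?case using coproduct_sums.add[OF add(4) k(1), of c] add(3) assms(2) k by simp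
qed

lemma (in additive_category) compact_factors_small:
  fixes K :: "'k set"
  assumes W: "compact_object C W" and K: "small_in TYPE('a) K"
    and S: "is_coproduct C K F S \<iota>" and k: "k \<in> Hom C W S"
  shows "k \<in> coproduct_sums C K F S \<iota> W"
proof -
  obtain e :: "'k \<Rightarrow> 'a" where e: "inj_on e K"
    using small_in_embed[OF K] .
  have "bij_betw (inv_into K e) (e ` K) K" using bij_betw_inv_into[of e K "e ` K"] e by (simp add: bij_betw_def)
  note S' = coproduct_reindex[OF S this]
  have "small (e ` K)" using small_in_image[OF K] by (simp add: small_iff_small_in)
  then have "k \<in> coproduct_sums C (e ` K) (\<lambda>i. F (inv_into K e i)) S (\<lambda>i. \<iota> (inv_into K e i)) W"
    using compact_factors[OF W _ S' k] by blast
  then show ?thesis by (rule coproduct_sums_inv_into[OF _ e])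
qed

text \<open>A contravariant functor to sets, written as a right action. Exactness is stated as
  extension over weak coequalizers, that is over cones of differences, so that it makes sense for
  plain sets.\<close>

locale brown_functor = triangulated_category T
  for T :: "('o, 'a, 'z) tri_category_scheme" (structure) +
  fixes H :: "'o \<Rightarrow> 'h set" and act :: "'h \<Rightarrow> 'a \<Rightarrow> 'h" (infixl \<open>\<odot>\<close> 70)
  assumes universe: "inaccessible_universe TYPE('a)"
    and cg: "compactly_generated T"
    and act_closed: "f \<in> Hom T X Y \<Longrightarrow> x \<in> H Y \<Longrightarrow> x \<odot> f \<in> H X"
    and act_Comp: "f \<in> Hom T X Y \<Longrightarrow> g \<in> Hom T Y Z \<Longrightarrow> x \<in> H Z \<Longrightarrow> x \<odot> (g \<star> f) = x \<odot> g \<odot> f"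
    and act_Ide: "X \<in> Ob T \<Longrightarrow> x \<in> H X \<Longrightarrow> x \<odot> Ide T X = x"
    and H_coproduct: "small (I :: 'a set) \<Longrightarrow> is_coproduct T I F S \<iota> \<Longrightarrow> (\<And>i. i \<in> I \<Longrightarrow> xs i \<in> H (F i)) \<Longrightarrow>
      \<exists>s\<in>H S. \<forall>i\<in>I. s \<odot> \<iota> i = xs i"
    and H_coproduct_ext: "small (I :: 'a set) \<Longrightarrow> is_coproduct T I F S \<iota> \<Longrightarrow> s \<in> H S \<Longrightarrow> t \<in> H S \<Longrightarrow>
      (\<And>i. i \<in> I \<Longrightarrow> s \<odot> \<iota> i = t \<odot> \<iota> i) \<Longrightarrow> s = t"
    and H_weak_coequalizer: "a \<in> Hom T X Y \<Longrightarrow> b \<in> Hom T X Y \<Longrightarrow> (hsub T a b, g, h) \<in> Tri T \<Longrightarrow>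
      g \<in> Hom T Y Z \<Longrightarrow> h \<in> Hom T Z (susp_ob T X) \<Longrightarrow> y \<in> H Y \<Longrightarrow> y \<odot> a = y \<odot> b \<Longrightarrow> \<exists>z\<in>H Z. z \<odot> g = y"
    and H_small: "compact_object T C \<Longrightarrow> small_in TYPE('a) (H C)"
begin

lemma family_coproduct:
  fixes K :: "'k set"
  assumes K: "small_in TYPE('a) K" and F: "\<And>k. k \<in> K \<Longrightarrow> F k \<in> Ob T" and x: "\<And>k. k \<in> K \<Longrightarrow> x k \<in> H (F k)"
  obtains S \<iota> s where "is_coproduct T K F S \<iota>" "s \<in> H S" "\<And>k. k \<in> K \<Longrightarrow> s \<odot> \<iota> k = x k"
    "\<And>t t'. t \<in> H S \<Longrightarrow> t' \<in> H S \<Longrightarrow> (\<And>k. k \<in> K \<Longrightarrow> t \<odot> \<iota> k = t' \<odot> \<iota> k) \<Longrightarrow> t = t'"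
proof -
  obtain e :: "'k \<Rightarrow> 'a" where e: "inj_on e K"
    using small_in_embed[OF K] .
  let ?I = "e ` K" and ?F = "\<lambda>i. F (inv_into K e i)"
  have I: "small ?I" using small_in_image[OF K] by (simp add: small_iff_small_in)
  have F': "?F i \<in> Ob T" if "i \<in> ?I" for i using F inv_into_into[OF that] by blast
  obtain S \<iota> where S: "is_coproduct T ?I ?F S \<iota>" using compactly_generatedD(3)[OF cg I, of ?F] F' by blast
  have "\<exists>s\<in>H S. \<forall>i\<in>?I. s \<odot> \<iota> i = x (inv_into K e i)"
    by (rule H_coproduct[OF I S]) (use x inv_into_into[of _ e K] in blast)
  then obtain s where s: "s \<in> H S" "\<And>i. i \<in> ?I \<Longrightarrow> s \<odot> \<iota> i = x (inv_into K e i)" by blast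
  show ?thesis
  proof (rule that[OF coproduct_inv_into[OF S e] s(1)])
    show "s \<odot> \<iota> (e k) = x k" if "k \<in> K" for k using s(2)[of "e k"] that e by simp
    show "t = t'" if "t \<in> H S" "t' \<in> H S" "\<And>k. k \<in> K \<Longrightarrow> t \<odot> \<iota> (e k) = t' \<odot> \<iota> (e k)" for t t'
      by (rule H_coproduct_ext[OF I S that(1,2)]) (use that(3) in auto)
  qed
qed

section \<open>Approximation by killing relations, relative to a set of generators\<close>

context
  fixes \<G> :: "'o set"
  assumes G_small: "small_in TYPE('a) \<G>" and G_compact: "\<And>G. G \<in> \<G> \<Longrightarrow> compact_object T G"
    and G_detects: "\<And>X Y f. f \<in> Hom T X Y \<Longrightarrow>
      (\<And>G. G \<in> \<G> \<Longrightarrow> bij_betw (\<lambda>c. f \<star> c) (Hom T G X) (Hom T G Y)) \<Longrightarrow> iso_arrow T X Y f"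
begin

lemma G_ob: "G \<in> \<G> \<Longrightarrow> G \<in> Ob T"
  using G_compact by (simp add: compact_object_def)

text \<open>All pairs of arrows from generators that \<open>x\<close> identifies are collected into
  two arrows \<open>a\<close> and \<open>b\<close> out of one coproduct. Uniqueness on coproducts
  gives \<open>x \<odot> a = x \<odot> b\<close>, so \<open>x\<close> extends over the cone of their
  difference, in which all these pairs become equal.\<close>

lemma kill_relations:
  assumes X: "X \<in> Ob T" and x: "x \<in> H X"
  obtains Y j y where "j \<in> Hom T X Y" "y \<in> H Y" "y \<odot> j = x"
    "\<And>G c d. G \<in> \<G> \<Longrightarrow> c \<in> Hom T G X \<Longrightarrow> d \<in> Hom T G X \<Longrightarrow> x \<odot> c = x \<odot> d \<Longrightarrow> j \<star> c = j \<star> d"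
proof -
  define K where "K = (SIGMA G:\<G>. {(c, d). c \<in> Hom T G X \<and> d \<in> Hom T G X \<and> x \<odot> c = x \<odot> d})"
  have "small_in TYPE('a) {(c, d). c \<in> Hom T G X \<and> d \<in> Hom T G X \<and> x \<odot> c = x \<odot> d}" if "G \<in> \<G>" for G
  proof -
    have "small_in TYPE('a) (Hom T G X)"
      using compactly_generatedD(2)[OF cg G_ob[OF that] X] by (simp add: small_iff_small_in)
    then have "small_in TYPE('a) (Hom T G X \<times> Hom T G X)" by (intro small_in_Sigma[OF universe])
    then show ?thesis by (rule small_in_subset) auto
  qed
  then have K: "small_in TYPE('a) K" unfolding K_def by (intro small_in_Sigma[OF universe G_small])
  have xc: "x \<odot> fst (snd k) \<in> H (fst k)" if "k \<in> K" for k using act_closed[OF _ x] that unfolding K_def by auto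
  obtain P \<iota> s where P: "is_coproduct T K fst P \<iota>" and ext: "\<And>t t'. t \<in> H P \<Longrightarrow> t' \<in> H P \<Longrightarrow>
      (\<And>k. k \<in> K \<Longrightarrow> t \<odot> \<iota> k = t' \<odot> \<iota> k) \<Longrightarrow> t = t'"
    by (rule family_coproduct[OF K, of fst "\<lambda>k. x \<odot> fst (snd k)"]) (use xc G_ob in \<open>auto simp: K_def\<close>)
  have cd: "fst (snd k) \<in> Hom T (fst k) X" "snd (snd k) \<in> Hom T (fst k) X"
    "x \<odot> fst (snd k) = x \<odot> snd (snd k)" if "k \<in> K" for k using that by (auto simp: K_def)
  obtain a where a: "a \<in> Hom T P X" "\<And>k. k \<in> K \<Longrightarrow> a \<star> \<iota> k = fst (snd k)"
    using coproduct_desc[OF P X, of "\<lambda>k. fst (snd k)"] cd(1) by metis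
  obtain b where b: "b \<in> Hom T P X" "\<And>k. k \<in> K \<Longrightarrow> b \<star> \<iota> k = snd (snd k)"
    using coproduct_desc[OF P X, of "\<lambda>k. snd (snd k)"] cd(2) by metis
  have "x \<odot> a = x \<odot> b"
  proof (rule ext[OF act_closed[OF a(1) x] act_closed[OF b(1) x]])
    fix k assume k: "k \<in> K"
    show "x \<odot> a \<odot> \<iota> k = x \<odot> b \<odot> \<iota> k"
      using act_Comp[OF coproduct_ob(3)[OF P k] a(1) x] act_Comp[OF coproduct_ob(3)[OF P k] b(1) x]
        a(2)[OF k] b(2)[OF k] cd(3)[OF k] by simp
  qed
  moreover obtain Y j h where tri: "(hsub T a b, j, h) \<in> Tri T" "j \<in> Hom T X Y" "h \<in> Hom T Y (susp_ob T P)"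
    by (rule cone[OF hsub_closed[OF a(1) b(1)]])
  ultimately obtain y where y: "y \<in> H Y" "y \<odot> j = x" using H_weak_coequalizer[OF a(1) b(1) tri x] by blast
  have "hsub T (j \<star> a) (j \<star> b) = hzero T P Y"
    using tri_comp_zero[OF tri(1) hsub_closed[OF a(1) b(1)] tri(2,3)] Comp_hsub_right[OF a(1) b(1) tri(2)] by simp
  then have jab: "j \<star> a = j \<star> b"
    using hsub_eq_hzero_iff[OF Comp_closed[OF a(1) tri(2)] Comp_closed[OF b(1) tri(2)]] by simp
  show ?thesis
  proof (rule that[OF tri(2) y])
    fix G c d assume "G \<in> \<G>" "c \<in> Hom T G X" "d \<in> Hom T G X" "x \<odot> c = x \<odot> d"
    then have k: "(G, c, d) \<in> K" by (simp add: K_def)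
    show "j \<star> c = j \<star> d"
      using a(2)[OF k] b(2)[OF k] Comp_assoc[OF coproduct_ob(3)[OF P k] a(1) tri(2)]
        Comp_assoc[OF coproduct_ob(3)[OF P k] b(1) tri(2)] jab by simp
  qed
qed

text \<open>The recursion carries an object together with an element of \<open>H\<close>, since each
  stage depends on both; the connecting arrows are read off from the chosen steps
  afterwards.\<close>

lemma tower:
  assumes "X0 \<in> Ob T" "x0 \<in> H X0"
  obtains X x j where "X 0 = X0" "x 0 = x0" "\<And>n :: nat. X n \<in> Ob T" "\<And>n. x n \<in> H (X n)"
    "\<And>n. j n \<in> Hom T (X n) (X (Suc n))" "\<And>n. x (Suc n) \<odot> j n = x n"
    "\<And>n G c d. G \<in> \<G> \<Longrightarrow> c \<in> Hom T G (X n) \<Longrightarrow> d \<in> Hom T G (X n) \<Longrightarrow> x n \<odot> c = x n \<odot> d \<Longrightarrow>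
      j n \<star> c = j n \<star> d"
proof -
  let ?P = "\<lambda>p q. fst (snd q) \<in> Hom T (fst p) (fst q) \<and> snd (snd q) \<in> H (fst q) \<and> snd (snd q) \<odot> fst (snd q) = snd p \<and>
    (\<forall>G\<in>\<G>. \<forall>c\<in>Hom T G (fst p). \<forall>d\<in>Hom T G (fst p). snd p \<odot> c = snd p \<odot> d \<longrightarrow>
      fst (snd q) \<star> c = fst (snd q) \<star> d)"
  have "\<forall>p\<in>{(X, x). X \<in> Ob T \<and> x \<in> H X}. \<exists>q. ?P p q"
  proof
    fix p assume p: "p \<in> {(X, x). X \<in> Ob T \<and> x \<in> H X}"
    then have p': "fst p \<in> Ob T" "snd p \<in> H (fst p)" by auto
    obtain Y j y where *: "j \<in> Hom T (fst p) Y" "y \<in> H Y" "y \<odot> j = snd p"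
      "\<And>G c d. G \<in> \<G> \<Longrightarrow> c \<in> Hom T G (fst p) \<Longrightarrow> d \<in> Hom T G (fst p) \<Longrightarrow> snd p \<odot> c = snd p \<odot> d \<Longrightarrow> j \<star> c = j \<star> d"
      by (rule kill_relations[OF p']) blast
    have "?P p (Y, j, y)" unfolding fst_conv snd_conv by (intro conjI ballI impI) (fact *)+
    then show "\<exists>q. ?P p q" by (rule exI)
  qed
  from bchoice[OF this] obtain step where
    step: "\<And>p. p \<in> {(X, x). X \<in> Ob T \<and> x \<in> H X} \<Longrightarrow> ?P p (step p)" by blast
  define st where "st = rec_nat (X0, x0) (\<lambda>_ p. (fst (step p), snd (snd (step p))))"
  have st0: "st 0 = (X0, x0)" and stS: "\<And>n. st (Suc n) = (fst (step (st n)), snd (snd (step (st n))))"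
    by (simp_all add: st_def)
  have st_in: "st n \<in> {(X, x). X \<in> Ob T \<and> x \<in> H X}" for n
  proof (induction n)
    case 0
    then show ?case using assms st0 by simp
  next
    case (Suc n)
    have "fst (step (st n)) \<in> Ob T" using step[OF Suc] Hom_ob(2) by blast
    then show ?case using step[OF Suc] stS[of n] by simp
  qed
  show ?thesis
  proof (rule that[of "\<lambda>n. fst (st n)" "\<lambda>n. snd (st n)" "\<lambda>n. fst (snd (step (st n)))"])
    fix n
    show "fst (st n) \<in> Ob T" "snd (st n) \<in> H (fst (st n))" using st_in[of n] by auto
    show "fst (snd (step (st n))) \<in> Hom T (fst (st n)) (fst (st (Suc n)))"
      "snd (st (Suc n)) \<odot> fst (snd (step (st n))) = snd (st n)" using step[OF st_in[of n]] stS[of n] by auto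
    fix G c d assume "G \<in> \<G>" "c \<in> Hom T G (fst (st n))" "d \<in> Hom T G (fst (st n))" "snd (st n) \<odot> c = snd (st n) \<odot> d"
    then show "fst (snd (step (st n))) \<star> c = fst (snd (step (st n))) \<star> d" using step[OF st_in[of n]] by blast
  qed (simp_all add: st0)
qed

text \<open>Passing to the homotopy colimit of the tower makes the evaluation at \<open>x\<close> injective.\<close>

lemma telescope:
  assumes "X0 \<in> Ob T" "x0 \<in> H X0"
  obtains Y k y where "k \<in> Hom T X0 Y" "y \<in> H Y" "y \<odot> k = x0"
    "\<And>G c d. G \<in> \<G> \<Longrightarrow> c \<in> Hom T G Y \<Longrightarrow> d \<in> Hom T G Y \<Longrightarrow> y \<odot> c = y \<odot> d \<Longrightarrow> c = d"
proof -
  obtain X x j where X0: "X 0 = X0" "x 0 = x0" and X: "\<And>n :: nat. X n \<in> Ob T" and x: "\<And>n. x n \<in> H (X n)"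
    and j: "\<And>n. j n \<in> Hom T (X n) (X (Suc n))" and xj: "\<And>n. x (Suc n) \<odot> j n = x n"
    and kill: "\<And>n G c d. G \<in> \<G> \<Longrightarrow> c \<in> Hom T G (X n) \<Longrightarrow> d \<in> Hom T G (X n) \<Longrightarrow> x n \<odot> c = x n \<odot> d \<Longrightarrow>
      j n \<star> c = j n \<star> d"
    by (rule tower[OF assms]) blast
  have nat: "small_in TYPE('a) (UNIV :: nat set)" by (rule small_in_nat[OF universe])
  obtain S \<iota> s where S: "is_coproduct T (UNIV :: nat set) X S \<iota>" and s: "s \<in> H S" "\<And>n. s \<odot> \<iota> n = x n"
    and ext: "\<And>t t'. t \<in> H S \<Longrightarrow> t' \<in> H S \<Longrightarrow> (\<And>n. t \<odot> \<iota> n = t' \<odot> \<iota> n) \<Longrightarrow> t = t'"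
    by (rule family_coproduct[OF nat, of X x]) (use X x in auto)
  have S_ob: "S \<in> Ob T" and \<iota>: "\<And>n. \<iota> n \<in> Hom T (X n) S" using coproduct_ob[OF S] by auto
  have \<iota>j: "\<iota> (Suc n) \<star> j n \<in> Hom T (X n) S" for n
    using Comp_closed[OF j \<iota>] .
  \<comment> \<open>\<open>\<sigma>\<close> shifts each stage of the tower to the next; the cone of
    the identity minus \<open>\<sigma>\<close> is the homotopy colimit.\<close>
  obtain \<sigma> where \<sigma>: "\<sigma> \<in> Hom T S S" "\<And>n. \<sigma> \<star> \<iota> n = \<iota> (Suc n) \<star> j n"
    by (rule coproduct_desc[OF S S_ob, of "\<lambda>n. \<iota> (Suc n) \<star> j n"]) (use \<iota>j in auto)
  note I = Ide_closed[OF S_ob]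
  obtain Y q h where tri: "(hsub T (Ide T S) \<sigma>, q, h) \<in> Tri T" "q \<in> Hom T S Y" "h \<in> Hom T Y (susp_ob T S)"
    by (rule cone[OF hsub_closed[OF I \<sigma>(1)]])
  note tri' = tri(1) hsub_closed[OF I \<sigma>(1)] tri(2,3)
  have Y_ob: "Y \<in> Ob T" using Hom_ob[OF tri(2)] by blast
  have "s \<odot> Ide T S = s \<odot> \<sigma>"
  proof (rule ext[OF act_closed[OF I s(1)] act_closed[OF \<sigma>(1) s(1)]])
    fix n
    have "s \<odot> \<sigma> \<odot> \<iota> n = s \<odot> \<iota> (Suc n) \<odot> j n"
      using act_Comp[OF \<iota>[of n] \<sigma>(1) s(1)] \<sigma>(2)[of n] act_Comp[OF j \<iota> s(1), of n] by simp
    then show "s \<odot> Ide T S \<odot> \<iota> n = s \<odot> \<sigma> \<odot> \<iota> n" using s(2) xj act_Ide[OF S_ob s(1)] by simp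
  qed
  then obtain y where y: "y \<in> H Y" "y \<odot> q = s" using H_weak_coequalizer[OF I \<sigma>(1) tri s(1)] by blast
  have "hsub T (q \<star> Ide T S) (q \<star> \<sigma>) = hzero T S Y" using tri_comp_zero[OF tri'] Comp_hsub_right[OF I \<sigma>(1) tri(2)] by simp
  then have q\<sigma>: "q \<star> \<sigma> = q"
    using hsub_eq_hzero_iff[OF Comp_closed[OF I tri(2)] Comp_closed[OF \<sigma>(1) tri(2)]] Comp_Ide[OF tri(2)] by simp
  define \<mu> where "\<mu> = (\<lambda>n. q \<star> \<iota> n)"
  have \<mu>: "\<mu> n \<in> Hom T (X n) Y" for n
    unfolding \<mu>_def using Comp_closed[OF \<iota> tri(2)] .
  have \<mu>j: "\<mu> (Suc n) \<star> j n = \<mu> n" for n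
    using Comp_assoc[OF j \<iota> tri(2), of n] Comp_assoc[OF \<iota> \<sigma>(1) tri(2), of n] q\<sigma> \<sigma>(2)[of n] by (simp add: \<mu>_def)
  have y\<mu>: "y \<odot> \<mu> n = x n" for n using act_Comp[OF \<iota> tri(2) y(1), of n] y(2) s(2) by (simp add: \<mu>_def)
  have lift: "\<exists>t'\<in>Hom T W (X (n + m)). \<mu> (n + m) \<star> t' = \<mu> n \<star> t" if t: "t \<in> Hom T W (X n)" for W t n m
  proof (induction m)
    case 0
    then show ?case using t by auto
  next
    case (Suc m)
    then obtain t' where t': "t' \<in> Hom T W (X (n + m))" "\<mu> (n + m) \<star> t' = \<mu> n \<star> t" by blast
    have "\<mu> (Suc (n + m)) \<star> (j (n + m) \<star> t') = \<mu> n \<star> t" using Comp_assoc[OF t'(1) j \<mu>] \<mu>j[of "n + m"] t'(2) by simp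
    then show ?case using Comp_closed[OF t'(1) j] by auto
  qed
  have "susp_ar T (hsub T (Ide T S) \<sigma>) \<in> Hom T (susp_ob T S) (susp_ob T S)"
    using susp_closed[OF hsub_closed[OF I \<sigma>(1)]] .
  then have \<Sigma>\<sigma>h: "susp_ar T \<sigma> \<star> h = h"
  proof -
    assume a: "susp_ar T (hsub T (Ide T S) \<sigma>) \<in> Hom T (susp_ob T S) (susp_ob T S)"
    have "hadd T (susp_ar T (hsub T (Ide T S) \<sigma>)) (susp_ar T \<sigma>) = Ide T (susp_ob T S)"
      using susp_hadd[OF hsub_closed[OF I \<sigma>(1)] \<sigma>(1)] hsub_hadd_cancel[OF I \<sigma>(1)] susp_Ide[OF S_ob] by simp
    then have "hadd T (susp_ar T (hsub T (Ide T S) \<sigma>) \<star> h) (susp_ar T \<sigma> \<star> h) = h"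
      using Comp_hadd_left[OF tri(3) a susp_closed[OF \<sigma>(1)]] Ide_Comp[OF tri(3)] by simp
    then show ?thesis using susp_f_h[OF tri'] hadd_hzero(2)[OF Comp_closed[OF tri(3) susp_closed[OF \<sigma>(1)]]] by simp
  qed
  note \<Sigma>S = susp_coproduct[OF S]
  note \<Sigma>\<iota> = susp_closed[OF \<iota>] and \<Sigma>j = susp_closed[OF j] and \<Sigma>\<sigma> = susp_closed[OF \<sigma>(1)]
  have \<Sigma>\<sigma>\<iota>: "susp_ar T \<sigma> \<star> susp_ar T (\<iota> k) = susp_ar T (\<iota> (Suc k)) \<star> susp_ar T (j k)" for k
    using susp_Comp[OF \<iota> \<sigma>(1), of k] susp_Comp[OF j \<iota>, of k] \<sigma>(2)[of k] by simp
  \<comment> \<open>An arrow \<open>r\<close> fixed by the shift has no component at stage 0, since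
    nothing is shifted there, and inductively none at stage \<open>Suc n\<close>, whose component is
    the image of the one at stage \<open>n\<close>.\<close>
  have vanish: "p \<star> r = hzero T W (susp_ob T (X n))"
    if r: "r \<in> Hom T W (susp_ob T S)" "susp_ar T \<sigma> \<star> r = r"
      and p: "p \<in> Hom T (susp_ob T S) (susp_ob T (X n))" "p \<star> susp_ar T (\<iota> n) = Ide T (susp_ob T (X n))"
        "\<And>k. k \<noteq> n \<Longrightarrow> p \<star> susp_ar T (\<iota> k) = hzero T (susp_ob T (X k)) (susp_ob T (X n))" for W r n p
    using p
  proof (induction n arbitrary: p)
    case 0
    have "p \<star> susp_ar T \<sigma> = hzero T (susp_ob T S) (susp_ob T (X 0))"
    proof (rule coproduct_ext[OF \<Sigma>S Comp_closed[OF \<Sigma>\<sigma> 0(1)]])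
      show z: "hzero T (susp_ob T S) (susp_ob T (X 0)) \<in> Hom T (susp_ob T S) (susp_ob T (X 0))"
        using Hom_ob[OF 0(1)] by simp
      fix k
      have "(p \<star> susp_ar T \<sigma>) \<star> susp_ar T (\<iota> k) = (p \<star> susp_ar T (\<iota> (Suc k))) \<star> susp_ar T (j k)"
        using Comp_assoc[OF \<Sigma>\<iota> \<Sigma>\<sigma> 0(1), of k] \<Sigma>\<sigma>\<iota>[of k] Comp_assoc[OF \<Sigma>j \<Sigma>\<iota> 0(1), of k] by simp
      also have "\<dots> = hzero T (susp_ob T (X k)) (susp_ob T (X 0))"
        using 0(3)[of "Suc k"] Comp_hzero_left[OF \<Sigma>j susp_ob_closed[OF X], of k 0] by simp
      finally show "(p \<star> susp_ar T \<sigma>) \<star> susp_ar T (\<iota> k) =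
          hzero T (susp_ob T S) (susp_ob T (X 0)) \<star> susp_ar T (\<iota> k)"
        using Comp_hzero_left[OF \<Sigma>\<iota>[of k] susp_ob_closed[OF X[of 0]]] by simp
    qed
    then show ?case using Comp_assoc[OF r(1) \<Sigma>\<sigma> 0(1)] r(2) Comp_hzero_left[OF r(1) susp_ob_closed[OF X]] by simp
  next
    case (Suc n)
    obtain p' where p': "p' \<in> Hom T (susp_ob T S) (susp_ob T (X n))" "p' \<star> susp_ar T (\<iota> n) = Ide T (susp_ob T (X n))"
        "\<And>k. k \<noteq> n \<Longrightarrow> p' \<star> susp_ar T (\<iota> k) = hzero T (susp_ob T (X k)) (susp_ob T (X n))"
      by (rule coproduct_projection[OF \<Sigma>S, of n]) auto
    have "p \<star> susp_ar T \<sigma> = susp_ar T (j n) \<star> p'"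
    proof (rule coproduct_ext[OF \<Sigma>S Comp_closed[OF \<Sigma>\<sigma> Suc(2)] Comp_closed[OF p'(1) \<Sigma>j]])
      fix k
      have "(p \<star> susp_ar T \<sigma>) \<star> susp_ar T (\<iota> k) = (p \<star> susp_ar T (\<iota> (Suc k))) \<star> susp_ar T (j k)"
        using Comp_assoc[OF \<Sigma>\<iota> \<Sigma>\<sigma> Suc(2), of k] \<Sigma>\<sigma>\<iota>[of k] Comp_assoc[OF \<Sigma>j \<Sigma>\<iota> Suc(2), of k] by simp
      also have "\<dots> = susp_ar T (j n) \<star> (p' \<star> susp_ar T (\<iota> k))"
      proof (cases "k = n")
        case True
        then show ?thesis using Suc(3) p'(2) Ide_Comp[OF \<Sigma>j] Comp_Ide[OF \<Sigma>j] by simp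
      next
        case False
        then show ?thesis
          using Suc(4)[of "Suc k"] p'(3)[OF False] Comp_hzero_left[OF \<Sigma>j susp_ob_closed[OF X], of k "Suc n"]
            Comp_hzero_right[OF \<Sigma>j susp_ob_closed[OF X], of n k] by simp
      qed
      finally show "(p \<star> susp_ar T \<sigma>) \<star> susp_ar T (\<iota> k) = (susp_ar T (j n) \<star> p') \<star> susp_ar T (\<iota> k)"
        using Comp_assoc[OF \<Sigma>\<iota> p'(1) \<Sigma>j, of k] by simp
    qed
    then have "p \<star> r = susp_ar T (j n) \<star> (p' \<star> r)"
      using Comp_assoc[OF r(1) \<Sigma>\<sigma> Suc(2)] r(2) Comp_assoc[OF r(1) p'(1) \<Sigma>j] by simp
    then show ?case using Suc.IH[OF p'] Comp_hzero_right[OF \<Sigma>j Hom_ob(1)[OF r(1)]] by simp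
  qed
  \<comment> \<open>For compact \<open>W\<close> the composite \<open>h \<star> c\<close> is a
    finite sum fixed by the shift, so it vanishes. Thus \<open>c\<close> lifts to a finite sum of
    arrows into stages, and these can be moved to a common stage.\<close>
  have factor: "\<exists>n. \<exists>t\<in>Hom T W (X n). \<mu> n \<star> t = c" if W: "compact_object T W" and c: "c \<in> Hom T W Y" for W c
  proof -
    have W_ob: "W \<in> Ob T" using Hom_ob[OF c] by blast
    have hc: "h \<star> c \<in> Hom T W (susp_ob T S)"
      using Comp_closed[OF c tri(3)] .
    have \<sigma>hc: "susp_ar T \<sigma> \<star> (h \<star> c) = h \<star> c" using Comp_assoc[OF c tri(3) \<Sigma>\<sigma>] \<Sigma>\<sigma>h by simp
    have "h \<star> c = hzero T W (susp_ob T S)"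
      by (rule coproduct_sums_eq_hzero[OF \<Sigma>S W_ob compact_factors_small[OF W nat \<Sigma>S hc]])
        (rule vanish[OF hc \<sigma>hc]; simp)
    then obtain c' where c': "c' \<in> Hom T W S" "q \<star> c' = c" using tri_weak_kernel_connecting[OF tri' c] by blast
    have "\<exists>n. \<exists>t\<in>Hom T W (X n). \<mu> n \<star> t = q \<star> g" if "g \<in> coproduct_sums T UNIV X S \<iota> W" for g
      using that
    proof induction
      case zero
      have "\<mu> 0 \<star> hzero T W (X 0) = q \<star> hzero T W S"
        using Comp_hzero_right[OF \<mu> W_ob] Comp_hzero_right[OF tri(2) W_ob] by simp
      then show ?case using hzero_closed[OF W_ob X] by blast
    next
      case (add g i d)
      then obtain n t where t: "t \<in> Hom T W (X n)" "\<mu> n \<star> t = q \<star> g" by blast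
      obtain t1 where t1: "t1 \<in> Hom T W (X (n + i))" "\<mu> (n + i) \<star> t1 = q \<star> g" using lift[OF t(1), of i] t(2) by auto
      obtain t2 where t2: "t2 \<in> Hom T W (X (n + i))" "\<mu> (n + i) \<star> t2 = \<mu> i \<star> d"
        using lift[OF add(3), of n] by (auto simp: add.commute)
      have "\<mu> (n + i) \<star> hadd T t1 t2 = hadd T (q \<star> g) (q \<star> (\<iota> i \<star> d))"
        using Comp_hadd_right[OF t1(1) t2(1) \<mu>] t1(2) t2(2) Comp_assoc[OF add(3) \<iota> tri(2)] by (simp add: \<mu>_def)
      also have "\<dots> = q \<star> hadd T g (\<iota> i \<star> d)"
        using Comp_hadd_right[OF coproduct_sums_closed[OF S W_ob add(1)] Comp_closed[OF add(3) \<iota>] tri(2)] by simp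
      finally show ?case using hadd_closed[OF t1(1) t2(1)] by blast
    qed
    then show ?thesis using compact_factors_small[OF W nat S c'(1)] c'(2) by blast
  qed
  show ?thesis
  proof (rule that[OF \<mu>[of 0, unfolded X0] y(1) y\<mu>[of 0, unfolded X0]])
    fix G c d assume G: "G \<in> \<G>" and c: "c \<in> Hom T G Y" and d: "d \<in> Hom T G Y" and eq: "y \<odot> c = y \<odot> d"
    obtain n t where t: "t \<in> Hom T G (X n)" "\<mu> n \<star> t = c" using factor[OF G_compact[OF G] c] by blast
    obtain m u where u: "u \<in> Hom T G (X m)" "\<mu> m \<star> u = d" using factor[OF G_compact[OF G] d] by blast
    obtain t' where t': "t' \<in> Hom T G (X (n + m))" "\<mu> (n + m) \<star> t' = c" using lift[OF t(1), of m] t(2) by auto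
    obtain u' where u': "u' \<in> Hom T G (X (n + m))" "\<mu> (n + m) \<star> u' = d"
      using lift[OF u(1), of n] u(2) by (auto simp: add.commute)
    \<comment> \<open>Both arrows now live at stage \<open>n + m\<close>, where \<open>x\<close>
      identifies them, so the next map of the tower makes them equal.\<close>
    have "x (n + m) \<odot> t' = x (n + m) \<odot> u'"
      using act_Comp[OF t'(1) \<mu> y(1)] act_Comp[OF u'(1) \<mu> y(1)] eq t'(2) u'(2) y\<mu> by simp
    then have "j (n + m) \<star> t' = j (n + m) \<star> u'" using kill[OF G t'(1) u'(1)] by blast
    then have "\<mu> (Suc (n + m)) \<star> (j (n + m) \<star> t') = \<mu> (Suc (n + m)) \<star> (j (n + m) \<star> u')" by simp
    then show "c = d" using Comp_assoc[OF t'(1) j \<mu>] Comp_assoc[OF u'(1) j \<mu>] \<mu>j[of "n + m"] t'(2) u'(2) by simp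
  qed
qed

text \<open>The coproduct contains \<open>X\<close>, \<open>Y\<close> (indices
  \<open>Inl True\<close> and \<open>Inl False\<close>) and one copy of \<open>G\<close> for each
  element of \<open>H G\<close>. These copies make evaluation surjective at the generators, and the
  telescope makes it injective. Having both \<open>X\<close> and \<open>Y\<close> below one
  approximant is what the uniqueness arguments need.\<close>

lemma approximants:
  assumes X: "X \<in> Ob T" "x \<in> H X" and Y: "Y \<in> Ob T" "y \<in> H Y"
  obtains Z z j k where "j \<in> Hom T X Z" "k \<in> Hom T Y Z" "z \<in> H Z" "z \<odot> j = x" "z \<odot> k = y"
    "\<And>G. G \<in> \<G> \<Longrightarrow> bij_betw (\<lambda>c. z \<odot> c) (Hom T G Z) (H G)"
proof -
  let ?K = "Inl ` (UNIV :: bool set) \<union> Inr ` Sigma \<G> H"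
  define F :: "bool + 'o \<times> 'h \<Rightarrow> 'o" where "F = case_sum (case_bool X Y) fst"
  define e :: "bool + 'o \<times> 'h \<Rightarrow> 'h" where "e = case_sum (case_bool x y) snd"
  have K: "small_in TYPE('a) ?K"
  proof (intro small_in_Un[OF universe] small_in_image)
    show "small_in TYPE('a) (UNIV :: bool set)" by (rule small_in_countable[OF universe]) simp
    show "small_in TYPE('a) (Sigma \<G> H)" by (intro small_in_Sigma[OF universe G_small] H_small G_compact)
  qed
  have Fe: "F k \<in> Ob T \<and> e k \<in> H (F k)" if "k \<in> ?K" for k
    using that X Y G_ob by (auto simp: F_def e_def split: bool.split)
  obtain S \<iota> s where S: "is_coproduct T ?K F S \<iota>" and s: "s \<in> H S" "\<And>k. k \<in> ?K \<Longrightarrow> s \<odot> \<iota> k = e k"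
    by (rule family_coproduct[OF K, of F e]) (use Fe in blast)+
  obtain Z m z where m: "m \<in> Hom T S Z" and z: "z \<in> H Z" "z \<odot> m = s"
    and inj: "\<And>G c d. G \<in> \<G> \<Longrightarrow> c \<in> Hom T G Z \<Longrightarrow> d \<in> Hom T G Z \<Longrightarrow> z \<odot> c = z \<odot> d \<Longrightarrow> c = d"
    by (rule telescope[OF coproduct_ob(1)[OF S] s(1)]) blast
  have \<iota>: "m \<star> \<iota> k \<in> Hom T (F k) Z" "z \<odot> (m \<star> \<iota> k) = e k" if k: "k \<in> ?K" for k
    using Comp_closed[OF coproduct_ob(3)[OF S k] m] act_Comp[OF coproduct_ob(3)[OF S k] m z(1)] z(2) s(2)[OF k]
    by simp_all
  show ?thesis
  proof (rule that[OF _ _ z(1)])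
    show "m \<star> \<iota> (Inl True) \<in> Hom T X Z" "z \<odot> (m \<star> \<iota> (Inl True)) = x" using \<iota>[of "Inl True"] by (auto simp: F_def e_def)
    show "m \<star> \<iota> (Inl False) \<in> Hom T Y Z" "z \<odot> (m \<star> \<iota> (Inl False)) = y" using \<iota>[of "Inl False"] by (auto simp: F_def e_def)
    fix G assume G: "G \<in> \<G>"
    show "bij_betw (\<lambda>c. z \<odot> c) (Hom T G Z) (H G)"
      unfolding bij_betw_def
    proof (intro conjI equalityI subsetI)
      show "inj_on (\<lambda>c. z \<odot> c) (Hom T G Z)" using inj[OF G] by (auto intro: inj_onI)
      show "u \<in> H G" if "u \<in> (\<lambda>c. z \<odot> c) ` Hom T G Z" for u using that act_closed z(1) by blast
      fix u assume "u \<in> H G"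
      then have "Inr (G, u) \<in> ?K" using G by blast
      from \<iota>[OF this] have "m \<star> \<iota> (Inr (G, u)) \<in> Hom T G Z" "u = z \<odot> (m \<star> \<iota> (Inr (G, u)))" by (simp_all add: F_def e_def)
      then show "u \<in> (\<lambda>c. z \<odot> c) ` Hom T G Z" by (rule rev_image_eqI)
    qed
  qed
qed

text \<open>On each generator composition with \<open>m\<close> compares two bijections onto
  \<open>H G\<close>, so it is bijective, and the generators detect isomorphisms.\<close>

lemma comparison_iso:
  assumes X: "x \<in> H X" "\<And>G. G \<in> \<G> \<Longrightarrow> bij_betw (\<lambda>c. x \<odot> c) (Hom T G X) (H G)"
    and Y: "y \<in> H Y" "\<And>G. G \<in> \<G> \<Longrightarrow> bij_betw (\<lambda>c. y \<odot> c) (Hom T G Y) (H G)"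
    and m: "m \<in> Hom T X Y" "y \<odot> m = x"
  shows "iso_arrow T X Y m"
proof (rule G_detects[OF m(1)])
  fix G assume G: "G \<in> \<G>"
  have ym: "y \<odot> (m \<star> c) = x \<odot> c" if "c \<in> Hom T G X" for c using act_Comp[OF that m(1) Y(1)] m(2) by simp
  show "bij_betw (\<lambda>c. m \<star> c) (Hom T G X) (Hom T G Y)"
    unfolding bij_betw_def
  proof (intro conjI equalityI subsetI inj_onI)
    fix c d assume cd: "c \<in> Hom T G X" "d \<in> Hom T G X" "m \<star> c = m \<star> d"
    then have "x \<odot> c = x \<odot> d" using ym by metis
    then show "c = d" using X(2)[OF G] cd by (auto simp: bij_betw_def inj_on_def)
  next
    show "d \<in> Hom T G Y" if "d \<in> (\<lambda>c. m \<star> c) ` Hom T G X" for d using that Comp_closed m(1) by blast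
    fix d assume d: "d \<in> Hom T G Y"
    then have "y \<odot> d \<in> (\<lambda>c. x \<odot> c) ` Hom T G X" using X(2)[OF G] act_closed[OF d Y(1)] by (simp add: bij_betw_def)
    then obtain c where c: "c \<in> Hom T G X" "y \<odot> d = x \<odot> c" by blast
    then have "d = m \<star> c" using ym[OF c(1)] Y(2)[OF G] d Comp_closed[OF c(1) m(1)] by (auto simp: bij_betw_def inj_on_def)
    then show "d \<in> (\<lambda>c. m \<star> c) ` Hom T G X" using c(1) by blast
  qed
qed

text \<open>Injectivity: \<open>x\<close> extends to the cone of the difference of \<open>a\<close>
  and \<open>b\<close>. The map from \<open>X\<close> to an approximant of that cone is an
  isomorphism factoring through an arrow that equalizes \<open>a\<close> and \<open>b\<close>.
  Surjectivity: a common approximant of \<open>X\<close> and \<open>Y\<close> is isomorphic to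
  \<open>X\<close>, which turns the arrow from \<open>Y\<close> into the required one.\<close>

lemma representable_aux: "\<exists>X\<in>Ob T. \<exists>x\<in>H X. \<forall>Y\<in>Ob T. bij_betw (\<lambda>f. x \<odot> f) (Hom T Y X) (H Y)"
proof -
  \<comment> \<open>The empty coproduct merely provides some object that carries an element of
    \<open>H\<close>, as a starting point.\<close>
  have "small_in TYPE('a) ({} :: nat set)" by (rule small_in_countable[OF universe]) simp
  then obtain S :: 'o and s where S: "S \<in> Ob T" "s \<in> H S"
    by (rule family_coproduct[of "{}" "\<lambda>_. undefined" "\<lambda>_. undefined"]) (auto dest: coproduct_ob(1))
  obtain X x where x: "x \<in> H X" "\<And>G. G \<in> \<G> \<Longrightarrow> bij_betw (\<lambda>c. x \<odot> c) (Hom T G X) (H G)" and X: "X \<in> Ob T"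
    by (rule approximants[OF S S]) (use Hom_ob in blast)
  have "bij_betw (\<lambda>f. x \<odot> f) (Hom T Y X) (H Y)" if Y: "Y \<in> Ob T" for Y
    unfolding bij_betw_def
  proof (intro conjI equalityI subsetI inj_onI)
    fix a b assume ab: "a \<in> Hom T Y X" "b \<in> Hom T Y X" "x \<odot> a = x \<odot> b"
    obtain Z g h where tri: "(hsub T a b, g, h) \<in> Tri T" "g \<in> Hom T X Z" "h \<in> Hom T Z (susp_ob T Y)"
      by (rule cone[OF hsub_closed[OF ab(1,2)]])
    obtain z where z: "z \<in> H Z" "z \<odot> g = x" using H_weak_coequalizer[OF ab(1,2) tri x(1) ab(3)] by blast
    have Z: "Z \<in> Ob T" using Hom_ob[OF tri(2)] by blast
    obtain V v j where j: "j \<in> Hom T Z V" and v: "v \<in> H V" "v \<odot> j = z"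
      "\<And>G. G \<in> \<G> \<Longrightarrow> bij_betw (\<lambda>c. v \<odot> c) (Hom T G V) (H G)" by (rule approximants[OF Z z(1) Z z(1)]) blast
    have jg: "j \<star> g \<in> Hom T X V" "v \<odot> (j \<star> g) = x"
      using Comp_closed[OF tri(2) j] act_Comp[OF tri(2) j v(1)] v(2) z(2) by simp_all
    have iso: "iso_arrow T X V (j \<star> g)" by (rule comparison_iso[OF x v(1,3) jg])
    have "hsub T (g \<star> a) (g \<star> b) = hzero T Y Z"
      using tri_comp_zero[OF tri(1) hsub_closed[OF ab(1,2)] tri(2,3)] Comp_hsub_right[OF ab(1,2) tri(2)] by simp
    then have "g \<star> a = g \<star> b"
      using hsub_eq_hzero_iff[OF Comp_closed[OF ab(1) tri(2)] Comp_closed[OF ab(2) tri(2)]] by simp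
    then have "(j \<star> g) \<star> a = (j \<star> g) \<star> b" using Comp_assoc[OF ab(1) tri(2) j] Comp_assoc[OF ab(2) tri(2) j] by simp
    then show "a = b" using iso_arrow_cancel_left[OF iso ab(1,2)] by blast
  next
    show "y \<in> H Y" if "y \<in> (\<lambda>f. x \<odot> f) ` Hom T Y X" for y using that act_closed x(1) by blast
    fix y assume y: "y \<in> H Y"
    obtain V v j k where j: "j \<in> Hom T X V" and k: "k \<in> Hom T Y V" and v: "v \<in> H V" "v \<odot> j = x" "v \<odot> k = y"
      "\<And>G. G \<in> \<G> \<Longrightarrow> bij_betw (\<lambda>c. v \<odot> c) (Hom T G V) (H G)" by (rule approximants[OF X x(1) Y y]) blast
    have "iso_arrow T X V j" by (rule comparison_iso[OF x v(1,4) j v(2)])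
    then obtain j' where j': "j' \<in> Hom T V X" "j \<star> j' = Ide T V" by (rule iso_arrowE)
    have "x \<odot> (j' \<star> k) = v \<odot> ((j \<star> j') \<star> k)"
      using act_Comp[OF Comp_closed[OF k j'(1)] j v(1)] v(2) Comp_assoc[OF k j'(1) j] by simp
    then have "x \<odot> (j' \<star> k) = y" using j'(2) Ide_Comp[OF k] v(3) by simp
    then show "y \<in> (\<lambda>f. x \<odot> f) ` Hom T Y X" using Comp_closed[OF k j'(1)] by blast
  qed
  then show ?thesis using X x(1) by blast
qed

end

theorem representable: "\<exists>X\<in>Ob T. \<exists>x\<in>H X. \<forall>Y\<in>Ob T. bij_betw (\<lambda>f. x \<odot> f) (Hom T Y X) (H Y)"
proof -
  obtain \<G> where "small_in TYPE('a) \<G>" "\<And>G. G \<in> \<G> \<Longrightarrow> compact_object T G"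
    "\<And>X Y f. f \<in> Hom T X Y \<Longrightarrow>
      (\<And>G. G \<in> \<G> \<Longrightarrow> bij_betw (\<lambda>c. f \<star> c) (Hom T G X) (Hom T G Y)) \<Longrightarrow> iso_arrow T X Y f"
    by (rule iso_detecting_generators[OF universe cg]) blast
  then show ?thesis by (rule representable_aux)
qed

end

section \<open>Presheaves of abelian groups\<close>

text \<open>Naturality without the extensionality built into \<open>nat_trans\<close>, suited to
  explicit formulas; \<open>mod_arrow\<close> restores it by restricting the components.\<close>

definition natural ::
    "('o, 'a, 'z) ab_category_scheme \<Rightarrow> ('o, 'a, 'u) module_fctr \<Rightarrow> ('o, 'a, 'u) module_fctr \<Rightarrow> ('o \<Rightarrow> 'u \<Rightarrow> 'u) \<Rightarrow> bool"
  where "natural C F G t \<longleftrightarrow> (\<forall>X \<in> Ob C. t X \<in> hom (on_ob F X) (on_ob G X)) \<and>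
    (\<forall>X Y. \<forall>f \<in> Hom C X Y. \<forall>y \<in> sec F Y. t X (on_ar F f y) = on_ar G f (t Y y))"

definition mod_arrow ::
    "('o, 'a, 'z) ab_category_scheme \<Rightarrow> ('o, 'a, 'u) module_fctr \<Rightarrow> ('o, 'a, 'u) module_fctr \<Rightarrow> ('o \<Rightarrow> 'u \<Rightarrow> 'u) \<Rightarrow>
      ('o, 'a, 'u) module_arrow"
  where "mod_arrow C F G t = (F, \<lambda>X\<in>Ob C. \<lambda>x\<in>sec F X. t X x, G)"

lemma Ob_ModCat [simp]: "F \<in> Ob (ModCat C) \<longleftrightarrow> additive_presheaf C F"
  by (simp add: ModCat_def)

lemma Hom_ModCat:
  "m \<in> Hom (ModCat C) F G \<longleftrightarrow>
    additive_presheaf C F \<and> additive_presheaf C G \<and> (\<exists>\<alpha>\<in>nat_trans C F G. m = (F, \<alpha>, G))"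
  by (auto simp: Hom_def ModCat_def)

lemma
  assumes "additive_presheaf C F"
  shows presheaf_group: "X \<in> Ob C \<Longrightarrow> comm_group (on_ob F X)"
    and presheaf_small: "X \<in> Ob C \<Longrightarrow> small (sec F X)"
    and presheaf_hom: "f \<in> Hom C X Y \<Longrightarrow> on_ar F f \<in> hom (on_ob F Y) (on_ob F X)"
    and presheaf_Ide: "X \<in> Ob C \<Longrightarrow> x \<in> sec F X \<Longrightarrow> on_ar F (Ide C X) x = x"
    and presheaf_Comp: "f \<in> Hom C X Y \<Longrightarrow> g \<in> Hom C Y Z \<Longrightarrow> z \<in> sec F Z \<Longrightarrow>
      on_ar F (g \<star>\<^bsub>C\<^esub> f) z = on_ar F f (on_ar F g z)"
    and presheaf_hadd: "f \<in> Hom C X Y \<Longrightarrow> g \<in> Hom C X Y \<Longrightarrow> y \<in> sec F Y \<Longrightarrow>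
      on_ar F (hadd C f g) y = on_ar F f y \<otimes>\<^bsub>on_ob F X\<^esub> on_ar F g y"
  using assms unfolding additive_presheaf_def by blast+

lemma presheaf_group': "additive_presheaf C F \<Longrightarrow> X \<in> Ob C \<Longrightarrow> group (on_ob F X)"
  by (rule comm_group.axioms(2)[OF presheaf_group])

lemma presheaf_closed:
  "additive_presheaf C F \<Longrightarrow> f \<in> Hom C X Y \<Longrightarrow> y \<in> sec F Y \<Longrightarrow> on_ar F f y \<in> sec F X"
  using presheaf_hom[of C F f X Y] by (auto simp: hom_def)

lemma presheaf_mult:
  "additive_presheaf C F \<Longrightarrow> f \<in> Hom C X Y \<Longrightarrow> x \<in> sec F Y \<Longrightarrow> y \<in> sec F Y \<Longrightarrow>
    on_ar F f (x \<otimes>\<^bsub>on_ob F Y\<^esub> y) = on_ar F f x \<otimes>\<^bsub>on_ob F X\<^esub> on_ar F f y"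
  using presheaf_hom[of C F f X Y] by (auto simp: hom_def)

lemma presheaf_one_closed: "additive_presheaf C F \<Longrightarrow> X \<in> Ob C \<Longrightarrow> \<one>\<^bsub>on_ob F X\<^esub> \<in> sec F X"
  by (rule monoid.one_closed[OF group.is_monoid[OF presheaf_group']])

lemma
  assumes "natural C F G t"
  shows natural_hom: "X \<in> Ob C \<Longrightarrow> t X \<in> hom (on_ob F X) (on_ob G X)"
    and natural_eq: "f \<in> Hom C X Y \<Longrightarrow> y \<in> sec F Y \<Longrightarrow> t X (on_ar F f y) = on_ar G f (t Y y)"
    and natural_closed: "X \<in> Ob C \<Longrightarrow> x \<in> sec F X \<Longrightarrow> t X x \<in> sec G X"
    and natural_mult: "X \<in> Ob C \<Longrightarrow> x \<in> sec F X \<Longrightarrow> y \<in> sec F X \<Longrightarrow>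
      t X (x \<otimes>\<^bsub>on_ob F X\<^esub> y) = t X x \<otimes>\<^bsub>on_ob G X\<^esub> t X y"
  using assms by (auto simp: natural_def hom_def)

lemma naturalI:
  assumes "\<And>X x. X \<in> Ob C \<Longrightarrow> x \<in> sec F X \<Longrightarrow> t X x \<in> sec G X"
    and "\<And>X x y. X \<in> Ob C \<Longrightarrow> x \<in> sec F X \<Longrightarrow> y \<in> sec F X \<Longrightarrow>
      t X (x \<otimes>\<^bsub>on_ob F X\<^esub> y) = t X x \<otimes>\<^bsub>on_ob G X\<^esub> t X y"
    and "\<And>X Y f y. f \<in> Hom C X Y \<Longrightarrow> y \<in> sec F Y \<Longrightarrow> t X (on_ar F f y) = on_ar G f (t Y y)"
  shows "natural C F G t"
  using assms by (simp add: natural_def hom_def Pi_iff)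

lemma natural_one:
  assumes "natural C F G t" "additive_presheaf C F" "additive_presheaf C G" "X \<in> Ob C"
  shows "t X \<one>\<^bsub>on_ob F X\<^esub> = \<one>\<^bsub>on_ob G X\<^esub>"
  by (rule hom_one[OF natural_hom[OF assms(1,4)] presheaf_group'[OF assms(2,4)] presheaf_group'[OF assms(3,4)]])

lemma presheaf_one:
  "category C \<Longrightarrow> additive_presheaf C F \<Longrightarrow> f \<in> Hom C X Y \<Longrightarrow> on_ar F f \<one>\<^bsub>on_ob F Y\<^esub> = \<one>\<^bsub>on_ob F X\<^esub>"
  using hom_one[OF presheaf_hom[of C F f X Y]] presheaf_group'[of C F X] presheaf_group'[of C F Y]
    category.Hom_ob[of C f X Y] by simp

lemma mod_arrow_Hom:
  fixes C :: "('o, 'a, 'z) ab_category_scheme" and F :: "('o, 'a, 'u) module_fctr"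
  assumes cat: "category C" and F: "additive_presheaf C F" and G: "additive_presheaf C G" and t: "natural C F G t"
  shows "mod_arrow C F G t \<in> Hom (ModCat C) F G"
proof -
  have "(\<lambda>X\<in>Ob C. \<lambda>x\<in>sec F X. t X x) \<in> nat_trans C F G"
    unfolding nat_trans_def
  proof (intro CollectI conjI PiE_I allI ballI)
    fix X assume X: "X \<in> Ob C"
    have "(\<lambda>x\<in>sec F X. t X x) \<in> hom (on_ob F X) (on_ob G X)"
      using natural_hom[OF t X] group.is_monoid[OF presheaf_group'[OF F X]] monoid.m_closed by (fastforce simp: hom_def)
    then show "(\<lambda>X\<in>Ob C. \<lambda>x\<in>sec F X. t X x) X \<in>
        hom (on_ob F X) (on_ob G X) \<inter> extensional (sec F X)"
      using X by simp
  next
    fix X Y f y assume f: "f \<in> Hom C X Y" and y: "y \<in> sec F Y"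
    show "(\<lambda>X\<in>Ob C. \<lambda>x\<in>sec F X. t X x) X (on_ar F f y) =
        on_ar G f ((\<lambda>X\<in>Ob C. \<lambda>x\<in>sec F X. t X x) Y y)"
      using natural_eq[OF t f y] category.Hom_ob[OF cat f] y presheaf_closed[OF F f y] by simp
  qed auto
  then show ?thesis using F G by (auto simp: Hom_ModCat mod_arrow_def)
qed

lemma component_mod_arrow [simp]:
  "X \<in> Ob C \<Longrightarrow> x \<in> sec F X \<Longrightarrow> component (mod_arrow C F G t) X x = t X x" by (simp add: mod_arrow_def)

lemma Hom_ModCat_natural:
  assumes "m \<in> Hom (ModCat C) F G"
  shows "natural C F G (component m)"
  using assms by (auto simp: Hom_ModCat nat_trans_def natural_def)

lemma Hom_ModCat_presheaf:
  assumes "m \<in> Hom (ModCat C) F G"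
  shows "additive_presheaf C F" "additive_presheaf C G"
  using assms by (auto simp: Hom_ModCat)

lemma ModCat_ext:
  assumes "m \<in> Hom (ModCat C) F G" "n \<in> Hom (ModCat C) F G"
    "\<And>X x. X \<in> Ob C \<Longrightarrow> x \<in> sec F X \<Longrightarrow> component m X x = component n X x"
  shows "m = n"
proof -
  obtain \<alpha> \<beta> where ab: "\<alpha> \<in> nat_trans C F G" "\<beta> \<in> nat_trans C F G" "m = (F, \<alpha>, G)" "n = (F, \<beta>, G)"
    using assms by (auto simp: Hom_ModCat)
  have "\<alpha> X = \<beta> X" if X: "X \<in> Ob C" for X
  proof (rule extensionalityI[of _ "sec F X"])
    show "\<alpha> X \<in> extensional (sec F X)" "\<beta> X \<in> extensional (sec F X)" using ab(1,2) X by (auto simp: nat_trans_def)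
    show "\<alpha> X x = \<beta> X x" if "x \<in> sec F X" for x using assms(3)[OF X that] ab(3,4) by simp
  qed
  moreover have "\<alpha> \<in> extensional (Ob C)" "\<beta> \<in> extensional (Ob C)" using ab(1,2) by (auto simp: nat_trans_def PiE_def)
  ultimately have "\<alpha> = \<beta>" by (intro extensionalityI[of _ "Ob C"]) auto
  then show ?thesis using ab by simp
qed

lemma Comp_ModCat:
  "(G, \<beta>, H) \<star>\<^bsub>ModCat C\<^esub> (F, \<alpha>, G') = (F, \<lambda>X\<in>Ob C. compose (sec F X) (\<beta> X) (\<alpha> X), H)" by (simp add: ModCat_def)

lemma component_Comp:
  assumes "m \<in> Hom (ModCat C) F G" "n \<in> Hom (ModCat C) G H" "X \<in> Ob C" "x \<in> sec F X"
  shows "component (n \<star>\<^bsub>ModCat C\<^esub> m) X x = component n X (component m X x)"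
  using assms by (auto simp: Hom_ModCat Comp_ModCat compose_def)

lemma natural_Comp:
  assumes "natural C F G s" "natural C G H t" "category C"
  shows "natural C F H (\<lambda>X x. t X (s X x))"
proof (rule naturalI)
  fix X Y f y assume "f \<in> Hom C X Y" "y \<in> sec F Y"
  then show "t X (s X (on_ar F f y)) = on_ar H f (t Y (s Y y))"
    using natural_eq[OF assms(1)] natural_eq[OF assms(2)] natural_closed[OF assms(1)] category.Hom_ob[OF assms(3)]
    by metis
qed (use natural_closed[OF assms(1)] natural_closed[OF assms(2)] natural_mult[OF assms(1)] natural_mult[OF assms(2)]
  in simp_all)

lemma Comp_ModCat_closed:
  fixes C :: "('o, 'a, 'z) ab_category_scheme" and F :: "('o, 'a, 'u) module_fctr"
  assumes cat: "category C" and m: "m \<in> Hom (ModCat C) F G" and n: "n \<in> Hom (ModCat C) G H"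
  shows "n \<star>\<^bsub>ModCat C\<^esub> m \<in> Hom (ModCat C) F H"
proof -
  have "n \<star>\<^bsub>ModCat C\<^esub> m = mod_arrow C F H (\<lambda>X x. component n X (component m X x))"
    using m n by (auto simp: Hom_ModCat Comp_ModCat compose_def mod_arrow_def restrict_def fun_eq_iff)
  then show ?thesis
    using mod_arrow_Hom[OF cat Hom_ModCat_presheaf(1)[OF m] Hom_ModCat_presheaf(2)[OF n]
        natural_Comp[OF Hom_ModCat_natural[OF m] Hom_ModCat_natural[OF n] cat]] by simp
qed

lemma Ide_ModCat: "Ide (ModCat C) F = mod_arrow C F F (\<lambda>X x. x)"
  by (simp add: ModCat_def mod_arrow_def)

lemma natural_id: "category C \<Longrightarrow> additive_presheaf C F \<Longrightarrow> natural C F F (\<lambda>X x. x)"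
  by (rule naturalI) simp_all

lemma category_ModCat:
  fixes C :: "('o, 'a, 'z) ab_category_scheme"
  assumes cat: "category C"
  shows "category (ModCat C :: (('o, 'a, 'u) module_fctr, ('o, 'a, 'u) module_arrow) category)" (is "category ?M")
proof
  fix f :: "('o, 'a, 'u) module_arrow" assume "f \<in> Arr ?M"
  then have f: "f \<in> Hom ?M (Dom ?M f) (Cod ?M f)" by (rule Arr_Hom)
  show "Dom ?M f \<in> Ob ?M" "Cod ?M f \<in> Ob ?M" using Hom_ModCat_presheaf[OF f] by simp_all
next
  fix f g X Y Z assume "f \<in> Hom ?M X Y" "g \<in> Hom ?M Y Z"
  then show "g \<star>\<^bsub>?M\<^esub> f \<in> Hom ?M X Z" by (rule Comp_ModCat_closed[OF cat])
next
  fix f g h W X Y Z assume *: "f \<in> Hom ?M W X" "g \<in> Hom ?M X Y" "h \<in> Hom ?M Y Z"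
  note gf = Comp_ModCat_closed[OF cat *(1,2)] and hg = Comp_ModCat_closed[OF cat *(2,3)]
  show "h \<star>\<^bsub>?M\<^esub> (g \<star>\<^bsub>?M\<^esub> f) = (h \<star>\<^bsub>?M\<^esub> g) \<star>\<^bsub>?M\<^esub> f"
    by (rule ModCat_ext[OF Comp_ModCat_closed[OF cat gf *(3)] Comp_ModCat_closed[OF cat *(1) hg]])
      (simp add: component_Comp[OF gf *(3)] component_Comp[OF *(1,2)] component_Comp[OF *(1) hg]
        component_Comp[OF *(2,3)] natural_closed[OF Hom_ModCat_natural[OF *(1)]])
next
  fix X assume "X \<in> Ob ?M"
  then have X: "additive_presheaf C X" by simp
  show "Ide ?M X \<in> Hom ?M X X" unfolding Ide_ModCat by (rule mod_arrow_Hom[OF cat X X natural_id[OF cat X]])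
next
  fix f X Y assume f: "f \<in> Hom ?M X Y"
  note X = Hom_ModCat_presheaf(1)[OF f] and Y = Hom_ModCat_presheaf(2)[OF f]
  have IX: "Ide ?M X \<in> Hom ?M X X" and IY: "Ide ?M Y \<in> Hom ?M Y Y"
    unfolding Ide_ModCat using mod_arrow_Hom[OF cat] natural_id[OF cat] X Y by blast+
  show "f \<star>\<^bsub>?M\<^esub> Ide ?M X = f"
    by (rule ModCat_ext[OF Comp_ModCat_closed[OF cat IX f] f])
      (use component_Comp[OF IX f] in \<open>simp add: Ide_ModCat\<close>)
  show "Ide ?M Y \<star>\<^bsub>?M\<^esub> f = f"
    by (rule ModCat_ext[OF Comp_ModCat_closed[OF cat f IY] f])
      (use component_Comp[OF f IY] natural_closed[OF Hom_ModCat_natural[OF f]] in \<open>simp add: Ide_ModCat\<close>)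
qed

text \<open>Pointwise inverses of a natural family are again additive and natural, because the
  family is injective.\<close>

lemma isomorphic_ModCat_iff:
  fixes C :: "('o, 'a, 'z) ab_category_scheme" and F :: "('o, 'a, 'u) module_fctr"
  assumes cat: "category C"
  shows "isomorphic (ModCat C) F G \<longleftrightarrow> additive_presheaf C F \<and> additive_presheaf C G \<and>
    (\<exists>t. natural C F G t \<and> (\<forall>X\<in>Ob C. bij_betw (t X) (sec F X) (sec G X)))"
    (is "?L \<longleftrightarrow> ?R")
proof
  assume ?L
  then obtain m n where F: "additive_presheaf C F" "additive_presheaf C G"
    and m: "m \<in> Hom (ModCat C) F G" and n: "n \<in> Hom (ModCat C) G F"
    and nm: "n \<star>\<^bsub>ModCat C\<^esub> m = Ide (ModCat C) F" "m \<star>\<^bsub>ModCat C\<^esub> n = Ide (ModCat C) G"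
    unfolding isomorphic_def iso_arrow_def by auto
  have "bij_betw (component m X) (sec F X) (sec G X)" if X: "X \<in> Ob C" for X
  proof (rule bij_betw_byWitness[where f' = "component n X"])
    show "\<forall>x\<in>sec F X. component n X (component m X x) = x"
      using component_Comp[OF m n X] nm(1) X by (simp add: Ide_ModCat)
    show "\<forall>x\<in>sec G X. component m X (component n X x) = x"
      using component_Comp[OF n m X] nm(2) X by (simp add: Ide_ModCat)
  qed (use natural_closed[OF Hom_ModCat_natural[OF m] X] natural_closed[OF Hom_ModCat_natural[OF n] X] in auto)
  then show ?R using F Hom_ModCat_natural[OF m] by blast
next
  assume ?R
  then obtain t where F: "additive_presheaf C F" and G: "additive_presheaf C G" and t: "natural C F G t"
    and bij: "\<And>X. X \<in> Ob C \<Longrightarrow> bij_betw (t X) (sec F X) (sec G X)"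
    by blast
  define s where "s = (\<lambda>X. inv_into (sec F X) (t X))"
  have s: "s X y \<in> sec F X" "t X (s X y) = y" if "X \<in> Ob C" "y \<in> sec G X" for X y
    unfolding s_def using bij[OF that(1)] that(2) by (auto simp: bij_betw_def f_inv_into_f inv_into_into)
  have st: "s X (t X x) = x" if "X \<in> Ob C" "x \<in> sec F X" for X x
    unfolding s_def using bij[OF that(1)] that(2) by (simp add: bij_betw_def)
  have inj: "x = y" if "X \<in> Ob C" "x \<in> sec F X" "y \<in> sec F X" "t X x = t X y" for X x y using st that by metis
  have snat: "natural C G F s"
  proof (rule naturalI)
    fix X x y assume X: "X \<in> Ob C" and xy: "x \<in> sec G X" "y \<in> sec G X"
    interpret FX: group "on_ob F X" by (rule presheaf_group'[OF F X])
    interpret GX: group "on_ob G X" by (rule presheaf_group'[OF G X])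
    show "s X (x \<otimes>\<^bsub>on_ob G X\<^esub> y) = s X x \<otimes>\<^bsub>on_ob F X\<^esub> s X y"
      by (rule inj[OF X]) (use s[OF X] xy natural_mult[OF t X] in simp_all)
  next
    fix X Y f y assume f: "f \<in> Hom C X Y" and y: "y \<in> sec G Y"
    note XY = category.Hom_ob[OF cat f]
    show "s X (on_ar G f y) = on_ar F f (s Y y)"
      by (rule inj[OF XY(1)])
        (use s[OF XY(1)] s[OF XY(2) y] natural_eq[OF t f] presheaf_closed[OF F f] presheaf_closed[OF G f y] in simp_all)
  qed (use s in auto)
  let ?m = "mod_arrow C F G t" and ?n = "mod_arrow C G F s"
  have m: "?m \<in> Hom (ModCat C) F G" and n: "?n \<in> Hom (ModCat C) G F" using mod_arrow_Hom[OF cat] F G t snat by blast+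
  have IF: "Ide (ModCat C) F \<in> Hom (ModCat C) F F" and IG: "Ide (ModCat C) G \<in> Hom (ModCat C) G G"
    unfolding Ide_ModCat using mod_arrow_Hom[OF cat] natural_id[OF cat] F G by blast+
  have "?n \<star>\<^bsub>ModCat C\<^esub> ?m = Ide (ModCat C) F"
    by (rule ModCat_ext[OF Comp_ModCat_closed[OF cat m n] IF])
      (use component_Comp[OF m n] natural_closed[OF t] st in \<open>simp add: Ide_ModCat\<close>)
  moreover have "?m \<star>\<^bsub>ModCat C\<^esub> ?n = Ide (ModCat C) G"
    by (rule ModCat_ext[OF Comp_ModCat_closed[OF cat n m] IG])
      (use component_Comp[OF n m] s in \<open>simp add: Ide_ModCat\<close>)
  ultimately have "iso_arrow (ModCat C) F G ?m" unfolding iso_arrow_def using m n by (intro conjI bexI[of _ ?n])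
  then show ?L using F G unfolding isomorphic_def by (intro conjI exI[of _ ?m]) simp_all
qed

lemma (in category) isomorphic_sym: "isomorphic C X Y \<Longrightarrow> isomorphic C Y X"
  unfolding isomorphic_def iso_arrow_def by blast

lemma (in category) isomorphic_trans:
  assumes "isomorphic C X Y" "isomorphic C Y Z"
  shows "isomorphic C X Z"
proof -
  obtain f f' where f: "f \<in> Hom C X Y" "f' \<in> Hom C Y X" "f' \<star> f = Ide C X" "f \<star> f' = Ide C Y"
    using assms(1) unfolding isomorphic_def iso_arrow_def by blast
  obtain g g' where g: "g \<in> Hom C Y Z" "g' \<in> Hom C Z Y" "g' \<star> g = Ide C Y" "g \<star> g' = Ide C Z"
    using assms(2) unfolding isomorphic_def iso_arrow_def by blast
  note gf = Comp_closed[OF f(1) g(1)] and fg = Comp_closed[OF g(2) f(2)]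
  have "(f' \<star> g') \<star> (g \<star> f) = f' \<star> ((g' \<star> g) \<star> f)" using Comp_assoc[OF gf g(2) f(2)] Comp_assoc[OF f(1) g(1,2)] by simp
  moreover have "(g \<star> f) \<star> (f' \<star> g') = g \<star> ((f \<star> f') \<star> g')"
    using Comp_assoc[OF fg f(1) g(1)] Comp_assoc[OF g(2) f(2,1)] by simp
  ultimately show ?thesis
    using f g gf fg Ide_Comp[OF f(1)] Ide_Comp[OF g(2)] assms unfolding isomorphic_def iso_arrow_def by auto
qed

section \<open>Representable presheaves and sub-presheaves\<close>

lemma comm_subgroup:
  assumes "comm_group G" "subgroup S G"
  shows "comm_group (G\<lparr>carrier := S\<rparr>)"
proof -
  interpret comm_group G by fact
  interpret S: group "G\<lparr>carrier := S\<rparr>" by (rule subgroup.subgroup_is_group[OF assms(2) group_axioms])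
  show ?thesis by (rule S.group_comm_groupI) (use subgroup.subset[OF assms(2)] in \<open>auto intro: m_comm\<close>)
qed

context additive_category
begin

lemma hom_presheaf_presheaf:
  assumes X: "X \<in> Ob C" and small: "\<And>A. A \<in> Ob C \<Longrightarrow> small (Hom C A X)"
  shows "additive_presheaf C (hom_presheaf C X)"
  unfolding additive_presheaf_def hom_presheaf_def
  using hom_group X small Comp_closed Comp_hadd_left Comp_hadd_right Comp_assoc Comp_Ide by (auto simp: hom_def)

lemma yoneda_natural:
  assumes F: "additive_presheaf C F" and x: "x \<in> sec F X"
  shows "natural C (hom_presheaf C X) F (\<lambda>A g. on_ar F g x)"
  by (rule naturalI) (use presheaf_closed[OF F] presheaf_hadd[OF F] presheaf_Comp[OF F] x in \<open>auto simp: hom_presheaf_def\<close>)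

definition sub_presheaf :: "('o, 'a, 'u) module_fctr \<Rightarrow> ('o \<Rightarrow> 'u set) \<Rightarrow> ('o, 'a, 'u) module_fctr"
  where "sub_presheaf F S = \<lparr>on_ob = (\<lambda>X. (on_ob F X)\<lparr>carrier := S X\<rparr>), on_ar = on_ar F\<rparr>"

lemma sub_presheaf_presheaf:
  assumes F: "additive_presheaf C F" and S: "\<And>X. X \<in> Ob C \<Longrightarrow> subgroup (S X) (on_ob F X)"
    and stable: "\<And>X Y f y. f \<in> Hom C X Y \<Longrightarrow> y \<in> S Y \<Longrightarrow> on_ar F f y \<in> S X"
  shows "additive_presheaf C (sub_presheaf F S)"
proof -
  have sub: "x \<in> sec F X" if "X \<in> Ob C" "x \<in> S X" for X x using subgroup.subset[OF S] that by blast
  have "comm_group ((on_ob F X)\<lparr>carrier := S X\<rparr>)" if X: "X \<in> Ob C" for X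
    by (rule comm_subgroup[OF presheaf_group[OF F X] S[OF X]])
  moreover have "small (S X)" if X: "X \<in> Ob C" for X
    using small_in_subset presheaf_small[OF F X] subgroup.subset[OF S[OF X]] unfolding small_iff_small_in by blast
  ultimately show ?thesis
    unfolding additive_presheaf_def sub_presheaf_def
    using stable sub Hom_ob presheaf_Ide[OF F] presheaf_Comp[OF F] presheaf_hadd[OF F] presheaf_mult[OF F]
    by (auto simp: hom_def)
qed

end


subsection \<open>Character duals\<close>

text \<open>The covariant counterpart of \<open>additive_presheaf\<close>: composing a presheaf with
  the contravariant duality yields such a functor on the other category.\<close>

definition covariant_module :: "('o, 'a, 'z) ab_category_scheme \<Rightarrow> ('o, 'a, 'u) module_fctr \<Rightarrow> bool"
  where "covariant_module C E \<longleftrightarrow>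
    (\<forall>X \<in> Ob C. comm_group (on_ob E X) \<and> small (sec E X)) \<and>
    (\<forall>X Y. \<forall>f \<in> Hom C X Y. on_ar E f \<in> hom (on_ob E X) (on_ob E Y)) \<and>
    (\<forall>X \<in> Ob C. \<forall>x \<in> sec E X. on_ar E (Ide C X) x = x) \<and>
    (\<forall>X Y Z. \<forall>f \<in> Hom C X Y. \<forall>g \<in> Hom C Y Z. \<forall>x \<in> sec E X.
      on_ar E (g \<star>\<^bsub>C\<^esub> f) x = on_ar E g (on_ar E f x)) \<and>
    (\<forall>X Y. \<forall>f \<in> Hom C X Y. \<forall>g \<in> Hom C X Y. \<forall>x \<in> sec E X.
      on_ar E (hadd C f g) x = on_ar E f x \<otimes>\<^bsub>on_ob E Y\<^esub> on_ar E g x)"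

lemma
  assumes "covariant_module C E"
  shows covariant_group: "X \<in> Ob C \<Longrightarrow> comm_group (on_ob E X)"
    and covariant_small: "X \<in> Ob C \<Longrightarrow> small (sec E X)"
    and covariant_hom: "f \<in> Hom C X Y \<Longrightarrow> on_ar E f \<in> hom (on_ob E X) (on_ob E Y)"
    and covariant_Ide: "X \<in> Ob C \<Longrightarrow> x \<in> sec E X \<Longrightarrow> on_ar E (Ide C X) x = x"
    and covariant_Comp: "f \<in> Hom C X Y \<Longrightarrow> g \<in> Hom C Y Z \<Longrightarrow> x \<in> sec E X \<Longrightarrow>
      on_ar E (g \<star>\<^bsub>C\<^esub> f) x = on_ar E g (on_ar E f x)"
    and covariant_hadd: "f \<in> Hom C X Y \<Longrightarrow> g \<in> Hom C X Y \<Longrightarrow> x \<in> sec E X \<Longrightarrow>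
      on_ar E (hadd C f g) x = on_ar E f x \<otimes>\<^bsub>on_ob E Y\<^esub> on_ar E g x"
  using assms unfolding covariant_module_def by blast+

lemma covariant_group': "covariant_module C E \<Longrightarrow> X \<in> Ob C \<Longrightarrow> group (on_ob E X)"
  by (rule comm_group.axioms(2)[OF covariant_group])

lemma covariant_closed:
  "covariant_module C E \<Longrightarrow> f \<in> Hom C X Y \<Longrightarrow> x \<in> sec E X \<Longrightarrow> on_ar E f x \<in> sec E Y"
  using covariant_hom[of C E f X Y] by (auto simp: hom_def)

lemma covariant_mult:
  "covariant_module C E \<Longrightarrow> f \<in> Hom C X Y \<Longrightarrow> x \<in> sec E X \<Longrightarrow> y \<in> sec E X \<Longrightarrow>
    on_ar E f (x \<otimes>\<^bsub>on_ob E X\<^esub> y) = on_ar E f x \<otimes>\<^bsub>on_ob E Y\<^esub> on_ar E f y"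
  using covariant_hom[of C E f X Y] by (auto simp: hom_def)

definition after :: "('o, 'a, 'u) module_fctr \<Rightarrow> ('p, 'b, 'o, 'a) fctr \<Rightarrow> ('p, 'b, 'u) module_fctr"
  where "after F D = \<lparr>on_ob = (\<lambda>X. on_ob F (on_ob D X)), on_ar = (\<lambda>f. on_ar F (on_ar D f))\<rparr>"

text \<open>An identity takes the place of the duality. Since the dual of \<open>F\<close> is the
  character dual of \<open>after F D\<close>, characters can be studied on a single category before
  the duality enters.\<close>

abbreviation char_dual :: "('p, 'b, 'z) ab_category_scheme \<Rightarrow> ('p, 'b, 'u) module_fctr \<Rightarrow> ('p, 'b, 'u) module_fctr"
  where "char_dual B E \<equiv> dual_presheaf B \<lparr>on_ob = (\<lambda>X. X), on_ar = (\<lambda>f. f)\<rparr> E"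

lemma dual_presheaf_eq: "dual_presheaf B D F = char_dual B (after F D)"
  by (simp add: dual_presheaf_def after_def)

lemma on_ob_char_dual:
  "on_ob (char_dual B E) X = image_group (encode (on_ob E X)) (character_group (on_ob E X))"
  by (simp add: dual_presheaf_def)

definition pull :: "('p, 'b, 'z) ab_category_scheme \<Rightarrow> ('p, 'b, 'u) module_fctr \<Rightarrow> 'b \<Rightarrow> ('u \<Rightarrow> rat set) \<Rightarrow> ('u \<Rightarrow> rat set)"
  where "pull B E f \<chi> = (\<lambda>x\<in>sec E (Dom B f). \<chi> (on_ar E f x))"

lemma pull_apply:
  "f \<in> Hom B X Y \<Longrightarrow> x \<in> sec E X \<Longrightarrow> pull B E f \<chi> x = \<chi> (on_ar E f x)" by (auto simp: pull_def Hom_def)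

lemma pull_closed:
  assumes E: "covariant_module B E" and cat: "category B" and f: "f \<in> Hom B X Y"
    and \<chi>: "\<chi> \<in> chars (on_ob E Y)"
  shows "pull B E f \<chi> \<in> chars (on_ob E X)"
proof -
  have "(\<lambda>x. \<chi> (on_ar E f x)) \<in> hom (on_ob E X) QZ"
    using covariant_closed[OF E f] covariant_mult[OF E f] character_closed[OF \<chi>] character_mult[OF \<chi>]
    by (auto simp: hom_def)
  then show ?thesis
    using restrict_character[OF covariant_group'[OF E], of X] category.Hom_ob[OF cat f] f by (auto simp: pull_def Hom_def)
qed

context
  fixes B :: "('p, 'b, 'z) ab_category_scheme" and E :: "('p, 'b, 'u) module_fctr"
  assumes universe: "inaccessible_universe TYPE('u)" and B: "additive_category B" and E: "covariant_module B E"
begin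

interpretation B: additive_category B
  by (rule B)

lemma encode_inj: "X \<in> Ob B \<Longrightarrow> inj_on (encode (on_ob E X)) (chars (on_ob E X))"
  by (rule inj_on_encode[OF universe covariant_small[OF E]])

lemma encode_decode: "X \<in> Ob B \<Longrightarrow> \<chi> \<in> chars (on_ob E X) \<Longrightarrow>
    decode (on_ob E X) (encode (on_ob E X) \<chi>) = \<chi>"
  by (rule decode_encode[OF universe covariant_small[OF E]])

lemma carrier_char_dual:
  "sec (char_dual B E) X = encode (on_ob E X) ` chars (on_ob E X)" by (simp add: on_ob_char_dual carrier_image_group)

lemma char_dual_cases:
  assumes "u \<in> sec (char_dual B E) X"
  obtains \<chi> where "\<chi> \<in> chars (on_ob E X)" "u = encode (on_ob E X) \<chi>" using assms unfolding carrier_char_dual by blast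

lemma mult_char_dual:
  "X \<in> Ob B \<Longrightarrow> \<chi> \<in> chars (on_ob E X) \<Longrightarrow> \<psi> \<in> chars (on_ob E X) \<Longrightarrow>
    encode (on_ob E X) \<chi> \<otimes>\<^bsub>on_ob (char_dual B E) X\<^esub> encode (on_ob E X) \<psi> =
    encode (on_ob E X) (\<chi> \<otimes>\<^bsub>character_group (on_ob E X)\<^esub> \<psi>)"
  unfolding on_ob_char_dual by (rule mult_image_group[OF encode_inj])

lemma one_char_dual:
  "\<one>\<^bsub>on_ob (char_dual B E) X\<^esub> = encode (on_ob E X) \<one>\<^bsub>character_group (on_ob E X)\<^esub>"
  by (simp add: on_ob_char_dual image_group_def)

lemma on_ar_char_dual:
  assumes f: "f \<in> Hom B X Y" and \<chi>: "\<chi> \<in> chars (on_ob E Y)"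
  shows "on_ar (char_dual B E) f (encode (on_ob E Y) \<chi>) = encode (on_ob E X) (pull B E f \<chi>)"
  using encode_decode[OF B.Hom_ob(2)[OF f] \<chi>] f by (simp add: dual_presheaf_def pull_def Hom_def Let_def)

lemma char_dual_presheaf: "additive_presheaf B (char_dual B E)"
  unfolding additive_presheaf_def
proof (intro conjI ballI allI)
  fix X assume X: "X \<in> Ob B"
  show "comm_group (on_ob (char_dual B E) X)"
    unfolding on_ob_char_dual
    by (rule comm_group_image_group[OF comm_group_character_group[OF covariant_group[OF E X]] encode_inj[OF X]])
  show "small (sec (char_dual B E) X)"
    using small_in_image[OF small_character_group[OF universe]] covariant_small[OF E X]
    unfolding small_iff_small_in carrier_char_dual by blast
  fix u assume "u \<in> sec (char_dual B E) X"
  then obtain \<chi> where \<chi>: "\<chi> \<in> chars (on_ob E X)" "u = encode (on_ob E X) \<chi>" by (rule char_dual_cases)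
  have "pull B E (Ide B X) \<chi> = \<chi>"
    by (rule character_eqI[OF pull_closed[OF E B.category_axioms B.Ide_closed[OF X] \<chi>(1)] \<chi>(1)])
      (simp add: pull_apply[OF B.Ide_closed[OF X]] covariant_Ide[OF E X])
  then show "on_ar (char_dual B E) (Ide B X) u = u" using on_ar_char_dual[OF B.Ide_closed[OF X] \<chi>(1)] \<chi>(2) by simp
next
  fix X Y f assume f: "f \<in> Hom B X Y"
  note XY = B.Hom_ob[OF f]
  note p = pull_closed[OF E B.category_axioms f]
  show "on_ar (char_dual B E) f \<in> hom (on_ob (char_dual B E) Y) (on_ob (char_dual B E) X)"
  proof (rule homI)
    fix u assume "u \<in> sec (char_dual B E) Y"
    then obtain \<chi> where \<chi>: "\<chi> \<in> chars (on_ob E Y)" "u = encode (on_ob E Y) \<chi>" by (rule char_dual_cases)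
    show "on_ar (char_dual B E) f u \<in> sec (char_dual B E) X"
      using on_ar_char_dual[OF f \<chi>(1)] \<chi>(2) p[OF \<chi>(1)] by (simp add: carrier_char_dual)
    fix v assume "v \<in> sec (char_dual B E) Y"
    then obtain \<psi> where \<psi>: "\<psi> \<in> chars (on_ob E Y)" "v = encode (on_ob E Y) \<psi>" by (rule char_dual_cases)
    interpret CY: comm_group "character_group (on_ob E Y)"
      by (rule comm_group_character_group[OF covariant_group[OF E XY(2)]])
    interpret CX: comm_group "character_group (on_ob E X)"
      by (rule comm_group_character_group[OF covariant_group[OF E XY(1)]])
    note m = CY.m_closed[OF \<chi>(1) \<psi>(1)]
    have "pull B E f (\<chi> \<otimes>\<^bsub>character_group (on_ob E Y)\<^esub> \<psi>) =
        pull B E f \<chi> \<otimes>\<^bsub>character_group (on_ob E X)\<^esub> pull B E f \<psi>"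
      by (rule character_eqI[OF p[OF m] CX.m_closed[OF p[OF \<chi>(1)] p[OF \<psi>(1)]]])
        (use covariant_closed[OF E f] in \<open>simp add: pull_apply[OF f] mult_character_group\<close>)
    then show "on_ar (char_dual B E) f (u \<otimes>\<^bsub>on_ob (char_dual B E) Y\<^esub> v) =
        on_ar (char_dual B E) f u \<otimes>\<^bsub>on_ob (char_dual B E) X\<^esub> on_ar (char_dual B E) f v"
      using \<chi> \<psi> mult_char_dual[OF XY(2)] mult_char_dual[OF XY(1)] p on_ar_char_dual[OF f] m by simp
  qed
next
  fix X Y Z f g u assume f: "f \<in> Hom B X Y" and g: "g \<in> Hom B Y Z" and u: "u \<in> sec (char_dual B E) Z"
  obtain \<chi> where \<chi>: "\<chi> \<in> chars (on_ob E Z)" "u = encode (on_ob E Z) \<chi>" using u by (rule char_dual_cases)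
  note gf = B.Comp_closed[OF f g]
  note pg = pull_closed[OF E B.category_axioms g \<chi>(1)]
  have "pull B E (g \<star>\<^bsub>B\<^esub> f) \<chi> = pull B E f (pull B E g \<chi>)"
    by (rule character_eqI[OF pull_closed[OF E B.category_axioms gf \<chi>(1)] pull_closed[OF E B.category_axioms f pg]])
      (use covariant_closed[OF E f] covariant_Comp[OF E f g] in \<open>simp add: pull_apply[OF f] pull_apply[OF g] pull_apply[OF gf]\<close>)
  then show "on_ar (char_dual B E) (g \<star>\<^bsub>B\<^esub> f) u = on_ar (char_dual B E) f (on_ar (char_dual B E) g u)"
    using \<chi> on_ar_char_dual[OF gf] on_ar_char_dual[OF g] on_ar_char_dual[OF f] pg by simp
next
  fix X Y f g u assume f: "f \<in> Hom B X Y" and g: "g \<in> Hom B X Y" and u: "u \<in> sec (char_dual B E) Y"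
  obtain \<chi> where \<chi>: "\<chi> \<in> chars (on_ob E Y)" "u = encode (on_ob E Y) \<chi>" using u by (rule char_dual_cases)
  note fg = B.hadd_closed[OF f g] and X = B.Hom_ob(1)[OF f]
  note p = pull_closed[OF E B.category_axioms _ \<chi>(1)]
  interpret CX: comm_group "character_group (on_ob E X)" by (rule comm_group_character_group[OF covariant_group[OF E X]])
  have "pull B E (hadd B f g) \<chi> = pull B E f \<chi> \<otimes>\<^bsub>character_group (on_ob E X)\<^esub> pull B E g \<chi>"
    by (rule character_eqI[OF p[OF fg] CX.m_closed[OF p[OF f] p[OF g]]])
      (use covariant_closed[OF E f] covariant_closed[OF E g] covariant_hadd[OF E f g] character_mult[OF \<chi>(1)]
        in \<open>simp add: pull_apply[OF f] pull_apply[OF g] pull_apply[OF fg] mult_character_group\<close>)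
  then show "on_ar (char_dual B E) (hadd B f g) u =
      on_ar (char_dual B E) f u \<otimes>\<^bsub>on_ob (char_dual B E) X\<^esub> on_ar (char_dual B E) g u"
    using \<chi> mult_char_dual[OF X p[OF f] p[OF g]] on_ar_char_dual[OF fg] on_ar_char_dual[OF f] on_ar_char_dual[OF g] by simp
qed

end

section \<open>Definability of classes of flat presheaves\<close>

text \<open>The equational criterion of flatness; relations between several elements reduce to single
  arrows because there are biproducts.\<close>

definition flat_presheaf :: "('o, 'a, 'z) ab_category_scheme \<Rightarrow> ('o, 'a, 'u) module_fctr \<Rightarrow> bool"
  where "flat_presheaf C F \<longleftrightarrow> (\<forall>X Y. \<forall>f\<in>Hom C X Y. \<forall>y\<in>sec F Y. on_ar F f y = \<one>\<^bsub>on_ob F X\<^esub> \<longrightarrow>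
    (\<exists>Z. \<exists>g\<in>Hom C Y Z. \<exists>z\<in>sec F Z. g \<star>\<^bsub>C\<^esub> f = hzero C X Z \<and> on_ar F g z = y))"

text \<open>In the application \<open>\<Psi>\<close> is the image under the duality of the arrows
  that define a class of objects. Injectivity is phrased through the kernel so that, like flatness,
  it starts from one vanishing relation on one element.\<close>

definition flat_injective :: "('o, 'a, 'z) ab_category_scheme \<Rightarrow> 'a set \<Rightarrow> ('o, 'a, 'u) module_fctr set"
  where "flat_injective C \<Psi> = {F. additive_presheaf C F \<and> flat_presheaf C F \<and>
    (\<forall>f\<in>\<Psi>. \<forall>y\<in>sec F (Cod C f). on_ar F f y = \<one>\<^bsub>on_ob F (Dom C f)\<^esub> \<longrightarrow> y = \<one>\<^bsub>on_ob F (Cod C f)\<^esub>)}"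

text \<open>What cones provide in the category of compact objects: every arrow is the first, and also the second,
  map of a sequence that is exact under all \<open>Hom\<close> functors, covariant and contravariant.\<close>

locale exact_sequences_category = additive_category C
  for C :: "('o, 'u, 'z) ab_category_scheme" (structure) +
  assumes universe: "inaccessible_universe TYPE('u)"
    and small_homs: "X \<in> Ob C \<Longrightarrow> Y \<in> Ob C \<Longrightarrow> small (Hom C X Y)"
    and right_sequence: "f \<in> Hom C X Y \<Longrightarrow> \<exists>Z. \<exists>g\<in>Hom C Y Z. g \<star> f = hzero C X Z \<and>
      (\<forall>V. \<forall>l\<in>Hom C Y V. l \<star> f = hzero C X V \<longrightarrow> (\<exists>l'\<in>Hom C Z V. l' \<star> g = l)) \<and>
      (\<forall>W. \<forall>k\<in>Hom C W Y. g \<star> k = hzero C W Z \<longrightarrow> (\<exists>k'\<in>Hom C W X. f \<star> k' = k))"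
    and left_sequence: "f \<in> Hom C X Y \<Longrightarrow> \<exists>W. \<exists>h\<in>Hom C W X. f \<star> h = hzero C W Y \<and>
      (\<forall>V. \<forall>l\<in>Hom C X V. l \<star> h = hzero C W V \<longrightarrow> (\<exists>l'\<in>Hom C Y V. l' \<star> f = l)) \<and>
      (\<forall>V. \<forall>k\<in>Hom C V X. f \<star> k = hzero C V Y \<longrightarrow> (\<exists>k'\<in>Hom C V W. h \<star> k' = k))"
begin

abbreviation comp_Mod (infixl \<open>\<bullet>\<close> 70)
  where "n \<bullet> m \<equiv> n \<star>\<^bsub>ModCat C\<^esub> m"

lemma right_seq:
  assumes "f \<in> Hom C X Y"
  obtains Z g where "g \<in> Hom C Y Z" "g \<star> f = hzero C X Z"
    "\<And>V l. l \<in> Hom C Y V \<Longrightarrow> l \<star> f = hzero C X V \<Longrightarrow> \<exists>l'\<in>Hom C Z V. l' \<star> g = l"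
    "\<And>W k. k \<in> Hom C W Y \<Longrightarrow> g \<star> k = hzero C W Z \<Longrightarrow> \<exists>k'\<in>Hom C W X. f \<star> k' = k" using right_sequence[OF assms] by metis

lemma left_seq:
  assumes "f \<in> Hom C X Y"
  obtains W h where "h \<in> Hom C W X" "f \<star> h = hzero C W Y"
    "\<And>V l. l \<in> Hom C X V \<Longrightarrow> l \<star> h = hzero C W V \<Longrightarrow> \<exists>l'\<in>Hom C Y V. l' \<star> f = l"
    "\<And>V k. k \<in> Hom C V X \<Longrightarrow> f \<star> k = hzero C V Y \<Longrightarrow> \<exists>k'\<in>Hom C V W. h \<star> k' = k" using left_sequence[OF assms] by metis

lemma representable_presheaf: "X \<in> Ob C \<Longrightarrow> additive_presheaf C (hom_presheaf C X)"
  by (rule hom_presheaf_presheaf) (auto intro: small_homs)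

lemma flat_presheafI:
  assumes "\<And>X Y f y. f \<in> Hom C X Y \<Longrightarrow> y \<in> sec F Y \<Longrightarrow> on_ar F f y = \<one>\<^bsub>on_ob F X\<^esub> \<Longrightarrow>
    \<exists>Z. \<exists>g\<in>Hom C Y Z. \<exists>z\<in>sec F Z. g \<star> f = hzero C X Z \<and> on_ar F g z = y"
  shows "flat_presheaf C F"
  using assms unfolding flat_presheaf_def by blast

lemma flat_presheafE:
  assumes "flat_presheaf C F" "f \<in> Hom C X Y" "y \<in> sec F Y" "on_ar F f y = \<one>\<^bsub>on_ob F X\<^esub>"
  obtains Z g z where "g \<in> Hom C Y Z" "z \<in> sec F Z" "g \<star> f = hzero C X Z" "on_ar F g z = y"
  using assms unfolding flat_presheaf_def by blast

text \<open>In the definition of flatness the witness depends on the element. If every arrow killing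
  \<open>f\<close> factors through \<open>g\<close>, then \<open>g\<close> serves all elements at
  once, in every flat presheaf.\<close>

lemma flat_presheaf_lift:
  assumes F: "additive_presheaf C F" "flat_presheaf C F" and f: "f \<in> Hom C X Y" and g: "g \<in> Hom C Y Z"
    and weak: "\<And>V l. l \<in> Hom C Y V \<Longrightarrow> l \<star> f = hzero C X V \<Longrightarrow> \<exists>l'\<in>Hom C Z V. l' \<star> g = l"
    and y: "y \<in> sec F Y" "on_ar F f y = \<one>\<^bsub>on_ob F X\<^esub>"
  shows "\<exists>z\<in>sec F Z. on_ar F g z = y"
proof -
  obtain V l v where l: "l \<in> Hom C Y V" "v \<in> sec F V" "l \<star> f = hzero C X V" "on_ar F l v = y"
    by (rule flat_presheafE[OF F(2) f y])
  obtain l' where l': "l' \<in> Hom C Z V" "l' \<star> g = l" using weak[OF l(1,3)] by blast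
  have "on_ar F g (on_ar F l' v) = y" using presheaf_Comp[OF F(1) g l'(1) l(2)] l'(2) l(4) by simp
  then show ?thesis using presheaf_closed[OF F(1) l'(1) l(2)] by blast
qed

lemma flat_injectiveI:
  assumes "additive_presheaf C F" "flat_presheaf C F"
    "\<And>f X Y y. f \<in> \<Psi> \<Longrightarrow> f \<in> Hom C X Y \<Longrightarrow> y \<in> sec F Y \<Longrightarrow> on_ar F f y = \<one>\<^bsub>on_ob F X\<^esub> \<Longrightarrow>
      y = \<one>\<^bsub>on_ob F Y\<^esub>" "\<Psi> \<subseteq> Arr C"
  shows "F \<in> flat_injective C \<Psi>"
  unfolding flat_injective_def
proof (intro CollectI conjI ballI impI)
  fix f y assume f: "f \<in> \<Psi>" and y: "y \<in> sec F (Cod C f)"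
    "on_ar F f y = \<one>\<^bsub>on_ob F (Dom C f)\<^esub>"
  have "f \<in> Hom C (Dom C f) (Cod C f)" using assms(4) f by (intro Arr_Hom) blast
  then show "y = \<one>\<^bsub>on_ob F (Cod C f)\<^esub>" by (rule assms(3)[OF f _ y])
qed (fact assms)+

lemma flat_injectiveD:
  assumes "F \<in> flat_injective C \<Psi>"
  shows "additive_presheaf C F" "flat_presheaf C F"
    "f \<in> \<Psi> \<Longrightarrow> f \<in> Hom C X Y \<Longrightarrow> y \<in> sec F Y \<Longrightarrow> on_ar F f y = \<one>\<^bsub>on_ob F X\<^esub> \<Longrightarrow>
      y = \<one>\<^bsub>on_ob F Y\<^esub>"
  using assms unfolding flat_injective_def by (auto simp: Hom_def)


subsection \<open>Direct limits\<close>

context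
  fixes I :: "'i set" and r and F :: "'i \<Rightarrow> ('o, 'u, 'u) module_fctr" and \<phi> and L and \<mu>
  assumes lim: "is_direct_limit (ModCat C) I r F \<phi> L \<mu>"
begin

lemma
  shows lim_nonempty: "I \<noteq> {}"
    and lim_order: "refl_on I r" "trans r"
    and lim_upper: "i \<in> I \<Longrightarrow> j \<in> I \<Longrightarrow> \<exists>k\<in>I. (i, k) \<in> r \<and> (j, k) \<in> r"
    and lim_maps: "(i, j) \<in> r \<Longrightarrow> \<phi> i j \<in> Hom (ModCat C) (F i) (F j)"
    and lim_comp: "(i, j) \<in> r \<Longrightarrow> (j, k) \<in> r \<Longrightarrow> \<phi> j k \<bullet> \<phi> i j = \<phi> i k"
    and lim_legs: "i \<in> I \<Longrightarrow> \<mu> i \<in> Hom (ModCat C) (F i) L"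
    and lim_cocone: "(i, j) \<in> r \<Longrightarrow> \<mu> j \<bullet> \<phi> i j = \<mu> i"
    and lim_sub: "r \<subseteq> I \<times> I"
  using lim unfolding is_direct_limit_def direct_system_def directed_index_def partial_order_on_def preorder_on_def
  by (auto simp: refl_on_def)

lemma lim_desc:
  assumes "additive_presheaf C G" "\<And>i. i \<in> I \<Longrightarrow> f i \<in> Hom (ModCat C) (F i) G"
    "\<And>i j. (i, j) \<in> r \<Longrightarrow> f j \<bullet> \<phi> i j = f i"
  shows "\<exists>!u. u \<in> Hom (ModCat C) L G \<and> (\<forall>i \<in> I. u \<bullet> \<mu> i = f i)"
  using lim assms unfolding is_direct_limit_def by simp

lemma lim_in: "(i, j) \<in> r \<Longrightarrow> i \<in> I \<and> j \<in> I"
  using lim_sub by blast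

lemma lim_presheaf: "additive_presheaf C L" "i \<in> I \<Longrightarrow> additive_presheaf C (F i)"
  using lim_nonempty lim_legs Hom_ModCat_presheaf by blast+

lemma lim_cocone_component:
  assumes "(i, j) \<in> r" "X \<in> Ob C" "x \<in> sec (F i) X"
  shows "component (\<mu> j) X (component (\<phi> i j) X x) = component (\<mu> i) X x"
  using component_Comp[OF lim_maps[OF assms(1)] lim_legs assms(2,3)] lim_in[OF assms(1)] lim_cocone[OF assms(1)] by simp

text \<open>The images of the legs form a sub-presheaf, closed under the group operation by
  directedness, and the cocone factors through it. Uniqueness of arrows out of \<open>L\<close>
  shows that the induced map followed by the inclusion is the identity, so the sub-presheaf is all
  of \<open>L\<close>.\<close>

lemma lim_surj:
  assumes X: "X \<in> Ob C" and l: "l \<in> sec L X"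
  shows "\<exists>i\<in>I. \<exists>x\<in>sec (F i) X. component (\<mu> i) X x = l"
proof -
  define S where "S = (\<lambda>X. {component (\<mu> i) X x | i x. i \<in> I \<and> x \<in> sec (F i) X})"
  have \<mu>: "natural C (F i) L (component (\<mu> i))" if "i \<in> I" for i
    using Hom_ModCat_natural[OF lim_legs[OF that]] .
  have S1: "S X \<subseteq> sec L X" if "X \<in> Ob C" for X unfolding S_def using natural_closed[OF \<mu> that] by auto
  have S2: "subgroup (S X) (on_ob L X)" if X: "X \<in> Ob C" for X
  proof -
    interpret LX: group "on_ob L X" by (rule presheaf_group'[OF lim_presheaf(1) X])
    show ?thesis
    proof (rule LX.subgroupI)
      show "S X \<subseteq> sec L X" by (rule S1[OF X])
      obtain i where i: "i \<in> I" using lim_nonempty by blast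
      show "S X \<noteq> {}" unfolding S_def using i presheaf_one_closed[OF lim_presheaf(2)[OF i] X] by auto
    next
      fix a assume "a \<in> S X"
      then obtain i x where i: "i \<in> I" "x \<in> sec (F i) X" "a = component (\<mu> i) X x" by (auto simp: S_def)
      interpret FX: group "on_ob (F i) X" by (rule presheaf_group'[OF lim_presheaf(2)[OF i(1)] X])
      interpret h: group_hom "on_ob (F i) X" "on_ob L X" "component (\<mu> i) X"
        using natural_hom[OF \<mu>[OF i(1)] X] by unfold_locales
      have "inv\<^bsub>on_ob L X\<^esub> a = component (\<mu> i) X (inv\<^bsub>on_ob (F i) X\<^esub> x)" using i h.hom_inv by simp
      then show "inv\<^bsub>on_ob L X\<^esub> a \<in> S X" unfolding S_def using i FX.inv_closed by blast
    next
      fix a b assume "a \<in> S X" "b \<in> S X"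
      then obtain i x j y where i: "i \<in> I" "x \<in> sec (F i) X" "a = component (\<mu> i) X x"
        and j: "j \<in> I" "y \<in> sec (F j) X" "b = component (\<mu> j) X y"
        by (auto simp: S_def)
      obtain k where k: "k \<in> I" "(i, k) \<in> r" "(j, k) \<in> r" using lim_upper[OF i(1) j(1)] by blast
      let ?x = "component (\<phi> i k) X x" and ?y = "component (\<phi> j k) X y"
      have xy: "?x \<in> sec (F k) X" "?y \<in> sec (F k) X"
        using natural_closed[OF Hom_ModCat_natural[OF lim_maps] X] k i j by blast+
      have "a \<otimes>\<^bsub>on_ob L X\<^esub> b = component (\<mu> k) X (?x \<otimes>\<^bsub>on_ob (F k) X\<^esub> ?y)"
        using natural_mult[OF \<mu>[OF k(1)] X xy] lim_cocone_component[OF k(2) X i(2)] lim_cocone_component[OF k(3) X j(2)] i j by simp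
      moreover have "?x \<otimes>\<^bsub>on_ob (F k) X\<^esub> ?y \<in> sec (F k) X"
        using monoid.m_closed[OF group.is_monoid[OF presheaf_group'[OF lim_presheaf(2)[OF k(1)] X]] xy] .
      ultimately show "a \<otimes>\<^bsub>on_ob L X\<^esub> b \<in> S X" unfolding S_def using k(1) by blast
    qed
  qed
  have S3: "on_ar L f y \<in> S X" if f: "f \<in> Hom C X Y" and y: "y \<in> S Y" for X Y f y
  proof -
    obtain i x where i: "i \<in> I" "x \<in> sec (F i) Y" "y = component (\<mu> i) Y x" using y by (auto simp: S_def)
    have "on_ar L f y = component (\<mu> i) X (on_ar (F i) f x)" using natural_eq[OF \<mu>[OF i(1)] f i(2)] i(3) by simp
    then show ?thesis unfolding S_def using i(1) presheaf_closed[OF lim_presheaf(2)[OF i(1)] f i(2)] by blast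
  qed
  let ?L = "sub_presheaf L S"
  have L': "additive_presheaf C ?L" by (rule sub_presheaf_presheaf[OF lim_presheaf(1) S2 S3])
  have f: "natural C (F i) ?L (component (\<mu> i))" if "i \<in> I" for i
    by (rule naturalI) (use natural_eq[OF \<mu>[OF that]] natural_mult[OF \<mu>[OF that]] that in \<open>auto simp: sub_presheaf_def S_def\<close>)
  let ?f = "\<lambda>i. mod_arrow C (F i) ?L (component (\<mu> i))"
  have f': "?f i \<in> Hom (ModCat C) (F i) ?L" if "i \<in> I" for i
    by (rule mod_arrow_Hom[OF category_axioms lim_presheaf(2)[OF that] L' f[OF that]])
  have "?f j \<bullet> \<phi> i j = ?f i" if ij: "(i, j) \<in> r" for i j
  proof (rule ModCat_ext[OF Comp_ModCat_closed[OF category_axioms lim_maps[OF ij] f']])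
    show "j \<in> I" "?f i \<in> Hom (ModCat C) (F i) ?L" using f' lim_in[OF ij] by auto
    fix X x assume X: "X \<in> Ob C" "x \<in> sec (F i) X"
    have "component (\<phi> i j) X x \<in> sec (F j) X"
      using natural_closed[OF Hom_ModCat_natural[OF lim_maps[OF ij]] X] .
    then show "component (?f j \<bullet> \<phi> i j) X x = component (?f i) X x"
      using component_Comp[OF lim_maps[OF ij] f' X] lim_in[OF ij] lim_cocone_component[OF ij X] X by simp
  qed
  then obtain u where u: "u \<in> Hom (ModCat C) L ?L" "\<And>i. i \<in> I \<Longrightarrow> u \<bullet> \<mu> i = ?f i"
    using lim_desc[of ?L ?f, OF L' f'] by metis
  have inc: "natural C ?L L (\<lambda>X x. x)" by (rule naturalI) (use S1 in \<open>auto simp: sub_presheaf_def\<close>)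
  let ?inc = "mod_arrow C ?L L (\<lambda>X x. x)"
  have inc': "?inc \<in> Hom (ModCat C) ?L L" by (rule mod_arrow_Hom[OF category_axioms L' lim_presheaf(1) inc])
  have id: "Ide (ModCat C) L \<in> Hom (ModCat C) L L"
    using category.Ide_closed[OF category_ModCat[OF category_axioms]] lim_presheaf(1) by simp
  have iu: "?inc \<bullet> u \<in> Hom (ModCat C) L L" by (rule Comp_ModCat_closed[OF category_axioms u(1) inc'])
  have carL: "sec ?L X = S X" for X by (simp add: sub_presheaf_def)
  have uc: "component u X y \<in> S X" if "X \<in> Ob C" "y \<in> sec L X" for X y
    using natural_closed[OF Hom_ModCat_natural[OF u(1)] that] by (simp add: sub_presheaf_def)
  have "?inc \<bullet> u = Ide (ModCat C) L"
  proof -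
    have 1: "(?inc \<bullet> u) \<bullet> \<mu> i = \<mu> i" if i: "i \<in> I" for i
    proof (rule ModCat_ext[OF Comp_ModCat_closed[OF category_axioms lim_legs[OF i] iu] lim_legs[OF i]])
      fix X x assume X: "X \<in> Ob C" "x \<in> sec (F i) X"
      note \<mu>x = natural_closed[OF \<mu>[OF i] X]
      have "component ((?inc \<bullet> u) \<bullet> \<mu> i) X x = component ?inc X (component u X (component (\<mu> i) X x))"
        using component_Comp[OF lim_legs[OF i] iu X] component_Comp[OF u(1) inc' X(1) \<mu>x] by simp
      also have "\<dots> = component u X (component (\<mu> i) X x)" using uc[OF X(1) \<mu>x] X(1) by (simp add: carL)
      also have "\<dots> = component (?f i) X x" using component_Comp[OF lim_legs[OF i] u(1) X] u(2)[OF i] by simp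
      finally show "component ((?inc \<bullet> u) \<bullet> \<mu> i) X x = component (\<mu> i) X x" using X by simp
    qed
    have 2: "Ide (ModCat C) L \<bullet> \<mu> i = \<mu> i" if i: "i \<in> I" for i
      using category.Ide_Comp[OF category_ModCat[OF category_axioms] lim_legs[OF i]] .
    have "\<exists>!u. u \<in> Hom (ModCat C) L L \<and> (\<forall>i \<in> I. u \<bullet> \<mu> i = \<mu> i)"
      by (rule lim_desc[OF lim_presheaf(1) lim_legs lim_cocone])
    then obtain w where w: "\<And>v. v \<in> Hom (ModCat C) L L \<Longrightarrow> (\<forall>i \<in> I. v \<bullet> \<mu> i = \<mu> i) \<Longrightarrow> v = w" by (elim ex1E) blast
    show ?thesis using w[OF iu] w[OF id] 1 2 by metis
  qed
  then have "component ?inc X (component u X l) = l" using component_Comp[OF u(1) inc' X l] X l by (simp add: Ide_ModCat)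
  then have "l \<in> S X" using uc[OF X l] X by (simp add: carL)
  then show ?thesis by (auto simp: S_def)
qed

end

text \<open>The coinduced presheaf at an object \<open>X\<close>: maps into it are characters of the value at \<open>X\<close>.\<close>

definition corepresented :: "'o \<Rightarrow> ('o, 'u, 'u) module_fctr"
  where "corepresented X = \<lparr>on_ob = (\<lambda>Y. hom_group C X Y), on_ar = (\<lambda>f h. f \<star> h)\<rparr>"

lemma corepresented_covariant: "X \<in> Ob C \<Longrightarrow> covariant_module C (corepresented X)"
  unfolding covariant_module_def corepresented_def
  using hom_group small_homs Comp_closed Comp_hadd_left Comp_hadd_right Comp_assoc Ide_Comp by (auto simp: hom_def)

text \<open>The adjunction between evaluation at \<open>X\<close> and coinduction: the character
  \<open>\<chi>\<close> becomes the map sending \<open>a\<close> to the character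
  \<open>h \<mapsto> \<chi> (on_ar F h a)\<close>, and it is recovered at the identity of
  \<open>X\<close>.\<close>

lemma coinduced_natural:
  assumes X: "X \<in> Ob C" and F: "additive_presheaf C F" and \<chi>: "\<chi> \<in> hom (on_ob F X) QZ"
  defines "t \<equiv> \<lambda>Y a. encode (hom_group C X Y) (\<lambda>h\<in>Hom C X Y. \<chi> (on_ar F h a))"
  shows "natural C F (char_dual C (corepresented X)) t"
    and "Y \<in> Ob C \<Longrightarrow> a \<in> sec F Y \<Longrightarrow>
      (\<lambda>h\<in>Hom C X Y. \<chi> (on_ar F h a)) \<in> chars (hom_group C X Y)"
proof -
  note E = corepresented_covariant[OF X]
  have ob: "on_ob (corepresented X) Y = hom_group C X Y" for Y by (simp add: corepresented_def)
  have \<chi>_mult: "\<chi> (a \<otimes>\<^bsub>on_ob F X\<^esub> b) = \<chi> a \<otimes>\<^bsub>QZ\<^esub> \<chi> b" if "a \<in> sec F X" "b \<in> sec F X" for a b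
    using \<chi> that by (simp add: hom_def)
  have \<chi>_closed: "\<chi> a \<in> carrier QZ" if "a \<in> sec F X" for a using \<chi> that by (auto simp: hom_def)
  have char: "(\<lambda>h\<in>Hom C X Y. \<chi> (on_ar F h a)) \<in> chars (hom_group C X Y)"
    if Y: "Y \<in> Ob C" and a: "a \<in> sec F Y" for Y a
  proof -
    have "(\<lambda>h. \<chi> (on_ar F h a)) \<in> hom (hom_group C X Y) QZ"
      using presheaf_closed[OF F _ a] presheaf_hadd[OF F _ _ a] \<chi>_mult \<chi>_closed by (auto simp: hom_def)
    then show ?thesis using restrict_character[OF comm_group.axioms(2)[OF hom_group[OF X Y]]] by simp
  qed
  then show "Y \<in> Ob C \<Longrightarrow> a \<in> sec F Y \<Longrightarrow>
      (\<lambda>h\<in>Hom C X Y. \<chi> (on_ar F h a)) \<in> chars (hom_group C X Y)"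
    by blast
  note cd = universe additive_category_axioms E
  show "natural C F (char_dual C (corepresented X)) t"
  proof (rule naturalI)
    fix Y a assume Y: "Y \<in> Ob C" and a: "a \<in> sec F Y"
    show "t Y a \<in> sec (char_dual C (corepresented X)) Y"
      using char[OF Y a] by (simp add: carrier_char_dual[OF cd] t_def ob)
    fix b assume b: "b \<in> sec F Y"
    have "(\<lambda>h\<in>Hom C X Y. \<chi> (on_ar F h (a \<otimes>\<^bsub>on_ob F Y\<^esub> b))) =
        (\<lambda>h\<in>Hom C X Y. \<chi> (on_ar F h a)) \<otimes>\<^bsub>character_group (hom_group C X Y)\<^esub> (\<lambda>h\<in>Hom C X Y. \<chi> (on_ar F h b))"
      using presheaf_mult[OF F _ a b] presheaf_closed[OF F _ a] presheaf_closed[OF F _ b] \<chi>_mult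
      by (auto simp: mult_character_group restrict_def fun_eq_iff)
    then show "t Y (a \<otimes>\<^bsub>on_ob F Y\<^esub> b) = t Y a \<otimes>\<^bsub>on_ob (char_dual C (corepresented X)) Y\<^esub> t Y b"
      using mult_char_dual[OF cd Y, of "\<lambda>h\<in>Hom C X Y. \<chi> (on_ar F h a)" "\<lambda>h\<in>Hom C X Y. \<chi> (on_ar F h b)"]
        char[OF Y a] char[OF Y b] by (simp add: t_def ob)
  next
    fix Y Z f a assume f: "f \<in> Hom C Y Z" and a: "a \<in> sec F Z"
    note YZ = Hom_ob[OF f]
    have "pull C (corepresented X) f (\<lambda>h\<in>Hom C X Z. \<chi> (on_ar F h a)) = (\<lambda>h\<in>Hom C X Y. \<chi> (on_ar F h (on_ar F f a)))"
      using f Comp_closed[OF _ f] presheaf_Comp[OF F _ f a]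
      by (auto simp: pull_def corepresented_def Hom_DomCod[OF f] restrict_def fun_eq_iff)
    then show "t Y (on_ar F f a) = on_ar (char_dual C (corepresented X)) f (t Z a)"
      using on_ar_char_dual[OF cd f, of "\<lambda>h\<in>Hom C X Z. \<chi> (on_ar F h a)"] char[OF YZ(2) a] by (simp add: t_def ob)
  qed
qed

text \<open>The colimit of the groups \<open>F i X\<close> is a subgroup of the reduced product, so characters of that
  group detect the elements that do not vanish eventually.\<close>

lemma lim_kernel:
  fixes I :: "'i set" and F :: "'i \<Rightarrow> ('o, 'u, 'u) module_fctr"
  assumes lim: "is_direct_limit (ModCat C) I r F \<phi> L \<mu>"
    and X: "X \<in> Ob C" and i: "i \<in> I" and x: "x \<in> sec (F i) X"
    and z: "component (\<mu> i) X x = \<one>\<^bsub>on_ob L X\<^esub>"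
  shows "\<exists>j. (i, j) \<in> r \<and> component (\<phi> i j) X x = \<one>\<^bsub>on_ob (F j) X\<^esub>"
proof (rule ccontr)
  assume nz: "\<nexists>j. (i, j) \<in> r \<and> component (\<phi> i j) X x = \<one>\<^bsub>on_ob (F j) X\<^esub>"
  note lim_upper = lim_upper[OF lim] and lim_maps = lim_maps[OF lim] and lim_in = lim_in[OF lim]
    and lim_presheaf = lim_presheaf[OF lim] and lim_comp = lim_comp[OF lim] and lim_legs = lim_legs[OF lim]
  have tr: "(a, c) \<in> r" if "(a, b) \<in> r" "(b, c) \<in> r" for a b c by (rule transD[OF lim_order(2)[OF lim] that])
  have grp: "comm_group (on_ob (F j) X)" if "j \<in> I" for j
    using presheaf_group[OF lim_presheaf(2)[OF that] X] .
  have grp': "group (on_ob (F j) X)" if "j \<in> I" for j by (rule comm_group.axioms(2)[OF grp[OF that]])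
  have \<phi>: "natural C (F j) (F k) (component (\<phi> j k))" if "(j, k) \<in> r" for j k
    using Hom_ModCat_natural[OF lim_maps[OF that]] .
  have \<phi>\<phi>: "component (\<phi> k l) X (component (\<phi> j k) X a) = component (\<phi> j l) X a"
    if "(j, k) \<in> r" "(k, l) \<in> r" "a \<in> sec (F j) X" for j k l a
    using component_Comp[OF lim_maps[OF that(1)] lim_maps[OF that(2)] X that(3)] lim_comp[OF that(1,2)] by simp
  \<comment> \<open>This product is only a source of characters and is never made into a presheaf,
    so its size does not matter.\<close>
  let ?P = "product_group I (\<lambda>j. on_ob (F j) X)"
  have P: "comm_group ?P"
  proof (rule group.group_comm_groupI)
    show "group ?P" using grp' by (rule product_group)
    fix p q assume "p \<in> carrier ?P" "q \<in> carrier ?P"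
    then show "p \<otimes>\<^bsub>?P\<^esub> q = q \<otimes>\<^bsub>?P\<^esub> p" using comm_groupE(4)[OF grp] by (auto simp: PiE_iff intro!: restrict_ext)
  qed
  interpret P: comm_group ?P by (rule P)
  \<comment> \<open>The families that are trivial beyond some index; modulo \<open>N\<close> only
    the eventual behaviour of a family counts.\<close>
  define N where "N = {p \<in> carrier ?P. \<exists>j\<in>I. \<forall>k. (j, k) \<in> r \<longrightarrow> p k = \<one>\<^bsub>on_ob (F k) X\<^esub>}"
  have N: "subgroup N ?P"
  proof (rule P.subgroupI)
    show "N \<subseteq> carrier ?P" by (auto simp: N_def)
    have "\<one>\<^bsub>?P\<^esub> \<in> N" unfolding N_def using i lim_in P.one_closed by auto
    then show "N \<noteq> {}" by blast
  next
    fix p assume "p \<in> N"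
    then obtain j where j: "p \<in> carrier ?P" "j \<in> I" "\<And>k. (j, k) \<in> r \<Longrightarrow> p k = \<one>\<^bsub>on_ob (F k) X\<^esub>" by (auto simp: N_def)
    have "(inv\<^bsub>?P\<^esub> p) k = \<one>\<^bsub>on_ob (F k) X\<^esub>" if k: "(j, k) \<in> r" for k
      using inv_product_group[of p I "\<lambda>j. on_ob (F j) X"] j grp' lim_in[OF k] monoid.inv_one[OF group.is_monoid[OF grp']] k by simp
    then show "inv\<^bsub>?P\<^esub> p \<in> N" using j P.inv_closed[OF j(1)] unfolding N_def by blast
  next
    fix p q assume "p \<in> N" "q \<in> N"
    then obtain j k where j: "p \<in> carrier ?P" "j \<in> I" "\<And>k. (j, k) \<in> r \<Longrightarrow> p k = \<one>\<^bsub>on_ob (F k) X\<^esub>"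
      and k: "q \<in> carrier ?P" "k \<in> I" "\<And>l. (k, l) \<in> r \<Longrightarrow> q l = \<one>\<^bsub>on_ob (F l) X\<^esub>"
      by (auto simp: N_def)
    obtain m where m: "m \<in> I" "(j, m) \<in> r" "(k, m) \<in> r" using lim_upper[OF j(2) k(2)] by blast
    have "(p \<otimes>\<^bsub>?P\<^esub> q) l = \<one>\<^bsub>on_ob (F l) X\<^esub>" if l: "(m, l) \<in> r" for l
      using j(3)[OF tr[OF m(2) l]] k(3)[OF tr[OF m(3) l]] lim_in[OF l] group.is_monoid[OF grp'] monoid.l_one monoid.one_closed
      by fastforce
    then show "p \<otimes>\<^bsub>?P\<^esub> q \<in> N" using m(1) P.m_closed[OF j(1) k(1)] unfolding N_def by blast
  qed
  \<comment> \<open>An element at stage \<open>j\<close> is spread over its images at later stages,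
    with units elsewhere. Modulo \<open>N\<close> this is compatible with the transition
    maps.\<close>
  define fam where "fam = (\<lambda>j a. \<lambda>k\<in>I. if (j, k) \<in> r then component (\<phi> j k) X a else \<one>\<^bsub>on_ob (F k) X\<^esub>)"
  have one: "\<one>\<^bsub>on_ob (F k) X\<^esub> \<in> sec (F k) X" if "k \<in> I" for k
    by (rule monoid.one_closed[OF group.is_monoid[OF grp'[OF that]]])
  have fam: "fam j a \<in> carrier ?P" if a: "a \<in> sec (F j) X" for j a
  proof -
    have "(if (j, k) \<in> r then component (\<phi> j k) X a else \<one>\<^bsub>on_ob (F k) X\<^esub>) \<in> sec (F k) X" if "k \<in> I" for k
      using natural_closed[OF \<phi> X a] one[OF that] by simp
    then show ?thesis by (simp add: fam_def)
  qed
  have fam_mult: "fam j (a \<otimes>\<^bsub>on_ob (F j) X\<^esub> b) = fam j a \<otimes>\<^bsub>?P\<^esub> fam j b"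
    if "a \<in> sec (F j) X" "b \<in> sec (F j) X" for j a b
    using natural_mult[OF \<phi> X] that group.is_monoid[OF grp'] monoid.l_one monoid.one_closed
    by (fastforce simp: fam_def intro!: restrict_ext)
  have "fam i x \<notin> N"
  proof
    assume "fam i x \<in> N"
    then obtain j where j: "j \<in> I" "\<And>k. (j, k) \<in> r \<Longrightarrow> fam i x k = \<one>\<^bsub>on_ob (F k) X\<^esub>" by (auto simp: N_def)
    obtain k where k: "k \<in> I" "(i, k) \<in> r" "(j, k) \<in> r" using lim_upper[OF i j(1)] by blast
    then show False using j(2)[OF k(3)] nz by (auto simp: fam_def)
  qed
  then obtain \<chi> where \<chi>: "\<chi> \<in> hom ?P QZ" "\<And>n. n \<in> N \<Longrightarrow> \<chi> n = \<one>\<^bsub>QZ\<^esub>"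
      "\<chi> (fam i x) \<noteq> \<one>\<^bsub>QZ\<^esub>" by (rule P.character_separates[OF N fam[OF x]]) blast
  \<comment> \<open>Since \<open>\<chi>\<close> is trivial on \<open>N\<close>, these characters are
    compatible with the transition maps. By coinduction they give a cocone that is nontrivial at
    \<open>x\<close>, although \<open>x\<close> vanishes in the limit.\<close>
  define \<psi> where "\<psi> = (\<lambda>j a. \<chi> (fam j a))"
  have \<psi>: "\<psi> j \<in> hom (on_ob (F j) X) QZ" for j
  proof (rule homI)
    fix a assume a: "a \<in> sec (F j) X"
    show "\<psi> j a \<in> carrier QZ" unfolding \<psi>_def by (rule hom_in_carrier[OF \<chi>(1) fam[OF a]])
    fix b assume b: "b \<in> sec (F j) X"
    show "\<psi> j (a \<otimes>\<^bsub>on_ob (F j) X\<^esub> b) = \<psi> j a \<otimes>\<^bsub>QZ\<^esub> \<psi> j b"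
      unfolding \<psi>_def fam_mult[OF a b] by (rule hom_mult[OF \<chi>(1) fam[OF a] fam[OF b]])
  qed
  have \<psi>\<phi>: "\<psi> k (component (\<phi> j k) X a) = \<psi> j a" if jk: "(j, k) \<in> r" and a: "a \<in> sec (F j) X" for j k a
  proof -
    have \<phi>a: "component (\<phi> j k) X a \<in> sec (F k) X"
      using natural_closed[OF \<phi>[OF jk] X a] .
    note f1 = fam[OF \<phi>a] and f2 = fam[OF a]
    have "fam k (component (\<phi> j k) X a) \<otimes>\<^bsub>?P\<^esub> inv\<^bsub>?P\<^esub> (fam j a) \<in> N"
    proof -
      have "(fam k (component (\<phi> j k) X a) \<otimes>\<^bsub>?P\<^esub> inv\<^bsub>?P\<^esub> (fam j a)) l = \<one>\<^bsub>on_ob (F l) X\<^esub>" if l: "(k, l) \<in> r" for l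
        using inv_product_group[of "fam j a" I "\<lambda>j. on_ob (F j) X"] f2 grp' lim_in[OF l] l tr[OF jk l] \<phi>\<phi>[OF jk l a]
          group.r_inv[OF grp'] natural_closed[OF \<phi>[OF tr[OF jk l]] X a] by (simp add: fam_def)
      then show ?thesis unfolding N_def using lim_in[OF jk] P.m_closed[OF f1 P.inv_closed[OF f2]] by blast
    qed
    then have "\<chi> (fam k (component (\<phi> j k) X a) \<otimes>\<^bsub>?P\<^esub> inv\<^bsub>?P\<^esub> (fam j a)) = \<one>\<^bsub>QZ\<^esub>" by (rule \<chi>(2))
    then have "\<chi> ((fam k (component (\<phi> j k) X a) \<otimes>\<^bsub>?P\<^esub> inv\<^bsub>?P\<^esub> (fam j a)) \<otimes>\<^bsub>?P\<^esub> fam j a) = \<chi> (fam j a)"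
      by (simp only: hom_mult[OF \<chi>(1) P.m_closed[OF f1 P.inv_closed[OF f2]] f2] QZ.l_one[OF hom_in_carrier[OF \<chi>(1) f2]])
    moreover have "(fam k (component (\<phi> j k) X a) \<otimes>\<^bsub>?P\<^esub> inv\<^bsub>?P\<^esub> (fam j a)) \<otimes>\<^bsub>?P\<^esub> fam j a = fam k (component (\<phi> j k) X a)"
      using P.m_assoc[OF f1 P.inv_closed[OF f2] f2] P.l_inv[OF f2] P.r_one[OF f1] by metis
    ultimately show ?thesis by (simp add: \<psi>_def)
  qed
  define t where "t = (\<lambda>j Y a. encode (hom_group C X Y) (\<lambda>h\<in>Hom C X Y. \<psi> j (on_ar (F j) h a)))"
  let ?Q = "char_dual C (corepresented X)"
  note cd = universe additive_category_axioms corepresented_covariant[OF X]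
  have Q: "additive_presheaf C ?Q" by (rule char_dual_presheaf[OF cd])
  have t: "natural C (F j) ?Q (t j)" if "j \<in> I" for j
    unfolding t_def by (rule coinduced_natural(1)[OF X lim_presheaf(2)[OF that] \<psi>])
  let ?f = "\<lambda>j. mod_arrow C (F j) ?Q (t j)"
  have f: "?f j \<in> Hom (ModCat C) (F j) ?Q" if "j \<in> I" for j
    by (rule mod_arrow_Hom[OF category_axioms lim_presheaf(2)[OF that] Q t[OF that]])
  have "?f k \<bullet> \<phi> j k = ?f j" if jk: "(j, k) \<in> r" for j k
  proof (rule ModCat_ext[OF Comp_ModCat_closed[OF category_axioms lim_maps[OF jk] f]])
    show "k \<in> I" "?f j \<in> Hom (ModCat C) (F j) ?Q" using f lim_in[OF jk] by auto
    fix Y a assume Y: "Y \<in> Ob C" "a \<in> sec (F j) Y"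
    have "component (\<phi> j k) Y a \<in> sec (F k) Y"
      using natural_closed[OF \<phi>[OF jk] Y] .
    moreover have "\<psi> k (on_ar (F k) h (component (\<phi> j k) Y a)) = \<psi> j (on_ar (F j) h a)" if h: "h \<in> Hom C X Y" for h
      using natural_eq[OF \<phi>[OF jk] h Y(2)] \<psi>\<phi>[OF jk presheaf_closed[OF lim_presheaf(2) h Y(2)]] lim_in[OF jk] by simp
    ultimately show "component (?f k \<bullet> \<phi> j k) Y a = component (?f j) Y a"
      using component_Comp[OF lim_maps[OF jk] f Y] lim_in[OF jk] Y by (simp add: t_def cong: restrict_cong)
  qed
  then obtain u where u: "u \<in> Hom (ModCat C) L ?Q" "\<And>j. j \<in> I \<Longrightarrow> u \<bullet> \<mu> j = ?f j"
    using lim_desc[OF lim, of ?Q ?f, OF Q f] by metis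
  have "t i X x = component u X (component (\<mu> i) X x)"
    using component_Comp[OF lim_legs[OF i] u(1) X x] u(2)[OF i] X x by simp
  then have "t i X x = \<one>\<^bsub>on_ob ?Q X\<^esub>" using z natural_one[OF Hom_ModCat_natural[OF u(1)] lim_presheaf(1) Q X] by simp
  then have "encode (hom_group C X X) (\<lambda>h\<in>Hom C X X. \<psi> i (on_ar (F i) h x)) =
      encode (hom_group C X X) \<one>\<^bsub>character_group (hom_group C X X)\<^esub>"
    using one_char_dual[OF cd, of X] by (simp add: t_def corepresented_def)
  moreover have "(\<lambda>h\<in>Hom C X X. \<psi> i (on_ar (F i) h x)) \<in> chars (hom_group C X X)"
    by (rule coinduced_natural(2)[OF X lim_presheaf(2)[OF i] \<psi> X x])
  moreover have "\<one>\<^bsub>character_group (hom_group C X X)\<^esub> \<in> chars (hom_group C X X)"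
    using comm_groupE(2)[OF comm_group_character_group[OF hom_group[OF X X]]] .
  ultimately have "(\<lambda>h\<in>Hom C X X. \<psi> i (on_ar (F i) h x)) = \<one>\<^bsub>character_group (hom_group C X X)\<^esub>"
    using inj_on_encode[OF universe, of "hom_group C X X"] small_homs[OF X X] by (simp add: inj_on_def)
  then have "(\<lambda>h\<in>Hom C X X. \<psi> i (on_ar (F i) h x)) (Ide C X) = \<one>\<^bsub>character_group (hom_group C X X)\<^esub> (Ide C X)" by simp
  then have "\<psi> i x = \<one>\<^bsub>QZ\<^esub>"
    using Ide_closed[OF X] presheaf_Ide[OF lim_presheaf(2)[OF i] X x] by (simp add: one_character_group)
  then show False using \<chi>(3) by (simp add: \<psi>_def)
qed

text \<open>Flatness and injectivity both start from one vanishing relation on one element, and such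
  a relation in the limit already holds at some stage.\<close>

theorem flat_injective_direct_limit:
  fixes I :: "'i set" and F :: "'i \<Rightarrow> ('o, 'u, 'u) module_fctr"
  assumes lim: "is_direct_limit (ModCat C) I r F \<phi> L \<mu>"
    and F: "\<And>i. i \<in> I \<Longrightarrow> F i \<in> flat_injective C \<Psi>" and \<Psi>: "\<Psi> \<subseteq> Arr C"
  shows "L \<in> flat_injective C \<Psi>"
proof -
  have step: "\<exists>j\<in>I. \<exists>b\<in>sec (F j) Y. component (\<mu> j) Y b = y \<and> on_ar (F j) f b = \<one>\<^bsub>on_ob (F j) X\<^esub>"
    if f: "f \<in> Hom C X Y" and y: "y \<in> sec L Y" "on_ar L f y = \<one>\<^bsub>on_ob L X\<^esub>" for X Y f y
  proof -
    note XY = Hom_ob[OF f]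
    obtain i b where i: "i \<in> I" and b: "b \<in> sec (F i) Y" "component (\<mu> i) Y b = y"
      using lim_surj[OF lim XY(2) y(1)] by blast
    note Fi = flat_injectiveD(1)[OF F[OF i]]
    have "component (\<mu> i) X (on_ar (F i) f b) = \<one>\<^bsub>on_ob L X\<^esub>"
      using natural_eq[OF Hom_ModCat_natural[OF lim_legs[OF lim i]] f b(1)] b(2) y(2) by simp
    then obtain j where j: "(i, j) \<in> r" "component (\<phi> i j) X (on_ar (F i) f b) = \<one>\<^bsub>on_ob (F j) X\<^esub>"
      using lim_kernel[OF lim XY(1) i presheaf_closed[OF Fi f b(1)]] by blast
    note \<phi> = Hom_ModCat_natural[OF lim_maps[OF lim j(1)]]
    have "j \<in> I" using lim_in[OF lim j(1)] by blast
    then show ?thesis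
      using natural_closed[OF \<phi> XY(2) b(1)] natural_eq[OF \<phi> f b(1)] j(2)
        lim_cocone_component[OF lim j(1) XY(2) b(1)] b(2)
      by (intro bexI[of _ j] bexI[of _ "component (\<phi> i j) Y b"]) simp_all
  qed
  show ?thesis
  proof (rule flat_injectiveI[OF lim_presheaf(1)[OF lim] flat_presheafI _ \<Psi>])
    fix X Y f y assume f: "f \<in> Hom C X Y" and y: "y \<in> sec L Y" "on_ar L f y = \<one>\<^bsub>on_ob L X\<^esub>"
    obtain j b where j: "j \<in> I" and b: "b \<in> sec (F j) Y" "component (\<mu> j) Y b = y"
        "on_ar (F j) f b = \<one>\<^bsub>on_ob (F j) X\<^esub>" using step[OF f y] by blast
    note \<mu> = Hom_ModCat_natural[OF lim_legs[OF lim j]]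
    obtain Z g z where g: "g \<in> Hom C Y Z" "z \<in> sec (F j) Z" "g \<star> f = hzero C X Z" "on_ar (F j) g z = b"
      by (rule flat_presheafE[OF flat_injectiveD(2)[OF F[OF j]] f b(1,3)])
    have "on_ar L g (component (\<mu> j) Z z) = y" using natural_eq[OF \<mu> g(1,2)] g(4) b(2) by simp
    then show "\<exists>Z. \<exists>g\<in>Hom C Y Z. \<exists>z\<in>sec L Z. g \<star> f = hzero C X Z \<and> on_ar L g z = y"
      using g natural_closed[OF \<mu> Hom_ob(2)[OF g(1)] g(2)] by blast
  next
    fix f X Y y assume f: "f \<in> \<Psi>" "f \<in> Hom C X Y" and y: "y \<in> sec L Y" "on_ar L f y = \<one>\<^bsub>on_ob L X\<^esub>"
    obtain j b where j: "j \<in> I" and b: "b \<in> sec (F j) Y" "component (\<mu> j) Y b = y"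
        "on_ar (F j) f b = \<one>\<^bsub>on_ob (F j) X\<^esub>" using step[OF f(2) y] by blast
    have "b = \<one>\<^bsub>on_ob (F j) Y\<^esub>" by (rule flat_injectiveD(3)[OF F[OF j] f b(1,3)])
    then show "y = \<one>\<^bsub>on_ob L Y\<^esub>"
      using natural_one[OF Hom_ModCat_natural[OF lim_legs[OF lim j]] lim_presheaf(2)[OF lim j] lim_presheaf(1)[OF lim]
          Hom_ob(2)[OF f(2)]] b(2) by simp
  qed
qed

lemma carrier_hom_presheaf [simp]: "sec (hom_presheaf C X) A = Hom C A X"
  by (simp add: hom_presheaf_def)

lemma yoneda_arrow:
  assumes X: "X \<in> Ob C" and G: "additive_presheaf C G" and x: "x \<in> sec G X"
  shows "mod_arrow C (hom_presheaf C X) G (\<lambda>A g. on_ar G g x) \<in> Hom (ModCat C) (hom_presheaf C X) G"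
  by (rule mod_arrow_Hom[OF category_axioms representable_presheaf[OF X] G yoneda_natural[OF G x]])

subsection \<open>Products\<close>

context
  fixes I :: "'i set" and F :: "'i \<Rightarrow> ('o, 'u, 'u) module_fctr" and P and \<pi>
  assumes prod: "is_product (ModCat C) I F P \<pi>"
begin

lemma
  shows prod_presheaf: "additive_presheaf C P"
    and prod_legs: "i \<in> I \<Longrightarrow> \<pi> i \<in> Hom (ModCat C) P (F i)"
    and prod_desc: "additive_presheaf C G \<Longrightarrow> (\<And>i. i \<in> I \<Longrightarrow> f i \<in> Hom (ModCat C) G (F i)) \<Longrightarrow>
      \<exists>!u. u \<in> Hom (ModCat C) G P \<and> (\<forall>i \<in> I. \<pi> i \<bullet> u = f i)"
  using prod by (simp_all add: is_product_def)

text \<open>Elements of \<open>P\<close> at \<open>X\<close> correspond to arrows from the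
  representable at \<open>X\<close>, so the uniqueness part of the universal property separates
  them.\<close>

lemma prod_separated:
  assumes X: "X \<in> Ob C" and y: "y \<in> sec P X" "y' \<in> sec P X"
    and eq: "\<And>i. i \<in> I \<Longrightarrow> component (\<pi> i) X y = component (\<pi> i) X y'"
  shows "y = y'"
proof -
  let ?m = "\<lambda>y. mod_arrow C (hom_presheaf C X) P (\<lambda>A g. on_ar P g y)"
  note m = yoneda_arrow[OF X prod_presheaf]
  have *: "\<pi> i \<bullet> ?m y = \<pi> i \<bullet> ?m y'" if i: "i \<in> I" for i
  proof (rule ModCat_ext[OF Comp_ModCat_closed[OF category_axioms m[OF y(1)] prod_legs[OF i]]
        Comp_ModCat_closed[OF category_axioms m[OF y(2)] prod_legs[OF i]]])
    fix A g assume A: "A \<in> Ob C" and g: "g \<in> sec (hom_presheaf C X) A"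
    then have g': "g \<in> Hom C A X" by simp
    show "component (\<pi> i \<bullet> ?m y) A g = component (\<pi> i \<bullet> ?m y') A g"
      using component_Comp[OF m[OF y(1)] prod_legs[OF i] A g] component_Comp[OF m[OF y(2)] prod_legs[OF i] A g]
        natural_eq[OF Hom_ModCat_natural[OF prod_legs[OF i]] g'] y eq[OF i] A g by simp
  qed
  have "\<exists>!u. u \<in> Hom (ModCat C) (hom_presheaf C X) P \<and> (\<forall>i \<in> I. \<pi> i \<bullet> u = \<pi> i \<bullet> ?m y)"
    by (rule prod_desc[OF representable_presheaf[OF X] Comp_ModCat_closed[OF category_axioms m[OF y(1)] prod_legs]])
  then obtain w where w: "\<And>v. v \<in> Hom (ModCat C) (hom_presheaf C X) P \<Longrightarrow>
      (\<forall>i \<in> I. \<pi> i \<bullet> v = \<pi> i \<bullet> ?m y) \<Longrightarrow> v = w"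
    by (elim ex1E) blast
  have "?m y = ?m y'" using w[OF m[OF y(1)]] w[OF m[OF y(2)]] * by simp
  then have "component (?m y) X (Ide C X) = component (?m y') X (Ide C X)" by simp
  then show ?thesis using Ide_closed[OF X] X presheaf_Ide[OF prod_presheaf X] y by simp
qed

lemma prod_exists:
  assumes X: "X \<in> Ob C" and x: "\<And>i. i \<in> I \<Longrightarrow> x i \<in> sec (F i) X"
  shows "\<exists>y\<in>sec P X. \<forall>i\<in>I. component (\<pi> i) X y = x i"
proof -
  have Fi: "additive_presheaf C (F i)" if "i \<in> I" for i
    using Hom_ModCat_presheaf(2)[OF prod_legs[OF that]] .
  let ?f = "\<lambda>i. mod_arrow C (hom_presheaf C X) (F i) (\<lambda>A g. on_ar (F i) g (x i))"
  have "\<exists>!u. u \<in> Hom (ModCat C) (hom_presheaf C X) P \<and> (\<forall>i \<in> I. \<pi> i \<bullet> u = ?f i)"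
    by (rule prod_desc[OF representable_presheaf[OF X] yoneda_arrow[OF X Fi x]])
  then obtain u where u: "u \<in> Hom (ModCat C) (hom_presheaf C X) P" "\<forall>i \<in> I. \<pi> i \<bullet> u = ?f i" by (elim ex1E) blast
  have I: "Ide C X \<in> sec (hom_presheaf C X) X" using Ide_closed[OF X] by simp
  have "component (\<pi> i) X (component u X (Ide C X)) = x i" if i: "i \<in> I" for i
    using component_Comp[OF u(1) prod_legs[OF i] X I] u(2) i presheaf_Ide[OF Fi[OF i] X x[OF i]] X I by simp
  then show ?thesis using natural_closed[OF Hom_ModCat_natural[OF u(1)] X I] by blast
qed

text \<open>The weak cokernel \<open>g\<close> of \<open>f\<close> is a witness common to all
  factors, so the lifts along it can be chosen factor by factor and combined.\<close>

theorem flat_injective_product: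
  assumes F: "\<And>i. i \<in> I \<Longrightarrow> F i \<in> flat_injective C \<Psi>" and \<Psi>: "\<Psi> \<subseteq> Arr C"
  shows "P \<in> flat_injective C \<Psi>"
proof -
  note \<pi> = Hom_ModCat_natural[OF prod_legs]
  have Fi: "additive_presheaf C (F i)" if "i \<in> I" for i
    using Hom_ModCat_presheaf(2)[OF prod_legs[OF that]] .
  have vanish: "component (\<pi> i) Y y \<in> sec (F i) Y"
      "on_ar (F i) f (component (\<pi> i) Y y) = \<one>\<^bsub>on_ob (F i) X\<^esub>"
    if "i \<in> I" "f \<in> Hom C X Y" "y \<in> sec P Y" "on_ar P f y = \<one>\<^bsub>on_ob P X\<^esub>" for X Y f y i
    using natural_closed[OF \<pi>[OF that(1)] Hom_ob(2)[OF that(2)] that(3)] natural_eq[OF \<pi>[OF that(1)] that(2,3)]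
      natural_one[OF \<pi>[OF that(1)] prod_presheaf Fi[OF that(1)] Hom_ob(1)[OF that(2)]] that(4) by simp_all
  show ?thesis
  proof (rule flat_injectiveI[OF prod_presheaf flat_presheafI _ \<Psi>])
    fix X Y f y assume f: "f \<in> Hom C X Y" and y: "y \<in> sec P Y" "on_ar P f y = \<one>\<^bsub>on_ob P X\<^esub>"
    obtain Z g where g: "g \<in> Hom C Y Z" "g \<star> f = hzero C X Z"
      and weak: "\<And>V l. l \<in> Hom C Y V \<Longrightarrow> l \<star> f = hzero C X V \<Longrightarrow> \<exists>l'\<in>Hom C Z V. l' \<star> g = l"
      by (rule right_seq[OF f]) blast
    have "\<forall>i\<in>I. \<exists>z. z \<in> sec (F i) Z \<and> on_ar (F i) g z = component (\<pi> i) Y y"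
      using flat_presheaf_lift[OF Fi flat_injectiveD(2)[OF F] f g(1) weak vanish[OF _ f y]] by blast
    from bchoice[OF this] obtain z where z: "\<And>i. i \<in> I \<Longrightarrow> z i \<in> sec (F i) Z"
      "\<And>i. i \<in> I \<Longrightarrow> on_ar (F i) g (z i) = component (\<pi> i) Y y" by blast
    obtain p where p: "p \<in> sec P Z" "\<And>i. i \<in> I \<Longrightarrow> component (\<pi> i) Z p = z i"
      using prod_exists[OF Hom_ob(2)[OF g(1)], of z] z(1) by blast
    have "on_ar P g p = y"
      by (rule prod_separated[OF Hom_ob(2)[OF f] presheaf_closed[OF prod_presheaf g(1) p(1)] y(1)])
        (use natural_eq[OF \<pi> g(1) p(1)] p(2) z(2) in simp)
    then show "\<exists>Z. \<exists>g\<in>Hom C Y Z. \<exists>z\<in>sec P Z. g \<star> f = hzero C X Z \<and> on_ar P g z = y" using g p(1) by blast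
  next
    fix f X Y y assume f: "f \<in> \<Psi>" "f \<in> Hom C X Y" and y: "y \<in> sec P Y" "on_ar P f y = \<one>\<^bsub>on_ob P X\<^esub>"
    note Y = Hom_ob(2)[OF f(2)]
    show "y = \<one>\<^bsub>on_ob P Y\<^esub>"
    proof (rule prod_separated[OF Y y(1) presheaf_one_closed[OF prod_presheaf Y]])
      fix i assume i: "i \<in> I"
      show "component (\<pi> i) Y y = component (\<pi> i) Y \<one>\<^bsub>on_ob P Y\<^esub>"
        using flat_injectiveD(3)[OF F[OF i] f vanish[OF i f(2) y]] natural_one[OF \<pi>[OF i] prod_presheaf Fi[OF i] Y] by simp
    qed
  qed
qed

end


subsection \<open>Retracts, pure subobjects and coproducts\<close>

lemma flat_injective_retract:
  assumes G: "G \<in> flat_injective C \<Psi>" and \<Psi>: "\<Psi> \<subseteq> Arr C"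
    and s: "s \<in> Hom (ModCat C) F G" and t: "t \<in> Hom (ModCat C) G F" and ts: "t \<bullet> s = Ide (ModCat C) F"
  shows "F \<in> flat_injective C \<Psi>"
proof -
  have F: "additive_presheaf C F" and G': "additive_presheaf C G" using Hom_ModCat_presheaf[OF s] by auto
  note sn = Hom_ModCat_natural[OF s] and tn = Hom_ModCat_natural[OF t]
  have ts': "component t X (component s X x) = x" if "X \<in> Ob C" "x \<in> sec F X" for X x
    using component_Comp[OF s t that] ts that by (simp add: Ide_ModCat)
  have vanish: "on_ar G f (component s Y y) = \<one>\<^bsub>on_ob G X\<^esub>"
    if "f \<in> Hom C X Y" "y \<in> sec F Y" "on_ar F f y = \<one>\<^bsub>on_ob F X\<^esub>" for f X Y y
    using natural_eq[OF sn that(1,2)] that(3) natural_one[OF sn F G' Hom_ob(1)[OF that(1)]] by simp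
  show ?thesis
  proof (rule flat_injectiveI[OF F flat_presheafI _ \<Psi>])
    fix X Y f y assume f: "f \<in> Hom C X Y" and y: "y \<in> sec F Y" "on_ar F f y = \<one>\<^bsub>on_ob F X\<^esub>"
    note Y = Hom_ob(2)[OF f]
    obtain Z g z where g: "g \<in> Hom C Y Z" "z \<in> sec G Z" "g \<star> f = hzero C X Z" "on_ar G g z = component s Y y"
      by (rule flat_presheafE[OF flat_injectiveD(2)[OF G] f natural_closed[OF sn Y y(1)] vanish[OF f y]])
    have "on_ar F g (component t Z z) = y" using natural_eq[OF tn g(1,2)] g(4) ts'[OF Y y(1)] by simp
    then show "\<exists>Z. \<exists>g\<in>Hom C Y Z. \<exists>z\<in>sec F Z. g \<star> f = hzero C X Z \<and> on_ar F g z = y"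
      using g(1,3) natural_closed[OF tn Hom_ob(2)[OF g(1)] g(2)] by blast
  next
    fix f X Y y assume f: "f \<in> \<Psi>" "f \<in> Hom C X Y" and y: "y \<in> sec F Y" "on_ar F f y = \<one>\<^bsub>on_ob F X\<^esub>"
    note Y = Hom_ob(2)[OF f(2)]
    have "component s Y y = \<one>\<^bsub>on_ob G Y\<^esub>"
      by (rule flat_injectiveD(3)[OF G f natural_closed[OF sn Y y(1)] vanish[OF f(2) y]])
    then show "y = \<one>\<^bsub>on_ob F Y\<^esub>" using ts'[OF Y y(1)] natural_one[OF tn G' F Y] by simp
  qed
qed

lemma additive_coset_eq:
  assumes H: "additive_presheaf C H" and c: "c \<in> Hom C W Z" "d \<in> Hom C W Z" and h: "h \<in> sec H Z"
    and z: "on_ar H (hsub C c d) h = \<one>\<^bsub>on_ob H W\<^esub>"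
  shows "on_ar H c h = on_ar H d h"
proof -
  interpret group "on_ob H W" by (rule presheaf_group'[OF H Hom_ob(1)[OF c(1)]])
  show ?thesis
    using presheaf_hadd[OF H hsub_closed[OF c] c(2) h] hsub_hadd_cancel[OF c] z presheaf_closed[OF H c(2) h] by simp
qed

text \<open>The image of \<open>hom_presheaf C Z \<rightarrow> hom_presheaf C V\<close> serves as a finitely presented test object.\<close>

lemma image_finitely_presented:
  assumes g: "g \<in> Hom C Y Z" and k: "k \<in> Hom C Z V" and kg: "k \<star> g = hzero C Y V"
    and weak: "\<And>W c. c \<in> Hom C W Z \<Longrightarrow> k \<star> c = hzero C W V \<Longrightarrow> \<exists>c'\<in>Hom C W Y. g \<star> c' = c"
  defines "P \<equiv> sub_presheaf (hom_presheaf C V) (\<lambda>W. (\<lambda>c. k \<star> c) ` Hom C W Z)"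
  shows "finitely_presented C P" "additive_presheaf C P"
proof -
  have YZV: "Y \<in> Ob C" "Z \<in> Ob C" "V \<in> Ob C" using Hom_ob[OF g] Hom_ob[OF k] by auto
  show P: "additive_presheaf C P"
    unfolding P_def
  proof (rule sub_presheaf_presheaf[OF representable_presheaf[OF YZV(3)]])
    fix W assume W: "W \<in> Ob C"
    interpret G: comm_group "hom_group C W V" by (rule hom_group[OF W YZV(3)])
    have "subgroup ((\<lambda>c. k \<star> c) ` Hom C W Z) (hom_group C W V)"
    proof (rule G.subgroupI)
      show "(\<lambda>c. k \<star> c) ` Hom C W Z \<subseteq> carrier (hom_group C W V)" using Comp_closed[OF _ k] by auto
      show "(\<lambda>c. k \<star> c) ` Hom C W Z \<noteq> {}" using hzero_closed[OF W YZV(2)] by blast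
      fix a assume "a \<in> (\<lambda>c. k \<star> c) ` Hom C W Z"
      then obtain c where c: "c \<in> Hom C W Z" "a = k \<star> c" by blast
      show "inv\<^bsub>hom_group C W V\<^esub> a \<in> (\<lambda>c. k \<star> c) ` Hom C W Z"
        using Comp_hneg_right[OF c(1) k] c(2) hneg_closed[OF c(1)] by (metis imageI)
      fix b assume "b \<in> (\<lambda>c. k \<star> c) ` Hom C W Z"
      then obtain d where d: "d \<in> Hom C W Z" "b = k \<star> d" by blast
      show "a \<otimes>\<^bsub>hom_group C W V\<^esub> b \<in> (\<lambda>c. k \<star> c) ` Hom C W Z"
        using Comp_hadd_right[OF c(1) d(1) k] c(2) d(2) hadd_closed[OF c(1) d(1)] by (metis hom_group_simps(2) imageI)
    qed
    then show "subgroup ((\<lambda>c. k \<star> c) ` Hom C W Z) (on_ob (hom_presheaf C V) W)" by (simp add: hom_presheaf_def)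
  next
    fix W W' f y assume f: "f \<in> Hom C W W'" and "y \<in> (\<lambda>c. k \<star> c) ` Hom C W' Z"
    then obtain c where c: "c \<in> Hom C W' Z" "y = k \<star> c" by blast
    have "y \<star> f = k \<star> (c \<star> f)" using Comp_assoc[OF f c(1) k] c(2) by simp
    then show "on_ar (hom_presheaf C V) f y \<in> (\<lambda>c. k \<star> c) ` Hom C W Z"
      using Comp_closed[OF f c(1)] by (simp add: hom_presheaf_def)
  qed
  let ?p = "mod_arrow C (hom_presheaf C Z) P (\<lambda>W c. k \<star> c)"
  have "natural C (hom_presheaf C Z) P (\<lambda>W c. k \<star> c)"
    by (rule naturalI)
      (use Comp_hadd_right[OF _ _ k] Comp_assoc[OF _ _ k] in \<open>auto simp: P_def sub_presheaf_def hom_presheaf_def\<close>)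
  then have p: "?p \<in> Hom (ModCat C) (hom_presheaf C Z) P"
    by (rule mod_arrow_Hom[OF category_axioms representable_presheaf[OF YZV(2)] P])
  have gm: "hom_presheaf_map C (Ob C) g = mod_arrow C (hom_presheaf C Y) (hom_presheaf C Z) (\<lambda>W c. g \<star> c)"
    using Hom_DomCod[OF g] by (simp add: hom_presheaf_map_def mod_arrow_def)
  have "natural C (hom_presheaf C Y) (hom_presheaf C Z) (\<lambda>W c. g \<star> c)"
    by (rule naturalI)
      (use Comp_hadd_right[OF _ _ g] Comp_closed[OF _ g] Comp_assoc[OF _ _ g] in \<open>auto simp: hom_presheaf_def\<close>)
  then have gH: "hom_presheaf_map C (Ob C) g \<in> Hom (ModCat C) (hom_presheaf C Y) (hom_presheaf C Z)"
    unfolding gm by (rule mod_arrow_Hom[OF category_axioms representable_presheaf[OF YZV(1)] representable_presheaf[OF YZV(2)]])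
  have carP: "sec P W = (\<lambda>c. k \<star> c) ` Hom C W Z" "\<one>\<^bsub>on_ob P W\<^esub> = hzero C W V" for W
    by (simp_all add: P_def sub_presheaf_def hom_presheaf_def)
  have pc: "component ?p W c = k \<star> c" if "W \<in> Ob C" "c \<in> Hom C W Z" for W c using that by simp
  have gc: "component (hom_presheaf_map C (Ob C) g) W c = g \<star> c" if "W \<in> Ob C" "c \<in> Hom C W Y" for W c
    using that by (simp add: gm)
  have "exact_at C (hom_presheaf_map C (Ob C) g) ?p"
    unfolding exact_at_def
  proof (intro conjI ballI)
    show "hom_presheaf_map C (Ob C) g \<in> Arr (ModCat C)" "?p \<in> Arr (ModCat C)"
      "Cod (ModCat C) (hom_presheaf_map C (Ob C) g) = Dom (ModCat C) ?p"
      using Hom_DomCod[OF p] Hom_DomCod[OF gH] by simp_all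
    fix W assume W: "W \<in> Ob C"
    have "component (hom_presheaf_map C (Ob C) g) W ` Hom C W Y = (\<lambda>c. g \<star> c) ` Hom C W Y"
      by (rule image_cong) (use gc W in auto)
    moreover have "(\<lambda>c. g \<star> c) ` Hom C W Y = {c \<in> Hom C W Z. k \<star> c = hzero C W V}"
    proof (intro equalityI subsetI)
      fix c assume "c \<in> (\<lambda>c. g \<star> c) ` Hom C W Y"
      then obtain c' where c': "c' \<in> Hom C W Y" "c = g \<star> c'" by blast
      have "k \<star> c = hzero C W V" using Comp_assoc[OF c'(1) g k] kg c'(2) Comp_hzero_left[OF c'(1) YZV(3)] by simp
      then show "c \<in> {c \<in> Hom C W Z. k \<star> c = hzero C W V}" using Comp_closed[OF c'(1) g] c'(2) by simp
    next
      fix c assume "c \<in> {c \<in> Hom C W Z. k \<star> c = hzero C W V}"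
      then show "c \<in> (\<lambda>c. g \<star> c) ` Hom C W Y" using weak[of c W] by force
    qed
    moreover have "{c \<in> Hom C W Z. k \<star> c = hzero C W V} = {c \<in> Hom C W Z. component ?p W c = hzero C W V}"
      by (rule Collect_cong) (use pc[OF W] in metis)
    ultimately show "component (hom_presheaf_map C (Ob C) g) W `
        sec (Dom (ModCat C) (hom_presheaf_map C (Ob C) g)) W =
        kernel (on_ob (Dom (ModCat C) ?p) W) (on_ob (Cod (ModCat C) ?p) W) (component ?p W)"
      using Hom_DomCod[OF p] Hom_DomCod[OF gH] by (simp add: kernel_def carP)
  qed
  moreover have "epi_Mod C ?p" unfolding epi_Mod_def using Hom_DomCod[OF p] pc by (auto simp: carP)
  ultimately show "finitely_presented C P"
    unfolding finitely_presented_def using P p Hom_DomCod[OF g] by (auto intro!: bexI[of _ g])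
qed

text \<open>In \<open>G\<close> the element \<open>y\<close> lifts along \<open>g\<close> to some
  \<open>z\<close>, which need not come from \<open>F\<close>. Its image \<open>h\<close> in the
  quotient \<open>H\<close> is killed by \<open>g\<close> and so defines an arrow from the cokernel
  \<open>P\<close> of composition with \<open>g\<close>. Purity lifts this arrow to
  \<open>G\<close>, giving \<open>w\<close> with the same image \<open>h\<close> and killed by
  \<open>g\<close>. Then \<open>z\<close> divided by \<open>w\<close> comes from \<open>F\<close>
  and is still sent to \<open>y\<close>.\<close>

theorem flat_injective_pure:
  assumes G: "G \<in> flat_injective C \<Psi>" and \<Psi>: "\<Psi> \<subseteq> Arr C"
    and m: "m \<in> Hom (ModCat C) F G" and pure: "pure_mono_Mod C m"
  shows "F \<in> flat_injective C \<Psi>"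
proof -
  have F: "additive_presheaf C F" and G': "additive_presheaf C G" using Hom_ModCat_presheaf[OF m] by auto
  note mn = Hom_ModCat_natural[OF m]
  obtain n where ex: "short_exact C m n"
    and lift: "\<And>P p. finitely_presented C P \<Longrightarrow> p \<in> Hom (ModCat C) P (Cod (ModCat C) n) \<Longrightarrow>
      \<exists>q \<in> Hom (ModCat C) P (Dom (ModCat C) n). n \<bullet> q = p"
    using pure unfolding pure_mono_Mod_def by blast
  define H where "H = Cod (ModCat C) n"
  have "Dom (ModCat C) n = G" "n \<in> Arr (ModCat C)" using ex Hom_DomCod[OF m] by (auto simp: short_exact_def exact_at_def)
  then have n: "n \<in> Hom (ModCat C) G H" by (simp add: Hom_def H_def)
  note H = Hom_ModCat_presheaf(2)[OF n] and nn = Hom_ModCat_natural[OF n]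
  have inj: "inj_on (component m X) (sec F X)" if "X \<in> Ob C" for X
    using ex that Hom_DomCod[OF m] by (auto simp: short_exact_def)
  have ker: "component m X ` sec F X = {y \<in> sec G X. component n X y = \<one>\<^bsub>on_ob H X\<^esub>}" if "X \<in> Ob C" for X
    using ex that Hom_DomCod[OF m] Hom_DomCod[OF n] by (simp add: short_exact_def exact_at_def kernel_def)
  have m1: "component m X \<one>\<^bsub>on_ob F X\<^esub> = \<one>\<^bsub>on_ob G X\<^esub>" if "X \<in> Ob C" for X by (rule natural_one[OF mn F G' that])
  have vanish: "on_ar G f (component m Y y) = \<one>\<^bsub>on_ob G X\<^esub>"
    if "f \<in> Hom C X Y" "y \<in> sec F Y" "on_ar F f y = \<one>\<^bsub>on_ob F X\<^esub>" for f X Y y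
    using natural_eq[OF mn that(1,2)] that(3) m1[OF Hom_ob(1)[OF that(1)]] by simp
  show ?thesis
  proof (rule flat_injectiveI[OF F flat_presheafI _ \<Psi>])
    fix f X Y y assume f: "f \<in> \<Psi>" "f \<in> Hom C X Y" and y: "y \<in> sec F Y" "on_ar F f y = \<one>\<^bsub>on_ob F X\<^esub>"
    note Y = Hom_ob(2)[OF f(2)]
    have "component m Y y = \<one>\<^bsub>on_ob G Y\<^esub>"
      by (rule flat_injectiveD(3)[OF G f natural_closed[OF mn Y y(1)] vanish[OF f(2) y]])
    then show "y = \<one>\<^bsub>on_ob F Y\<^esub>" using inj_onD[OF inj[OF Y] _ y(1) presheaf_one_closed[OF F Y]] m1[OF Y] by simp
  next
    fix X Y f y assume f: "f \<in> Hom C X Y" and y: "y \<in> sec F Y" "on_ar F f y = \<one>\<^bsub>on_ob F X\<^esub>"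
    note Y = Hom_ob(2)[OF f]
    obtain Z g where g: "g \<in> Hom C Y Z" "g \<star> f = hzero C X Z"
      and weak: "\<And>V l. l \<in> Hom C Y V \<Longrightarrow> l \<star> f = hzero C X V \<Longrightarrow> \<exists>l'\<in>Hom C Z V. l' \<star> g = l"
      by (rule right_seq[OF f]) blast
    note Z = Hom_ob(2)[OF g(1)]
    obtain z where z: "z \<in> sec G Z" "on_ar G g z = component m Y y"
      using flat_presheaf_lift[OF G' flat_injectiveD(2)[OF G] f g(1) weak natural_closed[OF mn Y y(1)] vanish[OF f y]] by blast
    \<comment> \<open>\<open>g\<close> is a weak kernel of \<open>k\<close>, so \<open>k\<close>
      identifies two arrows into \<open>Z\<close> exactly when their difference factors through
      \<open>g\<close>. This realizes the cokernel of composition with \<open>g\<close> inside a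
      representable presheaf.\<close>
    obtain V k where k: "k \<in> Hom C Z V" "k \<star> g = hzero C Y V"
      and weak': "\<And>W c. c \<in> Hom C W Z \<Longrightarrow> k \<star> c = hzero C W V \<Longrightarrow> \<exists>c'\<in>Hom C W Y. g \<star> c' = c"
      by (rule right_seq[OF g(1)]) blast
    define P where "P = sub_presheaf (hom_presheaf C V) (\<lambda>W. (\<lambda>c. k \<star> c) ` Hom C W Z)"
    have P: "finitely_presented C P" "additive_presheaf C P"
      unfolding P_def using image_finitely_presented[OF g(1) k weak'] by blast+
    have carP: "sec P W = (\<lambda>c. k \<star> c) ` Hom C W Z" "\<one>\<^bsub>on_ob P W\<^esub> = hzero C W V"
      "a \<otimes>\<^bsub>on_ob P W\<^esub> b = hadd C a b" "on_ar P e a = a \<star> e" for W a b e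
      by (simp_all add: P_def sub_presheaf_def hom_presheaf_def)
    define h where "h = component n Z z"
    have h: "h \<in> sec H Z" unfolding h_def by (rule natural_closed[OF nn Z z(1)])
    have "component m Y y \<in> component m Y ` sec F Y" using y(1) by blast
    then have gh: "on_ar H g h = \<one>\<^bsub>on_ob H Y\<^esub>" using natural_eq[OF nn g(1) z(1)] z(2) ker[OF Y] by (simp add: h_def)
    have indep: "on_ar H c h = on_ar H d h" if cd: "c \<in> Hom C W Z" "d \<in> Hom C W Z" "k \<star> c = k \<star> d" for W c d
    proof (rule additive_coset_eq[OF H cd(1,2) h])
      have "k \<star> hsub C c d = hzero C W V"
        using Comp_hsub_right[OF cd(1,2) k(1)] cd(3) hsub_eq_hzero_iff[OF Comp_closed[OF cd(1) k(1)] Comp_closed[OF cd(2) k(1)]]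
        by simp
      then obtain e where e: "e \<in> Hom C W Y" "g \<star> e = hsub C c d" using weak'[OF hsub_closed[OF cd(1,2)]] by blast
      show "on_ar H (hsub C c d) h = \<one>\<^bsub>on_ob H W\<^esub>"
        using presheaf_Comp[OF H e(1) g(1) h] e(2) gh presheaf_one[OF category_axioms H e(1)] by simp
    qed
    define t where "t = (\<lambda>W a. on_ar H (SOME c. c \<in> Hom C W Z \<and> k \<star> c = a) h)"
    have t: "t W (k \<star> c) = on_ar H c h" if c: "c \<in> Hom C W Z" for W c
    proof -
      have "(SOME d. d \<in> Hom C W Z \<and> k \<star> d = k \<star> c) \<in> Hom C W Z \<and> k \<star> (SOME d. d \<in> Hom C W Z \<and> k \<star> d = k \<star> c) = k \<star> c"
        by (rule someI[of _ c]) (simp add: c)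
      then show ?thesis unfolding t_def using indep[OF _ c] by blast
    qed
    have tn: "natural C P H t"
    proof (rule naturalI)
      fix W a assume W: "W \<in> Ob C" and "a \<in> sec P W"
      then obtain c where c: "c \<in> Hom C W Z" "a = k \<star> c" by (auto simp: carP)
      show "t W a \<in> sec H W" using t[OF c(1)] c(2) presheaf_closed[OF H c(1) h] by simp
      fix b assume "b \<in> sec P W"
      then obtain d where d: "d \<in> Hom C W Z" "b = k \<star> d" by (auto simp: carP)
      have "a \<otimes>\<^bsub>on_ob P W\<^esub> b = k \<star> hadd C c d" using Comp_hadd_right[OF c(1) d(1) k(1)] c(2) d(2) by (simp add: carP)
      then show "t W (a \<otimes>\<^bsub>on_ob P W\<^esub> b) = t W a \<otimes>\<^bsub>on_ob H W\<^esub> t W b"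
        using t[OF hadd_closed[OF c(1) d(1)]] t[OF c(1)] t[OF d(1)] c(2) d(2) presheaf_hadd[OF H c(1) d(1) h] by simp
    next
      fix W W' e a assume e: "e \<in> Hom C W W'" and "a \<in> sec P W'"
      then obtain c where c: "c \<in> Hom C W' Z" "a = k \<star> c" by (auto simp: carP)
      have "on_ar P e a = k \<star> (c \<star> e)" using Comp_assoc[OF e c(1) k(1)] c(2) by (simp add: carP)
      then show "t W (on_ar P e a) = on_ar H e (t W' a)"
        using t[OF Comp_closed[OF e c(1)]] t[OF c(1)] c(2) presheaf_Comp[OF H e c(1) h] by simp
    qed
    have "mod_arrow C P H t \<in> Hom (ModCat C) P (Cod (ModCat C) n)"
      using mod_arrow_Hom[OF category_axioms P(2) H tn] by (simp add: H_def)
    then obtain q where "q \<in> Hom (ModCat C) P (Dom (ModCat C) n)" and nq: "n \<bullet> q = mod_arrow C P H t"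
      using lift[OF P(1)] by blast
    then have q: "q \<in> Hom (ModCat C) P G" using \<open>Dom (ModCat C) n = G\<close> by simp
    note qn = Hom_ModCat_natural[OF q]
    \<comment> \<open>\<open>k\<close> is the generator of \<open>P\<close>, being the image of the
      identity of \<open>Z\<close>; its image under \<open>q\<close> is the correction term
      \<open>w\<close>.\<close>
    have kP: "k \<in> sec P Z" using Comp_Ide[OF k(1)] Ide_closed[OF Z] by (auto simp: carP intro!: rev_image_eqI)
    define w where "w = component q Z k"
    have w: "w \<in> sec G Z" unfolding w_def by (rule natural_closed[OF qn Z kP])
    have gw: "on_ar G g w = \<one>\<^bsub>on_ob G Y\<^esub>"
      using natural_eq[OF qn g(1) kP] k(2) natural_one[OF qn P(2) G' Y] by (simp add: w_def carP)
    have "component n Z w = t Z k" using component_Comp[OF q n Z kP] nq Z kP by (simp add: w_def)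
    then have nw: "component n Z w = h" using t[OF Ide_closed[OF Z]] Comp_Ide[OF k(1)] presheaf_Ide[OF H Z h] by simp
    interpret GZ: comm_group "on_ob G Z" by (rule presheaf_group[OF G' Z])
    interpret GY: comm_group "on_ob G Y" by (rule presheaf_group[OF G' Y])
    interpret HZ: comm_group "on_ob H Z" by (rule presheaf_group[OF H Z])
    interpret nh: group_hom "on_ob G Z" "on_ob H Z" "component n Z" using natural_hom[OF nn Z] by unfold_locales
    interpret gh: group_hom "on_ob G Z" "on_ob G Y" "on_ar G g" using presheaf_hom[OF G' g(1)] by unfold_locales
    let ?d = "z \<otimes>\<^bsub>on_ob G Z\<^esub> inv\<^bsub>on_ob G Z\<^esub> w"
    have "component n Z ?d = \<one>\<^bsub>on_ob H Z\<^esub>" using z(1) w nw h by (simp flip: h_def)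
    then have "?d \<in> component m Z ` sec F Z" using ker[OF Z] z(1) w by simp
    then obtain z' where z': "z' \<in> sec F Z" "component m Z z' = ?d" by (elim imageE) simp
    have "component m Y (on_ar F g z') = component m Y y"
      using natural_eq[OF mn g(1) z'(1)] z'(2) z w gw natural_closed[OF mn Y y(1)] by simp
    then have "on_ar F g z' = y" using inj_onD[OF inj[OF Y]] presheaf_closed[OF F g(1) z'(1)] y(1) by blast
    then show "\<exists>Z. \<exists>g\<in>Hom C Y Z. \<exists>z\<in>sec F Z. g \<star> f = hzero C X Z \<and> on_ar F g z = y" using g z'(1) by blast
  qed
qed

theorem definable_flat_injective:
  assumes \<Psi>: "\<Psi> \<subseteq> Arr C"
  shows "definable_Mod C (flat_injective C \<Psi>)"
  unfolding definable_Mod_def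
proof (intro conjI allI impI)
  show "flat_injective C \<Psi> \<subseteq> Ob (ModCat C)" by (auto simp: flat_injective_def)
  show "L \<in> flat_injective C \<Psi>"
    if "small I \<and> is_direct_limit (ModCat C) I r F \<phi> L \<mu> \<and> (\<forall>i \<in> I. F i \<in> flat_injective C \<Psi>)"
    for I :: "'u set" and r and F :: "'u \<Rightarrow> ('o, 'u, 'u) module_fctr" and \<phi> L \<mu>
    using flat_injective_direct_limit[of I r F \<phi> L \<mu> \<Psi>] that \<Psi> by blast
  show "P \<in> flat_injective C \<Psi>"
    if "small I \<and> is_product (ModCat C) I F P \<pi> \<and> (\<forall>i \<in> I. F i \<in> flat_injective C \<Psi>)"
    for I :: "'u set" and F :: "'u \<Rightarrow> ('o, 'u, 'u) module_fctr" and P \<pi>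
    using flat_injective_product[of I F P \<pi> \<Psi>] that \<Psi> by blast
  show "F \<in> flat_injective C \<Psi>"
    if "m \<in> Hom (ModCat C) F G \<and> pure_mono_Mod C m \<and> G \<in> flat_injective C \<Psi>" for F G :: "('o, 'u, 'u) module_fctr" and m
    using flat_injective_pure[OF _ \<Psi>] that by blast
qed

lemma natural_trivial:
  assumes "additive_presheaf C F" "additive_presheaf C G"
  shows "natural C F G (\<lambda>X x. \<one>\<^bsub>on_ob G X\<^esub>)"
proof (rule naturalI)
  fix X Y f y assume "f \<in> Hom C X Y"
  then show "\<one>\<^bsub>on_ob G X\<^esub> = on_ar G f \<one>\<^bsub>on_ob G Y\<^esub>" using presheaf_one[OF category_axioms assms(2)] by simp
next
  fix X assume X: "X \<in> Ob C"
  show "\<one>\<^bsub>on_ob G X\<^esub> = \<one>\<^bsub>on_ob G X\<^esub> \<otimes>\<^bsub>on_ob G X\<^esub> \<one>\<^bsub>on_ob G X\<^esub>"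
    using monoid.l_one[OF group.is_monoid[OF presheaf_group'[OF assms(2) X]] presheaf_one_closed[OF assms(2) X]] by simp
qed (use presheaf_one_closed[OF assms(2)] in simp)

text \<open>As in an additive category, projections out of an abstract coproduct are induced by
  identities and trivial maps.\<close>

lemma presheaf_coproduct_projections:
  fixes F :: "'i \<Rightarrow> ('o, 'u, 'u) module_fctr"
  assumes S: "is_coproduct (ModCat C) I F S \<iota>"
  obtains \<pi> where "\<And>i. i \<in> I \<Longrightarrow> \<pi> i \<in> Hom (ModCat C) S (F i)" "\<And>i. i \<in> I \<Longrightarrow> \<pi> i \<bullet> \<iota> i = Ide (ModCat C) (F i)"
    "\<And>i j. i \<in> I \<Longrightarrow> j \<in> I \<Longrightarrow> i \<noteq> j \<Longrightarrow> \<pi> i \<bullet> \<iota> j = mod_arrow C (F j) (F i) (\<lambda>X x. \<one>\<^bsub>on_ob (F i) X\<^esub>)"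
proof -
  interpret M: category "ModCat C :: (('o, 'u, 'u) module_fctr, ('o, 'u, 'u) module_arrow) category"
    by (rule category_ModCat[OF category_axioms])
  have F: "additive_presheaf C (F i)" if "i \<in> I" for i using M.coproduct_ob(2)[OF S that] by simp
  have "\<forall>i\<in>I. \<exists>p. p \<in> Hom (ModCat C) S (F i) \<and>
      (\<forall>j\<in>I. p \<bullet> \<iota> j = (if i = j then Ide (ModCat C) (F i) else mod_arrow C (F j) (F i) (\<lambda>X x. \<one>\<^bsub>on_ob (F i) X\<^esub>)))"
  proof
    fix i assume i: "i \<in> I"
    have "(if i = j then Ide (ModCat C) (F i) else mod_arrow C (F j) (F i) (\<lambda>X x. \<one>\<^bsub>on_ob (F i) X\<^esub>)) \<in> Hom (ModCat C) (F j) (F i)"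
      if j: "j \<in> I" for j
      using M.Ide_closed[of "F i"] F[OF i] mod_arrow_Hom[OF category_axioms F[OF j] F[OF i] natural_trivial[OF F[OF j] F[OF i]]] by auto
    then show "\<exists>p. p \<in> Hom (ModCat C) S (F i) \<and>
      (\<forall>j\<in>I. p \<bullet> \<iota> j = (if i = j then Ide (ModCat C) (F i) else mod_arrow C (F j) (F i) (\<lambda>X x. \<one>\<^bsub>on_ob (F i) X\<^esub>)))"
      using M.coproduct_desc[OF S M.coproduct_ob(2)[OF S i],
          of "\<lambda>j. if i = j then Ide (ModCat C) (F i) else mod_arrow C (F j) (F i) (\<lambda>X x. \<one>\<^bsub>on_ob (F i) X\<^esub>)"] by metis
  qed
  from bchoice[OF this] obtain \<pi> where \<pi>: "\<forall>i\<in>I. \<pi> i \<in> Hom (ModCat C) S (F i) \<and>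
      (\<forall>j\<in>I. \<pi> i \<bullet> \<iota> j = (if i = j then Ide (ModCat C) (F i) else mod_arrow C (F j) (F i) (\<lambda>X x. \<one>\<^bsub>on_ob (F i) X\<^esub>)))"
    by blast
  show ?thesis by (rule that[of \<pi>]) (use \<pi> in auto)
qed

theorem flat_injective_summands:
  assumes \<Psi>: "\<Psi> \<subseteq> Arr C"
  shows "closed_summands (ModCat C) (flat_injective C \<Psi> :: ('o, 'u, 'u) module_fctr set)"
  unfolding closed_summands_def
proof (intro allI impI)
  fix X X' S :: "('o, 'u, 'u) module_fctr" and \<iota> assume *: "is_coproduct (ModCat C) UNIV (case_bool X X') S \<iota> \<and> S \<in> flat_injective C \<Psi>"
  then obtain \<pi> where \<pi>: "\<And>i. \<pi> i \<in> Hom (ModCat C) S (case_bool X X' i)"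
      "\<And>i. \<pi> i \<bullet> \<iota> i = Ide (ModCat C) (case_bool X X' i)"
    using presheaf_coproduct_projections[of UNIV "case_bool X X'" S \<iota>] by (metis UNIV_I)
  have "\<iota> True \<in> Hom (ModCat C) X S"
    using category.coproduct_ob(3)[OF category_ModCat[OF category_axioms] conjunct1[OF *], of True] by simp
  then show "X \<in> flat_injective C \<Psi>"
    using flat_injective_retract[OF conjunct2[OF *] \<Psi> _ ] \<pi>(1)[of True] \<pi>(2)[of True] by simp
qed

text \<open>The abstract coproduct is recognized as a direct sum: the product of all composites of
  projection and injection agrees with the identity on every injection. Elements are then treated
  componentwise, again with one weak cokernel as common witness.\<close>

theorem flat_injective_finite_coproducts:
  assumes \<Psi>: "\<Psi> \<subseteq> Arr C"
  shows "closed_finite_coproducts (ModCat C) (flat_injective C \<Psi> :: ('o, 'u, 'u) module_fctr set)"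
  unfolding closed_finite_coproducts_def
proof (intro allI impI)
  fix n :: nat and F and S :: "('o, 'u, 'u) module_fctr" and \<iota> assume *: "is_coproduct (ModCat C) {..<n} F S \<iota> \<and> (\<forall>i<n. F i \<in> flat_injective C \<Psi>)"
  then have S: "is_coproduct (ModCat C) {..<n} F S \<iota>" and F: "\<And>i. i < n \<Longrightarrow> F i \<in> flat_injective C \<Psi>" by auto
  interpret M: category "ModCat C :: (('o, 'u, 'u) module_fctr, ('o, 'u, 'u) module_arrow) category"
    by (rule category_ModCat[OF category_axioms])
  have S': "additive_presheaf C S" using M.coproduct_ob(1)[OF S] by simp
  have Fi: "additive_presheaf C (F i)" if "i < n" for i
    using flat_injectiveD(1)[OF F[OF that]] .
  obtain \<pi> where \<pi>0: "\<And>i. i \<in> {..<n} \<Longrightarrow> \<pi> i \<in> Hom (ModCat C) S (F i)"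
      "\<And>i. i \<in> {..<n} \<Longrightarrow> \<pi> i \<bullet> \<iota> i = Ide (ModCat C) (F i)"
      "\<And>i j. i \<in> {..<n} \<Longrightarrow> j \<in> {..<n} \<Longrightarrow> i \<noteq> j \<Longrightarrow> \<pi> i \<bullet> \<iota> j = mod_arrow C (F j) (F i) (\<lambda>X x. \<one>\<^bsub>on_ob (F i) X\<^esub>)"
    by (rule presheaf_coproduct_projections[OF S]) blast
  have \<pi>1: "\<pi> i \<in> Hom (ModCat C) S (F i)" if "i < n" for i using \<pi>0(1) that by simp
  have \<iota>1: "\<iota> i \<in> Hom (ModCat C) (F i) S" if "i < n" for i using M.coproduct_ob(3)[OF S] that by simp
  note \<pi> = Hom_ModCat_natural[OF \<pi>1] and \<iota> = Hom_ModCat_natural[OF \<iota>1]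
  have \<pi>\<iota>: "component (\<pi> i) X (component (\<iota> j) X x) = (if i = j then x else \<one>\<^bsub>on_ob (F i) X\<^esub>)"
    if "i < n" "j < n" "X \<in> Ob C" "x \<in> sec (F j) X" for i j X x
    using component_Comp[OF \<iota>1[OF that(2)] \<pi>1[OF that(1)] that(3,4)] \<pi>0(2)[of i] \<pi>0(3)[of i j] that
    by (cases "i = j") (simp_all add: Ide_ModCat)
  define e where "e = (\<lambda>X x. finprod (on_ob S X) (\<lambda>i. component (\<iota> i) X (component (\<pi> i) X x)) {..<n})"
  have c: "component (\<iota> i) X (component (\<pi> i) X x) \<in> sec S X" if "i < n" "X \<in> Ob C" "x \<in> sec S X" for i X x
    using natural_closed[OF \<iota>[OF that(1)] that(2) natural_closed[OF \<pi>[OF that(1)] that(2,3)]] .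
  have en: "natural C S S e"
  proof (rule naturalI)
    fix X x assume X: "X \<in> Ob C" and x: "x \<in> sec S X"
    interpret SX: comm_group "on_ob S X" by (rule presheaf_group[OF S' X])
    show "e X x \<in> sec S X" unfolding e_def using c[OF _ X x] by (intro SX.finprod_closed) auto
    fix y assume y: "y \<in> sec S X"
    have "e X (x \<otimes>\<^bsub>on_ob S X\<^esub> y) = finprod (on_ob S X) (\<lambda>i. component (\<iota> i) X (component (\<pi> i) X x) \<otimes>\<^bsub>on_ob S X\<^esub>
        component (\<iota> i) X (component (\<pi> i) X y)) {..<n}"
      unfolding e_def
    proof (rule SX.finprod_cong')
      fix i assume "i \<in> {..<n}"
      then have i: "i < n" by simp
      show "component (\<iota> i) X (component (\<pi> i) X (x \<otimes>\<^bsub>on_ob S X\<^esub> y)) =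
          component (\<iota> i) X (component (\<pi> i) X x) \<otimes>\<^bsub>on_ob S X\<^esub> component (\<iota> i) X (component (\<pi> i) X y)"
        using natural_mult[OF \<pi>[OF i] X x y] natural_mult[OF \<iota>[OF i] X natural_closed[OF \<pi>[OF i] X x] natural_closed[OF \<pi>[OF i] X y]]
        by simp
    qed (use c[OF _ X x] c[OF _ X y] in auto)
    also have "\<dots> = e X x \<otimes>\<^bsub>on_ob S X\<^esub> e X y"
      unfolding e_def using c[OF _ X x] c[OF _ X y] by (intro SX.finprod_multf) auto
    finally show "e X (x \<otimes>\<^bsub>on_ob S X\<^esub> y) = e X x \<otimes>\<^bsub>on_ob S X\<^esub> e X y" .
  next
    fix X Y f y assume f: "f \<in> Hom C X Y" and y: "y \<in> sec S Y"
    note XY = Hom_ob[OF f]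
    interpret SX: comm_group "on_ob S X" by (rule presheaf_group[OF S' XY(1)])
    have "on_ar S f (e Y y) = finprod (on_ob S X) (\<lambda>i. on_ar S f (component (\<iota> i) Y (component (\<pi> i) Y y))) {..<n}"
      unfolding e_def using c[OF _ XY(2) y] by (intro hom_finprod presheaf_group[OF S'] XY presheaf_hom[OF S' f]) auto
    also have "\<dots> = e X (on_ar S f y)"
      unfolding e_def
    proof (rule SX.finprod_cong')
      fix i assume "i \<in> {..<n}"
      then have i: "i < n" by simp
      show "on_ar S f (component (\<iota> i) Y (component (\<pi> i) Y y)) = component (\<iota> i) X (component (\<pi> i) X (on_ar S f y))"
        using natural_eq[OF \<iota>[OF i] f natural_closed[OF \<pi>[OF i] XY(2) y]] natural_eq[OF \<pi>[OF i] f y] by simp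
    qed (use c[OF _ XY(1) presheaf_closed[OF S' f y]] in auto)
    finally show "e X (on_ar S f y) = on_ar S f (e Y y)" ..
  qed
  let ?e = "mod_arrow C S S e"
  have e: "?e \<in> Hom (ModCat C) S S" by (rule mod_arrow_Hom[OF category_axioms S' S' en])
  have IS: "Ide (ModCat C) S \<in> Hom (ModCat C) S S" using M.Ide_closed S' by simp
  have "?e = Ide (ModCat C) S"
  proof (rule M.coproduct_ext[OF S e IS])
    fix j assume "j \<in> {..<n}"
    then have j: "j < n" by simp
    show "?e \<bullet> \<iota> j = Ide (ModCat C) S \<bullet> \<iota> j"
      unfolding M.Ide_Comp[OF \<iota>1[OF j]]
    proof (rule ModCat_ext[OF Comp_ModCat_closed[OF category_axioms \<iota>1[OF j] e] \<iota>1[OF j]])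
      fix X x assume X: "X \<in> Ob C" and x: "x \<in> sec (F j) X"
      interpret SX: comm_group "on_ob S X" by (rule presheaf_group[OF S' X])
      note \<iota>x = natural_closed[OF \<iota>[OF j] X x]
      have "e X (component (\<iota> j) X x) = finprod (on_ob S X) (\<lambda>i. if j = i then component (\<iota> j) X x else \<one>\<^bsub>on_ob S X\<^esub>) {..<n}"
        unfolding e_def
      proof (rule SX.finprod_cong')
        fix i assume "i \<in> {..<n}"
        then have i: "i < n" by simp
        show "component (\<iota> i) X (component (\<pi> i) X (component (\<iota> j) X x)) = (if j = i then component (\<iota> j) X x else \<one>\<^bsub>on_ob S X\<^esub>)"
          using \<pi>\<iota>[OF i j X x] natural_one[OF \<iota>[OF i] Fi[OF i] S' X] by auto
      qed (use \<iota>x in auto)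
      also have "\<dots> = component (\<iota> j) X x" using j \<iota>x by (intro SX.finprod_singleton) auto
      finally show "component (?e \<bullet> \<iota> j) X x = component (\<iota> j) X x" using component_Comp[OF \<iota>1[OF j] e X x] X \<iota>x by simp
    qed
  qed
  then have "component ?e X x = component (Ide (ModCat C) S) X x" for X x by simp
  then have id: "e X x = x" if "X \<in> Ob C" "x \<in> sec S X" for X x using that by (metis Ide_ModCat component_mod_arrow)
  have vanish: "component (\<pi> i) Y y \<in> sec (F i) Y"
      "on_ar (F i) f (component (\<pi> i) Y y) = \<one>\<^bsub>on_ob (F i) X\<^esub>"
    if "i < n" "f \<in> Hom C X Y" "y \<in> sec S Y" "on_ar S f y = \<one>\<^bsub>on_ob S X\<^esub>" for X Y f y i
    using natural_closed[OF \<pi>[OF that(1)] Hom_ob(2)[OF that(2)] that(3)] natural_eq[OF \<pi>[OF that(1)] that(2,3)]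
      natural_one[OF \<pi>[OF that(1)] S' Fi[OF that(1)] Hom_ob(1)[OF that(2)]] that(4) by simp_all
  show "S \<in> flat_injective C \<Psi>"
  proof (rule flat_injectiveI[OF S' flat_presheafI _ \<Psi>])
    fix X Y f y assume f: "f \<in> Hom C X Y" and y: "y \<in> sec S Y" "on_ar S f y = \<one>\<^bsub>on_ob S X\<^esub>"
    note Y = Hom_ob(2)[OF f]
    obtain Z g where g: "g \<in> Hom C Y Z" "g \<star> f = hzero C X Z"
      and weak: "\<And>V l. l \<in> Hom C Y V \<Longrightarrow> l \<star> f = hzero C X V \<Longrightarrow> \<exists>l'\<in>Hom C Z V. l' \<star> g = l"
      by (rule right_seq[OF f]) blast
    note Z = Hom_ob(2)[OF g(1)]
    have "\<forall>i\<in>{..<n}. \<exists>z. z \<in> sec (F i) Z \<and> on_ar (F i) g z = component (\<pi> i) Y y"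
      using flat_presheaf_lift[OF Fi flat_injectiveD(2)[OF F] f g(1) weak vanish[OF _ f y]] by blast
    from bchoice[OF this] obtain z where z: "\<And>i. i < n \<Longrightarrow> z i \<in> sec (F i) Z"
      "\<And>i. i < n \<Longrightarrow> on_ar (F i) g (z i) = component (\<pi> i) Y y" by blast
    interpret SZ: comm_group "on_ob S Z" by (rule presheaf_group[OF S' Z])
    interpret SY: comm_group "on_ob S Y" by (rule presheaf_group[OF S' Y])
    have cz: "component (\<iota> i) Z (z i) \<in> sec S Z" if "i < n" for i
      using natural_closed[OF \<iota>[OF that] Z z(1)[OF that]] .
    have "on_ar S g (finprod (on_ob S Z) (\<lambda>i. component (\<iota> i) Z (z i)) {..<n}) =
        finprod (on_ob S Y) (\<lambda>i. on_ar S g (component (\<iota> i) Z (z i))) {..<n}"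
      using cz by (intro hom_finprod presheaf_group[OF S'] Y Z presheaf_hom[OF S' g(1)]) auto
    also have "\<dots> = e Y y"
      unfolding e_def by (rule SY.finprod_cong') (use natural_eq[OF \<iota> g(1) z(1)] z(2) c[OF _ Y y(1)] in auto)
    finally have "on_ar S g (finprod (on_ob S Z) (\<lambda>i. component (\<iota> i) Z (z i)) {..<n}) = y" using id[OF Y y(1)] by simp
    moreover have "finprod (on_ob S Z) (\<lambda>i. component (\<iota> i) Z (z i)) {..<n} \<in> sec S Z"
      using cz by (intro SZ.finprod_closed) auto
    ultimately show "\<exists>Z. \<exists>g\<in>Hom C Y Z. \<exists>z\<in>sec S Z. g \<star> f = hzero C X Z \<and> on_ar S g z = y" using g by blast
  next
    fix f X Y y assume f: "f \<in> \<Psi>" "f \<in> Hom C X Y" and y: "y \<in> sec S Y" "on_ar S f y = \<one>\<^bsub>on_ob S X\<^esub>"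
    note Y = Hom_ob(2)[OF f(2)]
    interpret SY: comm_group "on_ob S Y" by (rule presheaf_group[OF S' Y])
    have "component (\<iota> i) Y (component (\<pi> i) Y y) = \<one>\<^bsub>on_ob S Y\<^esub>" if i: "i < n" for i
      using flat_injectiveD(3)[OF F[OF i] f vanish[OF i f(2) y]] natural_one[OF \<iota>[OF i] Fi[OF i] S' Y] by simp
    then have "e Y y = \<one>\<^bsub>on_ob S Y\<^esub>" unfolding e_def by (intro SY.finprod_one_eqI) auto
    then show "y = \<one>\<^bsub>on_ob S Y\<^esub>" using id[OF Y y(1)] by simp
  qed
qed

end

section \<open>The category of compact objects\<close>

lemma compacts_simps [simp]:
  "Ob (compacts T) = {X. compact_object T X}" "Dom (compacts T) = Dom T" "Cod (compacts T) = Cod T"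
  "Ide (compacts T) = Ide T" "hadd (compacts T) = hadd T" "hzero (compacts T) = hzero T"
  "Comp (compacts T) = Comp T" by (simp_all add: compacts_def full_subcategory_def)

lemma Hom_compacts:
  "f \<in> Hom (compacts T) X Y \<longleftrightarrow> f \<in> Hom T X Y \<and> compact_object T X \<and> compact_object T Y"
  by (auto simp: compacts_def full_subcategory_def Hom_def)

lemma Hom_compacts_eq:
  "compact_object T X \<Longrightarrow> compact_object T Y \<Longrightarrow> Hom (compacts T) X Y = Hom T X Y" by (auto simp: Hom_compacts)

lemma hom_group_compacts:
  "compact_object T X \<Longrightarrow> compact_object T Y \<Longrightarrow> hom_group (compacts T) X Y = hom_group T X Y"
  by (simp add: hom_group_def Hom_compacts_eq)

lemma compact_object_ob: "compact_object T X \<Longrightarrow> X \<in> Ob T"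
  by (simp add: compact_object_def)

context additive_category
begin

text \<open>Zero objects are compact and biproducts of compact objects are compact, so the full
  subcategory inherits the additive structure.\<close>

lemma compacts_additive: "additive_category (compacts C)"
proof (intro additive_category.intro category.intro additive_category_axioms.intro)
  fix f assume "f \<in> Arr (compacts C)"
  then show "Dom (compacts C) f \<in> Ob (compacts C)" "Cod (compacts C) f \<in> Ob (compacts C)"
    by (auto simp: compacts_def full_subcategory_def)
next
  show "\<exists>Z. zero_object (compacts C) Z"
  proof -
    obtain Z where Z: "zero_object C Z" using zero_object by blast
    have "compact_object C Z" by (rule compact_zero[OF Z])
    then have "zero_object (compacts C) Z"
      using Z unfolding zero_object_def by (simp add: Hom_compacts_eq compact_object_ob)
    then show ?thesis by blast
  qed
  fix X Y assume "X \<in> Ob (compacts C)" "Y \<in> Ob (compacts C)"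
  then have X: "compact_object C X" and Y: "compact_object C Y" by auto
  obtain S i j p q where ij: "i \<in> Hom C X S" "j \<in> Hom C Y S" and pq: "p \<in> Hom C S X" "q \<in> Hom C S Y"
    and id: "hadd C (i \<star> p) (j \<star> q) = Ide C S" and cop: "is_coproduct C UNIV (case_bool X Y) S (case_bool i j)"
    by (rule biproduct[OF compact_object_ob[OF X] compact_object_ob[OF Y]])
  have S: "compact_object C S" by (rule compact_biproduct[OF X Y ij pq id])
  have XY: "compact_object C (case_bool X Y b)" for b using X Y by (cases b) auto
  have "is_coproduct (compacts C) UNIV (case_bool X Y) S (case_bool i j)"
    unfolding is_coproduct_def
  proof (intro conjI ballI allI impI)
    show "case_bool i j b \<in> Hom (compacts C) (case_bool X Y b) S" for b
      using ij X Y S by (cases b) (auto simp: Hom_compacts)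
    fix V f assume V: "V \<in> Ob (compacts C)" and f: "\<forall>b\<in>UNIV. f b \<in> Hom (compacts C) (case_bool X Y b) V"
    then have V': "compact_object C V" "V \<in> Ob C" and f': "\<forall>b. f b \<in> Hom C (case_bool X Y b) V"
      by (auto simp: Hom_compacts compact_object_ob)
    have "\<exists>!u. u \<in> Hom C S V \<and> (\<forall>b \<in> UNIV. u \<star> case_bool i j b = f b)" using cop V'(2) f' by (simp add: is_coproduct_def)
    then show "\<exists>!u. u \<in> Hom (compacts C) S V \<and> (\<forall>b\<in>UNIV. u \<star>\<^bsub>compacts C\<^esub> case_bool i j b = f b)"
      by (simp add: Hom_compacts_eq[OF S V'(1)])
  qed (use XY S in auto)
  then show "\<exists>S \<iota>. is_coproduct (compacts C) UNIV (case_bool X Y) S \<iota>" by blast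
next
  fix X Y assume "X \<in> Ob (compacts C)" "Y \<in> Ob (compacts C)"
  then show "comm_group (hom_group (compacts C) X Y)"
    using hom_group[of X Y] compact_object_ob[of C X] compact_object_ob[of C Y] hom_group_compacts[of C X Y] by simp
qed (auto simp: Hom_compacts Comp_closed Comp_assoc Comp_Ide Ide_Comp Ide_closed compact_object_ob
    Comp_hadd_left Comp_hadd_right)

end

context triangulated_category
begin

lemma compacts_exact_sequences:
  assumes "inaccessible_universe TYPE('a)" "compactly_generated T"
  shows "exact_sequences_category (compacts T)"
proof -
  interpret A: additive_category "compacts T" by (rule compacts_additive)
  show ?thesis
  proof
    show "inaccessible_universe TYPE('a)" by fact
    show "small (Hom (compacts T) X Y)" if "X \<in> Ob (compacts T)" "Y \<in> Ob (compacts T)" for X Y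
      using compactly_generatedD(2)[OF assms(2)] that by (simp add: Hom_compacts_eq compact_object_ob)
  next
    fix f X Y assume "f \<in> Hom (compacts T) X Y"
    then have f: "compact_object T X" "compact_object T Y" "f \<in> Hom T X Y" by (auto simp: Hom_compacts)
    obtain Z g where g: "compact_object T Z" "g \<in> Hom T Y Z" "g \<star> f = hzero T X Z"
      "\<And>V l. l \<in> Hom T Y V \<Longrightarrow> l \<star> f = hzero T X V \<Longrightarrow> \<exists>l'\<in>Hom T Z V. l' \<star> g = l"
      "\<And>W k. k \<in> Hom T W Y \<Longrightarrow> g \<star> k = hzero T W Z \<Longrightarrow> \<exists>k'\<in>Hom T W X. f \<star> k' = k"
      by (rule compact_right_sequence[OF assms(2) f]) blast
    show "\<exists>Z. \<exists>g\<in>Hom (compacts T) Y Z. g \<star>\<^bsub>compacts T\<^esub> f = hzero (compacts T) X Z \<and>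
      (\<forall>V. \<forall>l\<in>Hom (compacts T) Y V. l \<star>\<^bsub>compacts T\<^esub> f = hzero (compacts T) X V \<longrightarrow>
        (\<exists>l'\<in>Hom (compacts T) Z V. l' \<star>\<^bsub>compacts T\<^esub> g = l)) \<and>
      (\<forall>W. \<forall>k\<in>Hom (compacts T) W Y. g \<star>\<^bsub>compacts T\<^esub> k = hzero (compacts T) W Z \<longrightarrow>
        (\<exists>k'\<in>Hom (compacts T) W X. f \<star>\<^bsub>compacts T\<^esub> k' = k))"
    proof (rule exI[of _ Z], rule bexI[of _ g], intro conjI allI ballI impI)
      show "\<exists>l'\<in>Hom (compacts T) Z V. l' \<star>\<^bsub>compacts T\<^esub> g = l"
        if "l \<in> Hom (compacts T) Y V" "l \<star>\<^bsub>compacts T\<^esub> f = hzero (compacts T) X V" for V l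
        using g(4)[of l V] that g(1) by (auto simp: Hom_compacts)
      show "\<exists>k'\<in>Hom (compacts T) W X. f \<star>\<^bsub>compacts T\<^esub> k' = k"
        if "k \<in> Hom (compacts T) W Y" "g \<star>\<^bsub>compacts T\<^esub> k = hzero (compacts T) W Z" for W k
        using g(5)[of k W] that f(1) by (auto simp: Hom_compacts)
    qed (use f g(1-3) in \<open>simp_all add: Hom_compacts\<close>)
    obtain W h where h: "compact_object T W" "h \<in> Hom T W X" "f \<star> h = hzero T W Y"
      "\<And>V l. l \<in> Hom T X V \<Longrightarrow> l \<star> h = hzero T W V \<Longrightarrow> \<exists>l'\<in>Hom T Y V. l' \<star> f = l"
      "\<And>V k. k \<in> Hom T V X \<Longrightarrow> f \<star> k = hzero T V Y \<Longrightarrow> \<exists>k'\<in>Hom T V W. h \<star> k' = k"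
      by (rule compact_left_sequence[OF assms(2) f]) blast
    show "\<exists>W. \<exists>h\<in>Hom (compacts T) W X. f \<star>\<^bsub>compacts T\<^esub> h = hzero (compacts T) W Y \<and>
      (\<forall>V. \<forall>l\<in>Hom (compacts T) X V. l \<star>\<^bsub>compacts T\<^esub> h = hzero (compacts T) W V \<longrightarrow>
        (\<exists>l'\<in>Hom (compacts T) Y V. l' \<star>\<^bsub>compacts T\<^esub> f = l)) \<and>
      (\<forall>V. \<forall>k\<in>Hom (compacts T) V X. f \<star>\<^bsub>compacts T\<^esub> k = hzero (compacts T) V Y \<longrightarrow>
        (\<exists>k'\<in>Hom (compacts T) V W. h \<star>\<^bsub>compacts T\<^esub> k' = k))"
    proof (rule exI[of _ W], rule bexI[of _ h], intro conjI allI ballI impI)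
      show "\<exists>l'\<in>Hom (compacts T) Y V. l' \<star>\<^bsub>compacts T\<^esub> f = l"
        if "l \<in> Hom (compacts T) X V" "l \<star>\<^bsub>compacts T\<^esub> h = hzero (compacts T) W V" for V l
        using h(4)[of l V] that f(2) by (auto simp: Hom_compacts)
      show "\<exists>k'\<in>Hom (compacts T) V W. h \<star>\<^bsub>compacts T\<^esub> k' = k"
        if "k \<in> Hom (compacts T) V X" "f \<star>\<^bsub>compacts T\<^esub> k = hzero (compacts T) V Y" for V k
        using h(5)[of k V] that h(1) by (auto simp: Hom_compacts)
    qed (use f h(1-3) in \<open>simp_all add: Hom_compacts\<close>)
  qed
qed

end


section \<open>Flat functors and representability of their character duals\<close>

text \<open>Flatness for covariant functors: a relation imposed by \<open>f\<close> is witnessed by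
  an arrow before \<open>f\<close> instead of after it.\<close>

definition flat_covariant :: "('o, 'a, 'z) ab_category_scheme \<Rightarrow> ('o, 'a, 'u) module_fctr \<Rightarrow> bool"
  where "flat_covariant C E \<longleftrightarrow> (\<forall>X Y. \<forall>f\<in>Hom C X Y. \<forall>a\<in>sec E X. on_ar E f a = \<one>\<^bsub>on_ob E Y\<^esub> \<longrightarrow>
    (\<exists>W. \<exists>h\<in>Hom C W X. \<exists>b\<in>sec E W. f \<star>\<^bsub>C\<^esub> h = hzero C W Y \<and> on_ar E h b = a))"

text \<open>In the application \<open>E\<close> is a flat presheaf on the compact objects of the
  other category, composed with the duality.\<close>

locale flat_functional = triangulated_category T
  for T :: "('o, 'a, 'z) tri_category_scheme" (structure) +
  fixes E :: "('o, 'a, 'a) module_fctr"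
  assumes universe: "inaccessible_universe TYPE('a)"
    and cg: "compactly_generated T"
    and E: "covariant_module (compacts T) E"
    and E_flat: "flat_covariant (compacts T) E"
begin

abbreviation Char :: "'o \<Rightarrow> ('a \<Rightarrow> rat set) monoid"
  where "Char C \<equiv> character_group (on_ob E C)"

abbreviation pl :: "'a \<Rightarrow> ('a \<Rightarrow> rat set) \<Rightarrow> 'a \<Rightarrow> rat set"
  where "pl \<equiv> pull (compacts T) E"

text \<open>\<open>functionals Y\<close> consists of the natural transformations from \<open>Hom T _ Y\<close>, restricted to compact
  objects, to the character dual of \<open>E\<close>.\<close>

definition functionals :: "'o \<Rightarrow> ('o \<Rightarrow> 'a \<Rightarrow> 'a \<Rightarrow> rat set) set"
  where "functionals Y = {\<beta> \<in> (\<Pi>\<^sub>E C\<in>{C. compact_object T C}. \<Pi>\<^sub>E g\<in>Hom T C Y. carrier (Char C)).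
    (\<forall>C g g'. compact_object T C \<longrightarrow> g \<in> Hom T C Y \<longrightarrow> g' \<in> Hom T C Y \<longrightarrow>
      \<beta> C (hadd T g g') = \<beta> C g \<otimes>\<^bsub>Char C\<^esub> \<beta> C g') \<and>
    (\<forall>B C f g. f \<in> Hom (compacts T) B C \<longrightarrow> g \<in> Hom T C Y \<longrightarrow> \<beta> B (g \<star> f) = pl f (\<beta> C g))}"

definition precompose :: "('o \<Rightarrow> 'a \<Rightarrow> 'a \<Rightarrow> rat set) \<Rightarrow> 'a \<Rightarrow> ('o \<Rightarrow> 'a \<Rightarrow> 'a \<Rightarrow> rat set)" (infixl \<open>\<odot>\<close> 70)
  where "\<beta> \<odot> f = (\<lambda>C\<in>{C. compact_object T C}. \<lambda>g\<in>Hom T C (Dom T f). \<beta> C (f \<star> g))"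

lemma
  assumes "\<beta> \<in> functionals Y"
  shows functional_closed: "compact_object T C \<Longrightarrow> g \<in> Hom T C Y \<Longrightarrow> \<beta> C g \<in> carrier (Char C)"
    and functional_hadd: "compact_object T C \<Longrightarrow> g \<in> Hom T C Y \<Longrightarrow> g' \<in> Hom T C Y \<Longrightarrow>
      \<beta> C (hadd T g g') = \<beta> C g \<otimes>\<^bsub>Char C\<^esub> \<beta> C g'"
    and functional_natural: "compact_object T B \<Longrightarrow> compact_object T C \<Longrightarrow> f \<in> Hom T B C \<Longrightarrow> g \<in> Hom T C Y \<Longrightarrow>
      \<beta> B (g \<star> f) = pl f (\<beta> C g)"
proof -
  have "\<beta> \<in> (\<Pi>\<^sub>E C\<in>{C. compact_object T C}. \<Pi>\<^sub>E g\<in>Hom T C Y. carrier (Char C))" using assms by (simp add: functionals_def)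
  then show "compact_object T C \<Longrightarrow> g \<in> Hom T C Y \<Longrightarrow> \<beta> C g \<in> carrier (Char C)" by (auto dest!: PiE_mem)
qed (use assms in \<open>simp_all add: functionals_def Hom_compacts\<close>)

lemma functionalsI:
  assumes "\<And>C g. compact_object T C \<Longrightarrow> g \<in> Hom T C Y \<Longrightarrow> \<beta> C g \<in> carrier (Char C)"
    and "\<And>C g g'. compact_object T C \<Longrightarrow> g \<in> Hom T C Y \<Longrightarrow> g' \<in> Hom T C Y \<Longrightarrow>
      \<beta> C (hadd T g g') = \<beta> C g \<otimes>\<^bsub>Char C\<^esub> \<beta> C g'"
    and "\<And>B C f g. compact_object T B \<Longrightarrow> compact_object T C \<Longrightarrow> f \<in> Hom T B C \<Longrightarrow> g \<in> Hom T C Y \<Longrightarrow>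
      \<beta> B (g \<star> f) = pl f (\<beta> C g)"
  shows "(\<lambda>C\<in>{C. compact_object T C}. \<lambda>g\<in>Hom T C Y. \<beta> C g) \<in> functionals Y"
proof -
  let ?\<beta> = "\<lambda>C\<in>{C. compact_object T C}. \<lambda>g\<in>Hom T C Y. \<beta> C g"
  have val: "?\<beta> C g = \<beta> C g" if "compact_object T C" "g \<in> Hom T C Y" for C g using that by simp
  have 1: "?\<beta> \<in> (\<Pi>\<^sub>E C\<in>{C. compact_object T C}. \<Pi>\<^sub>E g\<in>Hom T C Y. carrier (Char C))" using assms(1) by simp
  have 2: "?\<beta> C (hadd T g g') = ?\<beta> C g \<otimes>\<^bsub>Char C\<^esub> ?\<beta> C g'"
    if "compact_object T C" "g \<in> Hom T C Y" "g' \<in> Hom T C Y" for C g g'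
    unfolding val[OF that(1,2)] val[OF that(1,3)] val[OF that(1) hadd_closed[OF that(2,3)]] by (rule assms(2)[OF that])
  have 3: "?\<beta> B (g \<star> f) = pl f (?\<beta> C g)"
    if "compact_object T B" "compact_object T C" "f \<in> Hom T B C" "g \<in> Hom T C Y" for B C f g
    unfolding val[OF that(2,4)] val[OF that(1) Comp_closed[OF that(3,4)]] by (rule assms(3)[OF that])
  show ?thesis
    unfolding functionals_def Hom_compacts
  proof (intro CollectI conjI allI impI, rule 1)
    fix B C f g assume "f \<in> Hom T B C \<and> compact_object T B \<and> compact_object T C" "g \<in> Hom T C Y"
    then show "?\<beta> B (g \<star> f) = pl f (?\<beta> C g)" by (intro 3) auto
  qed (rule 2)
qed

lemma functional_eqI:
  assumes "\<beta> \<in> functionals Y" "\<gamma> \<in> functionals Y"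
    "\<And>C g. compact_object T C \<Longrightarrow> g \<in> Hom T C Y \<Longrightarrow> \<beta> C g = \<gamma> C g"
  shows "\<beta> = \<gamma>"
proof (rule PiE_ext)
  show "\<beta> \<in> (\<Pi>\<^sub>E C\<in>{C. compact_object T C}. \<Pi>\<^sub>E g\<in>Hom T C Y. carrier (Char C))"
    "\<gamma> \<in> (\<Pi>\<^sub>E C\<in>{C. compact_object T C}. \<Pi>\<^sub>E g\<in>Hom T C Y. carrier (Char C))" using assms by (auto simp: functionals_def)
  then show "\<beta> C = \<gamma> C" if "C \<in> {C. compact_object T C}" for C
    using assms(3) that by (intro PiE_ext[of _ "Hom T C Y" "\<lambda>_. carrier (Char C)"]) (auto dest: PiE_mem)
qed

lemma precompose_apply:
  "f \<in> Hom T X Y \<Longrightarrow> compact_object T C \<Longrightarrow> g \<in> Hom T C X \<Longrightarrow> (\<beta> \<odot> f) C g = \<beta> C (f \<star> g)"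
  by (simp add: precompose_def Hom_DomCod)

lemma precompose_closed:
  assumes f: "f \<in> Hom T X Y" and \<beta>: "\<beta> \<in> functionals Y"
  shows "\<beta> \<odot> f \<in> functionals X"
proof -
  have "(\<lambda>C\<in>{C. compact_object T C}. \<lambda>g\<in>Hom T C X. \<beta> C (f \<star> g)) \<in> functionals X"
  proof (rule functionalsI)
    show "\<beta> C (f \<star> g) \<in> carrier (Char C)" if "compact_object T C" "g \<in> Hom T C X" for C g
      using functional_closed[OF \<beta> that(1) Comp_closed[OF that(2) f]] .
    show "\<beta> C (f \<star> hadd T g g') = \<beta> C (f \<star> g) \<otimes>\<^bsub>Char C\<^esub> \<beta> C (f \<star> g')"
      if "compact_object T C" "g \<in> Hom T C X" "g' \<in> Hom T C X" for C g g'
      using Comp_hadd_right[OF that(2,3) f] functional_hadd[OF \<beta> that(1) Comp_closed[OF that(2) f] Comp_closed[OF that(3) f]] by simp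
    show "\<beta> B (f \<star> (g \<star> h)) = pl h (\<beta> C (f \<star> g))"
      if "compact_object T B" "compact_object T C" "h \<in> Hom T B C" "g \<in> Hom T C X" for B C h g
      using Comp_assoc[OF that(3,4) f] functional_natural[OF \<beta> that(1-3) Comp_closed[OF that(4) f]] by simp
  qed
  then show ?thesis using f by (simp add: precompose_def Hom_DomCod)
qed

lemma precompose_Comp:
  assumes f: "f \<in> Hom T X Y" and g: "g \<in> Hom T Y Z" and \<beta>: "\<beta> \<in> functionals Z"
  shows "\<beta> \<odot> (g \<star> f) = \<beta> \<odot> g \<odot> f"
proof (rule functional_eqI[OF precompose_closed[OF Comp_closed[OF f g] \<beta>] precompose_closed[OF f precompose_closed[OF g \<beta>]]])
  fix C c assume C: "compact_object T C" "c \<in> Hom T C X"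
  show "(\<beta> \<odot> (g \<star> f)) C c = (\<beta> \<odot> g \<odot> f) C c"
    using precompose_apply[OF Comp_closed[OF f g] C] precompose_apply[OF f C] precompose_apply[OF g C(1) Comp_closed[OF C(2) f]]
      Comp_assoc[OF C(2) f g] by simp
qed

lemma precompose_Ide:
  assumes X: "X \<in> Ob T" and \<beta>: "\<beta> \<in> functionals X"
  shows "\<beta> \<odot> Ide T X = \<beta>"
  by (rule functional_eqI[OF precompose_closed[OF Ide_closed[OF X] \<beta>] \<beta>])
    (use precompose_apply[OF Ide_closed[OF X]] Ide_Comp in simp)

interpretation A: exact_sequences_category "compacts T"
  by (rule compacts_exact_sequences[OF universe cg])

lemma Char_group: "compact_object T C \<Longrightarrow> comm_group (Char C)"
  by (rule comm_group_character_group[OF covariant_group[OF E]]) simp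

lemma pl_closed: "compact_object T B \<Longrightarrow> compact_object T C \<Longrightarrow> f \<in> Hom T B C \<Longrightarrow> v \<in> carrier (Char C) \<Longrightarrow>
    pl f v \<in> carrier (Char B)"
  by (rule pull_closed[OF E A.category_axioms]) (auto simp: Hom_compacts)

lemma pl_apply: "compact_object T B \<Longrightarrow> compact_object T C \<Longrightarrow> f \<in> Hom T B C \<Longrightarrow> a \<in> sec E B \<Longrightarrow>
    pl f v a = v (on_ar E f a)"
  by (rule pull_apply) (auto simp: Hom_compacts)

lemma E_closed: "compact_object T B \<Longrightarrow> compact_object T C \<Longrightarrow> f \<in> Hom T B C \<Longrightarrow> a \<in> sec E B \<Longrightarrow>
    on_ar E f a \<in> sec E C"
  by (rule covariant_closed[OF E]) (auto simp: Hom_compacts)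

lemma E_Comp: "compact_object T B \<Longrightarrow> compact_object T C \<Longrightarrow> compact_object T D \<Longrightarrow> f \<in> Hom T B C \<Longrightarrow> g \<in> Hom T C D \<Longrightarrow>
    a \<in> sec E B \<Longrightarrow> on_ar E (g \<star> f) a = on_ar E g (on_ar E f a)"
  using covariant_Comp[OF E, of f B C g D a] by (simp add: Hom_compacts)

lemma E_hadd: "compact_object T B \<Longrightarrow> compact_object T C \<Longrightarrow> f \<in> Hom T B C \<Longrightarrow> g \<in> Hom T B C \<Longrightarrow>
    a \<in> sec E B \<Longrightarrow> on_ar E (hadd T f g) a = on_ar E f a \<otimes>\<^bsub>on_ob E C\<^esub> on_ar E g a"
  using covariant_hadd[OF E, of f B C g a] by (simp add: Hom_compacts)

lemma E_mult: "compact_object T B \<Longrightarrow> compact_object T C \<Longrightarrow> f \<in> Hom T B C \<Longrightarrow> a \<in> sec E B \<Longrightarrow>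
    b \<in> sec E B \<Longrightarrow> on_ar E f (a \<otimes>\<^bsub>on_ob E B\<^esub> b) = on_ar E f a \<otimes>\<^bsub>on_ob E C\<^esub> on_ar E f b"
  using covariant_mult[OF E, of f B C a b] by (simp add: Hom_compacts)

lemma E_Ide: "compact_object T C \<Longrightarrow> a \<in> sec E C \<Longrightarrow> on_ar E (Ide T C) a = a"
  using covariant_Ide[OF E, of C a] by simp

lemma E_group: "compact_object T C \<Longrightarrow> comm_group (on_ob E C)"
  using covariant_group[OF E, of C] by simp

lemma E_hzero:
  assumes "compact_object T B" "compact_object T C" "a \<in> sec E B"
  shows "on_ar E (hzero T B C) a = \<one>\<^bsub>on_ob E C\<^esub>"
proof -
  interpret comm_group "on_ob E C" by (rule E_group[OF assms(2)])
  have z: "hzero T B C \<in> Hom T B C" using assms by (simp add: compact_object_ob)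
  have "on_ar E (hzero T B C) a \<otimes>\<^bsub>on_ob E C\<^esub> on_ar E (hzero T B C) a = on_ar E (hzero T B C) a"
    using E_hadd[OF assms(1,2) z z assms(3)] hadd_hzero[OF z] by simp
  then show ?thesis using E_closed[OF assms(1,2) z assms(3)] by simp
qed

lemma pl_mult:
  assumes "compact_object T B" "compact_object T C" "f \<in> Hom T B C" "v \<in> carrier (Char C)" "w \<in> carrier (Char C)"
  shows "pl f (v \<otimes>\<^bsub>Char C\<^esub> w) = pl f v \<otimes>\<^bsub>Char B\<^esub> pl f w"
proof (rule character_eqI)
  interpret CC: comm_group "Char C" by (rule Char_group[OF assms(2)])
  interpret CB: comm_group "Char B" by (rule Char_group[OF assms(1)])
  show "pl f (v \<otimes>\<^bsub>Char C\<^esub> w) \<in> carrier (Char B)" by (rule pl_closed[OF assms(1-3) CC.m_closed[OF assms(4,5)]])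
  show "pl f v \<otimes>\<^bsub>Char B\<^esub> pl f w \<in> carrier (Char B)"
    by (rule CB.m_closed[OF pl_closed[OF assms(1-4)] pl_closed[OF assms(1-3,5)]])
  show "pl f (v \<otimes>\<^bsub>Char C\<^esub> w) a = (pl f v \<otimes>\<^bsub>Char B\<^esub> pl f w) a" if "a \<in> sec E B" for a
    using E_closed[OF assms(1-3) that] that by (simp add: pl_apply[OF assms(1-3)] mult_character_group)
qed

lemma pl_hom: "compact_object T B \<Longrightarrow> compact_object T C \<Longrightarrow> f \<in> Hom T B C \<Longrightarrow> group_hom (Char C) (Char B) (pl f)"
  using Char_group[of B] Char_group[of C] pl_closed pl_mult
  by (intro group_hom.intro comm_group.axioms(2)) (auto simp: group_hom_axioms_def hom_def)

lemma pl_hadd: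
  assumes "compact_object T B" "compact_object T C" "f \<in> Hom T B C" "g \<in> Hom T B C" "v \<in> carrier (Char C)"
  shows "pl (hadd T f g) v = pl f v \<otimes>\<^bsub>Char B\<^esub> pl g v"
proof (rule character_eqI)
  interpret CB: comm_group "Char B" by (rule Char_group[OF assms(1)])
  show "pl (hadd T f g) v \<in> carrier (Char B)" by (rule pl_closed[OF assms(1,2) hadd_closed[OF assms(3,4)] assms(5)])
  show "pl f v \<otimes>\<^bsub>Char B\<^esub> pl g v \<in> carrier (Char B)"
    by (rule CB.m_closed[OF pl_closed[OF assms(1-3,5)] pl_closed[OF assms(1,2,4,5)]])
  show "pl (hadd T f g) v a = (pl f v \<otimes>\<^bsub>Char B\<^esub> pl g v) a" if a: "a \<in> sec E B" for a
    using a E_hadd[OF assms(1-4) a] character_mult[OF assms(5) E_closed[OF assms(1-3) a] E_closed[OF assms(1,2,4) a]]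
    by (simp add: pl_apply[OF assms(1,2) hadd_closed[OF assms(3,4)]] pl_apply[OF assms(1-3)] pl_apply[OF assms(1,2,4)]
        mult_character_group)
qed

lemma pl_Comp:
  assumes "compact_object T B" "compact_object T C" "compact_object T D" "f \<in> Hom T B C" "g \<in> Hom T C D" "v \<in> carrier (Char D)"
  shows "pl (g \<star> f) v = pl f (pl g v)"
proof (rule character_eqI)
  show "pl (g \<star> f) v \<in> carrier (Char B)" by (rule pl_closed[OF assms(1,3) Comp_closed[OF assms(4,5)] assms(6)])
  show "pl f (pl g v) \<in> carrier (Char B)" by (rule pl_closed[OF assms(1,2,4) pl_closed[OF assms(2,3,5,6)]])
  show "pl (g \<star> f) v a = pl f (pl g v) a" if a: "a \<in> sec E B" for a
    using a E_Comp[OF assms(1-5) a] E_closed[OF assms(1,2,4) a]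
    by (simp add: pl_apply[OF assms(1,3) Comp_closed[OF assms(4,5)]] pl_apply[OF assms(1,2,4)] pl_apply[OF assms(2,3,5)])
qed

lemma pl_hzero:
  assumes "compact_object T B" "compact_object T C" "v \<in> carrier (Char C)"
  shows "pl (hzero T B C) v = \<one>\<^bsub>Char B\<^esub>"
proof (rule character_eqI)
  interpret CB: comm_group "Char B" by (rule Char_group[OF assms(1)])
  have z: "hzero T B C \<in> Hom T B C" using assms by (simp add: compact_object_ob)
  show "pl (hzero T B C) v \<in> carrier (Char B)" by (rule pl_closed[OF assms(1,2) z assms(3)])
  show "\<one>\<^bsub>Char B\<^esub> \<in> carrier (Char B)" by simp
  show "pl (hzero T B C) v a = \<one>\<^bsub>Char B\<^esub> a" if a: "a \<in> sec E B" for a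
    using a E_hzero[OF assms(1,2) a] character_one[OF comm_group.axioms(2)[OF E_group[OF assms(2)]] assms(3)]
    by (simp add: pl_apply[OF assms(1,2) z] one_character_group)
qed

lemma pl_Ide:
  assumes C: "compact_object T C" and v: "v \<in> carrier (Char C)"
  shows "pl (Ide T C) v = v"
proof (rule character_eqI[OF _ v])
  have i: "Ide T C \<in> Hom T C C"
    using Ide_closed[OF compact_object_ob[OF C]] .
  show "pl (Ide T C) v \<in> carrier (Char C)" by (rule pl_closed[OF C C i v])
  show "pl (Ide T C) v a = v a" if "a \<in> sec E C" for a using pl_apply[OF C C i that] E_Ide[OF C that] by simp
qed

lemma functional_hzero:
  assumes \<beta>: "\<beta> \<in> functionals Y" and C: "compact_object T C" and Y: "Y \<in> Ob T"
  shows "\<beta> C (hzero T C Y) = \<one>\<^bsub>Char C\<^esub>"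
proof -
  interpret comm_group "Char C" by (rule Char_group[OF C])
  have z: "hzero T C Y \<in> Hom T C Y" using C Y by (simp add: compact_object_ob)
  have "\<beta> C (hzero T C Y) \<otimes>\<^bsub>Char C\<^esub> \<beta> C (hzero T C Y) = \<beta> C (hzero T C Y)"
    using functional_hadd[OF \<beta> C z z] hadd_hzero[OF z] by simp
  then show ?thesis using functional_closed[OF \<beta> C z] by simp
qed

lemma yoneda_functional:
  assumes D: "compact_object T D" and v: "v \<in> carrier (Char D)"
  shows "(\<lambda>C\<in>{C. compact_object T C}. \<lambda>g\<in>Hom T C D. pl g v) \<in> functionals D"
  by (rule functionalsI) (use pl_closed[OF _ D _ v] pl_hadd[OF _ D _ _ v] pl_Comp[OF _ _ D _ _ v] in simp_all)

lemma functional_yoneda: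
  assumes "\<beta> \<in> functionals D" "compact_object T D" "compact_object T C" "g \<in> Hom T C D"
  shows "\<beta> C g = pl g (\<beta> D (Ide T D))"
  using functional_natural[OF assms(1,3,2,4) Ide_closed[OF compact_object_ob[OF assms(2)]]] Ide_Comp[OF assms(4)] by simp

text \<open>By Yoneda a functional on a compact object is determined by its value at the identity, a
  character of a small group.\<close>

lemma functionals_small:
  assumes D: "compact_object T D"
  shows "small_in TYPE('a) (functionals D)"
proof (rule small_in_inj_on)
  show "small_in TYPE('a) (carrier (Char D))"
    using small_character_group[OF universe] covariant_small[OF E, of D] D by (simp add: small_iff_small_in)
  show "inj_on (\<lambda>\<beta>. \<beta> D (Ide T D)) (functionals D)"
  proof (rule inj_onI)
    fix \<beta> \<gamma> assume \<beta>: "\<beta> \<in> functionals D" "\<gamma> \<in> functionals D" "\<beta> D (Ide T D) = \<gamma> D (Ide T D)"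
    show "\<beta> = \<gamma>"
      by (rule functional_eqI[OF \<beta>(1,2)]) (use functional_yoneda[OF \<beta>(1) D] functional_yoneda[OF \<beta>(2) D] \<beta>(3) in simp)
  qed
  show "(\<lambda>\<beta>. \<beta> D (Ide T D)) ` functionals D \<subseteq> carrier (Char D)"
    using functional_closed[OF _ D Ide_closed[OF compact_object_ob[OF D]]] by blast
qed

text \<open>An arrow from a compact object into a coproduct is a finite sum, so additivity leaves no
  freedom beyond the components.\<close>

lemma functionals_coproduct_ext:
  assumes I: "small (I :: 'a set)" and S: "is_coproduct T I F S \<iota>" and s: "s \<in> functionals S" and t: "t \<in> functionals S"
    and eq: "\<And>i. i \<in> I \<Longrightarrow> s \<odot> \<iota> i = t \<odot> \<iota> i"
  shows "s = t"
proof (rule functional_eqI[OF s t])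
  fix C g assume C: "compact_object T C" and g: "g \<in> Hom T C S"
  have C': "C \<in> Ob T" by (rule compact_object_ob[OF C])
  have "g \<in> coproduct_sums T I F S \<iota> C" by (rule compact_factors[OF C I S g])
  then show "s C g = t C g"
  proof induction
    case zero
    then show ?case using functional_hzero[OF s C] functional_hzero[OF t C] coproduct_ob(1)[OF S] by simp
  next
    case (add g i c)
    note \<iota> = coproduct_ob(3)[OF S add(2)]
    have "s C (\<iota> i \<star> c) = t C (\<iota> i \<star> c)"
      using precompose_apply[OF \<iota> C add(3), of s] precompose_apply[OF \<iota> C add(3), of t] eq[OF add(2)] by simp
    then show ?case
      using functional_hadd[OF s C coproduct_sums_closed[OF S C' add(1)] Comp_closed[OF add(3) \<iota>]]
        functional_hadd[OF t C coproduct_sums_closed[OF S C' add(1)] Comp_closed[OF add(3) \<iota>]] add(4) by simp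
  qed
qed

text \<open>The value at an arrow from a compact object is a product over its nonzero components,
  finite by compactness. Additivity and naturality are checked after enlarging the supports to a
  common finite index set.\<close>

lemma functionals_coproduct:
  assumes I: "small (I :: 'a set)" and S: "is_coproduct T I F S \<iota>" and x: "\<And>i. i \<in> I \<Longrightarrow> x i \<in> functionals (F i)"
  shows "\<exists>s\<in>functionals S. \<forall>i\<in>I. s \<odot> \<iota> i = x i"
proof -
  have "\<forall>i\<in>I. \<exists>p. p \<in> Hom T S (F i) \<and> p \<star> \<iota> i = Ide T (F i) \<and> (\<forall>j\<in>I. j \<noteq> i \<longrightarrow> p \<star> \<iota> j = hzero T (F j) (F i))"
    using coproduct_projection[OF S] by metis
  from bchoice[OF this] obtain p where p: "\<And>i. i \<in> I \<Longrightarrow> p i \<in> Hom T S (F i)" "\<And>i. i \<in> I \<Longrightarrow> p i \<star> \<iota> i = Ide T (F i)"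
    "\<And>i j. i \<in> I \<Longrightarrow> j \<in> I \<Longrightarrow> j \<noteq> i \<Longrightarrow> p i \<star> \<iota> j = hzero T (F j) (F i)" by blast
  define supp where "supp = (\<lambda>C g. {i \<in> I. p i \<star> g \<noteq> hzero T C (F i)})"
  have S_ob: "S \<in> Ob T" and F_ob: "\<And>i. i \<in> I \<Longrightarrow> F i \<in> Ob T" and \<iota>: "\<And>i. i \<in> I \<Longrightarrow> \<iota> i \<in> Hom T (F i) S"
    using coproduct_ob[OF S] by auto
  have pg: "p i \<star> g \<in> Hom T C (F i)" if "i \<in> I" "g \<in> Hom T C S" for i g C
    using Comp_closed[OF that(2) p(1)[OF that(1)]] .
  have supp_fin: "finite (supp C g)" if C: "compact_object T C" and g: "g \<in> Hom T C S" for C g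
    unfolding supp_def
    by (rule coproduct_sums_support[OF S compact_object_ob[OF C] compact_factors[OF C I S g] p])
  define s where "s = (\<lambda>C g. finprod (Char C) (\<lambda>i. x i C (p i \<star> g)) (supp C g))"
  have xpg: "x i C (p i \<star> g) \<in> carrier (Char C)" if "i \<in> I" "compact_object T C" "g \<in> Hom T C S" for i C g
    using functional_closed[OF x[OF that(1)] that(2) pg[OF that(1,3)]] .
  have s_eq: "s C g = finprod (Char C) (\<lambda>i. x i C (p i \<star> g)) J"
    if C: "compact_object T C" and g: "g \<in> Hom T C S" and J: "finite J" "supp C g \<subseteq> J" "J \<subseteq> I" for C g J
  proof -
    interpret CC: comm_group "Char C" by (rule Char_group[OF C])
    show ?thesis
      unfolding s_def
    proof (rule CC.finprod_mono_neutral_cong_left[OF J(1,2)])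
      show "(\<lambda>i. x i C (p i \<star> g)) \<in> J \<rightarrow> carrier (Char C)" using xpg C g J(3) by blast
      fix i assume "i \<in> J - supp C g"
      then have i: "i \<in> I" "p i \<star> g = hzero T C (F i)" using J(3) by (auto simp: supp_def)
      then show "x i C (p i \<star> g) = \<one>\<^bsub>Char C\<^esub>" using functional_hzero[OF x[OF i(1)] C F_ob[OF i(1)]] by simp
    qed simp
  qed
  have suppI: "supp C g \<subseteq> I" for C g by (auto simp: supp_def)
  let ?s = "\<lambda>C\<in>{C. compact_object T C}. \<lambda>g\<in>Hom T C S. s C g"
  have s: "?s \<in> functionals S"
  proof (rule functionalsI)
    fix C g assume C: "compact_object T C" and g: "g \<in> Hom T C S"
    interpret CC: comm_group "Char C" by (rule Char_group[OF C])
    show "s C g \<in> carrier (Char C)" unfolding s_def using xpg[OF _ C g] suppI by (intro CC.finprod_closed) blast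
    fix g' assume g': "g' \<in> Hom T C S"
    let ?J = "supp C g \<union> supp C g'"
    have J: "finite ?J" "?J \<subseteq> I" using supp_fin[OF C g] supp_fin[OF C g'] suppI by auto
    have pgg: "p i \<star> hadd T g g' = hadd T (p i \<star> g) (p i \<star> g')" if "i \<in> I" for i
      using Comp_hadd_right[OF g g' p(1)[OF that]] .
    have "supp C (hadd T g g') \<subseteq> ?J"
    proof
      fix i assume i: "i \<in> supp C (hadd T g g')"
      then have iI: "i \<in> I" using suppI by blast
      show "i \<in> ?J"
      proof (rule ccontr)
        assume "i \<notin> ?J"
        then have "p i \<star> g = hzero T C (F i)" "p i \<star> g' = hzero T C (F i)" using iI by (auto simp: supp_def)
        then show False
          using i pgg[OF iI] hadd_hzero(1)[OF hzero_closed[OF compact_object_ob[OF C] F_ob[OF iI]]] by (simp add: supp_def)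
      qed
    qed
    then have "s C (hadd T g g') = finprod (Char C) (\<lambda>i. x i C (p i \<star> hadd T g g')) ?J"
      by (rule s_eq[OF C hadd_closed[OF g g'] J(1) _ J(2)])
    also have "\<dots> = finprod (Char C) (\<lambda>i. x i C (p i \<star> g) \<otimes>\<^bsub>Char C\<^esub> x i C (p i \<star> g')) ?J"
    proof (rule CC.finprod_cong')
      fix i assume "i \<in> ?J"
      then have i: "i \<in> I" using J(2) by blast
      show "x i C (p i \<star> hadd T g g') = x i C (p i \<star> g) \<otimes>\<^bsub>Char C\<^esub> x i C (p i \<star> g')"
        using pgg[OF i] functional_hadd[OF x[OF i] C pg[OF i g] pg[OF i g']] by simp
    next
      show "(\<lambda>i. x i C (p i \<star> g) \<otimes>\<^bsub>Char C\<^esub> x i C (p i \<star> g')) \<in> ?J \<rightarrow> carrier (Char C)"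
        using J(2) xpg[OF _ C g] xpg[OF _ C g'] CC.m_closed by blast
    qed simp
    also have "\<dots> = finprod (Char C) (\<lambda>i. x i C (p i \<star> g)) ?J \<otimes>\<^bsub>Char C\<^esub> finprod (Char C) (\<lambda>i. x i C (p i \<star> g')) ?J"
      using J(2) xpg[OF _ C g] xpg[OF _ C g'] by (intro CC.finprod_multf) blast+
    also have "\<dots> = s C g \<otimes>\<^bsub>Char C\<^esub> s C g'" using s_eq[OF C g J(1) _ J(2)] s_eq[OF C g' J(1) _ J(2)] by simp
    finally show "s C (hadd T g g') = s C g \<otimes>\<^bsub>Char C\<^esub> s C g'" .
  next
    fix B C f g assume B: "compact_object T B" and C: "compact_object T C" and f: "f \<in> Hom T B C" and g: "g \<in> Hom T C S"
    interpret CC: comm_group "Char C" by (rule Char_group[OF C])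
    interpret CB: comm_group "Char B" by (rule Char_group[OF B])
    interpret plf: group_hom "Char C" "Char B" "pl f" by (rule pl_hom[OF B C f])
    have pgf: "p i \<star> (g \<star> f) = (p i \<star> g) \<star> f" if "i \<in> I" for i
      using Comp_assoc[OF f g p(1)[OF that]] .
    have "supp B (g \<star> f) \<subseteq> supp C g" using pgf Comp_hzero_left[OF f F_ob] by (auto simp: supp_def)
    then have "s B (g \<star> f) = finprod (Char B) (\<lambda>i. x i B (p i \<star> (g \<star> f))) (supp C g)"
      by (rule s_eq[OF B Comp_closed[OF f g] supp_fin[OF C g] _ suppI])
    also have "\<dots> = finprod (Char B) (\<lambda>i. pl f (x i C (p i \<star> g))) (supp C g)"
    proof (rule CB.finprod_cong')
      fix i assume "i \<in> supp C g"
      then have i: "i \<in> I" using suppI by blast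
      show "x i B (p i \<star> (g \<star> f)) = pl f (x i C (p i \<star> g))"
        using pgf[OF i] functional_natural[OF x[OF i] B C f pg[OF i g]] by simp
    next
      show "(\<lambda>i. pl f (x i C (p i \<star> g))) \<in> supp C g \<rightarrow> carrier (Char B)"
        using suppI pl_closed[OF B C f xpg[OF _ C g]] by blast
    qed simp
    also have "\<dots> = pl f (finprod (Char C) (\<lambda>i. x i C (p i \<star> g)) (supp C g))"
      by (rule hom_finprod[OF Char_group[OF C] Char_group[OF B] plf.homh, symmetric]) (use xpg[OF _ C g] suppI in blast)
    finally show "s B (g \<star> f) = pl f (s C g)" by (simp add: s_def)
  qed
  have "?s \<odot> \<iota> i = x i" if i: "i \<in> I" for i
  proof (rule functional_eqI[OF precompose_closed[OF \<iota>[OF i] s] x[OF i]])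
    fix C c assume C: "compact_object T C" and c: "c \<in> Hom T C (F i)"
    interpret CC: comm_group "Char C" by (rule Char_group[OF C])
    have ic: "\<iota> i \<star> c \<in> Hom T C S"
      using Comp_closed[OF c \<iota>[OF i]] .
    have "supp C (\<iota> i \<star> c) \<subseteq> {i}"
    proof
      fix k assume k: "k \<in> supp C (\<iota> i \<star> c)"
      then have kI: "k \<in> I" using suppI by blast
      show "k \<in> {i}"
      proof (rule ccontr)
        assume "k \<notin> {i}"
        then have "p k \<star> (\<iota> i \<star> c) = hzero T C (F k)"
          using Comp_assoc[OF c \<iota>[OF i] p(1)[OF kI]] p(3)[OF kI i] Comp_hzero_left[OF c F_ob[OF kI]] by simp
        then show False using k by (simp add: supp_def)
      qed
    qed
    then have "s C (\<iota> i \<star> c) = finprod (Char C) (\<lambda>k. x k C (p k \<star> (\<iota> i \<star> c))) {i}" using i by (intro s_eq[OF C ic]) auto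
    also have "\<dots> = x i C (p i \<star> (\<iota> i \<star> c))"
      using xpg[OF i C ic] CC.finprod_insert[of "{}" i "\<lambda>k. x k C (p k \<star> (\<iota> i \<star> c))"] by simp
    also have "p i \<star> (\<iota> i \<star> c) = c" using Comp_assoc[OF c \<iota>[OF i] p(1)[OF i]] p(2)[OF i] Ide_Comp[OF c] by simp
    finally show "(?s \<odot> \<iota> i) C c = x i C c" using precompose_apply[OF \<iota>[OF i] C c] C ic by simp
  qed
  then show ?thesis using s by blast
qed

end

lemma (in triangulated_category) yoneda_presheaf:
  assumes cg: "compactly_generated T" and X: "X \<in> Ob T"
  shows "additive_presheaf (compacts T) (yoneda T X)"
  unfolding additive_presheaf_def
  using hom_group[OF compact_object_ob X] compactly_generatedD(2)[OF cg compact_object_ob X]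
      Comp_closed Comp_hadd_left Comp_hadd_right Comp_assoc Comp_Ide by (auto simp: hom_presheaf_def hom_def Hom_compacts)

section \<open>Extension of partial functionals, and representability\<close>

context flat_functional
begin

interpretation A: exact_sequences_category "compacts T"
  by (rule compacts_exact_sequences[OF universe cg])

text \<open>The graph of a natural additive map from a sub-presheaf of \<open>yoneda T Z\<close> to
  the characters of \<open>E\<close>. As for partial characters, single-valuedness is asked at zero
  only.\<close>

definition partial_functional :: "'o \<Rightarrow> (('o \<times> 'a) \<times> ('a \<Rightarrow> rat set)) set \<Rightarrow> bool"
  where "partial_functional Z R \<longleftrightarrow>
    (\<forall>C g v. ((C, g), v) \<in> R \<longrightarrow> compact_object T C \<and> g \<in> Hom T C Z \<and> v \<in> carrier (Char C)) \<and>
    (\<forall>C. compact_object T C \<longrightarrow> ((C, hzero T C Z), \<one>\<^bsub>Char C\<^esub>) \<in> R) \<and>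
    (\<forall>C g v g' v'. ((C, g), v) \<in> R \<longrightarrow> ((C, g'), v') \<in> R \<longrightarrow> ((C, hadd T g g'), v \<otimes>\<^bsub>Char C\<^esub> v') \<in> R) \<and>
    (\<forall>C g v. ((C, g), v) \<in> R \<longrightarrow> ((C, hneg T C Z g), inv\<^bsub>Char C\<^esub> v) \<in> R) \<and>
    (\<forall>B C f g v. compact_object T B \<longrightarrow> f \<in> Hom T B C \<longrightarrow> ((C, g), v) \<in> R \<longrightarrow> ((B, g \<star> f), pl f v) \<in> R) \<and>
    (\<forall>C v. ((C, hzero T C Z), v) \<in> R \<longrightarrow> v = \<one>\<^bsub>Char C\<^esub>)"

lemma
  assumes "partial_functional Z R"
  shows partial_functional_closed: "((C, g), v) \<in> R \<Longrightarrow> compact_object T C \<and> g \<in> Hom T C Z \<and> v \<in> carrier (Char C)"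
    and partial_functional_zero: "compact_object T C \<Longrightarrow> ((C, hzero T C Z), \<one>\<^bsub>Char C\<^esub>) \<in> R"
    and partial_functional_add: "((C, g), v) \<in> R \<Longrightarrow> ((C, g'), v') \<in> R \<Longrightarrow> ((C, hadd T g g'), v \<otimes>\<^bsub>Char C\<^esub> v') \<in> R"
    and partial_functional_neg: "((C, g), v) \<in> R \<Longrightarrow> ((C, hneg T C Z g), inv\<^bsub>Char C\<^esub> v) \<in> R"
    and partial_functional_natural: "compact_object T B \<Longrightarrow> f \<in> Hom T B C \<Longrightarrow> ((C, g), v) \<in> R \<Longrightarrow> ((B, g \<star> f), pl f v) \<in> R"
    and partial_functional_single: "((C, hzero T C Z), v) \<in> R \<Longrightarrow> v = \<one>\<^bsub>Char C\<^esub>"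
  using assms unfolding partial_functional_def by simp_all

lemma partial_functional_unique:
  assumes R: "partial_functional Z R" and "((C, g), v) \<in> R" "((C, g), w) \<in> R"
  shows "v = w"
proof -
  note v = partial_functional_closed[OF R assms(2)] and w = partial_functional_closed[OF R assms(3)]
  interpret CC: comm_group "Char C" by (rule Char_group) (use v in blast)
  have g: "g \<in> Hom T C Z" using v by blast
  have "hadd T g (hneg T C Z g) = hzero T C Z" using hneg_hadd[OF g] hadd_comm[OF g hneg_closed[OF g]] by simp
  then have "((C, hzero T C Z), v \<otimes>\<^bsub>Char C\<^esub> inv\<^bsub>Char C\<^esub> w) \<in> R"
    using partial_functional_add[OF R assms(2) partial_functional_neg[OF R assms(3)]] by simp
  then have "v \<otimes>\<^bsub>Char C\<^esub> inv\<^bsub>Char C\<^esub> w = \<one>\<^bsub>Char C\<^esub>" by (rule partial_functional_single[OF R])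
  then show ?thesis using v w CC.inv_equality[of v "inv\<^bsub>Char C\<^esub> w"] by simp
qed

text \<open>The values that are forced on an element \<open>g\<close> define a partial character: flatness of \<open>E\<close> says
  precisely that they are consistent.\<close>

lemma forced_character:
  assumes R: "partial_functional Z R" and D: "compact_object T D" and g: "g \<in> Hom T D Z"
  shows "partial_character (on_ob E D)
    {(on_ar E f a, v a) | C f v a. compact_object T C \<and> f \<in> Hom T C D \<and> ((C, g \<star> f), v) \<in> R \<and> a \<in> sec E C}"
    (is "partial_character _ ?P")
  unfolding partial_character_def
proof (intro conjI allI impI)
  have Z: "Z \<in> Ob T" using Hom_ob[OF g] by blast
  have Pc: "\<exists>C f v a. x = on_ar E f a \<and> y = v a \<and> compact_object T C \<and> f \<in> Hom T C D \<and> ((C, g \<star> f), v) \<in> R \<and>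
      a \<in> sec E C \<and> v \<in> carrier (Char C)" if "(x, y) \<in> ?P" for x y
    using that partial_functional_closed[OF R] by blast
  show "?P \<subseteq> sec E D \<times> carrier QZ"
  proof (rule subrelI)
    fix x y assume xy: "(x, y) \<in> ?P"
    obtain C f v a where "x = on_ar E f a" "y = v a" "compact_object T C" "f \<in> Hom T C D"
      "a \<in> sec E C" "v \<in> carrier (Char C)" using Pc[OF xy] by (elim exE conjE) (rule that)
    then show "(x, y) \<in> sec E D \<times> carrier QZ" using E_closed[OF _ D] character_closed by auto
  qed
  have D': "D \<in> Ob T" by (rule compact_object_ob[OF D])
  interpret ED: comm_group "on_ob E D" by (rule E_group[OF D])
  have z: "hzero T D D \<in> Hom T D D" using D' by simp
  have "((D, g \<star> hzero T D D), \<one>\<^bsub>Char D\<^esub>) \<in> R" using partial_functional_zero[OF R D] Comp_hzero_right[OF g D'] by simp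
  moreover have "on_ar E (hzero T D D) \<one>\<^bsub>on_ob E D\<^esub> = \<one>\<^bsub>on_ob E D\<^esub>" "\<one>\<^bsub>Char D\<^esub> \<one>\<^bsub>on_ob E D\<^esub> = \<one>\<^bsub>QZ\<^esub>"
    using E_hzero[OF D D] by (simp_all add: one_character_group)
  ultimately show "(\<one>\<^bsub>on_ob E D\<^esub>, \<one>\<^bsub>QZ\<^esub>) \<in> ?P"
    using D z by (intro CollectI exI[of _ D] exI[of _ "hzero T D D"] exI[of _ "\<one>\<^bsub>Char D\<^esub>"] exI[of _ "\<one>\<^bsub>on_ob E D\<^esub>"]) simp
  fix x y assume xy: "(x, y) \<in> ?P"
  obtain C f v a where 1: "x = on_ar E f a" "y = v a" "compact_object T C" "f \<in> Hom T C D" "((C, g \<star> f), v) \<in> R"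
    "a \<in> sec E C" "v \<in> carrier (Char C)" using Pc[OF xy] by metis
  interpret EC: comm_group "on_ob E C" by (rule E_group[OF 1(3)])
  show "(inv\<^bsub>on_ob E D\<^esub> x, inv\<^bsub>QZ\<^esub> y) \<in> ?P"
  proof -
    have "inv\<^bsub>on_ob E D\<^esub> x = on_ar E f (inv\<^bsub>on_ob E C\<^esub> a)"
    proof (rule ED.inv_equality)
      show "on_ar E f (inv\<^bsub>on_ob E C\<^esub> a) \<otimes>\<^bsub>on_ob E D\<^esub> x = \<one>\<^bsub>on_ob E D\<^esub>"
      proof -
        have "on_ar E f (inv\<^bsub>on_ob E C\<^esub> a \<otimes>\<^bsub>on_ob E C\<^esub> a) = \<one>\<^bsub>on_ob E D\<^esub>"
          using hom_one[OF covariant_hom[OF E] EC.group_axioms ED.group_axioms, of f] 1 D by (simp add: Hom_compacts)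
        then show ?thesis using E_mult[OF 1(3) D 1(4) EC.inv_closed[OF 1(6)] 1(6)] 1(1) by simp
      qed
    qed (use 1 E_closed[OF 1(3) D 1(4)] in simp_all)
    moreover have "inv\<^bsub>QZ\<^esub> y = v (inv\<^bsub>on_ob E C\<^esub> a)"
    proof (rule QZ.inv_equality)
      show "v (inv\<^bsub>on_ob E C\<^esub> a) \<otimes>\<^bsub>QZ\<^esub> y = \<one>\<^bsub>QZ\<^esub>"
        using character_mult[OF 1(7) EC.inv_closed[OF 1(6)] 1(6)] character_one[OF EC.group_axioms 1(7)] 1 by simp
    qed (use 1 character_closed[OF 1(7)] in simp_all)
    ultimately show ?thesis using 1 EC.inv_closed[OF 1(6)] by blast
  qed
  fix x' y' assume xy': "(x', y') \<in> ?P"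
  obtain C' f' v' a' where 2: "x' = on_ar E f' a'" "y' = v' a'" "compact_object T C'" "f' \<in> Hom T C' D"
    "((C', g \<star> f'), v') \<in> R" "a' \<in> sec E C'" "v' \<in> carrier (Char C')" using Pc[OF xy'] by metis
  note C = compact_object_ob[OF 1(3)] and C' = compact_object_ob[OF 2(3)]
  \<comment> \<open>Two forced values may come from different compact objects \<open>C\<close> and
    \<open>C'\<close>; over their biproduct they become one forced value, for a single arrow
    \<open>F\<close>.\<close>
  obtain S i j p q where ij: "i \<in> Hom T C S" "j \<in> Hom T C' S" and pq: "p \<in> Hom T S C" "q \<in> Hom T S C'"
    and comp: "p \<star> i = Ide T C" "p \<star> j = hzero T C' C" "q \<star> i = hzero T C C'" "q \<star> j = Ide T C'"
    and id: "hadd T (i \<star> p) (j \<star> q) = Ide T S"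
    by (rule biproduct[OF C C'])
  have S: "compact_object T S" by (rule compact_biproduct[OF 1(3) 2(3) ij pq id])
  interpret ES: comm_group "on_ob E S" by (rule E_group[OF S])
  interpret EC': comm_group "on_ob E C'" by (rule E_group[OF 2(3)])
  define F where "F = hadd T (f \<star> p) (f' \<star> q)"
  define b where "b = on_ar E i a \<otimes>\<^bsub>on_ob E S\<^esub> on_ar E j a'"
  define w where "w = pl p v \<otimes>\<^bsub>Char S\<^esub> pl q v'"
  have fp: "f \<star> p \<in> Hom T S D" "f' \<star> q \<in> Hom T S D" using Comp_closed pq 1(4) 2(4) by blast+
  have F: "F \<in> Hom T S D" unfolding F_def by (rule hadd_closed[OF fp])
  have ia: "on_ar E i a \<in> sec E S" "on_ar E j a' \<in> sec E S"
    using E_closed[OF 1(3) S ij(1) 1(6)] E_closed[OF 2(3) S ij(2) 2(6)] by auto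
  have b: "b \<in> sec E S" unfolding b_def using ia by simp
  have "f \<star> p \<star> i = f" "f' \<star> q \<star> i = hzero T C D"
    using Comp_assoc[OF ij(1) pq(1) 1(4)] Comp_assoc[OF ij(1) pq(2) 2(4)] Comp_Ide[OF 1(4)] Comp_hzero_right[OF 2(4) C]
    unfolding comp by simp_all
  moreover have "f \<star> p \<star> j = hzero T C' D" "f' \<star> q \<star> j = f'"
    using Comp_assoc[OF ij(2) pq(1) 1(4)] Comp_assoc[OF ij(2) pq(2) 2(4)] Comp_Ide[OF 2(4)] Comp_hzero_right[OF 1(4) C']
    unfolding comp by simp_all
  ultimately have Fi: "F \<star> i = f" "F \<star> j = f'"
    unfolding F_def Comp_hadd_left[OF ij(1) fp] Comp_hadd_left[OF ij(2) fp]
    using hadd_hzero[OF 1(4)] hadd_hzero[OF 2(4)] by simp_all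
  have "on_ar E F b = x \<otimes>\<^bsub>on_ob E D\<^esub> x'"
    using E_mult[OF S D F ia] E_Comp[OF 1(3) S D ij(1) F 1(6)] E_Comp[OF 2(3) S D ij(2) F 2(6)] Fi 1(1) 2(1)
    by (simp add: b_def)
  moreover have "w b = y \<otimes>\<^bsub>QZ\<^esub> y'"
  proof -
    have "on_ar E p b = a"
      unfolding b_def E_mult[OF S 1(3) pq(1) ia]
        E_Comp[OF 1(3) S 1(3) ij(1) pq(1) 1(6), symmetric] E_Comp[OF 2(3) S 1(3) ij(2) pq(1) 2(6), symmetric] comp
      using E_Ide[OF 1(3,6)] E_hzero[OF 2(3) 1(3) 2(6)] 1(6) by simp
    moreover have "on_ar E q b = a'"
      unfolding b_def E_mult[OF S 2(3) pq(2) ia]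
        E_Comp[OF 1(3) S 2(3) ij(1) pq(2) 1(6), symmetric] E_Comp[OF 2(3) S 2(3) ij(2) pq(2) 2(6), symmetric] comp
      using E_Ide[OF 2(3,6)] E_hzero[OF 1(3) 2(3) 1(6)] 2(6) by simp
    ultimately show ?thesis
      using b 1(2) 2(2) by (simp add: w_def mult_character_group pl_apply[OF S 1(3) pq(1)] pl_apply[OF S 2(3) pq(2)])
  qed
  moreover have "((S, g \<star> F), w) \<in> R"
  proof -
    have "g \<star> F = hadd T ((g \<star> f) \<star> p) ((g \<star> f') \<star> q)"
      unfolding F_def using Comp_hadd_right[OF fp g] Comp_assoc[OF pq(1) 1(4) g] Comp_assoc[OF pq(2) 2(4) g] by simp
    then show ?thesis
      unfolding w_def using partial_functional_add[OF R partial_functional_natural[OF R S pq(1) 1(5)]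
          partial_functional_natural[OF R S pq(2) 2(5)]] by simp
  qed
  ultimately show "(x \<otimes>\<^bsub>on_ob E D\<^esub> x', y \<otimes>\<^bsub>QZ\<^esub> y') \<in> ?P"
    using S F b by (intro CollectI exI[of _ S] exI[of _ F] exI[of _ w] exI[of _ b]) simp
next
  fix y assume "(\<one>\<^bsub>on_ob E D\<^esub>, y) \<in> ?P"
  then obtain C f v a where 1: "on_ar E f a = \<one>\<^bsub>on_ob E D\<^esub>" "y = v a" "compact_object T C" "f \<in> Hom T C D" "((C, g \<star> f), v) \<in> R"
    "a \<in> sec E C" by auto
  have v: "v \<in> carrier (Char C)" using partial_functional_closed[OF R 1(5)] by blast
  \<comment> \<open>By flatness \<open>a\<close> is the image of some \<open>b\<close> along an
    \<open>h\<close> with \<open>f \<star> h\<close> zero. So \<open>v\<close> at \<open>a\<close>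
    is the restriction of \<open>v\<close> along \<open>h\<close> evaluated at \<open>b\<close>, and
    that restriction belongs to the zero arrow, where \<open>R\<close> takes only the trivial
    value.\<close>
  have "f \<in> Hom (compacts T) C D" using 1 D by (simp add: Hom_compacts)
  then obtain W h b where "h \<in> Hom (compacts T) W C" "b \<in> sec E W" "f \<star> h = hzero T W D" "on_ar E h b = a"
    using E_flat 1(1,6) unfolding flat_covariant_def by (metis compacts_simps(6,7))
  then have h: "compact_object T W" "h \<in> Hom T W C" "b \<in> sec E W" "f \<star> h = hzero T W D" "on_ar E h b = a"
    by (auto simp: Hom_compacts)
  have "((W, (g \<star> f) \<star> h), pl h v) \<in> R" by (rule partial_functional_natural[OF R h(1,2) 1(5)])
  moreover have "(g \<star> f) \<star> h = hzero T W Z"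
    using Comp_assoc[OF h(2) 1(4) g] h(4) Comp_hzero_right[OF g compact_object_ob[OF h(1)]] by simp
  ultimately have "pl h v = \<one>\<^bsub>Char W\<^esub>" using partial_functional_single[OF R] by simp
  then have "v (on_ar E h b) = \<one>\<^bsub>QZ\<^esub>" using pl_apply[OF h(1) 1(3) h(2,3), of v] h(3) by (simp add: one_character_group)
  then show "y = \<one>\<^bsub>QZ\<^esub>" using 1(2) h(5) by simp
qed

text \<open>A value \<open>u\<close> for \<open>g\<close> is a character of \<open>E\<close> at
  \<open>D\<close> whose restriction along \<open>f\<close> must be the old value wherever
  \<open>g \<star> f\<close> is already covered. These demands form a partial character, and any
  extension of it supplies \<open>u\<close>.\<close>

lemma partial_functional_extend:
  assumes R: "partial_functional Z R" and x: "x \<in> {(C, g). compact_object T C \<and> g \<in> Hom T C Z}"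
  shows "\<exists>R'. partial_functional Z R' \<and> R \<subseteq> R' \<and> x \<in> Domain R'"
proof -
  obtain D g where x_eq: "x = (D, g)" and D: "compact_object T D" and g: "g \<in> Hom T D Z" using x by auto
  have Z: "Z \<in> Ob T" and D': "D \<in> Ob T" using Hom_ob[OF g] by auto
  interpret ED: comm_group "on_ob E D" by (rule E_group[OF D])
  obtain \<chi> where \<chi>: "\<chi> \<in> hom (on_ob E D) QZ"
    and \<chi>v: "\<And>a u. (a, u) \<in> {(on_ar E f a, v a) | C f v a. compact_object T C \<and> f \<in> Hom T C D \<and> ((C, g \<star> f), v) \<in> R \<and>
      a \<in> sec E C} \<Longrightarrow> \<chi> a = u"
    by (rule ED.partial_character_extends[OF forced_character[OF R D g]]) blast
  define u where "u = restrict \<chi> (sec E D)"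
  have u: "u \<in> carrier (Char D)" unfolding u_def by (rule restrict_character[OF ED.group_axioms \<chi>])
  have forced: "v = pl f u" if C: "compact_object T C" and f: "f \<in> Hom T C D" and v: "((C, g \<star> f), v) \<in> R" for C f v
  proof (rule character_eqI[OF _ pl_closed[OF C D f u]])
    show "v \<in> carrier (Char C)" using partial_functional_closed[OF R v] by blast
    fix a assume a: "a \<in> sec E C"
    have "\<chi> (on_ar E f a) = v a" by (rule \<chi>v) (use C f v a in blast)
    then show "v a = pl f u a" using pl_apply[OF C D f a] E_closed[OF C D f a] by (simp add: u_def)
  qed
  \<comment> \<open>The sub-presheaf generated by the old domain and \<open>g\<close>: taking
    \<open>f\<close> zero recovers \<open>R\<close>, and taking \<open>f\<close> the identity of
    \<open>D\<close> covers \<open>g\<close>.\<close>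
  let ?R = "{((C, hadd T h (g \<star> f)), v \<otimes>\<^bsub>Char C\<^esub> pl f u) | C h f v. ((C, h), v) \<in> R \<and> f \<in> Hom T C D}"
  have RI: "((C, k), w) \<in> ?R" if "((C, h), v) \<in> R" "f \<in> Hom T C D" "k = hadd T h (g \<star> f)" "w = v \<otimes>\<^bsub>Char C\<^esub> pl f u" for C h f v k w
    using that by blast
  have RE: "\<exists>h f v. ((C, h), v) \<in> R \<and> f \<in> Hom T C D \<and> k = hadd T h (g \<star> f) \<and> w = v \<otimes>\<^bsub>Char C\<^esub> pl f u \<and>
      compact_object T C \<and> h \<in> Hom T C Z \<and> v \<in> carrier (Char C) \<and> g \<star> f \<in> Hom T C Z \<and> pl f u \<in> carrier (Char C)"
    if kw: "((C, k), w) \<in> ?R" for C k w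
  proof -
    obtain h f v where *: "((C, h), v) \<in> R" "f \<in> Hom T C D" "k = hadd T h (g \<star> f)" "w = v \<otimes>\<^bsub>Char C\<^esub> pl f u"
      using kw by blast
    have "compact_object T C" using partial_functional_closed[OF R *(1)] by blast
    then show ?thesis
      using * partial_functional_closed[OF R *(1)] Comp_closed[OF *(2) g] pl_closed[OF _ D *(2) u] by blast
  qed
  have sub: "R \<subseteq> ?R"
  proof
    fix y assume "y \<in> R"
    then obtain C h v where y: "y = ((C, h), v)" "((C, h), v) \<in> R" by (metis surj_pair)
    then have C: "compact_object T C" and h: "h \<in> Hom T C Z" and v: "v \<in> carrier (Char C)"
      using partial_functional_closed[OF R] by blast+
    interpret CC: comm_group "Char C" by (rule Char_group[OF C])
    have "((C, h), v) \<in> ?R"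
    proof (rule RI[OF y(2)])
      show "hzero T C D \<in> Hom T C D" using compact_object_ob[OF C] D' by simp
      show "h = hadd T h (g \<star> hzero T C D)" using Comp_hzero_right[OF g compact_object_ob[OF C]] hadd_hzero[OF h] by simp
      show "v = v \<otimes>\<^bsub>Char C\<^esub> pl (hzero T C D) u" using pl_hzero[OF C D u] v by simp
    qed
    then show "y \<in> ?R" using y(1) by simp
  qed
  have "partial_functional Z ?R"
    unfolding partial_functional_def
  proof (intro conjI allI impI)
    fix C k w assume kw: "((C, k), w) \<in> ?R"
    obtain h f v where 1: "((C, h), v) \<in> R" "f \<in> Hom T C D" "k = hadd T h (g \<star> f)" "w = v \<otimes>\<^bsub>Char C\<^esub> pl f u"
      "compact_object T C" "h \<in> Hom T C Z" "v \<in> carrier (Char C)" "g \<star> f \<in> Hom T C Z" "pl f u \<in> carrier (Char C)"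
      using RE[OF kw] by metis
    interpret CC: comm_group "Char C" by (rule Char_group[OF 1(5)])
    interpret HC: comm_group "hom_group T C Z" by (rule hom_comm_group[OF 1(6)])
    show "compact_object T C" "k \<in> Hom T C Z" "w \<in> carrier (Char C)" using 1 hadd_closed[OF 1(6,8)] by simp_all
    show "((C, hneg T C Z k), inv\<^bsub>Char C\<^esub> w) \<in> ?R"
    proof (rule RI[OF partial_functional_neg[OF R 1(1)] hneg_closed[OF 1(2)]])
      show "hneg T C Z k = hadd T (hneg T C Z h) (g \<star> hneg T C D f)"
        using HC.inv_mult[of h "g \<star> f"] 1(3,6,8) Comp_hneg_right[OF 1(2) g] by simp
      have "pl (hneg T C D f) u \<otimes>\<^bsub>Char C\<^esub> pl f u = \<one>\<^bsub>Char C\<^esub>"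
        using pl_hadd[OF 1(5) D hneg_closed[OF 1(2)] 1(2) u] hneg_hadd[OF 1(2)] pl_hzero[OF 1(5) D u] by simp
      then have "inv\<^bsub>Char C\<^esub> (pl f u) = pl (hneg T C D f) u"
        using CC.inv_equality 1(9) pl_closed[OF 1(5) D hneg_closed[OF 1(2)] u] by blast
      then show "inv\<^bsub>Char C\<^esub> w = inv\<^bsub>Char C\<^esub> v \<otimes>\<^bsub>Char C\<^esub> pl (hneg T C D f) u" using CC.inv_mult[OF 1(7,9)] 1(4) by simp
    qed
    show "((B, k \<star> e), pl e w) \<in> ?R" if B: "compact_object T B" and e: "e \<in> Hom T B C" for B e
    proof (rule RI[OF partial_functional_natural[OF R B e 1(1)] Comp_closed[OF e 1(2)]])
      show "k \<star> e = hadd T (h \<star> e) (g \<star> (f \<star> e))" using Comp_hadd_left[OF e 1(6,8)] Comp_assoc[OF e 1(2) g] 1(3) by simp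
      show "pl e w = pl e v \<otimes>\<^bsub>Char B\<^esub> pl (f \<star> e) u"
        using pl_mult[OF B 1(5) e 1(7,9)] pl_Comp[OF B 1(5) D e 1(2) u] 1(4) by simp
    qed
    fix k' w' assume kw': "((C, k'), w') \<in> ?R"
    obtain h' f' v' where 2: "((C, h'), v') \<in> R" "f' \<in> Hom T C D" "k' = hadd T h' (g \<star> f')" "w' = v' \<otimes>\<^bsub>Char C\<^esub> pl f' u"
      "compact_object T C" "h' \<in> Hom T C Z" "v' \<in> carrier (Char C)" "g \<star> f' \<in> Hom T C Z" "pl f' u \<in> carrier (Char C)"
      using RE[OF kw'] by metis
    show "((C, hadd T k k'), w \<otimes>\<^bsub>Char C\<^esub> w') \<in> ?R"
    proof (rule RI[OF partial_functional_add[OF R 1(1) 2(1)] hadd_closed[OF 1(2) 2(2)]])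
      have hc: "h \<in> carrier (hom_group T C Z)" "g \<star> f \<in> carrier (hom_group T C Z)"
        "h' \<in> carrier (hom_group T C Z)" "g \<star> f' \<in> carrier (hom_group T C Z)" by (simp_all add: 1(6,8) 2(6,8))
      have "(h \<otimes>\<^bsub>hom_group T C Z\<^esub> (g \<star> f)) \<otimes>\<^bsub>hom_group T C Z\<^esub> (h' \<otimes>\<^bsub>hom_group T C Z\<^esub> (g \<star> f')) =
          (h \<otimes>\<^bsub>hom_group T C Z\<^esub> h') \<otimes>\<^bsub>hom_group T C Z\<^esub> ((g \<star> f) \<otimes>\<^bsub>hom_group T C Z\<^esub> (g \<star> f'))"
        using hc by (simp add: HC.m_ac del: hom_group_simps)
      then show "hadd T k k' = hadd T (hadd T h h') (g \<star> hadd T f f')"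
        using 1(3) 2(3) Comp_hadd_right[OF 1(2) 2(2) g] by simp
      have "(v \<otimes>\<^bsub>Char C\<^esub> pl f u) \<otimes>\<^bsub>Char C\<^esub> (v' \<otimes>\<^bsub>Char C\<^esub> pl f' u) =
          (v \<otimes>\<^bsub>Char C\<^esub> v') \<otimes>\<^bsub>Char C\<^esub> (pl f u \<otimes>\<^bsub>Char C\<^esub> pl f' u)"
        using 1(7,9) 2(7,9) by (simp add: CC.m_ac)
      then show "w \<otimes>\<^bsub>Char C\<^esub> w' = v \<otimes>\<^bsub>Char C\<^esub> v' \<otimes>\<^bsub>Char C\<^esub> pl (hadd T f f') u"
        using 1(4) 2(4) pl_hadd[OF 1(5) D 1(2) 2(2) u] by simp
    qed
  next
    show "((C, hzero T C Z), \<one>\<^bsub>Char C\<^esub>) \<in> ?R" if "compact_object T C" for C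
      using sub partial_functional_zero[OF R that] by (rule subsetD)
    fix C w assume w: "((C, hzero T C Z), w) \<in> ?R"
    obtain h f v where 1: "((C, h), v) \<in> R" "f \<in> Hom T C D" "hzero T C Z = hadd T h (g \<star> f)" "w = v \<otimes>\<^bsub>Char C\<^esub> pl f u"
      "compact_object T C" "h \<in> Hom T C Z" "v \<in> carrier (Char C)" "g \<star> f \<in> Hom T C Z" "pl f u \<in> carrier (Char C)"
      using RE[OF w] by (elim exE conjE) (rule that)
    interpret CC: comm_group "Char C" by (rule Char_group[OF 1(5)])
    \<comment> \<open>If the sum is zero, then \<open>g \<star> f\<close> is the negative of an
      arrow covered by \<open>R\<close>. Its value was therefore forced, and it cancels
      \<open>v\<close>.\<close>
    have "hneg T C Z h = g \<star> f" by (rule hneg_unique[OF 1(6,8)]) (use 1(3) hadd_comm[OF 1(6,8)] in simp)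
    then have "((C, g \<star> f), inv\<^bsub>Char C\<^esub> v) \<in> R" using partial_functional_neg[OF R 1(1)] by simp
    then have "inv\<^bsub>Char C\<^esub> v = pl f u" by (rule forced[OF 1(5,2)])
    then show "w = \<one>\<^bsub>Char C\<^esub>" using 1(4,7) CC.r_inv[OF 1(7)] by simp
  qed
  moreover have "((D, g), u) \<in> ?R"
  proof (rule RI[OF partial_functional_zero[OF R D] Ide_closed[OF D']])
    interpret CD: comm_group "Char D" by (rule Char_group[OF D])
    show "g = hadd T (hzero T D Z) (g \<star> Ide T D)" using Comp_Ide[OF g] hadd_hzero[OF g] by simp
    show "u = \<one>\<^bsub>Char D\<^esub> \<otimes>\<^bsub>Char D\<^esub> pl (Ide T D) u" using pl_Ide[OF D u] u by simp
  qed
  ultimately show ?thesis using sub x_eq by blast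
qed

text \<open>In other words, the character dual of a flat functor is injective relative to
  sub-presheaves of \<open>yoneda T Z\<close>.\<close>

lemma partial_functional_extends:
  assumes R0: "partial_functional Z R0"
  shows "\<exists>\<beta>\<in>functionals Z. \<forall>C g v. ((C, g), v) \<in> R0 \<longrightarrow> \<beta> C g = v"
proof -
  let ?X = "{(C, g). compact_object T C \<and> g \<in> Hom T C Z}"
  obtain R where R: "partial_functional Z R" "R0 \<subseteq> R" "?X \<subseteq> Domain R"
  proof (rule relation_extend_Zorn[where P = "partial_functional Z" and X = ?X, OF R0])
    fix \<C> :: "(('o \<times> 'a) \<times> ('a \<Rightarrow> rat set)) set set"
    assume ne: "\<C> \<noteq> {}" and ch: "subset.chain {R. partial_functional Z R} \<C>"
    have P: "\<And>R. R \<in> \<C> \<Longrightarrow> partial_functional Z R" using ch by (auto simp: subset.chain_def)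
    show "partial_functional Z (\<Union>\<C>)"
      unfolding partial_functional_def
    proof (intro conjI allI impI)
      fix C g v assume "((C, g), v) \<in> \<Union>\<C>"
      then obtain S where S: "S \<in> \<C>" "((C, g), v) \<in> S" by blast
      show "compact_object T C" "g \<in> Hom T C Z" "v \<in> carrier (Char C)"
        using partial_functional_closed[OF P[OF S(1)] S(2)] by auto
      show "((C, hneg T C Z g), inv\<^bsub>Char C\<^esub> v) \<in> \<Union>\<C>" using partial_functional_neg[OF P[OF S(1)] S(2)] S(1) by blast
      show "((B, g \<star> f), pl f v) \<in> \<Union>\<C>" if "compact_object T B" "f \<in> Hom T B C" for B f
        using partial_functional_natural[OF P[OF S(1)] that S(2)] S(1) by blast
      fix g' v' assume "((C, g'), v') \<in> \<Union>\<C>"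
      then obtain S' where S': "S' \<in> \<C>" "((C, g'), v') \<in> S'" by blast
      have SS: "S \<union> S' \<in> \<C>" by (rule subset_chain_Un[OF ch S(1) S'(1)])
      show "((C, hadd T g g'), v \<otimes>\<^bsub>Char C\<^esub> v') \<in> \<Union>\<C>"
        using partial_functional_add[OF P[OF SS], of C g v g' v'] S(2) S'(2) SS by blast
    next
      show "((C, hzero T C Z), \<one>\<^bsub>Char C\<^esub>) \<in> \<Union>\<C>" if "compact_object T C" for C
        using ne partial_functional_zero[OF P that] by blast
      show "v = \<one>\<^bsub>Char C\<^esub>" if "((C, hzero T C Z), v) \<in> \<Union>\<C>" for C v using that partial_functional_single[OF P] by blast
    qed
  next
    show "\<exists>R'. partial_functional Z R' \<and> R \<subseteq> R' \<and> x \<in> Domain R'" if "partial_functional Z R" "x \<in> ?X" for R x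
      by (rule partial_functional_extend[OF that])
  qed
  define \<beta> where "\<beta> = (\<lambda>C g. SOME v. ((C, g), v) \<in> R)"
  have graph: "((C, g), \<beta> C g) \<in> R" if C: "compact_object T C" and g: "g \<in> Hom T C Z" for C g
  proof -
    obtain v where "((C, g), v) \<in> R" using R(3) C g by blast
    then show ?thesis unfolding \<beta>_def by (rule someI[where P = "\<lambda>v. ((C, g), v) \<in> R"])
  qed
  have val: "\<beta> C g = v" if "((C, g), v) \<in> R" for C g v
    using partial_functional_unique[OF R(1) graph that] partial_functional_closed[OF R(1) that] by blast
  have "(\<lambda>C\<in>{C. compact_object T C}. \<lambda>g\<in>Hom T C Z. \<beta> C g) \<in> functionals Z"
  proof (rule functionalsI)
    show "\<beta> C g \<in> carrier (Char C)" if "compact_object T C" "g \<in> Hom T C Z" for C g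
      using partial_functional_closed[OF R(1) graph[OF that]] by blast
    show "\<beta> C (hadd T g g') = \<beta> C g \<otimes>\<^bsub>Char C\<^esub> \<beta> C g'" if "compact_object T C" "g \<in> Hom T C Z" "g' \<in> Hom T C Z" for C g g'
      by (rule val[OF partial_functional_add[OF R(1) graph[OF that(1,2)] graph[OF that(1,3)]]])
    show "\<beta> B (g \<star> f) = pl f (\<beta> C g)"
      if "compact_object T B" "compact_object T C" "f \<in> Hom T B C" "g \<in> Hom T C Z" for B C f g
      by (rule val[OF partial_functional_natural[OF R(1) that(1,3) graph[OF that(2,4)]]])
  qed
  moreover have "(\<lambda>C\<in>{C. compact_object T C}. \<lambda>g\<in>Hom T C Z. \<beta> C g) C g = v" if "((C, g), v) \<in> R0" for C g v
    using val R(2) that partial_functional_closed[OF R0 that] by auto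
  ultimately show ?thesis by blast
qed

text \<open>\<open>y\<close> induces a partial functional on the arrows that factor through
  \<open>q\<close>. It is consistent because an arrow killed by \<open>q\<close> factors through
  \<open>hsub T a b\<close>, where \<open>y\<close> is trivial by \<open>eq\<close>; extending it to
  all arrows into \<open>Z\<close> gives \<open>z\<close>.\<close>

lemma functionals_weak_coequalizer:
  assumes a: "a \<in> Hom T X Y" and b: "b \<in> Hom T X Y" and tri: "(hsub T a b, q, h) \<in> Tri T" "q \<in> Hom T Y Z" "h \<in> Hom T Z (susp_ob T X)"
    and y: "y \<in> functionals Y" and eq: "y \<odot> a = y \<odot> b"
  shows "\<exists>z\<in>functionals Z. z \<odot> q = y"
proof -
  let ?R = "{((C, q \<star> c), y C c) | C c. compact_object T C \<and> c \<in> Hom T C Y}"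
  have Y: "Y \<in> Ob T" and Z: "Z \<in> Ob T" using Hom_ob[OF tri(2)] by auto
  note tri' = tri(1) hsub_closed[OF a b] tri(2,3)
  have RI: "((C, k), v) \<in> ?R" if "compact_object T C" "c \<in> Hom T C Y" "k = q \<star> c" "v = y C c" for C c k v
    using that by blast
  have neg: "y C (hneg T C Y c) = inv\<^bsub>Char C\<^esub> (y C c)" if C: "compact_object T C" and c: "c \<in> Hom T C Y" for C c
  proof -
    interpret CC: comm_group "Char C" by (rule Char_group[OF C])
    have "y C (hneg T C Y c) \<otimes>\<^bsub>Char C\<^esub> y C c = \<one>\<^bsub>Char C\<^esub>"
      using functional_hadd[OF y C hneg_closed[OF c] c] hneg_hadd[OF c] functional_hzero[OF y C Y] by simp
    then show ?thesis
      using CC.inv_equality functional_closed[OF y C c] functional_closed[OF y C hneg_closed[OF c]] by metis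
  qed
  have pf: "partial_functional Z ?R"
    unfolding partial_functional_def
  proof (intro conjI allI impI)
    fix C g v assume "((C, g), v) \<in> ?R"
    then obtain c where C: "compact_object T C" and c: "c \<in> Hom T C Y" and gv: "g = q \<star> c" "v = y C c" by blast
    show "compact_object T C" "g \<in> Hom T C Z" "v \<in> carrier (Char C)"
      using C Comp_closed[OF c tri(2)] functional_closed[OF y C c] gv by simp_all
    show "((C, hneg T C Z g), inv\<^bsub>Char C\<^esub> v) \<in> ?R"
      by (rule RI[OF C hneg_closed[OF c]]) (use Comp_hneg_right[OF c tri(2)] neg[OF C c] gv in simp_all)
    show "((B, g \<star> f), pl f v) \<in> ?R" if B: "compact_object T B" and f: "f \<in> Hom T B C" for B f
      by (rule RI[OF B Comp_closed[OF f c]])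
        (use Comp_assoc[OF f c tri(2)] functional_natural[OF y B C f c] gv in simp_all)
    fix g' v' assume "((C, g'), v') \<in> ?R"
    then obtain c' where c': "c' \<in> Hom T C Y" and gv': "g' = q \<star> c'" "v' = y C c'" by blast
    show "((C, hadd T g g'), v \<otimes>\<^bsub>Char C\<^esub> v') \<in> ?R"
      by (rule RI[OF C hadd_closed[OF c c']])
        (use Comp_hadd_right[OF c c' tri(2)] functional_hadd[OF y C c c'] gv gv' in simp_all)
  next
    show "((C, hzero T C Z), \<one>\<^bsub>Char C\<^esub>) \<in> ?R" if C: "compact_object T C" for C
      by (rule RI[OF C hzero_closed[OF compact_object_ob[OF C] Y]])
        (use Comp_hzero_right[OF tri(2) compact_object_ob[OF C]] functional_hzero[OF y C Y] in simp_all)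
    fix C v assume "((C, hzero T C Z), v) \<in> ?R"
    then obtain c where C: "compact_object T C" and c: "c \<in> Hom T C Y" and gv: "hzero T C Z = q \<star> c" "v = y C c" by blast
    interpret CC: comm_group "Char C" by (rule Char_group[OF C])
    obtain d where d: "d \<in> Hom T C X" "hsub T a b \<star> d = c" using tri_weak_kernel[OF tri' c] gv(1) by metis
    note ad = Comp_closed[OF d(1) a] and bd = Comp_closed[OF d(1) b]
    have "y C (a \<star> d) = y C (b \<star> d)"
      using precompose_apply[OF a C d(1), of y] precompose_apply[OF b C d(1), of y] eq by simp
    moreover have "hadd T c (b \<star> d) = a \<star> d" using d(2) Comp_hsub_left[OF d(1) a b] hsub_hadd_cancel[OF ad bd] by simp
    ultimately have "y C c \<otimes>\<^bsub>Char C\<^esub> y C (b \<star> d) = y C (b \<star> d)" using functional_hadd[OF y C c bd] by simp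
    then show "v = \<one>\<^bsub>Char C\<^esub>" using gv(2) functional_closed[OF y C c] functional_closed[OF y C bd] by simp
  qed
  obtain z where z: "z \<in> functionals Z" "\<forall>C g v. ((C, g), v) \<in> ?R \<longrightarrow> z C g = v"
    using partial_functional_extends[OF pf] by (rule bexE)
  have "z \<odot> q = y"
  proof (rule functional_eqI[OF precompose_closed[OF tri(2) z(1)] y])
    fix C c assume C: "compact_object T C" "c \<in> Hom T C Y"
    show "(z \<odot> q) C c = y C c" using precompose_apply[OF tri(2) C, of z] z(2)[rule_format, OF RI[OF C refl refl]] by simp
  qed
  then show ?thesis using z(1) by blast
qed

lemma brown_functor_functionals: "brown_functor T functionals (\<odot>)"
proof
  show "inaccessible_universe TYPE('a)" "compactly_generated T" by (fact universe cg)+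
  show "\<And>f X Y x. f \<in> Hom T X Y \<Longrightarrow> x \<in> functionals Y \<Longrightarrow> x \<odot> f \<in> functionals X" by (rule precompose_closed)
  show "\<And>f X Y g Z x. f \<in> Hom T X Y \<Longrightarrow> g \<in> Hom T Y Z \<Longrightarrow> x \<in> functionals Z \<Longrightarrow> x \<odot> (g \<star> f) = x \<odot> g \<odot> f"
    by (rule precompose_Comp)
  show "\<And>X x. X \<in> Ob T \<Longrightarrow> x \<in> functionals X \<Longrightarrow> x \<odot> Ide T X = x" by (rule precompose_Ide)
  show "\<exists>s\<in>functionals S. \<forall>i\<in>I. s \<odot> \<iota> i = xs i"
    if "small I" "is_coproduct T I F S \<iota>" "\<And>i. i \<in> I \<Longrightarrow> xs i \<in> functionals (F i)" for I :: "'a set" and F S \<iota> xs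
    by (rule functionals_coproduct[OF that])
  show "s = t" if "small I" "is_coproduct T I F S \<iota>" "s \<in> functionals S" "t \<in> functionals S"
    "\<And>i. i \<in> I \<Longrightarrow> s \<odot> \<iota> i = t \<odot> \<iota> i" for I :: "'a set" and F S \<iota> s t by (rule functionals_coproduct_ext[OF that])
  show "\<exists>z\<in>functionals Z. z \<odot> g = y" if "a \<in> Hom T X Y" "b \<in> Hom T X Y" "(hsub T a b, g, h) \<in> Tri T" "g \<in> Hom T Y Z"
    "h \<in> Hom T Z (susp_ob T X)" "y \<in> functionals Y" "y \<odot> a = y \<odot> b" for a X Y b g h Z y
    by (rule functionals_weak_coequalizer[OF that])
  show "small_in TYPE('a) (functionals C)" if "compact_object T C" for C by (rule functionals_small[OF that])
qed

text \<open>Brown representability yields \<open>X\<close> with a universal functional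
  \<open>x\<close>. Functionals on a compact \<open>C\<close> are characters of \<open>E\<close> at
  \<open>C\<close>, by evaluation at the identity, so the values of \<open>x\<close> form an
  isomorphism from \<open>yoneda T X\<close> to the character dual.\<close>

theorem char_dual_representable:
  "\<exists>X\<in>Ob T. isomorphic (ModCat (compacts T)) (char_dual (compacts T) E) (yoneda T X)"
proof -
  obtain X x where X: "X \<in> Ob T" and x: "x \<in> functionals X"
    and bij: "\<And>Y. Y \<in> Ob T \<Longrightarrow> bij_betw (\<lambda>f. x \<odot> f) (Hom T Y X) (functionals Y)"
    using brown_functor.representable[OF brown_functor_functionals] by metis
  note cd = universe A.additive_category_axioms E
  let ?D = "char_dual (compacts T) E"
  have D: "additive_presheaf (compacts T) ?D" by (rule char_dual_presheaf[OF cd])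
  have yX: "additive_presheaf (compacts T) (yoneda T X)" by (rule yoneda_presheaf[OF cg X])
  define t where "t = (\<lambda>C g. encode (on_ob E C) (x C g))"
  have t: "natural (compacts T) (yoneda T X) ?D t"
  proof (rule naturalI)
    fix C g assume "C \<in> Ob (compacts T)" and "g \<in> sec (yoneda T X) C"
    then have C: "compact_object T C" and g: "g \<in> Hom T C X" by (simp_all add: hom_presheaf_def)
    show "t C g \<in> sec ?D C" using functional_closed[OF x C g] by (simp add: t_def carrier_char_dual[OF cd])
    fix g' assume "g' \<in> sec (yoneda T X) C"
    then have g': "g' \<in> Hom T C X" by (simp add: hom_presheaf_def)
    show "t C (g \<otimes>\<^bsub>on_ob (yoneda T X) C\<^esub> g') = t C g \<otimes>\<^bsub>on_ob ?D C\<^esub> t C g'"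
      using mult_char_dual[OF cd, of C "x C g" "x C g'"] functional_hadd[OF x C g g'] functional_closed[OF x C g]
        functional_closed[OF x C g'] C by (simp add: t_def hom_presheaf_def)
  next
    fix B C f g assume "f \<in> Hom (compacts T) B C" and "g \<in> sec (yoneda T X) C"
    then have f: "f \<in> Hom (compacts T) B C" "compact_object T B" "compact_object T C" "f \<in> Hom T B C" and g: "g \<in> Hom T C X"
      by (simp_all add: hom_presheaf_def Hom_compacts)
    show "t B (on_ar (yoneda T X) f g) = on_ar ?D f (t C g)"
      using on_ar_char_dual[OF cd f(1) functional_closed[OF x f(3) g]] functional_natural[OF x f(2,3,4) g]
      by (simp add: t_def hom_presheaf_def)
  qed
  have "bij_betw (t C) (sec (yoneda T X) C) (sec ?D C)" if C: "compact_object T C" for C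
  proof -
    have C': "C \<in> Ob T" by (rule compact_object_ob[OF C])
    note I = Ide_closed[OF C']
    have inj: "g = g'" if g: "g \<in> Hom T C X" and g': "g' \<in> Hom T C X" and eq: "x C g = x C g'" for g g'
    proof -
      have "x \<odot> g = x \<odot> g'"
      proof (rule functional_eqI[OF precompose_closed[OF g x] precompose_closed[OF g' x]])
        fix B f assume B: "compact_object T B" and f: "f \<in> Hom T B C"
        show "(x \<odot> g) B f = (x \<odot> g') B f"
          using precompose_apply[OF g B f, of x] precompose_apply[OF g' B f, of x] functional_natural[OF x B C f g]
            functional_natural[OF x B C f g'] eq by simp
      qed
      then show ?thesis using bij[OF C'] g g' by (auto simp: bij_betw_def inj_on_def)
    qed
    \<comment> \<open>The functional on \<open>C\<close> generated by \<open>v\<close> is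
      \<open>x \<odot> g\<close> for some \<open>g\<close>; at the identity of \<open>C\<close> this
      reads \<open>x C g = v\<close>.\<close>
    have surj: "\<exists>g\<in>Hom T C X. x C g = v" if v: "v \<in> carrier (Char C)" for v
    proof -
      let ?\<beta> = "\<lambda>B\<in>{B. compact_object T B}. \<lambda>g\<in>Hom T B C. pl g v"
      have "?\<beta> \<in> (\<lambda>f. x \<odot> f) ` Hom T C X" using bij[OF C'] yoneda_functional[OF C v] by (simp add: bij_betw_def)
      then obtain g where g: "g \<in> Hom T C X" "?\<beta> = x \<odot> g" by blast
      have "x C g = ?\<beta> C (Ide T C)" unfolding g(2) using precompose_apply[OF g(1) C I, of x] Comp_Ide[OF g(1)] by simp
      then show ?thesis using g(1) pl_Ide[OF C v] C I by auto
    qed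
    have enc: "inj_on (encode (on_ob E C)) (carrier (Char C))" using encode_inj[OF cd, of C] C by simp
    show ?thesis
      unfolding bij_betw_def carrier_char_dual[OF cd]
    proof (intro conjI inj_onI equalityI subsetI)
      fix g g' assume "g \<in> sec (yoneda T X) C" "g' \<in> sec (yoneda T X) C" "t C g = t C g'"
      then have g: "g \<in> Hom T C X" "g' \<in> Hom T C X" "encode (on_ob E C) (x C g) = encode (on_ob E C) (x C g')"
        by (simp_all add: hom_presheaf_def t_def)
      have "x C g = x C g'" by (rule inj_onD[OF enc g(3) functional_closed[OF x C g(1)] functional_closed[OF x C g(2)]])
      then show "g = g'" by (rule inj[OF g(1,2)])
    next
      fix e assume "e \<in> t C ` sec (yoneda T X) C"
      then show "e \<in> encode (on_ob E C) ` carrier (Char C)"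
        using functional_closed[OF x C] by (auto simp: t_def hom_presheaf_def)
    next
      fix e assume "e \<in> encode (on_ob E C) ` carrier (Char C)"
      then obtain v where v: "v \<in> carrier (Char C)" "e = encode (on_ob E C) v" by blast
      obtain g where "g \<in> Hom T C X" "x C g = v" using surj[OF v(1)] by blast
      then show "e \<in> t C ` sec (yoneda T X) C" using v(2) by (auto simp: t_def hom_presheaf_def)
    qed
  qed
  then have "isomorphic (ModCat (compacts T)) (yoneda T X) ?D"
    unfolding isomorphic_ModCat_iff[OF A.category_axioms] using yX D t by auto
  then show ?thesis using category.isomorphic_sym[OF category_ModCat[OF A.category_axioms]] X by blast
qed

end

section \<open>Character duality\<close>

text \<open>The trivial kernel makes \<open>h a \<mapsto> \<chi> a\<close> a well-defined character
  on the image of \<open>h\<close>, and Q/Z is injective.\<close>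

lemma injective_extends_characters:
  assumes G: "comm_group G" and H: "comm_group H" and h: "h \<in> hom G H"
    and inj: "\<And>a. a \<in> carrier G \<Longrightarrow> h a = \<one>\<^bsub>H\<^esub> \<Longrightarrow> a = \<one>\<^bsub>G\<^esub>" and \<chi>: "\<chi> \<in> chars G"
  shows "\<exists>\<psi>\<in>chars H. \<forall>a\<in>carrier G. \<psi> (h a) = \<chi> a"
proof -
  interpret G: comm_group G by (rule G)
  interpret H: comm_group H by (rule H)
  interpret h: group_hom G H h using h by unfold_locales
  interpret X: group_hom G QZ \<chi> by unfold_locales (use \<chi> in \<open>simp add: carrier_character_group\<close>)
  let ?R = "{(h a, \<chi> a) | a. a \<in> carrier G}"
  have RI: "(b, u) \<in> ?R" if "a \<in> carrier G" "b = h a" "u = \<chi> a" for a b u using that by blast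
  have "partial_character H ?R"
    unfolding partial_character_def
  proof (intro conjI allI impI)
    show "?R \<subseteq> carrier H \<times> carrier QZ" by auto
    show "(\<one>\<^bsub>H\<^esub>, \<one>\<^bsub>QZ\<^esub>) \<in> ?R" by (rule RI[of "\<one>\<^bsub>G\<^esub>"]) simp_all
    fix b u assume "(b, u) \<in> ?R"
    then obtain a where a: "a \<in> carrier G" "b = h a" "u = \<chi> a" by blast
    show "(inv\<^bsub>H\<^esub> b, inv\<^bsub>QZ\<^esub> u) \<in> ?R" by (rule RI[of "inv\<^bsub>G\<^esub> a"]) (simp_all add: a)
    fix b' u' assume "(b', u') \<in> ?R"
    then obtain a' where a': "a' \<in> carrier G" "b' = h a'" "u' = \<chi> a'" by blast
    show "(b \<otimes>\<^bsub>H\<^esub> b', u \<otimes>\<^bsub>QZ\<^esub> u') \<in> ?R" by (rule RI[of "a \<otimes>\<^bsub>G\<^esub> a'"]) (simp_all add: a a')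
  next
    fix v assume "(\<one>\<^bsub>H\<^esub>, v) \<in> ?R"
    then obtain a where "a \<in> carrier G" "\<one>\<^bsub>H\<^esub> = h a" "v = \<chi> a" by blast
    then show "v = \<one>\<^bsub>QZ\<^esub>" using inj[of a] by simp
  qed
  then obtain \<psi> where \<psi>: "\<psi> \<in> hom H QZ" "\<And>b u. (b, u) \<in> ?R \<Longrightarrow> \<psi> b = u" by (rule H.partial_character_extends) blast
  have "restrict \<psi> (carrier H) (h a) = \<chi> a" if "a \<in> carrier G" for a using \<psi>(2)[OF RI[OF that refl refl]] that by simp
  then show ?thesis using restrict_character[OF H.group_axioms \<psi>(1)] by blast
qed

lemma comm_group_separates:
  assumes "comm_group G" "subgroup N G" "p \<in> carrier G" "p \<notin> N"
  shows "\<exists>\<chi>\<in>chars G. (\<forall>n\<in>N. \<chi> n = \<one>\<^bsub>QZ\<^esub>) \<and> \<chi> p \<noteq> \<one>\<^bsub>QZ\<^esub>"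
proof -
  interpret comm_group G by fact
  obtain \<chi> where \<chi>: "\<chi> \<in> hom G QZ" "\<And>n. n \<in> N \<Longrightarrow> \<chi> n = \<one>\<^bsub>QZ\<^esub>" "\<chi> p \<noteq> \<one>\<^bsub>QZ\<^esub>"
    by (rule character_separates[OF assms(2-4)]) blast
  have "\<forall>n\<in>N. restrict \<chi> (carrier G) n = \<one>\<^bsub>QZ\<^esub>" using \<chi>(2) subgroup.subset[OF assms(2)] by auto
  then show ?thesis
    using restrict_character[OF group_axioms \<chi>(1)] \<chi>(3) assms(3) by (intro bexI[of _ "restrict \<chi> (carrier G)"]) auto
qed

section \<open>Characters exchange injectivity and surjectivity\<close>

context
  fixes B :: "('p, 'b, 'z) ab_category_scheme" and E :: "('p, 'b, 'u) module_fctr" and f X Y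
  assumes universe: "inaccessible_universe TYPE('u)" and B: "additive_category B" and E: "covariant_module B E"
    and f: "f \<in> Hom B X Y"
begin

lemmas cd = universe B E

lemma f_ob: "X \<in> Ob B" "Y \<in> Ob B"
  using category.Hom_ob[OF additive_category.axioms(1)[OF B] f] by auto

lemma E_groups: "comm_group (on_ob E X)" "comm_group (on_ob E Y)"
  using covariant_group[OF E] f_ob by auto

text \<open>If \<open>f\<close> killed a nontrivial \<open>a\<close>, a character nontrivial at
  \<open>a\<close> could not be pulled back along \<open>f\<close>. Conversely, characters extend
  along an injective map.\<close>

lemma char_dual_surjective_iff:
  "on_ar (char_dual B E) f ` sec (char_dual B E) Y = sec (char_dual B E) X \<longleftrightarrow>
    (\<forall>a\<in>sec E X. on_ar E f a = \<one>\<^bsub>on_ob E Y\<^esub> \<longrightarrow> a = \<one>\<^bsub>on_ob E X\<^esub>)" (is "?L = ?R")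
proof
  interpret EX: comm_group "on_ob E X" by (rule E_groups)
  interpret EY: comm_group "on_ob E Y" by (rule E_groups)
  {
    assume surj: ?L
    show ?R
    proof (intro ballI impI, rule ccontr)
      fix a assume a: "a \<in> sec E X" "on_ar E f a = \<one>\<^bsub>on_ob E Y\<^esub>" "a \<noteq> \<one>\<^bsub>on_ob E X\<^esub>"
      have "a \<notin> {\<one>\<^bsub>on_ob E X\<^esub>}" using a(3) by simp
      from comm_group_separates[OF EX.comm_group_axioms EX.triv_subgroup a(1) this]
      obtain \<chi> where \<chi>: "\<chi> \<in> chars (on_ob E X)" "\<chi> a \<noteq> \<one>\<^bsub>QZ\<^esub>" by blast
      have "encode (on_ob E X) \<chi> \<in> sec (char_dual B E) X" unfolding carrier_char_dual[OF cd] using \<chi>(1) by (rule imageI)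
      then obtain \<psi> where \<psi>: "\<psi> \<in> chars (on_ob E Y)"
        "encode (on_ob E X) \<chi> = on_ar (char_dual B E) f (encode (on_ob E Y) \<psi>)"
        unfolding surj[symmetric] unfolding carrier_char_dual[OF cd] by blast
      have "encode (on_ob E X) \<chi> = encode (on_ob E X) (pull B E f \<psi>)"
        unfolding \<psi>(2) by (rule on_ar_char_dual[OF cd f \<psi>(1)])
      then have "\<chi> = pull B E f \<psi>"
        by (rule inj_onD[OF encode_inj[OF cd f_ob(1)] _ \<chi>(1) pull_closed[OF E additive_category.axioms(1)[OF B] f \<psi>(1)]])
      then show False using \<chi>(2) pull_apply[OF f a(1), of \<psi>] a(2) character_one[OF EY.group_axioms \<psi>(1)] by simp
    qed
  }
  assume inj: ?R
  show ?L
  proof (intro equalityI subsetI)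
    fix v assume "v \<in> on_ar (char_dual B E) f ` sec (char_dual B E) Y"
    then show "v \<in> sec (char_dual B E) X" using presheaf_closed[OF char_dual_presheaf[OF cd] f] by blast
  next
    fix v assume "v \<in> sec (char_dual B E) X"
    then obtain \<chi> where \<chi>: "\<chi> \<in> chars (on_ob E X)" "v = encode (on_ob E X) \<chi>" by (rule char_dual_cases[OF cd])
    obtain \<psi> where \<psi>: "\<psi> \<in> chars (on_ob E Y)" "\<forall>a\<in>sec E X. \<psi> (on_ar E f a) = \<chi> a"
      using injective_extends_characters[OF E_groups covariant_hom[OF E f] _ \<chi>(1)] inj by blast
    have "pull B E f \<psi> = \<chi>"
      by (rule character_eqI[OF pull_closed[OF E additive_category.axioms(1)[OF B] f \<psi>(1)] \<chi>(1)])
        (simp add: pull_apply[OF f] \<psi>(2))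
    then have "v = on_ar (char_dual B E) f (encode (on_ob E Y) \<psi>)" using on_ar_char_dual[OF cd f \<psi>(1)] \<chi>(2) by simp
    then show "v \<in> on_ar (char_dual B E) f ` sec (char_dual B E) Y" using \<psi>(1) carrier_char_dual[OF cd] by blast
  qed
qed

lemma on_ar_char_dual_eq_one_iff:
  assumes \<chi>: "\<chi> \<in> chars (on_ob E Y)"
  shows "on_ar (char_dual B E) f (encode (on_ob E Y) \<chi>) = \<one>\<^bsub>on_ob (char_dual B E) X\<^esub> \<longleftrightarrow>
    (\<forall>a\<in>sec E X. \<chi> (on_ar E f a) = \<one>\<^bsub>QZ\<^esub>)"
proof -
  interpret CX: comm_group "character_group (on_ob E X)" by (rule comm_group_character_group[OF E_groups(1)])
  have p: "pull B E f \<chi> \<in> chars (on_ob E X)" by (rule pull_closed[OF E additive_category.axioms(1)[OF B] f \<chi>])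
  have "on_ar (char_dual B E) f (encode (on_ob E Y) \<chi>) = \<one>\<^bsub>on_ob (char_dual B E) X\<^esub> \<longleftrightarrow>
      pull B E f \<chi> = \<one>\<^bsub>character_group (on_ob E X)\<^esub>"
    using on_ar_char_dual[OF cd f \<chi>] inj_on_eq_iff[OF encode_inj[OF cd f_ob(1)] p CX.one_closed]
    by (simp add: one_char_dual[OF cd])
  also have "\<dots> \<longleftrightarrow> (\<forall>a\<in>sec E X. pull B E f \<chi> a = \<one>\<^bsub>character_group (on_ob E X)\<^esub> a)"
    by (rule iffI, simp, rule character_eqI[OF p CX.one_closed]) blast
  also have "\<dots> \<longleftrightarrow> (\<forall>a\<in>sec E X. \<chi> (on_ar E f a) = \<one>\<^bsub>QZ\<^esub>)" by (simp add: one_character_group pull_apply[OF f])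
  finally show ?thesis .
qed

text \<open>An element outside the image is separated from it by a character, and that character is
  a nontrivial element killed in the dual.\<close>

lemma char_dual_injective_iff:
  "(\<forall>v\<in>sec (char_dual B E) Y. on_ar (char_dual B E) f v = \<one>\<^bsub>on_ob (char_dual B E) X\<^esub> \<longrightarrow>
      v = \<one>\<^bsub>on_ob (char_dual B E) Y\<^esub>) \<longleftrightarrow>
    on_ar E f ` sec E X = sec E Y" (is "?L = ?R")
proof
  interpret EX: comm_group "on_ob E X" by (rule E_groups)
  interpret EY: comm_group "on_ob E Y" by (rule E_groups)
  interpret f: group_hom "on_ob E X" "on_ob E Y" "on_ar E f" using covariant_hom[OF E f] by unfold_locales
  {
    assume inj: ?L
    show ?R
    proof (rule ccontr)
      assume "on_ar E f ` sec E X \<noteq> sec E Y"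
      then obtain p where p: "p \<in> sec E Y" "p \<notin> on_ar E f ` sec E X" by auto
      from comm_group_separates[OF E_groups(2) f.img_is_subgroup p]
      obtain \<chi> where \<chi>: "\<chi> \<in> chars (on_ob E Y)"
        "\<forall>n\<in>on_ar E f ` sec E X. \<chi> n = \<one>\<^bsub>QZ\<^esub>" "\<chi> p \<noteq> \<one>\<^bsub>QZ\<^esub>" by blast
      have "encode (on_ob E Y) \<chi> \<in> sec (char_dual B E) Y" unfolding carrier_char_dual[OF cd] using \<chi>(1) by (rule imageI)
      moreover have "on_ar (char_dual B E) f (encode (on_ob E Y) \<chi>) = \<one>\<^bsub>on_ob (char_dual B E) X\<^esub>"
        using on_ar_char_dual_eq_one_iff[OF \<chi>(1)] \<chi>(2) by simp
      ultimately have "encode (on_ob E Y) \<chi> = encode (on_ob E Y) \<one>\<^bsub>character_group (on_ob E Y)\<^esub>"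
        using inj one_char_dual[OF cd] by simp
      then have "\<chi> = \<one>\<^bsub>character_group (on_ob E Y)\<^esub>"
        by (rule inj_onD[OF encode_inj[OF cd f_ob(2)] _ \<chi>(1)
            monoid.one_closed[OF group.is_monoid[OF comm_group.axioms(2)[OF comm_group_character_group[OF E_groups(2)]]]]])
      then show False using \<chi>(3) p(1) by (simp add: one_character_group)
    qed
  }
  assume surj: ?R
  show ?L
  proof (intro ballI impI)
    fix v assume v: "v \<in> sec (char_dual B E) Y" "on_ar (char_dual B E) f v = \<one>\<^bsub>on_ob (char_dual B E) X\<^esub>"
    obtain \<chi> where \<chi>: "\<chi> \<in> chars (on_ob E Y)" "v = encode (on_ob E Y) \<chi>" by (rule char_dual_cases[OF cd v(1)])
    have "\<chi> = \<one>\<^bsub>character_group (on_ob E Y)\<^esub>"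
    proof (rule character_eqI[OF \<chi>(1)])
      show "\<one>\<^bsub>character_group (on_ob E Y)\<^esub> \<in> chars (on_ob E Y)"
        by (rule monoid.one_closed[OF group.is_monoid[OF comm_group.axioms(2)[OF comm_group_character_group[OF E_groups(2)]]]])
      fix b assume b: "b \<in> sec E Y"
      then obtain a where "a \<in> sec E X" "b = on_ar E f a" using surj by blast
      then show "\<chi> b = \<one>\<^bsub>character_group (on_ob E Y)\<^esub> b"
        using on_ar_char_dual_eq_one_iff[OF \<chi>(1)] v(2) \<chi>(2) b by (simp add: one_character_group)
    qed
    then show "v = \<one>\<^bsub>on_ob (char_dual B E) Y\<^esub>" by (simp add: \<chi>(2) one_char_dual[OF cd])
  qed
qed

end

section \<open>Invariance under isomorphism, and flatness of Yoneda functors and duals\<close>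

abbreviation onto :: "('o, 'a, 'z) category_scheme \<Rightarrow> ('o, 'a, 'u) module_fctr \<Rightarrow> 'a \<Rightarrow> bool"
  where "onto C F f \<equiv> on_ar F f ` sec F (Cod C f) = sec F (Dom C f)"

lemma isomorphic_surjective:
  fixes C :: "('o, 'a, 'z) ab_category_scheme" and F :: "('o, 'a, 'u) module_fctr"
  assumes cat: "category C" and iso: "isomorphic (ModCat C) F G" and f: "f \<in> Hom C X Y"
    and surj: "on_ar F f ` sec F Y = sec F X"
  shows "on_ar G f ` sec G Y = sec G X"
proof -
  note XY = category.Hom_ob[OF cat f]
  obtain t where F: "additive_presheaf C F" and G: "additive_presheaf C G" and t: "natural C F G t"
    and bij: "\<And>X. X \<in> Ob C \<Longrightarrow> t X ` sec F X = sec G X"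
    using iso unfolding isomorphic_ModCat_iff[OF cat] bij_betw_def by metis
  have "on_ar G f ` sec G Y = (\<lambda>y. t X (on_ar F f y)) ` sec F Y"
    unfolding bij[OF XY(2), symmetric] image_image using natural_eq[OF t f] by (intro image_cong) simp_all
  also have "\<dots> = t X ` (on_ar F f ` sec F Y)" by (simp add: image_image)
  finally show ?thesis
    unfolding surj bij[OF XY(1)] .
qed

lemma isomorphic_flat:
  fixes C :: "('o, 'a, 'z) ab_category_scheme" and F :: "('o, 'a, 'u) module_fctr"
  assumes cat: "category C" and iso: "isomorphic (ModCat C) F G" and F_flat: "flat_presheaf C F"
  shows "flat_presheaf C G"
  unfolding flat_presheaf_def
proof (intro allI ballI impI)
  fix X Y f y assume f: "f \<in> Hom C X Y" and y: "y \<in> sec G Y" and fy: "on_ar G f y = \<one>\<^bsub>on_ob G X\<^esub>"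
  note XY = category.Hom_ob[OF cat f]
  obtain t where F: "additive_presheaf C F" and G: "additive_presheaf C G" and t: "natural C F G t"
    and bij: "\<And>X. X \<in> Ob C \<Longrightarrow> bij_betw (t X) (sec F X) (sec G X)"
    using iso unfolding isomorphic_ModCat_iff[OF cat] by metis
  obtain x where x: "x \<in> sec F Y" "t Y x = y" using y unfolding bij_betw_imp_surj_on[OF bij[OF XY(2)], symmetric] by blast
  have "t X (on_ar F f x) = t X \<one>\<^bsub>on_ob F X\<^esub>" using natural_eq[OF t f x(1)] natural_one[OF t F G XY(1)] x(2) fy by simp
  then have "on_ar F f x = \<one>\<^bsub>on_ob F X\<^esub>"
    by (rule inj_onD[OF bij_betw_imp_inj_on[OF bij[OF XY(1)]] _ presheaf_closed[OF F f x(1)] presheaf_one_closed[OF F XY(1)]])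
  then obtain Z g z where g: "g \<in> Hom C Y Z" "z \<in> sec F Z" "g \<star>\<^bsub>C\<^esub> f = hzero C X Z" "on_ar F g z = x"
    using F_flat f x(1) unfolding flat_presheaf_def by metis
  have "t Z z \<in> sec G Z" "on_ar G g (t Z z) = y"
    using natural_closed[OF t _ g(2)] category.Hom_ob[OF cat g(1)] natural_eq[OF t g(1,2)] g(4) x(2) by auto
  then show "\<exists>Z. \<exists>g\<in>Hom C Y Z. \<exists>z\<in>sec G Z. g \<star>\<^bsub>C\<^esub> f = hzero C X Z \<and> on_ar G g z = y" using g(1,3) by blast
qed

text \<open>The cone provides a compact weak cokernel of \<open>f\<close> that is one in all of
  \<open>T\<close>, so it factors arrows into an arbitrary \<open>X\<close>.\<close>

lemma (in triangulated_category) yoneda_flat: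
  assumes cg: "compactly_generated T"
  shows "flat_presheaf (compacts T) (yoneda T X)"
  unfolding flat_presheaf_def
proof (intro allI ballI impI)
  fix A B f y assume "f \<in> Hom (compacts T) A B" and "y \<in> sec (yoneda T X) B"
    and "on_ar (yoneda T X) f y = \<one>\<^bsub>on_ob (yoneda T X) A\<^esub>"
  then have f: "compact_object T A" "compact_object T B" "f \<in> Hom T A B" and y: "y \<in> Hom T B X" "y \<star> f = hzero T A X"
    by (auto simp: hom_presheaf_def Hom_compacts)
  obtain Z g where g: "compact_object T Z" "g \<in> Hom T B Z" "g \<star> f = hzero T A Z"
    "\<And>V l. l \<in> Hom T B V \<Longrightarrow> l \<star> f = hzero T A V \<Longrightarrow> \<exists>l'\<in>Hom T Z V. l' \<star> g = l"
    by (rule compact_right_sequence[OF cg f]) blast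
  obtain z where "z \<in> Hom T Z X" "z \<star> g = y" using g(4)[OF y] by blast
  then show "\<exists>Z. \<exists>g\<in>Hom (compacts T) B Z. \<exists>z\<in>sec (yoneda T X) Z.
      g \<star>\<^bsub>compacts T\<^esub> f = hzero (compacts T) A Z \<and> on_ar (yoneda T X) g z = y"
    using g f(2) by (intro exI[of _ Z] bexI[of _ g] bexI[of _ z]) (simp_all add: hom_presheaf_def Hom_compacts)
qed

text \<open>Let \<open>h\<close> be a weak kernel of \<open>f\<close>. If \<open>a\<close> were not
  in the image of \<open>on_ar E h\<close>, a character trivial on that image but not at
  \<open>a\<close> would be killed by \<open>h\<close> in the dual. By flatness it would then come
  from a character at \<open>Y\<close>, which forces triviality at \<open>a\<close> because
  \<open>f\<close> kills \<open>a\<close>.\<close>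

lemma (in exact_sequences_category) char_dual_flat_covariant:
  fixes E :: "('o, 'u, 'u) module_fctr"
  assumes E: "covariant_module C E" and flat: "flat_presheaf C (char_dual C E)"
  shows "flat_covariant C E"
  unfolding flat_covariant_def
proof (intro allI ballI impI)
  fix X Y f a assume f: "f \<in> Hom C X Y" and a: "a \<in> sec E X" and fa: "on_ar E f a = \<one>\<^bsub>on_ob E Y\<^esub>"
  note cd = universe additive_category_axioms E
  obtain W h where h: "h \<in> Hom C W X" "f \<star> h = hzero C W Y"
    and weak: "\<And>V l. l \<in> Hom C X V \<Longrightarrow> l \<star> h = hzero C W V \<Longrightarrow> \<exists>l'\<in>Hom C Y V. l' \<star> f = l"
    by (rule left_seq[OF f]) blast
  note ob = Hom_ob[OF f] Hom_ob[OF h(1)]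
  interpret EX: comm_group "on_ob E X" by (rule covariant_group[OF E ob(1)])
  interpret h: group_hom "on_ob E W" "on_ob E X" "on_ar E h"
    by (intro group_hom.intro group_hom_axioms.intro covariant_group'[OF E] ob covariant_hom[OF E h(1)])
  have "a \<in> on_ar E h ` sec E W"
  proof (rule ccontr)
    assume "a \<notin> on_ar E h ` sec E W"
    from comm_group_separates[OF EX.comm_group_axioms h.img_is_subgroup a this]
    obtain \<chi> where \<chi>: "\<chi> \<in> chars (on_ob E X)"
      "\<forall>n\<in>on_ar E h ` sec E W. \<chi> n = \<one>\<^bsub>QZ\<^esub>" "\<chi> a \<noteq> \<one>\<^bsub>QZ\<^esub>" by blast
    have v: "encode (on_ob E X) \<chi> \<in> sec (char_dual C E) X" unfolding carrier_char_dual[OF cd] using \<chi>(1) by (rule imageI)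
    have "on_ar (char_dual C E) h (encode (on_ob E X) \<chi>) = \<one>\<^bsub>on_ob (char_dual C E) W\<^esub>"
      using on_ar_char_dual_eq_one_iff[OF cd h(1) \<chi>(1)] \<chi>(2) by simp
    from flat_presheaf_lift[OF char_dual_presheaf[OF cd] flat h(1) f weak v this]
    obtain z where z: "z \<in> sec (char_dual C E) Y" "on_ar (char_dual C E) f z = encode (on_ob E X) \<chi>" by blast
    obtain \<psi> where \<psi>: "\<psi> \<in> chars (on_ob E Y)" "z = encode (on_ob E Y) \<psi>" by (rule char_dual_cases[OF cd z(1)])
    have "encode (on_ob E X) (pull C E f \<psi>) = encode (on_ob E X) \<chi>" using on_ar_char_dual[OF cd f \<psi>(1)] z(2) \<psi>(2) by simp
    then have "pull C E f \<psi> = \<chi>"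
      by (rule inj_onD[OF encode_inj[OF cd ob(1)] _ pull_closed[OF E category_axioms f \<psi>(1)] \<chi>(1)])
    then have "\<chi> a = \<psi> (on_ar E f a)" using pull_apply[OF f a] by metis
    then show False using fa \<chi>(3) character_one[OF covariant_group'[OF E ob(2)] \<psi>(1)] by simp
  qed
  then show "\<exists>W. \<exists>h\<in>Hom C W X. \<exists>b\<in>sec E W. f \<star> h = hzero C W Y \<and> on_ar E h b = a" using h by blast
qed

lemma (in exact_sequences_category) flat_injective_isomorphic:
  fixes F :: "('o, 'u, 'u) module_fctr"
  assumes iso: "isomorphic (ModCat C) F G" and \<Psi>: "\<Psi> \<subseteq> Arr C"
  shows "F \<in> flat_injective C \<Psi> \<longleftrightarrow> G \<in> flat_injective C \<Psi>"
proof -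
  have transfer: "F \<in> flat_injective C \<Psi>" if iso: "isomorphic (ModCat C) F G" and G: "G \<in> flat_injective C \<Psi>"
    for F G :: "('o, 'u, 'u) module_fctr"
  proof -
    obtain s t where "s \<in> Hom (ModCat C) F G" "t \<in> Hom (ModCat C) G F" "t \<star>\<^bsub>ModCat C\<^esub> s = Ide (ModCat C) F"
      using iso unfolding isomorphic_def iso_arrow_def by blast
    then show ?thesis by (rule flat_injective_retract[OF G \<Psi>])
  qed
  show ?thesis
    using transfer[OF iso] transfer[OF category.isomorphic_sym[OF category_ModCat[OF category_axioms] iso]] by blast
qed

text \<open>An extension problem along \<open>f\<close> is moved to \<open>f'\<close> by the
  retraction \<open>e'\<close>, solved there, and the solution is pulled back along
  \<open>d\<close>. It serves to compare an arrow with its double dual.\<close>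

lemma (in category) precompose_surjective_transfer:
  assumes f: "f \<in> Hom C X X'" and f': "f' \<in> Hom C Z Z'" and e: "e \<in> Hom C X Z" "e' \<in> Hom C Z X" "e' \<star> e = Ide C X"
    and d: "d \<in> Hom C X' Z'" and nat: "d \<star> f = f' \<star> e"
    and surj: "(\<lambda>g. g \<star> f') ` Hom C Z' Y = Hom C Z Y"
  shows "(\<lambda>g. g \<star> f) ` Hom C X' Y = Hom C X Y"
proof (intro equalityI subsetI)
  fix v assume "v \<in> (\<lambda>g. g \<star> f) ` Hom C X' Y"
  then show "v \<in> Hom C X Y" using Comp_closed[OF f] by blast
next
  fix v assume v: "v \<in> Hom C X Y"
  have "v \<star> e' \<in> (\<lambda>g. g \<star> f') ` Hom C Z' Y" unfolding surj by (rule Comp_closed[OF e(2) v])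
  then obtain w where w: "w \<in> Hom C Z' Y" "v \<star> e' = w \<star> f'" by blast
  have "v = (v \<star> e') \<star> e" using Comp_assoc[OF e(1,2) v] e(3) Comp_Ide[OF v] by simp
  also have "\<dots> = (w \<star> d) \<star> f" using Comp_assoc[OF e(1) f' w(1)] Comp_assoc[OF f d w(1)] nat w(2) by simp
  finally show "v \<in> (\<lambda>g. g \<star> f) ` Hom C X' Y" using Comp_closed[OF d w(1)] by (rule image_eqI)
qed

section \<open>Auslander--Gruson--Jensen duality triples\<close>

locale AGJ =
  fixes T :: "('o, 'u, 'y) tri_category_scheme" (structure) and U :: "('p, 'u, 'z) tri_category_scheme"
    and QT :: "('o, 'u, 'p, 'u) fctr" and QU :: "('p, 'u, 'o, 'u) fctr"
    and DT :: "('o, 'u, 'p, 'u) fctr" and DU :: "('p, 'u, 'o, 'u) fctr"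
  assumes universe: "inaccessible_universe TYPE('u)" and AGJ: "AGJ_duality_triple T U QT QU DT DU"

lemma adjoint_duality_sym: "adjoint_duality A B D E \<Longrightarrow> adjoint_duality B A E D"
  unfolding adjoint_duality_def by blast

text \<open>The data are symmetric in the two categories, so each result below is proved for one
  side and transferred to the other through this lemma, under the name \<open>sym\<close>.\<close>

lemma AGJ_sym: "AGJ T U QT QU DT DU \<Longrightarrow> AGJ U T QU QT DU DT"
  unfolding AGJ_def AGJ_duality_triple_def duality_triple_def using adjoint_duality_sym by blast

text \<open>The inverses of the unit are kept as arrows of their own, together with their
  naturality. The counit is obtained as the unit of the mirrored triple.\<close>

definition inverse_units :: "('o, 'a, 'y) category_scheme \<Rightarrow> ('o, 'a, 'p, 'b) fctr \<Rightarrow> ('p, 'b, 'o, 'a) fctr \<Rightarrow>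
    ('o \<Rightarrow> 'a) \<Rightarrow> ('o \<Rightarrow> 'a) \<Rightarrow> bool"
  where "inverse_units A D E \<eta> \<eta>' \<longleftrightarrow>
    (\<forall>C\<in>Ob A. \<eta> C \<in> Hom A C (on_ob E (on_ob D C)) \<and> \<eta>' C \<in> Hom A (on_ob E (on_ob D C)) C \<and>
      \<eta>' C \<star>\<^bsub>A\<^esub> \<eta> C = Ide A C \<and> \<eta> C \<star>\<^bsub>A\<^esub> \<eta>' C = Ide A (on_ob E (on_ob D C))) \<and>
    (\<forall>B C. \<forall>f\<in>Hom A B C. \<eta> C \<star>\<^bsub>A\<^esub> f = on_ar E (on_ar D f) \<star>\<^bsub>A\<^esub> \<eta> B \<and>
      \<eta>' C \<star>\<^bsub>A\<^esub> on_ar E (on_ar D f) = f \<star>\<^bsub>A\<^esub> \<eta>' B)"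

lemma inverse_unitsD:
  assumes "inverse_units (compacts T) D E \<eta> \<eta>'"
  shows "compact_object T C \<Longrightarrow> \<eta> C \<in> Hom (compacts T) C (on_ob E (on_ob D C))"
    "compact_object T C \<Longrightarrow> \<eta>' C \<in> Hom (compacts T) (on_ob E (on_ob D C)) C"
    "compact_object T C \<Longrightarrow> \<eta>' C \<star>\<^bsub>T\<^esub> \<eta> C = Ide T C"
    "compact_object T C \<Longrightarrow> \<eta> C \<star>\<^bsub>T\<^esub> \<eta>' C = Ide T (on_ob E (on_ob D C))"
    "f \<in> Hom (compacts T) B C \<Longrightarrow> \<eta> C \<star>\<^bsub>T\<^esub> f = on_ar E (on_ar D f) \<star>\<^bsub>T\<^esub> \<eta> B"
    "f \<in> Hom (compacts T) B C \<Longrightarrow> \<eta>' C \<star>\<^bsub>T\<^esub> on_ar E (on_ar D f) = f \<star>\<^bsub>T\<^esub> \<eta>' B"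
  using assms by (simp_all add: inverse_units_def)

section \<open>The duality on compact objects: faithfulness, additivity, transfer of
  flatness\<close>

context AGJ
begin

lemmas sym = AGJ_sym[OF AGJ_axioms]

abbreviation \<A> where "\<A> \<equiv> compacts T"
abbreviation \<B> where "\<B> \<equiv> compacts U"

abbreviation dual (\<open>\<partial>\<close>)
  where "\<partial> \<equiv> dual_presheaf \<A> DT"

lemma duality: "duality_triple T U QT QU"
  and dual_adjoint: "adjoint_duality \<A> \<B> DT DU"
  and char_isos: "character_isos T U QT DT"
  using AGJ unfolding AGJ_duality_triple_def by auto

lemma cgT: "compactly_generated T" and cgU: "compactly_generated U"
  using duality unfolding duality_triple_def by auto

interpretation T: triangulated_category T
  by (rule compactly_generatedD[OF cgT])
interpretation U: triangulated_category U
  by (rule compactly_generatedD[OF cgU])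
interpretation A: exact_sequences_category \<A>
  by (rule T.compacts_exact_sequences[OF universe cgT])
interpretation B: exact_sequences_category \<B>
  by (rule U.compacts_exact_sequences[OF universe cgU])

lemma
  shows DT_ob: "compact_object T C \<Longrightarrow> compact_object U (on_ob DT C)"
    and DT_Ide: "compact_object T C \<Longrightarrow> on_ar DT (Ide T C) = Ide U (on_ob DT C)"
    and DT_closed: "f \<in> Hom \<A> B C \<Longrightarrow> on_ar DT f \<in> Hom \<B> (on_ob DT C) (on_ob DT B)"
    and DT_Comp: "f \<in> Hom \<A> B C \<Longrightarrow> g \<in> Hom \<A> C D \<Longrightarrow>
      on_ar DT (g \<star> f) = on_ar DT f \<star>\<^bsub>U\<^esub> on_ar DT g"
proof -
  have "contra_functor \<A> \<B> DT" using dual_adjoint by (simp add: adjoint_duality_def)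
  note D = this[unfolded contra_functor_def, simplified]
  show "compact_object T C \<Longrightarrow> compact_object U (on_ob DT C)"
    "compact_object T C \<Longrightarrow> on_ar DT (Ide T C) = Ide U (on_ob DT C)" using D by blast+
  show "f \<in> Hom \<A> B C \<Longrightarrow> on_ar DT f \<in> Hom \<B> (on_ob DT C) (on_ob DT B)" using D by blast
  show "f \<in> Hom \<A> B C \<Longrightarrow> g \<in> Hom \<A> C D \<Longrightarrow>
      on_ar DT (g \<star> f) = on_ar DT f \<star>\<^bsub>U\<^esub> on_ar DT g"
    using D by blast
qed

lemma QU_ob: "Y \<in> Ob U \<Longrightarrow> on_ob QU Y \<in> Ob T"
  using duality by (simp add: duality_triple_def pure_injective_def)

lemma unit_exists: "\<exists>\<eta> \<eta>'. inverse_units \<A> DT DU \<eta> \<eta>'"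
proof -
  obtain \<eta> where iso': "\<forall>C\<in>Ob \<A>. iso_arrow \<A> C (on_ob DU (on_ob DT C)) (\<eta> C)"
    and nat': "\<forall>B C. \<forall>f\<in>Hom \<A> B C. \<eta> C \<star>\<^bsub>\<A>\<^esub> f = on_ar DU (on_ar DT f) \<star>\<^bsub>\<A>\<^esub> \<eta> B"
    using dual_adjoint unfolding adjoint_duality_def by (elim conjE exE) (rule that)
  have iso: "iso_arrow \<A> C (on_ob DU (on_ob DT C)) (\<eta> C)" if "compact_object T C" for C using iso' that by simp
  have nat: "\<eta> C \<star> f = on_ar DU (on_ar DT f) \<star> \<eta> B" if "f \<in> Hom \<A> B C" for B C f
    using bspec[OF spec[OF spec[OF nat']] that] by simp
  have "\<exists>e. e \<in> Hom \<A> (on_ob DU (on_ob DT C)) C \<and> e \<star> \<eta> C = Ide T C \<and>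
      \<eta> C \<star> e = Ide T (on_ob DU (on_ob DT C))" if C: "compact_object T C" for C
    using iso[OF C] unfolding iso_arrow_def compacts_simps by blast
  then obtain \<eta>' where \<eta>': "\<And>C. compact_object T C \<Longrightarrow> \<eta>' C \<in> Hom \<A> (on_ob DU (on_ob DT C)) C"
    "\<And>C. compact_object T C \<Longrightarrow> \<eta>' C \<star> \<eta> C = Ide T C"
    "\<And>C. compact_object T C \<Longrightarrow> \<eta> C \<star> \<eta>' C = Ide T (on_ob DU (on_ob DT C))" by metis
  have \<eta>: "\<eta> C \<in> Hom \<A> C (on_ob DU (on_ob DT C))" if C: "compact_object T C" for C
    using iso[OF C] by (simp add: iso_arrow_def)
  have nat\<eta>': "\<eta>' C \<star> on_ar DU (on_ar DT f) = f \<star> \<eta>' B" if f: "f \<in> Hom \<A> B C" for B C f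
  proof -
    have BC: "compact_object T B" "compact_object T C" using f by (simp_all add: Hom_compacts)
    note DDf = AGJ.DT_closed[OF sym DT_closed[OF f]] and B = \<eta>[OF BC(1)] \<eta>'(1)[OF BC(1)]
      and C = \<eta>[OF BC(2)] \<eta>'(1)[OF BC(2)]
    have fB: "f \<star> \<eta>' B \<in> Hom \<A> (on_ob DU (on_ob DT B)) C" using A.Comp_closed[OF B(2) f] by simp
    have "on_ar DU (on_ar DT f) = on_ar DU (on_ar DT f) \<star> (\<eta> B \<star> \<eta>' B)" using A.Comp_Ide[OF DDf] \<eta>'(3)[OF BC(1)] by simp
    also have "\<dots> = (\<eta> C \<star> f) \<star> \<eta>' B" using A.Comp_assoc[OF B(2,1) DDf] nat[OF f] by simp
    also have "\<dots> = \<eta> C \<star> (f \<star> \<eta>' B)" using A.Comp_assoc[OF B(2) f C(1)] by simp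
    finally show ?thesis using A.Comp_assoc[OF fB C] \<eta>'(2)[OF BC(2)] A.Ide_Comp[OF fB] by simp
  qed
  have "inverse_units \<A> DT DU \<eta> \<eta>'" by (simp add: inverse_units_def \<eta> \<eta>' nat nat\<eta>')
  then show ?thesis by blast
qed

text \<open>The unit conjugates an arrow into its double dual, from which the arrow can be
  recovered.\<close>

lemma DT_faithful:
  assumes f: "f \<in> Hom \<A> B C" and g: "g \<in> Hom \<A> B C" and eq: "on_ar DT f = on_ar DT g"
  shows "f = g"
proof -
  obtain \<eta> \<eta>' where "inverse_units \<A> DT DU \<eta> \<eta>'" using unit_exists by blast
  note \<eta> = inverse_unitsD[OF this]
  have C: "compact_object T C" using f by (simp add: Hom_compacts)
  have "\<eta> C \<star> f = \<eta> C \<star> g"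
    unfolding \<eta>(5)[OF f] \<eta>(5)[OF g] eq ..
  then have "\<eta>' C \<star> (\<eta> C \<star> f) = \<eta>' C \<star> (\<eta> C \<star> g)" by simp
  then show ?thesis
    using A.Comp_assoc[OF f \<eta>(1,2)[OF C]] A.Comp_assoc[OF g \<eta>(1,2)[OF C]] \<eta>(3)[OF C] A.Ide_Comp[OF f] A.Ide_Comp[OF g]
    by simp
qed

lemma character_isosE:
  obtains \<Psi> where "\<And>C X. compact_object T C \<Longrightarrow> X \<in> Ob T \<Longrightarrow>
      \<Psi> C X \<in> iso (character_group (hom_group T C X)) (hom_group U (on_ob DT C) (on_ob QT X))"
    "\<And>B C f X \<phi>. f \<in> Hom \<A> B C \<Longrightarrow> X \<in> Ob T \<Longrightarrow> \<phi> \<in> chars (hom_group T B X) \<Longrightarrow>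
      \<Psi> C X (\<lambda>h\<in>Hom T C X. \<phi> (h \<star> f)) = \<Psi> B X \<phi> \<star>\<^bsub>U\<^esub> on_ar DT f"
proof -
  obtain \<Psi> where iso: "\<forall>C\<in>Ob \<A>. \<forall>X\<in>Ob T.
      \<Psi> C X \<in> iso (character_group (hom_group T C X)) (hom_group U (on_ob DT C) (on_ob QT X))"
    and nat: "\<forall>B C. \<forall>f\<in>Hom \<A> B C. \<forall>X\<in>Ob T. \<forall>\<phi>\<in>chars (hom_group T B X).
      \<Psi> C X (\<lambda>h\<in>Hom T C X. \<phi> (h \<star> f)) = \<Psi> B X \<phi> \<star>\<^bsub>U\<^esub> on_ar DT f"
    using char_isos unfolding character_isos_def by (elim conjE exE) (rule that)
  show ?thesis
  proof (rule that)
    show "\<Psi> C X \<in> iso (character_group (hom_group T C X)) (hom_group U (on_ob DT C) (on_ob QT X))"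
      if "compact_object T C" "X \<in> Ob T" for C X using iso that by simp
    show "\<Psi> C X (\<lambda>h\<in>Hom T C X. \<phi> (h \<star> f)) = \<Psi> B X \<phi> \<star>\<^bsub>U\<^esub> on_ar DT f"
      if "f \<in> Hom \<A> B C" "X \<in> Ob T" "\<phi> \<in> chars (hom_group T B X)" for B C f X \<phi> using nat that by blast
  qed
qed

text \<open>Under the character isomorphism, composing an arrow \<open>u\<close> from
  \<open>D B\<close> to \<open>Q X\<close> with \<open>D f\<close> corresponds to precomposing
  characters with \<open>f\<close>, which is additive in \<open>f\<close>. So the two sides agree
  after composition with any such \<open>u\<close>, in particular with the unit of
  \<open>D B\<close>, whose target is a \<open>Q\<close> of something.\<close>

lemma DT_hadd:
  assumes f: "f \<in> Hom \<A> B C" and g: "g \<in> Hom \<A> B C"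
  shows "on_ar DT (hadd T f g) = hadd U (on_ar DT f) (on_ar DT g)"
proof -
  obtain \<Psi> where iso: "\<And>C X. compact_object T C \<Longrightarrow> X \<in> Ob T \<Longrightarrow>
      \<Psi> C X \<in> iso (character_group (hom_group T C X)) (hom_group U (on_ob DT C) (on_ob QT X))"
    and nat: "\<And>B C f X \<phi>. f \<in> Hom \<A> B C \<Longrightarrow> X \<in> Ob T \<Longrightarrow> \<phi> \<in> chars (hom_group T B X) \<Longrightarrow>
      \<Psi> C X (\<lambda>h\<in>Hom T C X. \<phi> (h \<star> f)) = \<Psi> B X \<phi> \<star>\<^bsub>U\<^esub> on_ar DT f"
    by (rule character_isosE) blast
  have BC: "compact_object T B" "compact_object T C" and fg: "f \<in> Hom T B C" "g \<in> Hom T B C"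
    using f g by (simp_all add: Hom_compacts)
  note D = DT_closed[OF f] DT_closed[OF g] DT_closed[OF A.hadd_closed[OF f g], simplified]
  have D': "on_ar DT f \<in> Hom U (on_ob DT C) (on_ob DT B)" "on_ar DT g \<in> Hom U (on_ob DT C) (on_ob DT B)"
    "on_ar DT (hadd T f g) \<in> Hom U (on_ob DT C) (on_ob DT B)" using D by (simp_all add: Hom_compacts)
  have equalised: "u \<star>\<^bsub>U\<^esub> on_ar DT (hadd T f g) = u \<star>\<^bsub>U\<^esub> hadd U (on_ar DT f) (on_ar DT g)"
    if X: "X \<in> Ob T" and u: "u \<in> Hom U (on_ob DT B) (on_ob QT X)" for X u
  proof -
    have hg: "comm_group (hom_group T C X)" "comm_group (hom_group T B X)"
      using T.hom_group compact_object_ob[OF BC(1)] compact_object_ob[OF BC(2)] X by auto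
    obtain \<phi> where \<phi>: "\<phi> \<in> chars (hom_group T B X)" "u = \<Psi> B X \<phi>"
      using iso[OF BC(1) X] u by (auto simp: iso_def bij_betw_def)
    have char: "(\<lambda>h\<in>Hom T C X. \<phi> (h \<star> k)) \<in> chars (hom_group T C X)" if k: "k \<in> Hom T B C" for k
    proof -
      have "(\<lambda>h. \<phi> (h \<star> k)) \<in> hom (hom_group T C X) QZ"
        using character_closed[OF \<phi>(1)] character_mult[OF \<phi>(1)] T.Comp_closed[OF k] T.Comp_hadd_left[OF k]
        by (simp add: hom_def)
      from restrict_character[OF comm_group.axioms(2)[OF hg(1)] this] show ?thesis by simp
    qed
    have "(\<lambda>h\<in>Hom T C X. \<phi> (h \<star> hadd T f g)) = (\<lambda>h\<in>Hom T C X. \<phi> (h \<star> f)) \<otimes>\<^bsub>character_group (hom_group T C X)\<^esub>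
        (\<lambda>h\<in>Hom T C X. \<phi> (h \<star> g))"
      using character_mult[OF \<phi>(1)] T.Comp_closed[OF fg(1)] T.Comp_closed[OF fg(2)] T.Comp_hadd_right[OF fg]
      by (simp add: mult_character_group cong: restrict_cong)
    moreover have "\<Psi> C X \<in> hom (character_group (hom_group T C X)) (hom_group U (on_ob DT C) (on_ob QT X))"
      using iso[OF BC(2) X] by (simp add: iso_def)
    note hom_mult[OF this char[OF fg(1)] char[OF fg(2)]]
    ultimately have sum: "\<Psi> C X (\<lambda>h\<in>Hom T C X. \<phi> (h \<star> hadd T f g)) =
        hadd U (\<Psi> C X (\<lambda>h\<in>Hom T C X. \<phi> (h \<star> f))) (\<Psi> C X (\<lambda>h\<in>Hom T C X. \<phi> (h \<star> g)))"
      by (simp only: hom_group_simps)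
    have fg': "hadd T f g \<in> Hom \<A> B C" using A.hadd_closed[OF f g] by simp
    have "u \<star>\<^bsub>U\<^esub> on_ar DT (hadd T f g) = hadd U (u \<star>\<^bsub>U\<^esub> on_ar DT f) (u \<star>\<^bsub>U\<^esub> on_ar DT g)"
      unfolding \<phi>(2) nat[OF fg' X \<phi>(1), symmetric] nat[OF f X \<phi>(1), symmetric] nat[OF g X \<phi>(1), symmetric] by (rule sum)
    then show ?thesis
      unfolding U.Comp_hadd_right[OF D'(1,2) u] .
  qed
  obtain iU where "natural_pure_unit U QU QT iU"
    using duality unfolding duality_triple_def by (elim conjE exE) (rule that)
  then obtain i where i: "pure_mono U (on_ob DT B) (on_ob QT (on_ob QU (on_ob DT B))) (i (on_ob DT B))"
    using compact_object_ob[OF DT_ob[OF BC(1)]] unfolding natural_pure_unit_def by blast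
  have "on_ob QU (on_ob DT B) \<in> Ob T"
    using QU_ob[OF compact_object_ob[OF DT_ob[OF BC(1)]]] .
  moreover have iu: "i (on_ob DT B) \<in> Hom U (on_ob DT B) (on_ob QT (on_ob QU (on_ob DT B)))"
    using i by (simp add: pure_mono_def)
  ultimately have eq: "i (on_ob DT B) \<star>\<^bsub>U\<^esub> on_ar DT (hadd T f g) = i (on_ob DT B) \<star>\<^bsub>U\<^esub> hadd U (on_ar DT f) (on_ar DT g)"
    by (rule equalised)
  \<comment> \<open>A pure monomorphism is injective on arrows from compact objects, and
    \<open>on_ob DT C\<close> is compact, so the unit can be cancelled.\<close>
  have "inj_on (\<lambda>h. i (on_ob DT B) \<star>\<^bsub>U\<^esub> h) (Hom U (on_ob DT C) (on_ob DT B))"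
    using i DT_ob[OF BC(2)] unfolding pure_mono_def short_exact_def
    by (auto simp: hom_presheaf_map_def ModCat_def Hom_DomCod[OF iu] hom_presheaf_def)
  then show ?thesis by (rule inj_onD) (use eq D' U.hadd_closed[OF D'(1,2)] in simp_all)
qed

lemma DT_hzero:
  assumes "compact_object T B" "compact_object T C"
  shows "on_ar DT (hzero T B C) = hzero U (on_ob DT C) (on_ob DT B)"
proof -
  have z: "hzero T B C \<in> Hom \<A> B C" using A.hzero_closed[of B C] assms by simp
  interpret G: comm_group "hom_group \<B> (on_ob DT C) (on_ob DT B)" using B.hom_group DT_ob assms by simp
  have "hadd U (on_ar DT (hzero T B C)) (on_ar DT (hzero T B C)) = on_ar DT (hzero T B C)"
    using DT_hadd[OF z z] A.hadd_hzero[OF z] by simp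
  then show ?thesis using G.l_cancel_one'[of "on_ar DT (hzero T B C)" "on_ar DT (hzero T B C)"] DT_closed[OF z] by simp
qed

lemma after_DT_covariant:
  assumes F: "additive_presheaf \<B> F"
  shows "covariant_module \<A> (after F DT)"
  unfolding covariant_module_def
proof (intro conjI ballI allI)
  fix X assume "X \<in> Ob \<A>"
  then have X: "compact_object T X" "on_ob DT X \<in> Ob \<B>" using DT_ob by auto
  show "comm_group (on_ob (after F DT) X)" "small (sec (after F DT) X)"
    using presheaf_group[OF F X(2)] presheaf_small[OF F X(2)] by (simp_all add: after_def)
  show "on_ar (after F DT) (Ide \<A> X) x = x" if "x \<in> sec (after F DT) X" for x
    using presheaf_Ide[OF F X(2)] that DT_Ide[OF X(1)] by (simp add: after_def)
next
  fix X Y f assume f: "f \<in> Hom \<A> X Y"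
  show "on_ar (after F DT) f \<in> hom (on_ob (after F DT) X) (on_ob (after F DT) Y)"
    using presheaf_hom[OF F DT_closed[OF f]] by (simp add: after_def)
next
  fix X Y Z f g x assume f: "f \<in> Hom \<A> X Y" and g: "g \<in> Hom \<A> Y Z"
    and x: "x \<in> sec (after F DT) X"
  show "on_ar (after F DT) (g \<star>\<^bsub>\<A>\<^esub> f) x = on_ar (after F DT) g (on_ar (after F DT) f x)"
    using presheaf_Comp[OF F DT_closed[OF g] DT_closed[OF f], of x] x DT_Comp[OF f g] by (simp add: after_def)
next
  fix X Y f g x assume f: "f \<in> Hom \<A> X Y" and g: "g \<in> Hom \<A> X Y"
    and x: "x \<in> sec (after F DT) X"
  show "on_ar (after F DT) (hadd \<A> f g) x =
      on_ar (after F DT) f x \<otimes>\<^bsub>on_ob (after F DT) Y\<^esub> on_ar (after F DT) g x"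
    using presheaf_hadd[OF F DT_closed[OF f] DT_closed[OF g], of x] x DT_hadd[OF f g] by (simp add: after_def)
qed

lemma dual_presheaf_presheaf:
  fixes F :: "('p, 'u, 'u) module_fctr"
  shows "additive_presheaf \<B> F \<Longrightarrow> additive_presheaf \<A> (\<partial> F)"
  by (subst dual_presheaf_eq) (rule char_dual_presheaf[OF universe A.additive_category_axioms after_DT_covariant])

text \<open>The candidate is \<open>on_ar DU g\<close> conjugated by the unit. Naturality identifies
  its double dual with \<open>on_ar DU g\<close>, and \<open>DU\<close> is faithful by
  symmetry.\<close>

lemma DT_full:
  assumes C: "compact_object T C" "compact_object T C'" and g: "g \<in> Hom \<B> (on_ob DT C') (on_ob DT C)"
  shows "\<exists>f\<in>Hom \<A> C C'. on_ar DT f = g"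
proof -
  obtain \<eta> \<eta>' where "inverse_units \<A> DT DU \<eta> \<eta>'" using unit_exists by blast
  note \<eta> = inverse_unitsD[OF this]
  define f where "f = \<eta>' C' \<star> (on_ar DU g \<star> \<eta> C)"
  note Dg = AGJ.DT_closed[OF sym g]
  have g\<eta>: "on_ar DU g \<star> \<eta> C \<in> Hom \<A> C (on_ob DU (on_ob DT C'))" using A.Comp_closed[OF \<eta>(1)[OF C(1)] Dg] by simp
  have f: "f \<in> Hom \<A> C C'" unfolding f_def using A.Comp_closed[OF g\<eta> \<eta>(2)[OF C(2)]] by simp
  note DDf = AGJ.DT_closed[OF sym DT_closed[OF f]]
  have "on_ar DU (on_ar DT f) \<star> \<eta> C = on_ar DU g \<star> \<eta> C"
    unfolding \<eta>(5)[OF f, symmetric] unfolding f_def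
    using A.Comp_assoc[OF g\<eta> \<eta>(2)[OF C(2)] \<eta>(1)[OF C(2)]] \<eta>(4)[OF C(2)] A.Ide_Comp[OF g\<eta>] by simp
  then have "(on_ar DU (on_ar DT f) \<star> \<eta> C) \<star> \<eta>' C = (on_ar DU g \<star> \<eta> C) \<star> \<eta>' C" by simp
  then have "on_ar DU (on_ar DT f) = on_ar DU g"
    using A.Comp_assoc[OF \<eta>(2,1)[OF C(1)] DDf] A.Comp_assoc[OF \<eta>(2,1)[OF C(1)] Dg] \<eta>(4)[OF C(1)] A.Comp_Ide[OF DDf] A.Comp_Ide[OF Dg]
    by simp
  then have "on_ar DT f = g" by (rule AGJ.DT_faithful[OF sym DT_closed[OF f] g])
  then show ?thesis using f by blast
qed

text \<open>The duality reverses arrows: a witness \<open>g\<close> after \<open>on_ar DT f\<close>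
  becomes, once its end point is replaced by an isomorphic double dual, the image of an arrow
  \<open>h\<close> before \<open>f\<close>.\<close>

lemma flat_presheaf_after:
  fixes F :: "('p, 'u, 'u) module_fctr"
  assumes F: "additive_presheaf \<B> F" and flat: "flat_presheaf \<B> F"
  shows "flat_covariant \<A> (after F DT)"
  unfolding flat_covariant_def
proof (intro allI ballI impI)
  fix X Y f a assume f: "f \<in> Hom \<A> X Y" and "a \<in> sec (after F DT) X"
    and "on_ar (after F DT) f a = \<one>\<^bsub>on_ob (after F DT) Y\<^esub>"
  then have a: "a \<in> sec F (on_ob DT X)" "on_ar F (on_ar DT f) a = \<one>\<^bsub>on_ob F (on_ob DT Y)\<^esub>" by (simp_all add: after_def)
  obtain Z g z where g: "g \<in> Hom \<B> (on_ob DT X) Z" and z: "z \<in> sec F Z"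
    and gf: "g \<star>\<^bsub>U\<^esub> on_ar DT f = hzero U (on_ob DT Y) Z" and gz: "on_ar F g z = a"
    using B.flat_presheafE[OF flat DT_closed[OF f] a] by (metis compacts_simps(6,7))
  obtain \<epsilon> \<epsilon>' where "inverse_units \<B> DU DT \<epsilon> \<epsilon>'" using AGJ.unit_exists[OF sym] by blast
  note \<epsilon> = inverse_unitsD[OF this]
  have XY: "compact_object T X" "compact_object T Y" and Z: "compact_object U Z" using f g by (simp_all add: Hom_compacts)
  define W where "W = on_ob DU Z"
  have W: "compact_object T W" unfolding W_def by (rule AGJ.DT_ob[OF sym Z])
  note e = \<epsilon>(1)[OF Z, folded W_def] and e' = \<epsilon>(2)[OF Z, folded W_def]
  have eg: "\<epsilon> Z \<star>\<^bsub>U\<^esub> g \<in> Hom \<B> (on_ob DT X) (on_ob DT W)" using B.Comp_closed[OF g e] by simp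
  obtain h where h: "h \<in> Hom \<A> W X" "on_ar DT h = \<epsilon> Z \<star>\<^bsub>U\<^esub> g" using DT_full[OF W XY(1) eg] by blast
  have fh: "f \<star> h \<in> Hom \<A> W Y" using A.Comp_closed[OF h(1) f] by simp
  have z0: "hzero T W Y \<in> Hom \<A> W Y" using A.hzero_closed[of W Y] W XY(2) by simp
  have "on_ar DT (f \<star> h) = on_ar DT (hzero T W Y)"
    unfolding DT_Comp[OF h(1) f] DT_hzero[OF W XY(2)] h(2)
    using B.Comp_assoc[OF DT_closed[OF f] g e] B.Comp_hzero_right[OF e, of "on_ob DT Y"] gf DT_ob[OF XY(2)] by simp
  then have "f \<star> h = hzero T W Y" by (rule DT_faithful[OF fh z0])
  moreover have "on_ar F (on_ar DT h) (on_ar F (\<epsilon>' Z) z) = a"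
  proof -
    have "on_ar F (on_ar DT h) (on_ar F (\<epsilon>' Z) z) = on_ar F (\<epsilon>' Z \<star>\<^bsub>U\<^esub> (\<epsilon> Z \<star>\<^bsub>U\<^esub> g)) z"
      unfolding h(2) using presheaf_Comp[OF F eg e' z] by simp
    also have "\<epsilon>' Z \<star>\<^bsub>U\<^esub> (\<epsilon> Z \<star>\<^bsub>U\<^esub> g) = g" using B.Comp_assoc[OF g e e'] \<epsilon>(3)[OF Z] B.Ide_Comp[OF g] by simp
    finally show ?thesis using gz by simp
  qed
  moreover have "on_ar F (\<epsilon>' Z) z \<in> sec F (on_ob DT W)" by (rule presheaf_closed[OF F e' z])
  ultimately show "\<exists>W. \<exists>h\<in>Hom \<A> W X. \<exists>b\<in>sec (after F DT) W.
      f \<star>\<^bsub>\<A>\<^esub> h = hzero \<A> W Y \<and> on_ar (after F DT) h b = a"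
    using h(1) by (intro exI[of _ W] bexI[of _ h] bexI[of _ "on_ar F (\<epsilon>' Z) z"]) (simp_all add: after_def)
qed

text \<open>The element is first moved along \<open>\<epsilon>' Y\<close> to the value at a double
  dual, where the covariant criterion applies; the witness found there is then composed with
  \<open>\<epsilon> Y\<close>.\<close>

lemma flat_covariant_after:
  fixes F :: "('p, 'u, 'u) module_fctr"
  assumes F: "additive_presheaf \<B> F" and flat: "flat_covariant \<A> (after F DT)"
  shows "flat_presheaf \<B> F"
  unfolding flat_presheaf_def
proof (intro allI ballI impI)
  fix X Y g y assume g: "g \<in> Hom \<B> X Y" and y: "y \<in> sec F Y" and gy: "on_ar F g y = \<one>\<^bsub>on_ob F X\<^esub>"
  have X: "compact_object U X" and Y: "compact_object U Y" using g by (simp_all add: Hom_compacts)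
  obtain \<epsilon> \<epsilon>' where "inverse_units \<B> DU DT \<epsilon> \<epsilon>'" using AGJ.unit_exists[OF sym] by blast
  note \<epsilon> = inverse_unitsD[OF this]
  define a where "a = on_ar F (\<epsilon>' Y) y"
  note Dg = AGJ.DT_closed[OF sym g] and DDg = DT_closed[OF AGJ.DT_closed[OF sym g]]
  note eX = \<epsilon>(1)[OF X] and eX' = \<epsilon>(2)[OF X] and eY = \<epsilon>(1)[OF Y] and eY' = \<epsilon>(2)[OF Y]
  have a: "a \<in> sec F (on_ob DT (on_ob DU Y))" unfolding a_def by (rule presheaf_closed[OF F eY' y])
  have "on_ar F (on_ar DT (on_ar DU g)) a = on_ar F (\<epsilon>' X) (on_ar F g y)"
    unfolding a_def using presheaf_Comp[OF F DDg eY' y] presheaf_Comp[OF F eX' g y] \<epsilon>(6)[OF g] by simp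
  then have "on_ar F (on_ar DT (on_ar DU g)) a = \<one>\<^bsub>on_ob F (on_ob DT (on_ob DU X))\<^esub>"
    using gy presheaf_one[OF B.category_axioms F eX'] by simp
  then obtain W h b where h: "h \<in> Hom \<A> W (on_ob DU Y)" and b: "b \<in> sec F (on_ob DT W)"
    and gh: "on_ar DU g \<star> h = hzero T W (on_ob DU X)" and hb: "on_ar F (on_ar DT h) b = a"
    using flat[unfolded flat_covariant_def, rule_format, OF Dg, of a] a by (auto simp: after_def)
  have W: "compact_object T W" using h by (simp add: Hom_compacts)
  have k: "on_ar DT h \<star>\<^bsub>U\<^esub> \<epsilon> Y \<in> Hom \<B> Y (on_ob DT W)" using B.Comp_closed[OF eY DT_closed[OF h]] by simp
  have "(on_ar DT h \<star>\<^bsub>U\<^esub> \<epsilon> Y) \<star>\<^bsub>U\<^esub> g = on_ar DT h \<star>\<^bsub>U\<^esub> (on_ar DT (on_ar DU g) \<star>\<^bsub>U\<^esub> \<epsilon> X)"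
    using B.Comp_assoc[OF g eY DT_closed[OF h]] \<epsilon>(5)[OF g] by simp
  also have "\<dots> = on_ar DT (on_ar DU g \<star> h) \<star>\<^bsub>U\<^esub> \<epsilon> X"
    using B.Comp_assoc[OF eX DDg DT_closed[OF h]] DT_Comp[OF h Dg] by simp
  also have "\<dots> = hzero U X (on_ob DT W)"
    unfolding gh DT_hzero[OF W AGJ.DT_ob[OF sym X]] using B.Comp_hzero_left[OF eX, of "on_ob DT W"] DT_ob[OF W] by simp
  finally have "(on_ar DT h \<star>\<^bsub>U\<^esub> \<epsilon> Y) \<star>\<^bsub>U\<^esub> g = hzero U X (on_ob DT W)" .
  moreover have "on_ar F (on_ar DT h \<star>\<^bsub>U\<^esub> \<epsilon> Y) b = y"
    using presheaf_Comp[OF F eY DT_closed[OF h] b] hb presheaf_Comp[OF F eY eY' y] \<epsilon>(3)[OF Y] presheaf_Ide[OF F _ y] Y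
    by (simp add: a_def)
  ultimately show "\<exists>Z. \<exists>g'\<in>Hom \<B> Y Z. \<exists>z\<in>sec F Z. g' \<star>\<^bsub>\<B>\<^esub> g = hzero \<B> X Z \<and> on_ar F g' z = y"
    using k b by (intro exI[of _ "on_ob DT W"] bexI[of _ "on_ar DT h \<star>\<^bsub>U\<^esub> \<epsilon> Y"] bexI[of _ b]) simp_all
qed

lemma dual_flat:
  fixes F :: "('p, 'u, 'u) module_fctr"
  assumes F: "additive_presheaf \<B> F" and flat: "flat_presheaf \<A> (\<partial> F)"
  shows "flat_presheaf \<B> F"
proof -
  have "flat_presheaf \<A> (char_dual \<A> (after F DT))" using flat by (subst (asm) dual_presheaf_eq)
  then show ?thesis by (intro flat_covariant_after[OF F] A.char_dual_flat_covariant[OF after_DT_covariant[OF F]])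
qed

lemma dual_representable:
  fixes F :: "('p, 'u, 'u) module_fctr"
  assumes F: "additive_presheaf \<B> F" and flat: "flat_presheaf \<B> F"
  shows "\<exists>X\<in>Ob T. isomorphic (ModCat \<A>) (\<partial> F) (yoneda T X)"
proof -
  interpret flat_functional T "after F DT"
    by (intro flat_functional.intro flat_functional_axioms.intro T.triangulated_category_axioms universe cgT
        after_DT_covariant[OF F] flat_presheaf_after[OF F flat])
  show ?thesis by (subst dual_presheaf_eq) (rule char_dual_representable)
qed

lemma dual_surjective_iff:
  fixes F :: "('p, 'u, 'u) module_fctr"
  assumes F: "additive_presheaf \<B> F" and f: "f \<in> Hom \<A> X Y"
  shows "on_ar (\<partial> F) f ` sec (\<partial> F) Y =
      sec (\<partial> F) X \<longleftrightarrow>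
    (\<forall>a\<in>sec F (on_ob DT X). on_ar F (on_ar DT f) a = \<one>\<^bsub>on_ob F (on_ob DT Y)\<^esub> \<longrightarrow> a = \<one>\<^bsub>on_ob F (on_ob DT X)\<^esub>)"
  using char_dual_surjective_iff[OF universe A.additive_category_axioms after_DT_covariant[OF F] f]
  by (subst (1 2 3) dual_presheaf_eq) (simp add: after_def)

lemma dual_injective_iff:
  fixes F :: "('p, 'u, 'u) module_fctr"
  assumes F: "additive_presheaf \<B> F" and f: "f \<in> Hom \<A> X Y"
  shows "(\<forall>v\<in>sec (\<partial> F) Y.
      on_ar (\<partial> F) f v = \<one>\<^bsub>on_ob (\<partial> F) X\<^esub> \<longrightarrow>
      v = \<one>\<^bsub>on_ob (\<partial> F) Y\<^esub>) \<longleftrightarrow>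
    on_ar F (on_ar DT f) ` sec F (on_ob DT X) = sec F (on_ob DT Y)"
  using char_dual_injective_iff[OF universe A.additive_category_axioms after_DT_covariant[OF F] f]
  by (subst (1 2 3 4) dual_presheaf_eq) (simp add: after_def)

lemma flat_injective_image_iff:
  fixes F :: "('p, 'u, 'u) module_fctr"
  assumes \<Phi>: "\<Phi> \<subseteq> Arr \<A>" and F: "additive_presheaf \<B> F"
  shows "F \<in> flat_injective \<B> (on_ar DT ` \<Phi>) \<longleftrightarrow> flat_presheaf \<B> F \<and> (\<forall>f\<in>\<Phi>. onto T (\<partial> F) f)"
proof -
  have f: "f \<in> Hom \<A> (Dom T f) (Cod T f)" if "f \<in> \<Phi>" for f using that \<Phi> by (auto simp: Hom_def)
  have D: "Dom U (on_ar DT f) = on_ob DT (Cod T f)" "Cod U (on_ar DT f) = on_ob DT (Dom T f)" if "f \<in> \<Phi>" for f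
    using DT_closed[OF f[OF that]] by (simp_all add: Hom_def)
  show ?thesis unfolding flat_injective_def using F by (simp add: D dual_surjective_iff[OF F f] cong: ball_cong)
qed

section \<open>Description of the dual classes, biduals, and duality pairs\<close>

lemma DT_image: "\<Phi> \<subseteq> Arr \<A> \<Longrightarrow> on_ar DT ` \<Phi> \<subseteq> Arr \<B>"
proof
  fix k assume \<Phi>: "\<Phi> \<subseteq> Arr \<A>" and "k \<in> on_ar DT ` \<Phi>"
  then obtain f where "f \<in> Arr \<A>" "k = on_ar DT f" by blast
  then show "k \<in> Arr \<B>" using DT_closed[of f "Dom T f" "Cod T f"] by (simp add: Hom_def)
qed

lemma definableE:
  assumes "definable T \<X>"
  obtains \<Phi> where "\<Phi> \<subseteq> Arr \<A>"
    "\<And>X. X \<in> \<X> \<longleftrightarrow> X \<in> Ob T \<and> (\<forall>f\<in>\<Phi>. onto T (yoneda T X) f)"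
  using assms unfolding definable_def by (elim exE conjE) (rule that, assumption, simp add: hom_presheaf_def)

text \<open>\<open>yoneda_class\<close> asks for some representing object in the class. Membership
  in a definable class is read off from the restricted Yoneda functor, so any other representing
  object gives the same answer, although isomorphic Yoneda functors are not shown to come from
  isomorphic objects.\<close>

lemma yoneda_class_iff:
  assumes \<X>: "definable T \<X>" and X: "X \<in> Ob T" and iso: "isomorphic (ModCat \<A>) F (yoneda T X)"
  shows "F \<in> yoneda_class T \<X> \<longleftrightarrow> X \<in> \<X>"
proof
  assume "X \<in> \<X>"
  then show "F \<in> yoneda_class T \<X>" using iso unfolding yoneda_class_def isomorphic_def by blast
next
  assume "F \<in> yoneda_class T \<X>"
  then obtain X' where X': "X' \<in> \<X>" "isomorphic (ModCat \<A>) F (yoneda T X')" unfolding yoneda_class_def by blast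
  note M = category_ModCat[OF A.category_axioms]
  have iso': "isomorphic (ModCat \<A>) (yoneda T X') (yoneda T X)"
    by (rule category.isomorphic_trans[OF M category.isomorphic_sym[OF M X'(2)] iso])
  obtain \<Phi> where \<Phi>: "\<Phi> \<subseteq> Arr \<A>"
    "\<And>X. X \<in> \<X> \<longleftrightarrow> X \<in> Ob T \<and> (\<forall>f\<in>\<Phi>. onto T (yoneda T X) f)" by (rule definableE[OF \<X>]) blast
  have "onto T (yoneda T X) f" if "f \<in> \<Phi>" for f
  proof (rule isomorphic_surjective[OF A.category_axioms iso'])
    show "f \<in> Hom \<A> (Dom T f) (Cod T f)" using that \<Phi>(1) by (auto simp: Hom_def)
    show "onto T (yoneda T X') f" using \<Phi>(2)[of X'] X'(1) that by blast
  qed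
  then show "X \<in> \<X>" using \<Phi>(2)[of X] X by simp
qed

lemma dual_class_eq:
  assumes \<Phi>: "\<Phi> \<subseteq> Arr \<A>"
    and \<X>: "\<And>X. X \<in> \<X> \<longleftrightarrow> X \<in> Ob T \<and> (\<forall>f\<in>\<Phi>. onto T (yoneda T X) f)"
  shows "dual_class T U DT \<X> = flat_injective \<B> (on_ar DT ` \<Phi>)"
proof (rule Set.set_eqI)
  note M = category_ModCat[OF A.category_axioms]
  fix F :: "('p, 'u, 'u) module_fctr"
  let ?D = "\<partial> F"
  have surj_iff: "(\<forall>f\<in>\<Phi>. onto T ?D f) \<longleftrightarrow> X \<in> \<X>"
    if X: "X \<in> Ob T" and iso: "isomorphic (ModCat \<A>) ?D (yoneda T X)" for X
  proof -
    have "onto T ?D f \<longleftrightarrow>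
      onto T (yoneda T X) f" if "f \<in> \<Phi>" for f
    proof -
      have f: "f \<in> Hom \<A> (Dom T f) (Cod T f)" using that \<Phi> by (auto simp: Hom_def)
      show ?thesis
        by (rule iffI[OF isomorphic_surjective[OF A.category_axioms iso f]
              isomorphic_surjective[OF A.category_axioms category.isomorphic_sym[OF M iso] f]])
    qed
    then show ?thesis using \<X>[of X] X by simp
  qed
  show "F \<in> dual_class T U DT \<X> \<longleftrightarrow> F \<in> flat_injective \<B> (on_ar DT ` \<Phi>)"
  proof
    assume "F \<in> dual_class T U DT \<X>"
    then obtain X where F: "additive_presheaf \<B> F" and X: "X \<in> \<X>" and iso: "isomorphic (ModCat \<A>) ?D (yoneda T X)"
      unfolding dual_class_def yoneda_class_def by auto
    have "flat_presheaf \<A> ?D"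
      by (rule isomorphic_flat[OF A.category_axioms category.isomorphic_sym[OF M iso] T.yoneda_flat[OF cgT]])
    then show "F \<in> flat_injective \<B> (on_ar DT ` \<Phi>)"
      using flat_injective_image_iff[OF \<Phi> F] dual_flat[OF F] surj_iff[OF _ iso] X \<X>[of X] by simp
  next
    assume F': "F \<in> flat_injective \<B> (on_ar DT ` \<Phi>)"
    then have F: "additive_presheaf \<B> F" and flat: "flat_presheaf \<B> F" by (simp_all add: flat_injective_def)
    obtain X where X: "X \<in> Ob T" "isomorphic (ModCat \<A>) ?D (yoneda T X)" using dual_representable[OF F flat] by blast
    have "X \<in> \<X>" using flat_injective_image_iff[OF \<Phi> F] surj_iff[OF X] F' by blast
    then show "F \<in> dual_class T U DT \<X>"
      unfolding dual_class_def yoneda_class_def using F X(2) dual_presheaf_presheaf[OF F] by auto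
  qed
qed

lemma dual_class_flat_injective:
  assumes "definable T \<X>"
  obtains \<Psi> where "\<Psi> \<subseteq> Arr \<B>" "dual_class T U DT \<X> = flat_injective \<B> \<Psi>"
proof -
  obtain \<Phi> where \<Phi>: "\<Phi> \<subseteq> Arr \<A>"
    "\<And>X. X \<in> \<X> \<longleftrightarrow> X \<in> Ob T \<and> (\<forall>f\<in>\<Phi>. onto T (yoneda T X) f)" by (rule definableE[OF assms]) blast
  show ?thesis by (rule that[OF DT_image[OF \<Phi>(1)] dual_class_eq[OF \<Phi>]])
qed

lemma definable_dual_class:
  assumes "definable T \<X>"
  shows "definable_Mod \<B> (dual_class T U DT \<X>)"
  by (rule dual_class_flat_injective[OF assms]) (simp add: B.definable_flat_injective)

text \<open>The isomorphism of the triple describes arrows out of objects of the form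
  \<open>on_ob DT C\<close>. A general compact \<open>C\<close> of \<open>U\<close> is reached by
  evaluating it at \<open>on_ob DU C\<close> and composing with the isomorphism from
  \<open>C\<close> to its double dual.\<close>

lemma dual_yoneda:
  assumes X: "X \<in> Ob T"
  shows "isomorphic (ModCat \<B>) (dual_presheaf \<B> DU (yoneda T X)) (yoneda U (on_ob QT X))"
proof -
  obtain \<Psi> where iso: "\<And>C X. compact_object T C \<Longrightarrow> X \<in> Ob T \<Longrightarrow>
      \<Psi> C X \<in> iso (character_group (hom_group T C X)) (hom_group U (on_ob DT C) (on_ob QT X))"
    and nat: "\<And>B C f X \<phi>. f \<in> Hom \<A> B C \<Longrightarrow> X \<in> Ob T \<Longrightarrow> \<phi> \<in> chars (hom_group T B X) \<Longrightarrow>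
      \<Psi> C X (\<lambda>h\<in>Hom T C X. \<phi> (h \<star> f)) = \<Psi> B X \<phi> \<star>\<^bsub>U\<^esub> on_ar DT f"
    by (rule character_isosE) blast
  obtain \<epsilon> \<epsilon>' where "inverse_units \<B> DU DT \<epsilon> \<epsilon>'" using AGJ.unit_exists[OF sym] by blast
  note \<epsilon>0 = inverse_unitsD[OF this]
  note \<epsilon>' = \<epsilon>0(3,4) and \<epsilon>nat = \<epsilon>0(5)
  have \<epsilon>: "\<And>C. compact_object U C \<Longrightarrow> \<epsilon> C \<in> Hom U C (on_ob DT (on_ob DU C))"
    "\<And>C. compact_object U C \<Longrightarrow> \<epsilon>' C \<in> Hom U (on_ob DT (on_ob DU C)) C" using \<epsilon>0(1,2) by (simp_all add: Hom_compacts)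
  define E where "E = after (yoneda T X) DU"
  have E: "covariant_module \<B> E" unfolding E_def by (rule AGJ.after_DT_covariant[OF sym T.yoneda_presheaf[OF cgT X]])
  have E_ob: "on_ob E C = hom_group T (on_ob DU C) X" for C by (simp add: E_def after_def hom_presheaf_def)
  note cd = universe B.additive_category_axioms E
  let ?D = "char_dual \<B> E" and ?Ch = "\<lambda>C. chars (hom_group T (on_ob DU C) X)"
  define s where "s C \<chi> = \<Psi> (on_ob DU C) X \<chi> \<star>\<^bsub>U\<^esub> \<epsilon> C" for C \<chi>
  define t where "t C u = s C (decode (on_ob E C) u)" for C u
  have ts: "t C (encode (on_ob E C) \<chi>) = s C \<chi>" if "compact_object U C" "\<chi> \<in> ?Ch C" for C \<chi>
    using encode_decode[OF cd, of C \<chi>] that by (simp add: t_def E_ob)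
  have \<Psi>_closed: "\<Psi> (on_ob DU C) X \<chi> \<in> Hom U (on_ob DT (on_ob DU C)) (on_ob QT X)" if "compact_object U C" "\<chi> \<in> ?Ch C" for C \<chi>
    using iso[OF AGJ.DT_ob[OF sym that(1)] X] that(2) by (auto simp: iso_def hom_def)
  have t: "natural \<B> ?D (yoneda U (on_ob QT X)) t"
  proof (rule naturalI)
    fix C u assume C': "C \<in> Ob \<B>" and u: "u \<in> sec ?D C"
    then have C: "compact_object U C" by simp
    obtain \<chi> where \<chi>: "\<chi> \<in> ?Ch C" "u = encode (on_ob E C) \<chi>" by (rule char_dual_cases[OF cd u]) (simp add: E_ob)
    show "t C u \<in> sec (yoneda U (on_ob QT X)) C"
      using U.Comp_closed[OF \<epsilon>(1)[OF C] \<Psi>_closed[OF C \<chi>(1)]] ts[OF C \<chi>(1)] \<chi>(2) by (simp add: s_def hom_presheaf_def)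
    fix w assume w: "w \<in> sec ?D C"
    obtain \<psi> where \<psi>: "\<psi> \<in> ?Ch C" "w = encode (on_ob E C) \<psi>" by (rule char_dual_cases[OF cd w]) (simp add: E_ob)
    interpret Ch: comm_group "character_group (on_ob E C)"
      by (rule comm_group_character_group[OF covariant_group[OF E C']])
    have "\<Psi> (on_ob DU C) X \<in> hom (character_group (on_ob E C)) (hom_group U (on_ob DT (on_ob DU C)) (on_ob QT X))"
      using iso[OF AGJ.DT_ob[OF sym C] X] by (simp add: iso_def E_ob)
    from hom_mult[OF this \<chi>(1)[folded E_ob] \<psi>(1)[folded E_ob]]
    have "s C (\<chi> \<otimes>\<^bsub>character_group (on_ob E C)\<^esub> \<psi>) = hadd U (s C \<chi>) (s C \<psi>)"
      unfolding s_def using U.Comp_hadd_left[OF \<epsilon>(1)[OF C] \<Psi>_closed[OF C \<chi>(1)] \<Psi>_closed[OF C \<psi>(1)]] by simp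
    moreover have "\<chi> \<otimes>\<^bsub>character_group (on_ob E C)\<^esub> \<psi> \<in> ?Ch C"
      using Ch.m_closed[OF \<chi>(1)[folded E_ob] \<psi>(1)[folded E_ob]] by (simp add: E_ob)
    ultimately show "t C (u \<otimes>\<^bsub>on_ob ?D C\<^esub> w) = t C u \<otimes>\<^bsub>on_ob (yoneda U (on_ob QT X)) C\<^esub> t C w"
      using mult_char_dual[OF cd C' \<chi>(1)[folded E_ob] \<psi>(1)[folded E_ob]] ts[OF C] \<chi> \<psi> by (simp add: hom_presheaf_def)
  next
    fix B C f u assume f: "f \<in> Hom \<B> B C" and u: "u \<in> sec ?D C"
    have B: "compact_object U B" and C: "compact_object U C" and fU: "f \<in> Hom U B C"
      using f by (simp_all add: Hom_compacts)
    obtain \<chi> where \<chi>: "\<chi> \<in> ?Ch C" "u = encode (on_ob E C) \<chi>" by (rule char_dual_cases[OF cd u]) (simp add: E_ob)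
    note Df = AGJ.DT_closed[OF sym f]
    have DDf: "on_ar DT (on_ar DU f) \<in> Hom U (on_ob DT (on_ob DU B)) (on_ob DT (on_ob DU C))"
      using DT_closed[OF Df] by (simp add: Hom_compacts)
    have pull: "pull \<B> E f \<chi> = (\<lambda>h\<in>Hom T (on_ob DU B) X. \<chi> (h \<star> on_ar DU f))"
      using Hom_DomCod[OF fU] by (simp add: pull_def E_def after_def hom_presheaf_def)
    have "s B (pull \<B> E f \<chi>) = (\<Psi> (on_ob DU C) X \<chi> \<star>\<^bsub>U\<^esub> on_ar DT (on_ar DU f)) \<star>\<^bsub>U\<^esub> \<epsilon> B"
      unfolding s_def pull nat[OF Df X \<chi>(1)] ..
    also have "\<dots> = s C \<chi> \<star>\<^bsub>U\<^esub> f"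
      unfolding s_def using U.Comp_assoc[OF \<epsilon>(1)[OF B] DDf \<Psi>_closed[OF C \<chi>(1)]]
        U.Comp_assoc[OF fU \<epsilon>(1)[OF C] \<Psi>_closed[OF C \<chi>(1)]] \<epsilon>nat[OF f] by simp
    finally show "t B (on_ar ?D f u) = on_ar (yoneda U (on_ob QT X)) f (t C u)"
      using on_ar_char_dual[OF cd f \<chi>(1)[folded E_ob]] ts[OF C \<chi>(1)] \<chi>(2)
        ts[OF B pull_closed[OF E B.category_axioms f \<chi>(1)[folded E_ob], unfolded E_ob]] by (simp add: hom_presheaf_def)
  qed
  have "bij_betw (t C) (sec ?D C) (sec (yoneda U (on_ob QT X)) C)" if C: "compact_object U C" for C
    unfolding bij_betw_def
  proof (intro conjI inj_onI equalityI subsetI)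
    fix u w assume u: "u \<in> sec ?D C" and w: "w \<in> sec ?D C" and eq: "t C u = t C w"
    obtain \<chi> where \<chi>: "\<chi> \<in> ?Ch C" "u = encode (on_ob E C) \<chi>" by (rule char_dual_cases[OF cd u]) (simp add: E_ob)
    obtain \<psi> where \<psi>: "\<psi> \<in> ?Ch C" "w = encode (on_ob E C) \<psi>" by (rule char_dual_cases[OF cd w]) (simp add: E_ob)
    have cancel: "\<Psi> (on_ob DU C) X \<chi> = s C \<chi> \<star>\<^bsub>U\<^esub> \<epsilon>' C" if "\<chi> \<in> ?Ch C" for \<chi>
      unfolding s_def using U.Comp_assoc[OF \<epsilon>(2,1)[OF C] \<Psi>_closed[OF C that]] \<epsilon>'(2)[OF C] U.Comp_Ide[OF \<Psi>_closed[OF C that]]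
      by simp
    have "\<Psi> (on_ob DU C) X \<chi> = \<Psi> (on_ob DU C) X \<psi>"
      unfolding cancel[OF \<chi>(1)] cancel[OF \<psi>(1)] using eq ts[OF C \<chi>(1)] ts[OF C \<psi>(1)] \<chi>(2) \<psi>(2) by simp
    moreover have "inj_on (\<Psi> (on_ob DU C) X) (?Ch C)"
      using iso[OF AGJ.DT_ob[OF sym C] X] by (simp add: iso_def bij_betw_def)
    ultimately have "\<chi> = \<psi>" using \<chi>(1) \<psi>(1) by (simp add: inj_on_def)
    then show "u = w" using \<chi>(2) \<psi>(2) by simp
  next
    fix v assume "v \<in> t C ` sec ?D C"
    then show "v \<in> sec (yoneda U (on_ob QT X)) C" using natural_closed[OF t] C by auto
  next
    fix v assume "v \<in> sec (yoneda U (on_ob QT X)) C"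
    then have v: "v \<in> Hom U C (on_ob QT X)" by (simp add: hom_presheaf_def)
    have "v \<star>\<^bsub>U\<^esub> \<epsilon>' C \<in> \<Psi> (on_ob DU C) X ` ?Ch C"
      using iso[OF AGJ.DT_ob[OF sym C] X] U.Comp_closed[OF \<epsilon>(2)[OF C] v] by (simp add: iso_def bij_betw_def)
    then obtain \<chi> where \<chi>: "\<chi> \<in> ?Ch C" "v \<star>\<^bsub>U\<^esub> \<epsilon>' C = \<Psi> (on_ob DU C) X \<chi>" by blast
    have "v = (v \<star>\<^bsub>U\<^esub> \<epsilon>' C) \<star>\<^bsub>U\<^esub> \<epsilon> C" using U.Comp_assoc[OF \<epsilon>(1,2)[OF C] v] \<epsilon>'(1)[OF C] U.Comp_Ide[OF v] by simp
    then have "v = t C (encode (on_ob E C) \<chi>)" using ts[OF C \<chi>(1)] \<chi>(2) by (simp add: s_def)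
    then show "v \<in> t C ` sec ?D C" using \<chi>(1) carrier_char_dual[OF cd, of C] by (simp add: E_ob)
  qed
  then have "isomorphic (ModCat \<B>) ?D (yoneda U (on_ob QT X))"
    unfolding isomorphic_ModCat_iff[OF B.category_axioms]
    using char_dual_presheaf[OF cd] U.yoneda_presheaf[OF cgU AGJ.QU_ob[OF sym X]] t by auto
  then show ?thesis by (subst dual_presheaf_eq) (simp add: E_def)
qed

lemma yoneda_in_dual_class:
  assumes \<X>: "definable T \<X>" and Y: "Y \<in> Ob U"
  shows "yoneda U Y \<in> dual_class T U DT \<X> \<longleftrightarrow> on_ob QU Y \<in> \<X>"
  using yoneda_class_iff[OF \<X> QU_ob[OF Y] AGJ.dual_yoneda[OF sym Y]] U.yoneda_presheaf[OF cgU Y]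
  by (simp add: dual_class_def)

text \<open>Transposing along the two dualities, surjectivity of \<open>Hom(f, QQY)\<close> means injectivity of the character
  dual of \<open>Hom(f, Y)\<close> twice over.\<close>

lemma definable_bidual:
  assumes \<X>: "definable T \<X>" and X: "X \<in> Ob T"
  shows "on_ob QU (on_ob QT X) \<in> \<X> \<longleftrightarrow> X \<in> \<X>"
proof -
  obtain \<Phi> where \<Phi>: "\<Phi> \<subseteq> Arr \<A>"
    and \<X>_iff: "\<And>X. X \<in> \<X> \<longleftrightarrow> X \<in> Ob T \<and> (\<forall>f\<in>\<Phi>. onto T (yoneda T X) f)"
    by (rule definableE[OF \<X>]) blast
  obtain \<eta> \<eta>' where "inverse_units \<A> DT DU \<eta> \<eta>'" using unit_exists by blast
  note \<eta>0 = inverse_unitsD[OF this]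
  note inv = \<eta>0(3,4) and nat = \<eta>0(5,6)
  have \<eta>: "\<And>C. compact_object T C \<Longrightarrow> \<eta> C \<in> Hom T C (on_ob DU (on_ob DT C))"
    "\<And>C. compact_object T C \<Longrightarrow> \<eta>' C \<in> Hom T (on_ob DU (on_ob DT C)) C" using \<eta>0(1,2) by (simp_all add: Hom_compacts)
  let ?D = "dual_presheaf \<B> DU (yoneda T X)"
  note yX = T.yoneda_presheaf[OF cgT X] and QX = AGJ.QU_ob[OF sym X]
  have D: "additive_presheaf \<B> ?D" by (rule AGJ.dual_presheaf_presheaf[OF sym yX])
  have flat: "flat_presheaf \<B> ?D"
    by (rule isomorphic_flat[OF B.category_axioms
          category.isomorphic_sym[OF category_ModCat[OF B.category_axioms] dual_yoneda[OF X]] U.yoneda_flat[OF cgU]])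
  have "on_ob QU (on_ob QT X) \<in> \<X> \<longleftrightarrow> yoneda U (on_ob QT X) \<in> flat_injective \<B> (on_ar DT ` \<Phi>)"
    using yoneda_in_dual_class[OF \<X> QX] dual_class_eq[OF \<Phi> \<X>_iff] by simp
  also have "\<dots> \<longleftrightarrow> ?D \<in> flat_injective \<B> (on_ar DT ` \<Phi>)"
    by (rule B.flat_injective_isomorphic[OF dual_yoneda[OF X] DT_image[OF \<Phi>], symmetric])
  also have "\<dots> \<longleftrightarrow> (\<forall>f\<in>\<Phi>. onto T (yoneda T X) f)"
  proof -
    have "(\<forall>v\<in>sec ?D (Cod U (on_ar DT f)). on_ar ?D (on_ar DT f) v = \<one>\<^bsub>on_ob ?D (Dom U (on_ar DT f))\<^esub> \<longrightarrow>
        v = \<one>\<^bsub>on_ob ?D (Cod U (on_ar DT f))\<^esub>) \<longleftrightarrow>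
      onto T (yoneda T X) f"
      if f\<Phi>: "f \<in> \<Phi>" for f
    proof -
      have f: "f \<in> Hom \<A> (Dom T f) (Cod T f)" using f\<Phi> \<Phi> by (auto simp: Hom_def)
      then have C: "compact_object T (Dom T f)" "compact_object T (Cod T f)" and fT: "f \<in> Hom T (Dom T f) (Cod T f)"
        by (simp_all add: Hom_compacts)
      note Df = DT_closed[OF f]
      have DDf: "on_ar DU (on_ar DT f) \<in> Hom T (on_ob DU (on_ob DT (Dom T f))) (on_ob DU (on_ob DT (Cod T f)))"
        using AGJ.DT_closed[OF sym Df] by (simp add: Hom_compacts)
      \<comment> \<open>\<open>?D\<close> is the dual of \<open>yoneda T X\<close>, so injectivity
        at \<open>on_ar DT f\<close> means surjectivity of composition with the double dual of
        \<open>f\<close>; the unit and its inverse then exchange the double dual with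
        \<open>f\<close>.\<close>
      have 1: "(\<forall>v\<in>sec ?D (Cod U (on_ar DT f)). on_ar ?D (on_ar DT f) v = \<one>\<^bsub>on_ob ?D (Dom U (on_ar DT f))\<^esub> \<longrightarrow>
          v = \<one>\<^bsub>on_ob ?D (Cod U (on_ar DT f))\<^esub>) \<longleftrightarrow>
        (\<lambda>g. g \<star> on_ar DU (on_ar DT f)) ` Hom T (on_ob DU (on_ob DT (Cod T f))) X = Hom T (on_ob DU (on_ob DT (Dom T f))) X"
        using AGJ.dual_injective_iff[OF sym yX Df] Hom_DomCod[OF Df] by (simp add: hom_presheaf_def)
      have 2: "(\<lambda>g. g \<star> f) ` Hom T (Cod T f) X = Hom T (Dom T f) X"
        if "(\<lambda>g. g \<star> on_ar DU (on_ar DT f)) ` Hom T (on_ob DU (on_ob DT (Cod T f))) X = Hom T (on_ob DU (on_ob DT (Dom T f))) X"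
        by (rule T.precompose_surjective_transfer[OF fT DDf \<eta>(1,2)[OF C(1)] inv(1)[OF C(1)] \<eta>(1)[OF C(2)] nat(1)[OF f] that])
      have 3: "(\<lambda>g. g \<star> on_ar DU (on_ar DT f)) ` Hom T (on_ob DU (on_ob DT (Cod T f))) X = Hom T (on_ob DU (on_ob DT (Dom T f))) X"
        if "(\<lambda>g. g \<star> f) ` Hom T (Cod T f) X = Hom T (Dom T f) X"
        by (rule T.precompose_surjective_transfer[OF DDf fT \<eta>(2,1)[OF C(1)] inv(2)[OF C(1)] \<eta>(2)[OF C(2)] nat(2)[OF f] that])
      show ?thesis unfolding 1 using iffI[OF 2 3] by (simp add: hom_presheaf_def)
    qed
    then show ?thesis unfolding flat_injective_def using D flat by simp
  qed
  also have "\<dots> \<longleftrightarrow> X \<in> \<X>" using \<X>_iff[of X] X by simp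
  finally show ?thesis .
qed

text \<open>For flat \<open>F\<close> the dual is isomorphic to some \<open>yoneda T X\<close>, and
  both memberships reduce to \<open>X\<close> lying in \<open>\<X>\<close>. A presheaf that is not
  flat satisfies neither condition, because flatness of its dual would force its own.\<close>

lemma dual_class_duality_pair:
  assumes \<X>: "definable T \<X>" and \<Y>: "definable U \<Y>" and QT: "\<And>X. X \<in> Ob T \<Longrightarrow> X \<in> \<X> \<longleftrightarrow> on_ob QT X \<in> \<Y>"
  shows "duality_pair_Mod \<B> \<A> DT (dual_class T U DT \<X>) (dual_class U T DU \<Y>)"
proof -
  obtain \<Psi> where \<Psi>: "\<Psi> \<subseteq> Arr \<B>" "dual_class T U DT \<X> = flat_injective \<B> \<Psi>" by (rule dual_class_flat_injective[OF \<X>])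
  obtain \<Phi> where \<Phi>: "\<Phi> \<subseteq> Arr \<A>" "dual_class U T DU \<Y> = flat_injective \<A> \<Phi>"
    by (rule AGJ.dual_class_flat_injective[OF sym \<Y>])
  have "F \<in> dual_class T U DT \<X> \<longleftrightarrow> \<partial> F \<in> dual_class U T DU \<Y>"
    if F: "additive_presheaf \<B> F" for F :: "('p, 'u, 'u) module_fctr"
  proof (cases "flat_presheaf \<B> F")
    case True
    obtain X where X: "X \<in> Ob T" "isomorphic (ModCat \<A>) (\<partial> F) (yoneda T X)" using dual_representable[OF F True] by blast
    have "F \<in> dual_class T U DT \<X> \<longleftrightarrow> X \<in> \<X>" using yoneda_class_iff[OF \<X> X] F by (simp add: dual_class_def)
    also have "\<dots> \<longleftrightarrow> yoneda T X \<in> dual_class U T DU \<Y>" using AGJ.yoneda_in_dual_class[OF sym \<Y> X(1)] QT[OF X(1)] by simp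
    also have "\<dots> \<longleftrightarrow> \<partial> F \<in> dual_class U T DU \<Y>"
      unfolding \<Phi>(2) by (rule A.flat_injective_isomorphic[OF X(2) \<Phi>(1), symmetric])
    finally show ?thesis .
  next
    case False
    then show ?thesis unfolding \<Psi>(2) \<Phi>(2) using dual_flat[OF F] by (auto simp: flat_injective_def)
  qed
  then show ?thesis
    unfolding duality_pair_Mod_def
    using A.flat_injective_summands[OF \<Phi>(1)] A.flat_injective_finite_coproducts[OF \<Phi>(1)] \<Phi>(2) by (auto simp: dual_class_def)
qed

end

theorem corollary9p4:
  fixes T :: "('o, 'u) tri_category" and U :: "('p, 'u) tri_category"
    and QT :: "('o, 'u, 'p, 'u) fctr" and QU :: "('p, 'u, 'o, 'u) fctr"
    and DT :: "('o, 'u, 'p, 'u) fctr" and DU :: "('p, 'u, 'o, 'u) fctr"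
  assumes "inaccessible_universe TYPE('u)"
    and "AGJ_duality_triple T U QT QU DT DU"
  shows "(\<forall>\<X>. definable T \<X> \<longrightarrow> definable_Mod (compacts U) (dual_class T U DT \<X>)) \<and>
    (\<forall>\<X> \<Y>. duality_pair T U QT \<X> \<Y> \<and> definable T \<X> \<and> definable U \<Y> \<longrightarrow>
      symmetric_duality_pair_Mod (compacts T) (compacts U) DT DU
        (dual_class U T DU \<Y>) (dual_class T U DT \<X>) \<and>
      yoneda_preimage T (dual_class U T DU \<Y>) = \<X> \<and>
      yoneda_preimage U (dual_class T U DT \<X>) = \<Y>)"
proof (intro conjI allI impI)
  interpret AGJ T U QT QU DT DU using assms by (rule AGJ.intro)
  show "definable_Mod (compacts U) (dual_class T U DT \<X>)" if "definable T \<X>" for \<X> by (rule definable_dual_class[OF that])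
  fix \<X> \<Y> assume "duality_pair T U QT \<X> \<Y> \<and> definable T \<X> \<and> definable U \<Y>"
  then have \<X>: "definable T \<X>" "\<X> \<subseteq> Ob T" and \<Y>: "definable U \<Y>" "\<Y> \<subseteq> Ob U"
    and QT_iff: "\<And>X. X \<in> Ob T \<Longrightarrow> X \<in> \<X> \<longleftrightarrow> on_ob QT X \<in> \<Y>"
    unfolding duality_pair_def by auto
  \<comment> \<open>The definition of a duality pair gives the equivalence for \<open>QT\<close>
    only. Applied to \<open>on_ob QU Y\<close> it speaks about the double dual of \<open>Y\<close>,
    which lies in \<open>\<Y>\<close> exactly when \<open>Y\<close> does.\<close>
  have QU_iff: "Y \<in> \<Y> \<longleftrightarrow> on_ob QU Y \<in> \<X>" if Y: "Y \<in> Ob U" for Y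
    using AGJ.definable_bidual[OF sym \<Y>(1) Y] QT_iff[OF QU_ob[OF Y]] by simp
  show "symmetric_duality_pair_Mod (compacts T) (compacts U) DT DU (dual_class U T DU \<Y>) (dual_class T U DT \<X>)"
    unfolding symmetric_duality_pair_Mod_def
    using AGJ.dual_class_duality_pair[OF sym \<Y>(1) \<X>(1) QU_iff] dual_class_duality_pair[OF \<X>(1) \<Y>(1) QT_iff] by blast
  show "yoneda_preimage T (dual_class U T DU \<Y>) = \<X>"
    using AGJ.yoneda_in_dual_class[OF sym \<Y>(1)] QT_iff \<X>(2) unfolding yoneda_preimage_def by auto
  show "yoneda_preimage U (dual_class T U DT \<X>) = \<Y>"
    using yoneda_in_dual_class[OF \<X>(1)] QU_iff \<Y>(2) unfolding yoneda_preimage_def by auto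
qed

end
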